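(* There is a deterministic algorithm that, given any set $P$ of $n=2\ell$ points in the plane (not necessarily in general position), computes the 17-geographic neighborhood graph $\mathrm{17GNG}(P)$ of $P$ in $O(n\log^3 n)$ time.
   Context: Let $\mathrm{dist}$ denote the Euclidean distance. Partition the plane into six closed wedges $W_1,\ldots,W_6$ with apex at the origin, each with opening angle $60^\circ$, by the three lines through the origin with slopes $0$, $\sqrt{3}$ and $-\sqrt{3}$. For a point $p$, $p+W_i$ denotes $W_i$ translated by $p$. The 17-geographic neighborhood graph $\mathrm{17GNG}(P)$ of a finite set $P$ of points in the plane is the graph with vertex set $P$ that consists of all the edges $(p,q)\in P\times P$, with $p\ne q$, for which there exists $1\le i\le 6$ such that $q\in p+W_i$ and there are at most $16$ points $q'\in P\cap(p+W_i)$, $q'\ne p$, with $\mathrm{dist}(p,q')<\mathrm{dist}(p,q)$. It is known that the number of edges of $\mathrm{17GNG}(P)$ is $O(n)$. Computing the graph means reporting all of its edges explicitly. Running times are measured in the standard model of computational geometry (real RAM). *)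

theory Defs
  imports "HOL-Analysis.Analysis" "HOL-Library.Landau_Symbols"
begin

section \<open>The geographic neighborhood graph\<close>

text \<open>The metric on \<^typ>\<open>real \<times> real\<close> is the Euclidean one.\<close>

type_synonym point = "real \<times> real"

definition wedge :: "nat \<Rightarrow> point set" where
  "wedge i = {(r * cos \<theta>, r * sin \<theta>) | r \<theta>.
     0 \<le> r \<and> (real i - 1) * (pi / 3) \<le> \<theta> \<and> \<theta> \<le> real i * (pi / 3)}"

definition wedge_at :: "point \<Rightarrow> nat \<Rightarrow> point set" where
  "wedge_at p i = (\<lambda>v. p + v) ` wedge i"

definition gng17 :: "point set \<Rightarrow> (point \<times> point) set" where
  "gng17 P = {(p, q). p \<in> P \<and> q \<in> P \<and> p \<noteq> q \<and>
     (\<exists>i\<in>{1..6}. q \<in> wedge_at p i \<and>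
        card {q' \<in> P \<inter> wedge_at p i. q' \<noteq> p \<and> dist p q' < dist p q} \<le> 16)}"


section \<open>The real RAM\<close>

text \<open>
  A real RAM has a memory \<open>W\<close> of \<open>w\<close>-bit words and a memory \<open>R\<close> of real numbers, both
  addressed by words, a random-access read-only input consisting of real numbers, and a
  write-only output tape of words. All instructions have unit cost. Reals are manipulated
  exactly, but only by field operations, square roots and comparisons; there is no
  conversion from reals to words (no floor function), and word arithmetic wraps around
  modulo \<open>2 ^ w\<close>, so that large integers cannot be processed in unit time.
  Programs contain only integer constants.
\<close>

datatype word_op = WAdd | WSub | WMul | WDiv | WMod

datatype real_op = RAdd | RSub | RMul | RDiv

text \<open>In the comments, the operands of each instruction are called \<open>i\<close>, \<open>j\<close>, \<open>k\<close> from left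
  to right, and jump targets \<open>l\<close>.\<close>

datatype instr =
    WConst nat nat            (* W[i] := j *)
  | WMove nat nat             (* W[i] := W[j] *)
  | WLoad nat nat             (* W[i] := W[W[j]] *)
  | WStore nat nat            (* W[W[i]] := W[j] *)
  | WArith word_op nat nat nat (* W[i] := W[j] op W[k] *)
  | RConst nat int            (* R[i] := j *)
  | RMove nat nat             (* R[i] := R[j] *)
  | RLoad nat nat             (* R[i] := R[W[j]] *)
  | RStore nat nat            (* R[W[i]] := R[j] *)
  | RArith real_op nat nat nat (* R[i] := R[j] op R[k] *)
  | RSqrt nat nat             (* R[i] := sqrt R[j] *)
  | RCast nat nat             (* R[i] := W[j] *)
  | RInput nat nat            (* R[i] := input number W[j] *)
  | Jump nat                  (* goto l *)
  | JumpWEq nat nat nat       (* if W[i] = W[j] goto l *)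
  | JumpWLess nat nat nat     (* if W[i] < W[j] goto l *)
  | JumpREq nat nat nat       (* if R[i] = R[j] goto l *)
  | JumpRLess nat nat nat     (* if R[i] < R[j] goto l *)
  | Emit nat                  (* append W[i] to the output *)

type_synonym program = "instr list"

record state =
  pc :: nat
  wmem :: "nat \<Rightarrow> nat"
  rmem :: "nat \<Rightarrow> real"
  outp :: "nat list"

fun eval_wop :: "nat \<Rightarrow> word_op \<Rightarrow> nat \<Rightarrow> nat \<Rightarrow> nat" where
  "eval_wop w WAdd a b = (a + b) mod 2 ^ w"
| "eval_wop w WSub a b = nat ((int a - int b) mod 2 ^ w)"
| "eval_wop w WMul a b = (a * b) mod 2 ^ w"
| "eval_wop w WDiv a b = a div b"
| "eval_wop w WMod a b = a mod b"

fun eval_rop :: "real_op \<Rightarrow> real \<Rightarrow> real \<Rightarrow> real" where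
  "eval_rop RAdd x y = x + y"
| "eval_rop RSub x y = x - y"
| "eval_rop RMul x y = x * y"
| "eval_rop RDiv x y = x / y"

definition set_w :: "nat \<Rightarrow> nat \<Rightarrow> state \<Rightarrow> state" where
  "set_w i a s = s\<lparr>wmem := (wmem s)(i := a), pc := pc s + 1\<rparr>"

definition set_r :: "nat \<Rightarrow> real \<Rightarrow> state \<Rightarrow> state" where
  "set_r i x s = s\<lparr>rmem := (rmem s)(i := x), pc := pc s + 1\<rparr>"

definition branch :: "bool \<Rightarrow> nat \<Rightarrow> state \<Rightarrow> state" where
  "branch b l s = s\<lparr>pc := if b then l else pc s + 1\<rparr>"

fun exec :: "nat \<Rightarrow> real list \<Rightarrow> instr \<Rightarrow> state \<Rightarrow> state" where
  "exec w xs (WConst i j) s = set_w i (j mod 2 ^ w) s"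
| "exec w xs (WMove i j) s = set_w i (wmem s j) s"
| "exec w xs (WLoad i j) s = set_w i (wmem s (wmem s j)) s"
| "exec w xs (WStore i j) s = set_w (wmem s i) (wmem s j) s"
| "exec w xs (WArith f i j k) s = set_w i (eval_wop w f (wmem s j) (wmem s k)) s"
| "exec w xs (RConst i j) s = set_r i (of_int j) s"
| "exec w xs (RMove i j) s = set_r i (rmem s j) s"
| "exec w xs (RLoad i j) s = set_r i (rmem s (wmem s j)) s"
| "exec w xs (RStore i j) s = set_r (wmem s i) (rmem s j) s"
| "exec w xs (RArith f i j k) s = set_r i (eval_rop f (rmem s j) (rmem s k)) s"
| "exec w xs (RSqrt i j) s = set_r i (sqrt (rmem s j)) s"
| "exec w xs (RCast i j) s = set_r i (real (wmem s j)) s"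
| "exec w xs (RInput i j) s =
     set_r i (if wmem s j < length xs then xs ! wmem s j else 0) s"
| "exec w xs (Jump l) s = branch True l s"
| "exec w xs (JumpWEq i j l) s = branch (wmem s i = wmem s j) l s"
| "exec w xs (JumpWLess i j l) s = branch (wmem s i < wmem s j) l s"
| "exec w xs (JumpREq i j l) s = branch (rmem s i = rmem s j) l s"
| "exec w xs (JumpRLess i j l) s = branch (rmem s i < rmem s j) l s"
| "exec w xs (Emit i) s = s\<lparr>outp := outp s @ [wmem s i], pc := pc s + 1\<rparr>"

definition halted :: "program \<Rightarrow> state \<Rightarrow> bool" where
  "halted prog s \<longleftrightarrow> length prog \<le> pc s"

definition step :: "program \<Rightarrow> nat \<Rightarrow> real list \<Rightarrow> state \<Rightarrow> state" where
  "step prog w xs s = (if halted prog s then s else exec w xs (prog ! pc s) s)"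

text \<open>Initially \<open>W[0]\<close> holds the length of the input.\<close>

definition init :: "nat \<Rightarrow> real list \<Rightarrow> state" where
  "init w xs = \<lparr>pc = 0, wmem = (\<lambda>_. 0)(0 := length xs mod 2 ^ w), rmem = (\<lambda>_. 0), outp = []\<rparr>"

definition outputs_within :: "program \<Rightarrow> nat \<Rightarrow> real list \<Rightarrow> nat \<Rightarrow> nat list \<Rightarrow> bool" where
  "outputs_within prog w xs t ys \<longleftrightarrow>
     (\<exists>k\<le>t. let s = (step prog w xs ^^ k) (init w xs) in halted prog s \<and> outp s = ys)"


section \<open>Computing the graph on a real RAM\<close>

definition encode_points :: "point list \<Rightarrow> real list" where
  "encode_points ps = concat (map (\<lambda>(x, y). [x, y]) ps)"

definition encode_edges :: "(nat \<times> nat) list \<Rightarrow> nat list" where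
  "encode_edges es = concat (map (\<lambda>(a, b). [a, b]) es)"

text \<open>
  The point set is given as an arbitrary repetition-free list \<open>ps\<close>; the graph is reported by
  listing every edge exactly once, as a pair of positions in \<open>ps\<close>.
\<close>

definition reports_gng17 ::
    "program \<Rightarrow> nat \<Rightarrow> point list \<Rightarrow> nat \<Rightarrow> bool" where
  "reports_gng17 prog w ps t \<longleftrightarrow>
     (\<exists>es. outputs_within prog w (encode_points ps) t (encode_edges es) \<and>
           distinct es \<and>
           set es = {(a, b). a < length ps \<and> b < length ps \<and>
                             (ps ! a, ps ! b) \<in> gng17 (set ps)})"

text \<open>
  The algorithm is one program for all inputs and word sizes. It may rely on words having
  \<open>c log n\<close> bits for some constant \<open>c\<close> of its own, but on no upper bound on the word size;
  \<open>n + 2\<close> instead of \<open>n\<close> keeps this meaningful for \<open>n \<le> 1\<close>.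
\<close>

definition solves_gng17 :: "program \<Rightarrow> nat \<Rightarrow> point set \<Rightarrow> nat \<Rightarrow> bool" where
  "solves_gng17 prog c P t \<longleftrightarrow>
     (\<forall>ps w. distinct ps \<and> set ps = P \<and> real c * log 2 (real (card P) + 2) \<le> real w \<longrightarrow>
        reports_gng17 prog w ps t)"

end

theory Submission
  imports Defs
begin

text \<open>
  In the coordinates \<open>(2 r sin (\<theta> - \<alpha>), 2 r sin (\<alpha> + \<pi> / 3 - \<theta>))\<close> a point \<open>q\<close> lies in the wedge
  \<open>\<alpha> \<le> \<theta> \<le> \<alpha> + \<pi> / 3\<close> at \<open>p\<close> iff it dominates \<open>p\<close>, and a fixed linear map turns the coordinates for
  one wedge into those for the next. It therefore suffices to find, for all \<open>p\<close>, the points that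
  dominate \<open>p\<close> and have at most 16 closer points that dominate \<open>p\<close>.

  Merging bottom-up, first by one coordinate and inside every merge by the other one, splits all
  dominating pairs into products \<open>A \<times> B\<close> of total size \<open>O(n log\<^sup>2 n)\<close> such that every point
  of \<open>B\<close> dominates every point of \<open>A\<close>. For the maximal points of \<open>A\<close> against the minimal points
  of \<open>B\<close> the distance matrix is strictly totally monotone, because the segments of a
  crossing pair can be uncrossed. Hence all its row minima are found by divide and conquer, and
  if a column \<open>c\<close> contains some row minimum, then for every row \<open>a\<close> all such columns between
  \<open>c\<close> and the minima of \<open>a\<close> are closer to \<open>a\<close> than \<open>c\<close>; so \<open>c\<close> is one of the 17 such columns
  next to the minima of \<open>a\<close>, or it has more than 16 closer points. Deleting the columns with
  row minima, a point that remains has lost a closer one for every row, so 17 repetitions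
  suffice; likewise it suffices to peel 17 layers of maximal points off \<open>A\<close>, since what is
  left is dominated by 17 points that are closer than \<open>B\<close>. The resulting \<open>O(n log\<^sup>2 n)\<close> candidates
  contain all edges, hence the 17 closest dominating points of every \<open>p\<close>, so that comparing
  candidates with each other decides which of them are edges.

  The algorithm is a term of a functional language whose only iteration is the fold over a
  list; a compiler simulates it on the real RAM in time proportional to its cost, allocating
  records but never freeing them.
\<close>

section \<open>A first-order language of list folds\<close>

text \<open>No general position is assumed, and ties shape the proof. Points may share a coordinate,
  so both merges use lexicographic orders: for distinct points, dominance is exactly precedence in
  both. Distances may coincide, so a row can have many nearest columns, and all of them have to be
  removed together; otherwise a survivor tied with a removed column would not have lost a strictly
  closer point. This is why the uncrossing inequality must be strict: two rows then share at most
  one nearest column, and the sets of row minima have linear total size. Uncrossing in turn needs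
  chains along which one coordinate grows while the other shrinks, hence the restriction to maximal
  and minimal points. The third logarithm of the running time has two sources, the divide and
  conquer inside each product and the sorting of all candidates. As memory is never freed, a bound
  on the cost also bounds the addresses in use; it is polynomial in the number of points, so words
  of \<open>c log n\<close> bits suffice to exclude wraparound.\<close>

datatype val = NumV nat | RealV real | CellV val val

primrec num_of :: "val \<Rightarrow> real" where
  "num_of (NumV n) = real n"
| "num_of (RealV x) = x"
| "num_of (CellV a b) = 0"

primrec lft :: "val \<Rightarrow> val" where
  "lft (CellV a b) = a"
| "lft (NumV n) = NumV 0"
| "lft (RealV x) = NumV 0"

primrec rgt :: "val \<Rightarrow> val" where
  "rgt (CellV a b) = b"
| "rgt (NumV n) = NumV 0"
| "rgt (RealV x) = NumV 0"

primrec is_cell :: "val \<Rightarrow> bool" where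
  "is_cell (CellV a b) = True"
| "is_cell (NumV n) = False"
| "is_cell (RealV x) = False"

text \<open>
  \<open>Var k\<close> refers to the \<open>k\<close>-th oldest entry of the environment. Every intermediate result is
  pushed onto the environment while the remaining operands are evaluated, so that environment
  positions can be identified with machine registers. \<open>Frame k e\<close> evaluates \<open>e\<close> in the
  environment consisting of the \<open>k\<close> newest entries only; it serves to call closed code.
\<close>

datatype exp =
    Var nat
  | Bind exp exp
  | Num nat
  | Arith real_op exp exp
  | Root exp
  | Cell exp exp
  | Lft exp
  | Rgt exp
  | IfCell exp exp exp
  | IfLess exp exp exp exp
  | Fold exp exp exp
  | Frame nat exp

text \<open>The body receives the whole unread list and not just its first element: a fold can thus
  keep a suffix of its input without copying it, as \<open>splitE\<close> does. Anything that is not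
  a cell ends the list.\<close>

fun lfold :: "(val \<Rightarrow> val \<Rightarrow> val) \<Rightarrow> val \<Rightarrow> val \<Rightarrow> val" where
  "lfold f (CellV x r) s = lfold f r (f (CellV x r) s)"
| "lfold f (NumV n) s = s"
| "lfold f (RealV y) s = s"

fun lcost :: "(val \<Rightarrow> val \<Rightarrow> val) \<Rightarrow> (val \<Rightarrow> val \<Rightarrow> nat) \<Rightarrow> val \<Rightarrow> val \<Rightarrow> nat" where
  "lcost f c (CellV x r) s = 1 + c (CellV x r) s + lcost f c r (f (CellV x r) s)"
| "lcost f c (NumV n) s = 0"
| "lcost f c (RealV y) s = 0"

primrec ev :: "exp \<Rightarrow> val list \<Rightarrow> val" where
  "ev (Var k) \<rho> = (if k < length \<rho> then \<rho> ! k else NumV 0)"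
| "ev (Bind a b) \<rho> = ev b (\<rho> @ [ev a \<rho>])"
| "ev (Num n) \<rho> = NumV n"
| "ev (Arith f a b) \<rho> = RealV (eval_rop f (num_of (ev a \<rho>)) (num_of (ev b (\<rho> @ [ev a \<rho>]))))"
| "ev (Root a) \<rho> = RealV (sqrt (num_of (ev a \<rho>)))"
| "ev (Cell a b) \<rho> = CellV (ev a \<rho>) (ev b (\<rho> @ [ev a \<rho>]))"
| "ev (Lft a) \<rho> = lft (ev a \<rho>)"
| "ev (Rgt a) \<rho> = rgt (ev a \<rho>)"
| "ev (IfCell c a b) \<rho> = (if is_cell (ev c \<rho>) then ev a \<rho> else ev b \<rho>)"
| "ev (IfLess x y a b) \<rho> =
     (if num_of (ev x \<rho>) < num_of (ev y (\<rho> @ [ev x \<rho>])) then ev a \<rho> else ev b \<rho>)"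
| "ev (Fold l i b) \<rho> =
     lfold (\<lambda>r s. ev b (\<rho> @ [r, s])) (ev l \<rho>) (ev i (\<rho> @ [ev l \<rho>]))"
| "ev (Frame k a) \<rho> = ev a (drop (length \<rho> - k) \<rho>)"

primrec ct :: "exp \<Rightarrow> val list \<Rightarrow> nat" where
  "ct (Var k) \<rho> = 1"
| "ct (Bind a b) \<rho> = 1 + ct a \<rho> + ct b (\<rho> @ [ev a \<rho>])"
| "ct (Num n) \<rho> = 1 + n"
| "ct (Arith f a b) \<rho> = 1 + ct a \<rho> + ct b (\<rho> @ [ev a \<rho>])"
| "ct (Root a) \<rho> = 1 + ct a \<rho>"
| "ct (Cell a b) \<rho> = 1 + ct a \<rho> + ct b (\<rho> @ [ev a \<rho>])"
| "ct (Lft a) \<rho> = 1 + ct a \<rho>"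
| "ct (Rgt a) \<rho> = 1 + ct a \<rho>"
| "ct (IfCell c a b) \<rho> = 1 + ct c \<rho> + (if is_cell (ev c \<rho>) then ct a \<rho> else ct b \<rho>)"
| "ct (IfLess x y a b) \<rho> = 1 + ct x \<rho> + ct y (\<rho> @ [ev x \<rho>]) +
     (if num_of (ev x \<rho>) < num_of (ev y (\<rho> @ [ev x \<rho>])) then ct a \<rho> else ct b \<rho>)"
| "ct (Fold l i b) \<rho> = 1 + ct l \<rho> + ct i (\<rho> @ [ev l \<rho>]) +
     lcost (\<lambda>r s. ev b (\<rho> @ [r, s])) (\<lambda>r s. ct b (\<rho> @ [r, s]))
       (ev l \<rho>) (ev i (\<rho> @ [ev l \<rho>]))"
| "ct (Frame k a) \<rho> = 1 + ct a (drop (length \<rho> - k) \<rho>)"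

text \<open>The cost of a constant exceeds the constant, so a bound on the cost bounds all words.\<close>

section \<open>Compilation to the real RAM\<close>

text \<open>
  A value is represented by the address \<open>h\<close>, a multiple of 8, of a record: \<open>W[h]\<close> tells whether
  it is a cell, \<open>W[h+1]\<close> and \<open>W[h+2]\<close> point to its components, \<open>W[h+3]\<close> holds a natural number,
  and \<open>R[h]\<close> a real; fields that are not used are \<open>0\<close>. The record at address \<open>0\<close> represents
  \<open>NumV 0\<close>, so dereferencing a component of something that is not a cell needs no test.
  The register for environment position \<open>i\<close> is \<open>W[8i+4]\<close>, the next free address is in \<open>W[5]\<close>, and
  \<open>W[6]\<close>, \<open>W[7]\<close>, \<open>R[1]\<close>, \<open>R[2]\<close>, \<open>R[3]\<close> are scratch.
\<close>

definition reg :: "nat \<Rightarrow> nat" where "reg i = 8 * i + 4"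

definition bump :: "nat \<Rightarrow> instr list" where
  "bump t = [WMove t 5, WConst 6 8, WArith WAdd 5 5 6]"

text \<open>The real field and the natural-number field are added, because the one not in use is 0.
  This realizes \<open>num_of\<close> without a test for the kind of value; in a cell both fields
  are 0.\<close>

definition load_num :: "nat \<Rightarrow> nat \<Rightarrow> instr list" where
  "load_num i t = [RLoad i t, WConst 6 3, WArith WAdd 6 t 6, WLoad 6 6, RCast 3 6, RArith RAdd i i 3]"

definition load_field :: "nat \<Rightarrow> nat \<Rightarrow> instr list" where
  "load_field j t = [WConst 6 j, WArith WAdd 6 t 6, WLoad t 6]"

definition store_cell :: "nat \<Rightarrow> nat \<Rightarrow> instr list" where
  "store_cell a b = [WConst 7 1, WStore 5 7, WArith WAdd 6 5 7, WStore 6 a, WArith WAdd 6 6 7, WStore 6 b]"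

definition store_num :: "nat \<Rightarrow> instr list" where
  "store_num a = [WConst 6 3, WArith WAdd 6 5 6, WStore 6 a]"

text \<open>\<open>p\<close> is the absolute address of the code, needed because jumps are absolute;
  \<open>f\<close> is the first register of the current frame and \<open>d\<close> the number of
  environment entries. The value always goes to register \<open>f + d\<close>, the first one above
  the environment. A frame merely shifts \<open>f\<close>, so closed code is called without moving
  its arguments.\<close>

primrec compile :: "exp \<Rightarrow> nat \<Rightarrow> nat \<Rightarrow> nat \<Rightarrow> instr list" where
  "compile (Var k) p f d = (if k < d then [WMove (reg (f + d)) (reg (f + k))] else [WConst (reg (f + d)) 0])"
| "compile (Bind a b) p f d = (let A = compile a p f d; B = compile b (p + length A) f (d + 1) in
     A @ B @ [WMove (reg (f + d)) (reg (f + d + 1))])"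
| "compile (Num n) p f d = WConst 7 n # store_num 7 @ bump (reg (f + d))"
| "compile (Arith g a b) p f d = (let A = compile a p f d; B = compile b (p + length A) f (d + 1) in
     A @ B @ load_num 1 (reg (f + d)) @ load_num 2 (reg (f + d + 1)) @
       [RArith g 1 1 2, RStore 5 1] @ bump (reg (f + d)))"
| "compile (Root a) p f d = compile a p f d @ load_num 1 (reg (f + d)) @ [RSqrt 1 1, RStore 5 1] @ bump (reg (f + d))"
| "compile (Cell a b) p f d = (let A = compile a p f d; B = compile b (p + length A) f (d + 1) in
     A @ B @ store_cell (reg (f + d)) (reg (f + d + 1)) @ bump (reg (f + d)))"
| "compile (Lft a) p f d = compile a p f d @ load_field 1 (reg (f + d))"
| "compile (Rgt a) p f d = compile a p f d @ load_field 2 (reg (f + d))"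
| "compile (IfCell c a b) p f d = (let C = compile c p f d;
       B = compile b (p + length C + 3) f d;
       q = p + length C + 3 + length B + 1;
       A = compile a q f d in
     C @ [WLoad 6 (reg (f + d)), WConst 7 1, JumpWEq 6 7 q] @ B @ [Jump (q + length A)] @ A)"
| "compile (IfLess x y a b) p f d = (let X = compile x p f d; Y = compile y (p + length X) f (d + 1);
       p' = p + length X + length Y + 12;
       B = compile b (p' + 1) f d;
       q = p' + 1 + length B + 1;
       A = compile a q f d in
     X @ Y @ load_num 1 (reg (f + d)) @ load_num 2 (reg (f + d + 1)) @ [JumpRLess 1 2 q] @
       B @ [Jump (q + length A)] @ A)"
| "compile (Fold l i b) p f d = (let L = compile l p f d; I = compile i (p + length L) f (d + 1);
       p' = p + length L + length I;
       B = compile b (p' + 3) f (d + 2) in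
     L @ I @ [WLoad 6 (reg (f + d)), WConst 7 0, JumpWEq 6 7 (p' + 3 + length B + 5)] @
       B @ WMove (reg (f + d + 1)) (reg (f + d + 2)) # load_field 2 (reg (f + d)) @ [Jump p'] @
       [WMove (reg (f + d)) (reg (f + d + 1))])"
| "compile (Frame k a) p f d = compile a p (f + (d - k)) (d - (d - k))"


section \<open>Executions of straight-line code\<close>

definition code_at :: "program \<Rightarrow> nat \<Rightarrow> instr list \<Rightarrow> bool" where
  "code_at G p c \<longleftrightarrow> (\<forall>i<length c. p + i < length G \<and> G ! (p + i) = c ! i)"

lemma code_at_append: "code_at G p (a @ b) \<longleftrightarrow> code_at G p a \<and> code_at G (p + length a) b"
proof
  assume h: "code_at G p (a @ b)"
  have "code_at G p a" using h unfolding code_at_def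
    by (metis (no_types, lifting) length_append nth_append trans_less_add1)
  moreover have "code_at G (p + length a) b" unfolding code_at_def
  proof (intro allI impI)
    fix i assume "i < length b"
    then show "p + length a + i < length G \<and> G ! (p + length a + i) = b ! i"
      using h[unfolded code_at_def, rule_format, of "length a + i"] by (auto simp: add.assoc)
  qed
  ultimately show "code_at G p a \<and> code_at G (p + length a) b" ..
next
  assume h: "code_at G p a \<and> code_at G (p + length a) b"
  show "code_at G p (a @ b)" unfolding code_at_def
  proof (intro allI impI)
    fix i assume i: "i < length (a @ b)"
    show "p + i < length G \<and> G ! (p + i) = (a @ b) ! i"
    proof (cases "i < length a")
      case True then show ?thesis using h by (auto simp: code_at_def nth_append)
    next
      case False
      then have "i - length a < length b" using i by auto
      then show ?thesis using h False
        by (auto simp: code_at_def nth_append dest!: spec[of _ "i - length a"])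
    qed
  qed
qed

lemma code_at_Cons: "code_at G p (a # b) \<longleftrightarrow> p < length G \<and> G ! p = a \<and> code_at G (Suc p) b"
  using code_at_append[of G p "[a]" b] by (auto simp: code_at_def)

text \<open>\<open>Emit\<close> counts as a jump because straight-line code is also meant to leave
  the output unchanged.\<close>

fun jumps :: "instr \<Rightarrow> bool" where
  "jumps (Jump l) = True"
| "jumps (JumpWEq i j l) = True"
| "jumps (JumpWLess i j l) = True"
| "jumps (JumpREq i j l) = True"
| "jumps (JumpRLess i j l) = True"
| "jumps (Emit i) = True"
| "jumps _ = False"

fun execs :: "nat \<Rightarrow> real list \<Rightarrow> instr list \<Rightarrow> state \<Rightarrow> state" where
  "execs w xs [] s = s"
| "execs w xs (i # is) s = execs w xs is (exec w xs i s)"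

abbreviation steps :: "program \<Rightarrow> nat \<Rightarrow> real list \<Rightarrow> nat \<Rightarrow> state \<Rightarrow> state" where
  "steps G w xs n \<equiv> step G w xs ^^ n"

lemma step_code: "code_at G p (i # is) \<Longrightarrow> pc s = p \<Longrightarrow> step G w xs s = exec w xs i s"
  by (simp add: code_at_Cons step_def halted_def)

lemma exec_straight: "\<not> jumps i \<Longrightarrow> pc (exec w xs i s) = Suc (pc s) \<and> outp (exec w xs i s) = outp s"
  by (cases i) (auto simp: set_w_def set_r_def)

lemma steps_execs:
  assumes "code_at G p is" "pc s = p" "list_all (\<lambda>i. \<not> jumps i) is"
  shows "steps G w xs (length is) s = execs w xs is s \<and> pc (execs w xs is s) = p + length is \<and>
    outp (execs w xs is s) = outp s"
  using assms
proof (induction "is" arbitrary: p s)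
  case (Cons i "is")
  have "step G w xs s = exec w xs i s" using step_code Cons.prems by blast
  moreover have "code_at G (Suc p) is" using Cons.prems by (simp add: code_at_Cons)
  ultimately show ?case
    using Cons.IH[of "Suc p" "exec w xs i s"] Cons.prems exec_straight[of i w xs s]
    by (auto simp add: funpow_Suc_right simp del: funpow.simps)
qed simp

section \<open>The heap and its invariants\<close>

primrec rep :: "val \<Rightarrow> nat \<Rightarrow> state \<Rightarrow> nat \<Rightarrow> bool" where
  "rep (NumV n) H s h \<longleftrightarrow> h mod 8 = 0 \<and> h < H \<and> wmem s h = 0 \<and> wmem s (h + 1) = 0 \<and>
     wmem s (h + 2) = 0 \<and> wmem s (h + 3) = n \<and> rmem s h = 0"
| "rep (RealV x) H s h \<longleftrightarrow> h mod 8 = 0 \<and> h < H \<and> wmem s h = 0 \<and> wmem s (h + 1) = 0 \<and>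
     wmem s (h + 2) = 0 \<and> wmem s (h + 3) = 0 \<and> rmem s h = x"
| "rep (CellV a b) H s h \<longleftrightarrow> h mod 8 = 0 \<and> h < H \<and> wmem s h = 1 \<and> rep a H s (wmem s (h + 1)) \<and>
     rep b H s (wmem s (h + 2)) \<and> wmem s (h + 3) = 0 \<and> rmem s h = 0"

text \<open>Free memory is zero, so that allocation has to write only the fields in use; the fields
  at address 0 stay zero, so that they represent \<open>NumV 0\<close>.\<close>

definition hinv :: "nat \<Rightarrow> state \<Rightarrow> bool" where
  "hinv H s \<longleftrightarrow> wmem s 5 = H \<and> H mod 8 = 0 \<and> 8 \<le> H \<and>
     (\<forall>x. x mod 8 < 4 \<longrightarrow> x < 8 \<or> H \<le> x \<longrightarrow> wmem s x = 0) \<and>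
     (\<forall>x. x mod 8 = 0 \<longrightarrow> x < 8 \<or> H \<le> x \<longrightarrow> rmem s x = 0)"

text \<open>Values may share records. This is harmless because records below the heap top are never
  written again. The parameter \<open>b\<close> protects the lower registers, which hold the
  environment of the surrounding code.\<close>

definition pres :: "nat \<Rightarrow> nat \<Rightarrow> state \<Rightarrow> state \<Rightarrow> bool" where
  "pres b H s s' \<longleftrightarrow> (\<forall>x<H. x mod 8 < 4 \<longrightarrow> wmem s' x = wmem s x) \<and>
     (\<forall>x<H. x mod 8 = 0 \<longrightarrow> rmem s' x = rmem s x) \<and>
     (\<forall>i<b. wmem s' (reg i) = wmem s (reg i)) \<and> outp s' = outp s"

lemma pres_trans: "pres b H s s1 \<Longrightarrow> pres b' H1 s1 s2 \<Longrightarrow> b \<le> b' \<Longrightarrow> H \<le> H1 \<Longrightarrow> pres b H s s2"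
  unfolding pres_def by auto

lemma pres_weaken: "pres b H s s' \<Longrightarrow> b' \<le> b \<Longrightarrow> pres b' H s s'"
  unfolding pres_def by auto

lemma rep_lt: "rep v H s h \<Longrightarrow> h mod 8 = 0 \<and> h < H"
  by (cases v) auto

lemma mod8_less:
  assumes "h mod 8 = 0" "h < H" "H mod 8 = 0" "j < 8"
  shows "h + j < (H::nat)"
proof -
  obtain a b where "h = 8 * a" "H = 8 * b" using assms(1,3) by (auto elim!: dvdE simp: mod_eq_0_iff_dvd)
  then show ?thesis using assms by simp
qed

lemma mod8_field: "h mod 8 = 0 \<Longrightarrow> j < 8 \<Longrightarrow> (h + j) mod 8 = (j::nat)"
  by (auto simp: mod_eq_0_iff_dvd elim!: dvdE)

lemma rep_pres:
  assumes "H mod 8 = 0" "H \<le> H'" "pres b H s s'"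
  shows "rep v H s h \<Longrightarrow> rep v H' s' h"
proof (induction v arbitrary: h)
  case (NumV n)
  then have h: "h mod 8 = 0" "h < H" by auto
  have "wmem s' (h + j) = wmem s (h + j)" if "j < 4" for j
    using assms(3) mod8_less[OF h assms(1), of j] mod8_field[OF h(1), of j] that unfolding pres_def by auto
  from this[of 0] this[of 1] this[of 2] this[of 3] show ?case
    using NumV assms h by (auto simp: pres_def)
next
  case (RealV n)
  then have h: "h mod 8 = 0" "h < H" by auto
  have "wmem s' (h + j) = wmem s (h + j)" if "j < 4" for j
    using assms(3) mod8_less[OF h assms(1), of j] mod8_field[OF h(1), of j] that unfolding pres_def by auto
  from this[of 0] this[of 1] this[of 2] this[of 3] show ?case
    using RealV assms h by (auto simp: pres_def)
next
  case (CellV v1 v2)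
  then have h: "h mod 8 = 0" "h < H" by auto
  have "wmem s' (h + j) = wmem s (h + j)" if "j < 4" for j
    using assms(3) mod8_less[OF h assms(1), of j] mod8_field[OF h(1), of j] that unfolding pres_def by auto
  from this[of 0] this[of 1] this[of 2] this[of 3] show ?case
    using CellV assms h by (auto simp: pres_def)
qed

lemma rep_zero: "hinv H s \<Longrightarrow> rep (NumV 0) H s 0"
  by (auto simp: hinv_def)

lemma rep_parts:
  assumes "rep v H s h" "hinv H s"
  shows "wmem s h = (if is_cell v then 1 else 0)" "rep (lft v) H s (wmem s (h + 1))"
    "rep (rgt v) H s (wmem s (h + 2))" "rmem s h + real (wmem s (h + 3)) = num_of v"
  using assms rep_zero[OF assms(2)] by (cases v; auto)+

lemma reg_simps [simp]: "reg i mod 8 = 4" "reg i \<noteq> 5" "reg i \<noteq> 6" "reg i \<noteq> 7" "reg i = reg j \<longleftrightarrow> i = j"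
  "5 \<noteq> reg i" "6 \<noteq> reg i" "7 \<noteq> reg i"
  unfolding reg_def by presburger+

lemma mod8_reg: "x mod 8 < 4 \<Longrightarrow> x \<noteq> reg i"  "x mod 8 < 4 \<Longrightarrow> x \<noteq> (5::nat)" "x mod 8 < 4 \<Longrightarrow> x \<noteq> (6::nat)"
   "x mod 8 < 4 \<Longrightarrow> x \<noteq> (7::nat)"
  by auto

locale machine =
  fixes G :: program and w :: nat and xs :: "real list"
begin

text \<open>A cost unit, counted by \<open>k\<close>, pays for 40 instructions and for one record,
  that is 8 addresses. Instructions that allocate nothing are collected in \<open>m\<close> until
  \<open>runs_weaken\<close> charges them to a cost unit of the enclosing construct.\<close>

definition runs :: "nat \<Rightarrow> nat \<Rightarrow> nat \<Rightarrow> state \<Rightarrow> nat \<Rightarrow> state \<Rightarrow> nat \<Rightarrow> bool" where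
  "runs b k m s H s' H' \<longleftrightarrow> (\<exists>n\<le>40 * k + m. steps G w xs n s = s') \<and> hinv H' s' \<and> H \<le> H' \<and>
     H' \<le> H + 8 * k \<and> pres b H s s'"

lemma runs_trans:
  assumes "runs b k1 m1 s H s1 H1" "runs b' k2 m2 s1 H1 s2 H2" "b \<le> b'"
  shows "runs b (k1 + k2) (m1 + m2) s H s2 H2"
proof -
  obtain n1 n2 where n: "n1 \<le> 40 * k1 + m1" "steps G w xs n1 s = s1"
    "n2 \<le> 40 * k2 + m2" "steps G w xs n2 s1 = s2"
    using assms unfolding runs_def by auto
  have "steps G w xs (n2 + n1) s = s2" using n by (simp add: funpow_add)
  moreover have "n2 + n1 \<le> 40 * (k1 + k2) + (m1 + m2)" using n by simp
  moreover have "pres b H s s1" "pres b' H1 s1 s2" "H \<le> H1" using assms(1,2) unfolding runs_def by simp_all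
  then have "pres b H s s2" using assms(3) pres_trans by simp
  moreover have "hinv H2 s2" "H \<le> H2" using assms(1,2) unfolding runs_def by linarith+
  moreover have "H2 \<le> H + 8 * (k1 + k2)"
    using assms(1,2) unfolding runs_def distrib_left by linarith
  ultimately show ?thesis unfolding runs_def by blast
qed

lemma runs_weaken:
  assumes "runs b k m s H s' H'" "b' \<le> b" "k \<le> k'" "40 * k + m \<le> 40 * k' + m'"
  shows "runs b' k' m' s H s' H'"
proof -
  obtain n where "n \<le> 40 * k + m" "steps G w xs n s = s'" using assms(1) unfolding runs_def by auto
  then have "\<exists>n\<le>40 * k' + m'. steps G w xs n s = s'" using assms(4) by (intro exI[of _ n]) auto
  moreover have "H' \<le> H + 8 * k'" using assms(1,3) unfolding runs_def by linarith
  ultimately show ?thesis using assms(1) pres_weaken[OF _ assms(2)] unfolding runs_def by blast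
qed

lemma runs_hinv: "runs b k m s H s' H' \<Longrightarrow> hinv H' s' \<and> H \<le> H' \<and> H' \<le> H + 8 * k"
  by (auto simp: runs_def)

lemma runs_rep:
  assumes "runs b k m s H s' H'" "hinv H s" "rep v H s (wmem s (reg i))" "i < b"
  shows "rep v H' s' (wmem s' (reg i))"
  using assms rep_pres[of H H' b s s' v "wmem s (reg i)"] unfolding runs_def hinv_def pres_def by auto

lemma straight:
  assumes "code_at G p c" "pc s = p" "list_all (\<lambda>i. \<not> jumps i) c"
  shows "steps G w xs (length c) s = execs w xs c s" "pc (execs w xs c s) = p + length c"
    "outp (execs w xs c s) = outp s"
  using steps_execs[OF assms] by auto

text \<open>The common ending of all constructs that create a value. The code \<open>c\<close> fills
  the record at the heap top \<open>H\<close>; \<open>bump\<close> puts its address into the result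
  register and advances the top by 8. Together these are at most 33 instructions, within one cost
  unit.\<close>

lemma alloc:
  assumes c: "code_at G p (c @ bump (reg t))" "pc s = p" "list_all (\<lambda>i. \<not> jumps i) c" "length c \<le> 30"
    and H: "hinv H s" "H + 8 < 2 ^ w"
    and s1: "s1 = execs w xs c s"
    and W: "\<And>x. x mod 8 \<le> 5 \<Longrightarrow> x < H \<or> H + 8 \<le> x \<Longrightarrow> wmem s1 x = wmem s x"
    and R: "\<And>x. x mod 8 = 0 \<Longrightarrow> x \<noteq> H \<Longrightarrow> rmem s1 x = rmem s x"
    and v: "rep v (H + 8) s1 H"
    and r: "\<And>i. i < t \<Longrightarrow> wmem s1 (reg i) = wmem s (reg i)"
  shows "\<exists>s'. runs t 1 0 s H s' (H + 8) \<and> pc s' = p + length c + 3 \<and> rep v (H + 8) s' (wmem s' (reg t))"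
proof -
  have H': "H mod 8 = 0" "8 \<le> H" "wmem s 5 = H" using H by (auto simp: hinv_def)
  have c2: "code_at G p c" "code_at G (p + length c) (bump (reg t))" using c(1) by (auto simp: code_at_append)
  note st = straight[OF c2(1) c(2,3)]
  have W5: "wmem s1 5 = H" using W[of 5] H' by auto
  define s' where "s' = execs w xs (bump (reg t)) s1"
  have len: "length (bump (reg t)) = 3" by (simp add: bump_def)
  have st2: "steps G w xs 3 s1 = s'" "pc s' = p + length c + 3" "outp s' = outp s1"
    using straight[OF c2(2), of s1] st(2) s1 len unfolding s'_def
    by (simp_all add: bump_def numeral_3_eq_3 del: execs.simps funpow.simps)
  have "8 < (2::nat) ^ w" using H H' by linarith
  then have W': "wmem s' = (wmem s1)(reg t := H, 6 := 8, 5 := H + 8)" and R': "rmem s' = rmem s1"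
    using W5 H(2) by (auto simp: s'_def bump_def set_w_def fun_eq_iff)
  have "steps G w xs (3 + length c) s = s'" using st st2 s1 by (simp only: funpow_add o_apply)
  then have n: "\<exists>n\<le>40 * 1 + 0. steps G w xs n s = s'" using c(4) by (intro exI[of _ "3 + length c"]) auto
  have keep: "wmem s' x = wmem s1 x" if "x mod 8 < 4" for x
    unfolding W' using that mod8_reg[OF that] by auto
  have "hinv (H + 8) s'" unfolding hinv_def
  proof (intro conjI allI impI)
    show "wmem s' 5 = H + 8" "(H + 8) mod 8 = 0" "8 \<le> H + 8" using W' H' by auto
    show "wmem s' x = 0" if "x mod 8 < 4" "x < 8 \<or> H + 8 \<le> x" for x
      using keep[OF that(1)] W[of x] that H(1) H' unfolding hinv_def by auto
    show "rmem s' x = 0" if "x mod 8 = 0" "x < 8 \<or> H + 8 \<le> x" for x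
      using R' R[of x] that H(1) H' unfolding hinv_def by auto
  qed
  moreover have "pres t H s s'" unfolding pres_def
  proof (intro conjI allI impI)
    show "wmem s' x = wmem s x" if "x < H" "x mod 8 < 4" for x using keep[OF that(2)] W[of x] that by auto
    show "rmem s' x = rmem s x" if "x < H" "x mod 8 = 0" for x using R' R[of x] that by auto
    show "wmem s' (reg i) = wmem s (reg i)" if "i < t" for i using r[OF that] W' that by auto
    show "outp s' = outp s" using st2 st s1 by simp
  qed
  moreover have "pres 0 (H + 8) s1 s'" unfolding pres_def using keep R' st2 by auto
  then have "rep v (H + 8) s' H" using rep_pres[OF _ _ _ v] H' by auto
  moreover have "wmem s' (reg t) = H" using W' by auto
  ultimately show ?thesis using n st2 unfolding runs_def by (intro exI[of _ s']) auto
qed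


lemma runs_straight:
  assumes c: "code_at G p c" "pc s = p" "list_all (\<lambda>i. \<not> jumps i) c" and H: "hinv H s"
    and s1: "s1 = execs w xs c s"
    and W: "\<And>x. x mod 8 \<le> 5 \<Longrightarrow> x \<noteq> reg t \<Longrightarrow> wmem s1 x = wmem s x"
    and R: "\<And>x. x mod 8 = 0 \<Longrightarrow> rmem s1 x = rmem s x"
  shows "runs t 0 (length c) s H s1 H \<and> pc s1 = p + length c"
proof -
  note st = straight[OF c, folded s1]
  have W': "wmem s1 x = wmem s x" if "x mod 8 < 4" for x
    using W[of x] that by (cases "x = reg t") auto
  have "wmem s1 5 = wmem s 5" using W[of 5] by simp
  then have "hinv H s1" using H W' R unfolding hinv_def by auto
  moreover have "wmem s1 (reg i) = wmem s (reg i)" if "i < t" for i using W[of "reg i"] that by simp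
  then have "pres t H s s1" using W' R st unfolding pres_def by simp
  ultimately show ?thesis using st unfolding runs_def by auto
qed

lemma execs_append: "execs w xs (a @ b) s = execs w xs b (execs w xs a s)"
  by (induction a arbitrary: s) auto

lemma bounds: "hinv H s \<Longrightarrow> H < 2 ^ w \<Longrightarrow> j < 9 \<Longrightarrow> j mod 2 ^ w = (j::nat)"
  unfolding hinv_def by auto

lemma rep_bounds:
  assumes "rep v H s h" "hinv H s" "H < 2 ^ w" "j < 8"
  shows "(h + j) mod 2 ^ w = h + j"
  using mod8_less[of h H j] rep_lt[OF assms(1)] assms by (auto simp: hinv_def)

lemma exec_load_num:
  assumes "rep v H s (wmem s t)" "hinv H s" "H < 2 ^ w" and s1: "s1 = execs w xs (load_num i t) s"
    and "i \<noteq> 3" "t \<noteq> 6"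
  shows "\<And>x. x \<noteq> 6 \<Longrightarrow> wmem s1 x = wmem s x" "\<And>x. x \<noteq> i \<Longrightarrow> x \<noteq> 3 \<Longrightarrow> rmem s1 x = rmem s x"
    "rmem s1 i = num_of v"
proof -
  have 1: "3 mod 2 ^ w = (3::nat)" using bounds[OF assms(2,3), of 3] by simp
  have 2: "(wmem s t + 3) mod 2 ^ w = wmem s t + 3" using rep_bounds[OF assms(1-3)] by simp
  show "wmem s1 x = wmem s x" if "x \<noteq> 6" for x
    using that by (simp add: s1 load_num_def set_w_def set_r_def)
  show "rmem s1 x = rmem s x" if "x \<noteq> i" "x \<noteq> 3" for x
    using that by (simp add: s1 load_num_def set_w_def set_r_def)
  have 3: "wmem s t \<noteq> 3" "wmem s t + 3 \<noteq> 6" using rep_lt[OF assms(1)] by auto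
  show "rmem s1 i = num_of v" using rep_parts(4)[OF assms(1,2)] 1 2 3 \<open>i \<noteq> 3\<close> \<open>t \<noteq> 6\<close>
    by (simp add: s1 load_num_def set_w_def set_r_def)
qed

lemma runs_load_field:
  assumes c: "code_at G p (load_field j (reg t))" "pc s = p" and H: "hinv H s" "H < 2 ^ w"
    and v: "rep v H s (wmem s (reg t))" and j: "j \<in> {1, 2}"
  shows "\<exists>s'. runs t 0 3 s H s' H \<and> pc s' = p + 3 \<and>
    rep (if j = 1 then lft v else rgt v) H s' (wmem s' (reg t)) \<and>
    (\<forall>u i. i \<noteq> t \<longrightarrow> rep u H s (wmem s (reg i)) \<longrightarrow> rep u H s' (wmem s' (reg i)))"
proof -
  have 1: "j mod 2 ^ w = j" using bounds[OF H, of j] j by auto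
  have 2: "(wmem s (reg t) + j) mod 2 ^ w = wmem s (reg t) + j" using rep_bounds[OF v H, of j] j by auto
  have 3: "wmem s (reg t) + j \<noteq> 6" using rep_lt[OF v] j by auto
  define s' where "s' = execs w xs (load_field j (reg t)) s"
  have W: "wmem s' = (wmem s)(6 := wmem s (reg t) + j, reg t := wmem s (wmem s (reg t) + j))"
    and R: "rmem s' = rmem s"
    using 1 2 3 by (auto simp: s'_def load_field_def set_w_def fun_eq_iff)
  have "list_all (\<lambda>i. \<not> jumps i) (load_field j (reg t))" by (simp add: load_field_def)
  moreover have "wmem s' x = wmem s x" if "x mod 8 \<le> 5" "x \<noteq> reg t" for x
    using W that by (cases "x = 6") auto
  ultimately have r: "runs t 0 (length (load_field j (reg t))) s H s' H" "pc s' = p + 3"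
    using runs_straight[OF c _ H(1) s'_def, of t] R by (auto simp: load_field_def)
  moreover have "pres 0 H s s'" using r(1) pres_weaken unfolding runs_def by blast
  then have "rep u H s' h" if "rep u H s h" for u h using rep_pres[of H H 0 s s' u h] that H unfolding hinv_def by simp
  moreover have "rep (if j = 1 then lft v else rgt v) H s (wmem s (wmem s (reg t) + j))"
    using rep_parts[OF v H(1)] j by auto
  moreover have "wmem s' (reg i) = wmem s (reg i)" if "i \<noteq> t" for i using W that by simp
  moreover have "wmem s' (reg t) = wmem s (wmem s (reg t) + j)" using W by simp
  moreover have "length (load_field j (reg t)) = 3" by (simp add: load_field_def)
  ultimately show ?thesis by (intro exI[of _ s']) (simp del: One_nat_def)
qed

lemma runs_move:
  assumes c: "code_at G p [WMove (reg t) (reg t')]" "pc s = p" and H: "hinv H s"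
    and v: "rep v H s (wmem s (reg t'))"
  shows "\<exists>s'. runs t 0 1 s H s' H \<and> pc s' = p + 1 \<and> rep v H s' (wmem s' (reg t))"
proof -
  define s' where "s' = execs w xs [WMove (reg t) (reg t')] s"
  have W: "wmem s' = (wmem s)(reg t := wmem s (reg t'))" and R: "rmem s' = rmem s"
    by (auto simp: s'_def set_w_def fun_eq_iff)
  have r: "runs t 0 1 s H s' H" "pc s' = p + 1"
    using runs_straight[OF c _ H(1) s'_def, of t] W R by auto
  moreover have "pres 0 H s s'" using r(1) pres_weaken unfolding runs_def by blast
  then have "rep u H s' h" if "rep u H s h" for u h using rep_pres[of H H 0 s s' u h] that H unfolding hinv_def by simp
  ultimately show ?thesis using W v by (intro exI[of _ s']) auto
qed

lemma runs_test:
  assumes c: "code_at G p [WLoad 6 (reg t), WConst 7 c, JumpWEq 6 7 q]" "pc s = p"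
    and H: "hinv H s" "H < 2 ^ w" and v: "rep v H s (wmem s (reg t))" and cc: "c \<le> 1"
  shows "\<exists>s'. runs b 0 3 s H s' H \<and> pc s' = (if is_cell v \<longleftrightarrow> c = 1 then q else p + 3)"
proof -
  define c1 where "c1 = [WLoad 6 (reg t), WConst 7 c]"
  define s1 where "s1 = execs w xs c1 s"
  define s' where "s' = branch (wmem s1 6 = wmem s1 7) q s1"
  have "c < 2 ^ w" using cc H(1,2) unfolding hinv_def by auto
  then have W: "wmem s1 = (wmem s)(6 := wmem s (wmem s (reg t)), 7 := c)" and R: "rmem s1 = rmem s"
    by (auto simp: s1_def c1_def set_w_def fun_eq_iff)
  have c2: "code_at G p c1" "code_at G (p + 2) [JumpWEq 6 7 q]"
    using c(1) code_at_append[of G p c1 "[JumpWEq 6 7 q]"] by (auto simp: c1_def)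
  have r: "runs b 0 2 s H s1 H" "pc s1 = p + 2"
    using runs_straight[OF c2(1) c(2) _ H(1) s1_def, of b] W R by (fastforce simp: c1_def numeral_2_eq_2)+
  have st: "step G w xs s1 = s'" using step_code[OF c2(2) r(2)] by (simp add: s'_def)
  have f: "wmem s' = wmem s1" "rmem s' = rmem s1" "outp s' = outp s1" by (simp_all add: s'_def branch_def)
  have "runs b 0 1 s1 H s' H" using st f r(1) unfolding runs_def
    by (intro conjI exI[of _ 1]) (auto simp: hinv_def pres_def)
  from runs_trans[OF r(1) this] have "runs b 0 3 s H s' H" by simp
  moreover have "pc s' = (if is_cell v \<longleftrightarrow> c = 1 then q else p + 3)"
    using rep_parts(1)[OF v H(1)] W r(2) cc by (cases "c = 0") (auto simp: s'_def branch_def)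
  ultimately show ?thesis by auto
qed

lemma runs_jump:
  assumes "code_at G p [Jump q]" "pc s = p" "hinv H s"
  shows "\<exists>s'. runs b 0 1 s H s' H \<and> pc s' = q"
proof -
  define s' where "s' = branch True q s"
  have "step G w xs s = s'" using step_code[OF assms(1,2)] by (simp add: s'_def)
  moreover have "wmem s' = wmem s" "rmem s' = rmem s" "outp s' = outp s" "pc s' = q" by (simp_all add: s'_def branch_def)
  ultimately have "runs b 0 1 s H s' H" using assms(3) unfolding runs_def
    by (intro conjI exI[of _ 1]) (auto simp: hinv_def pres_def)
  then show ?thesis using \<open>pc s' = q\<close> by auto
qed

lemma straight_num: "list_all (\<lambda>i. \<not> jumps i) (load_num i t)"
  by (simp add: load_num_def)

lemma length_load_num: "length (load_num i t) = 6"
  by (simp add: load_num_def)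

lemma rep_cong:
  assumes "\<And>x. x mod 8 < 4 \<Longrightarrow> wmem s' x = wmem s x" "\<And>x. x mod 8 = 0 \<Longrightarrow> rmem s' x = rmem s x"
  shows "rep v H s h \<Longrightarrow> rep v H s' h"
proof (induction v arbitrary: h)
  case (NumV n)
  then have h: "h mod 8 = 0" by auto
  have "wmem s' (h + j) = wmem s (h + j)" if "j < 4" for j
    using assms mod8_field[OF h(1), of j] that by auto
  from this[of 0] this[of 1] this[of 2] this[of 3] show ?case using NumV assms(2) h by auto
next
  case (RealV n)
  then have h: "h mod 8 = 0" by auto
  have "wmem s' (h + j) = wmem s (h + j)" if "j < 4" for j
    using assms mod8_field[OF h(1), of j] that by auto
  from this[of 0] this[of 1] this[of 2] this[of 3] show ?case using RealV assms(2) h by auto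
next
  case (CellV v1 v2)
  then have h: "h mod 8 = 0" by auto
  have "wmem s' (h + j) = wmem s (h + j)" if "j < 4" for j
    using assms mod8_field[OF h(1), of j] that by auto
  from this[of 0] this[of 1] this[of 2] this[of 3] show ?case using CellV assms(2) h by auto
qed

lemma hinv_cong:
  assumes "\<And>x. x mod 8 \<le> 5 \<Longrightarrow> wmem s' x = wmem s x" "\<And>x. x mod 8 = 0 \<Longrightarrow> rmem s' x = rmem s x"
    "hinv H s"
  shows "hinv H s'"
  using assms unfolding hinv_def by auto

lemma exec_load_two:
  assumes "rep v H s (wmem s (reg t))" "rep u H s (wmem s (reg t'))" "hinv H s" "H < 2 ^ w"
    and s1: "s1 = execs w xs (load_num 1 (reg t) @ load_num 2 (reg t')) s"
  shows "\<And>x. x \<noteq> 6 \<Longrightarrow> wmem s1 x = wmem s x" "\<And>x. x \<noteq> 1 \<Longrightarrow> x \<noteq> 2 \<Longrightarrow> x \<noteq> 3 \<Longrightarrow> rmem s1 x = rmem s x"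
    "rmem s1 1 = num_of v" "rmem s1 2 = num_of u"
proof -
  define s0 where "s0 = execs w xs (load_num 1 (reg t)) s"
  have s1': "s1 = execs w xs (load_num 2 (reg t')) s0" by (simp add: s1 s0_def execs_append)
  note A = exec_load_num[OF assms(1,3,4) s0_def]
  have c: "\<And>x. x mod 8 \<le> 5 \<Longrightarrow> wmem s0 x = wmem s x" "\<And>x. x mod 8 = 0 \<Longrightarrow> rmem s0 x = rmem s x"
    subgoal for x using A(1)[of x] by (cases "x = 6") auto
    subgoal for x using A(2)[of x] by (cases "x = 1 \<or> x = 3") auto
    done
  have "rep u H s0 (wmem s0 (reg t'))" using rep_cong[OF c assms(2)] A(1) by simp
  note B = exec_load_num[OF this hinv_cong[OF c assms(3)] assms(4) s1']
  show "\<And>x. x \<noteq> 6 \<Longrightarrow> wmem s1 x = wmem s x" "\<And>x. x \<noteq> 1 \<Longrightarrow> x \<noteq> 2 \<Longrightarrow> x \<noteq> 3 \<Longrightarrow> rmem s1 x = rmem s x"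
    "rmem s1 1 = num_of v" "rmem s1 2 = num_of u"
    using A B by simp_all
qed

lemma runs_less:
  assumes c: "code_at G p (load_num 1 (reg t) @ load_num 2 (reg t') @ [JumpRLess 1 2 q])" "pc s = p"
    and H: "hinv H s" "H < 2 ^ w" and v: "rep v H s (wmem s (reg t))" "rep u H s (wmem s (reg t'))"
  shows "\<exists>s'. runs b 0 13 s H s' H \<and> pc s' = (if num_of v < num_of u then q else p + 13)"
proof -
  define c1 where "c1 = load_num 1 (reg t) @ load_num 2 (reg t')"
  define s1 where "s1 = execs w xs c1 s"
  define s' where "s' = branch (rmem s1 1 < rmem s1 2) q s1"
  note A = exec_load_two[OF v H s1_def[unfolded c1_def]]
  have c2: "code_at G p c1" "code_at G (p + 12) [JumpRLess 1 2 q]"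
    using c(1) code_at_append[of G p c1 "[JumpRLess 1 2 q]"] by (auto simp: c1_def length_load_num)
  have len: "length c1 = 12" by (simp add: c1_def length_load_num)
  have "list_all (\<lambda>i. \<not> jumps i) c1" by (simp add: c1_def straight_num)
  moreover have "\<And>x. x mod 8 \<le> 5 \<Longrightarrow> wmem s1 x = wmem s x" "\<And>x. x mod 8 = 0 \<Longrightarrow> rmem s1 x = rmem s x"
    subgoal for x using A(1)[of x] by (cases "x = 6") auto
    subgoal for x using A(2)[of x] by (cases "x = 1 \<or> x = 2 \<or> x = 3") auto
    done
  ultimately have r: "runs b 0 12 s H s1 H" "pc s1 = p + 12"
    using runs_straight[OF c2(1) c(2) _ H(1) s1_def, of b] len by auto
  have st: "step G w xs s1 = s'" using step_code[OF c2(2) r(2)] by (simp add: s'_def)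
  have f: "wmem s' = wmem s1" "rmem s' = rmem s1" "outp s' = outp s1" by (simp_all add: s'_def branch_def)
  have "runs b 0 1 s1 H s' H" using st f r(1) unfolding runs_def
    by (intro conjI exI[of _ 1]) (auto simp: hinv_def pres_def)
  from runs_trans[OF r(1) this] have "runs b 0 13 s H s' H" by simp
  moreover have "pc s' = (if num_of v < num_of u then q else p + 13)"
    using A r(2) by (auto simp: s'_def branch_def)
  ultimately show ?thesis by auto
qed

end

lemma reg_neq_field:
  assumes "h mod 8 = 0" "j < 4"
  shows "reg i \<noteq> h + j" "h + j \<noteq> reg i"
proof -
  obtain k where "h = 8 * k" using assms(1) by (auto simp: mod_eq_0_iff_dvd)
  then show "reg i \<noteq> h + j" "h + j \<noteq> reg i" using assms(2) unfolding reg_def by presburger+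
qed

context machine
begin

section \<open>Correctness of the compiled constructs\<close>

definition env :: "nat \<Rightarrow> val list \<Rightarrow> nat \<Rightarrow> state \<Rightarrow> bool" where
  "env f \<rho> H s \<longleftrightarrow> (\<forall>i<length \<rho>. rep (\<rho> ! i) H s (wmem s (reg (f + i))))"

lemma env_runs:
  assumes "runs b k m s H s' H'" "hinv H s" "env f \<rho> H s" "f + length \<rho> \<le> b"
  shows "env f \<rho> H' s'"
  using assms runs_rep[OF assms(1,2)] unfolding env_def by auto

lemma env_snoc:
  "env f \<rho> H s \<Longrightarrow> rep v H s (wmem s (reg (f + length \<rho>))) \<Longrightarrow> env f (\<rho> @ [v]) H s"
  unfolding env_def by (auto simp: nth_append less_Suc_eq)

lemma env_drop:
  "env f \<rho> H s \<Longrightarrow> env (f + k) (drop k \<rho>) H s"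
  unfolding env_def by (auto simp: add.assoc)

text \<open>The heap grows by at most 8 addresses per cost unit, so the bound on
  \<open>H + 8 * ct e \<rho>\<close> guarantees that no address wraps around during the whole
  evaluation.\<close>

definition good :: "exp \<Rightarrow> bool" where
  "good e \<longleftrightarrow> (\<forall>p f \<rho> s H. code_at G p (compile e p f (length \<rho>)) \<longrightarrow> pc s = p \<longrightarrow> hinv H s \<longrightarrow>
     env f \<rho> H s \<longrightarrow> H + 8 * ct e \<rho> < 2 ^ w \<longrightarrow>
     (\<exists>s' H'. runs (f + length \<rho>) (ct e \<rho>) 0 s H s' H' \<and> pc s' = p + length (compile e p f (length \<rho>)) \<and>
        rep (ev e \<rho>) H' s' (wmem s' (reg (f + length \<rho>)))))"

lemma goodD:
  assumes "good e" "code_at G p (compile e p f d)" "pc s = p" "hinv H s" "env f \<rho> H s" "length \<rho> = d"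
    "H + 8 * ct e \<rho> < 2 ^ w"
  shows "\<exists>s' H'. runs (f + d) (ct e \<rho>) 0 s H s' H' \<and> pc s' = p + length (compile e p f d) \<and>
        rep (ev e \<rho>) H' s' (wmem s' (reg (f + d))) \<and> env f \<rho> H' s' \<and> hinv H' s' \<and> H' \<le> H + 8 * ct e \<rho>"
proof -
  obtain s' H' where r: "runs (f + d) (ct e \<rho>) 0 s H s' H'" "pc s' = p + length (compile e p f d)"
        "rep (ev e \<rho>) H' s' (wmem s' (reg (f + d)))"
    using assms unfolding good_def by blast
  then show ?thesis using env_runs[OF r(1) assms(4,5)] runs_hinv[OF r(1)] assms(6) by auto
qed

lemma good_two:
  assumes g: "good a" "good b" and c: "code_at G p (compile a p f d)"
      "code_at G (p + length (compile a p f d)) (compile b (p + length (compile a p f d)) f (d + 1))"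
    and s: "pc s = p" "hinv H s" "env f \<rho> H s" "length \<rho> = d" "H + 8 * (ct a \<rho> + ct b (\<rho> @ [ev a \<rho>])) < 2 ^ w"
  shows "\<exists>s' H'. runs (f + d) (ct a \<rho> + ct b (\<rho> @ [ev a \<rho>])) 0 s H s' H' \<and>
        pc s' = p + length (compile a p f d) + length (compile b (p + length (compile a p f d)) f (d + 1)) \<and>
        rep (ev a \<rho>) H' s' (wmem s' (reg (f + d))) \<and>
        rep (ev b (\<rho> @ [ev a \<rho>])) H' s' (wmem s' (reg (f + d + 1))) \<and> env f \<rho> H' s' \<and> hinv H' s' \<and>
        H' \<le> H + 8 * (ct a \<rho> + ct b (\<rho> @ [ev a \<rho>]))"
proof -
  obtain s1 H1 where 1: "runs (f + d) (ct a \<rho>) 0 s H s1 H1" "pc s1 = p + length (compile a p f d)"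
      "rep (ev a \<rho>) H1 s1 (wmem s1 (reg (f + d)))" "env f \<rho> H1 s1" "hinv H1 s1" "H1 \<le> H + 8 * ct a \<rho>"
    using goodD[OF g(1) c(1) s(1-4)] s(5) by auto
  have e: "env f (\<rho> @ [ev a \<rho>]) H1 s1" using env_snoc 1(3,4) s(4) by simp
  obtain s2 H2 where 2: "runs (f + (d + 1)) (ct b (\<rho> @ [ev a \<rho>])) 0 s1 H1 s2 H2"
      "pc s2 = p + length (compile a p f d) + length (compile b (p + length (compile a p f d)) f (d + 1))"
      "rep (ev b (\<rho> @ [ev a \<rho>])) H2 s2 (wmem s2 (reg (f + (d + 1))))" "hinv H2 s2"
      "env f (\<rho> @ [ev a \<rho>]) H2 s2"
    using goodD[OF g(2) c(2) 1(2,5) e] s(4,5) 1(6) by auto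
  have r: "runs (f + d) (ct a \<rho> + ct b (\<rho> @ [ev a \<rho>])) 0 s H s2 H2" using runs_trans[OF 1(1) 2(1)] by simp
  show ?thesis using r 2 runs_rep[OF 2(1) 1(5) 1(3)] env_runs[OF r s(2,3)] s(4) runs_hinv[OF r]
    by (intro exI[of _ s2] exI[of _ H2]) (auto simp: add.assoc)
qed

lemma good_Var: "good (Var k)"
  unfolding good_def
proof (intro allI impI)
  fix p f \<rho> s H
  assume c: "code_at G p (compile (Var k) p f (length \<rho>))" and s: "pc s = p" "hinv H s" "env f \<rho> H s"
    "H + 8 * ct (Var k) \<rho> < 2 ^ w"
  show "\<exists>s' H'. runs (f + length \<rho>) (ct (Var k) \<rho>) 0 s H s' H' \<and>
          pc s' = p + length (compile (Var k) p f (length \<rho>)) \<and>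
          rep (ev (Var k) \<rho>) H' s' (wmem s' (reg (f + length \<rho>)))"
  proof (cases "k < length \<rho>")
    case True
    then obtain s' where "runs (f + length \<rho>) 0 1 s H s' H" "pc s' = p + 1"
       "rep (\<rho> ! k) H s' (wmem s' (reg (f + length \<rho>)))"
      using runs_move[of p "f + length \<rho>" "f + k" s H "\<rho> ! k"] c s by (auto simp: env_def)
    then show ?thesis using True runs_weaken[of "f + length \<rho>" 0 1 s H s' H "f + length \<rho>" 1 0]
      by (intro exI[of _ s'] exI[of _ H]) auto
  next
    case False
    define s' where "s' = execs w xs [WConst (reg (f + length \<rho>)) 0] s"
    have W: "wmem s' = (wmem s)(reg (f + length \<rho>) := 0)" and R: "rmem s' = rmem s"
      by (auto simp: s'_def set_w_def fun_eq_iff)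
    have r: "runs (f + length \<rho>) 0 1 s H s' H" "pc s' = p + 1"
      using runs_straight[of p "[WConst (reg (f + length \<rho>)) 0]" s H, OF _ s(1) _ s(2) s'_def, of "f + length \<rho>"]
        W R c False by auto
    then show ?thesis using runs_weaken[OF r(1), of "f + length \<rho>" 1 0] False W runs_hinv[OF r(1)] rep_zero[of H s']
      by (intro exI[of _ s'] exI[of _ H]) auto
  qed
qed

lemma good_Bind:
  assumes "good a" "good b"
  shows "good (Bind a b)"
  unfolding good_def
proof (intro allI impI)
  fix p f \<rho> s H
  assume c: "code_at G p (compile (Bind a b) p f (length \<rho>))" and s: "pc s = p" "hinv H s" "env f \<rho> H s"
    "H + 8 * ct (Bind a b) \<rho> < 2 ^ w"
  define d where "d = length \<rho>"
  define A where "A = compile a p f d"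
  define B where "B = compile b (p + length A) f (d + 1)"
  have c2: "code_at G p A" "code_at G (p + length A) B"
    "code_at G (p + length A + length B) [WMove (reg (f + d)) (reg (f + d + 1))]"
    using c by (simp_all add: code_at_append A_def B_def d_def Let_def add.assoc)
  obtain s1 H1 where 1: "runs (f + d) (ct a \<rho> + ct b (\<rho> @ [ev a \<rho>])) 0 s H s1 H1"
       "pc s1 = p + length A + length B" "rep (ev b (\<rho> @ [ev a \<rho>])) H1 s1 (wmem s1 (reg (f + d + 1)))"
       "hinv H1 s1"
    using good_two[OF assms c2(1)[unfolded A_def] c2(2)[unfolded A_def B_def] s(1-3)] s(4) d_def
    unfolding A_def B_def by auto
  obtain s2 where 2: "runs (f + d) 0 1 s1 H1 s2 H1" "pc s2 = p + length A + length B + 1"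
      "rep (ev b (\<rho> @ [ev a \<rho>])) H1 s2 (wmem s2 (reg (f + d)))"
    using runs_move[OF c2(3) 1(2,4,3)] by auto
  have "runs (f + d) (ct (Bind a b) \<rho>) 0 s H s2 H1"
    using runs_weaken[OF runs_trans[OF 1(1) 2(1)]] by simp
  then show "\<exists>s' H'. runs (f + length \<rho>) (ct (Bind a b) \<rho>) 0 s H s' H' \<and>
          pc s' = p + length (compile (Bind a b) p f (length \<rho>)) \<and>
          rep (ev (Bind a b) \<rho>) H' s' (wmem s' (reg (f + length \<rho>)))"
    using 2 by (intro exI[of _ s2] exI[of _ H1]) (auto simp: A_def B_def d_def Let_def)
qed

lemma good_Field:
  assumes "good a" "j \<in> {1, 2}"
    and ev: "\<And>\<rho>. ev e \<rho> = (if j = 1 then lft (ev a \<rho>) else rgt (ev a \<rho>))" and ct: "\<And>\<rho>. ct e \<rho> = 1 + ct a \<rho>"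
    and cm: "\<And>p f d. compile e p f d = compile a p f d @ load_field j (reg (f + d))"
  shows "good e"
  unfolding good_def
proof (intro allI impI)
  fix p f \<rho> s H
  assume c: "code_at G p (compile e p f (length \<rho>))" and s: "pc s = p" "hinv H s" "env f \<rho> H s"
    "H + 8 * ct e \<rho> < 2 ^ w"
  define d where "d = length \<rho>"
  define A where "A = compile a p f d"
  have c2: "code_at G p A" "code_at G (p + length A) (load_field j (reg (f + d)))"
    using c by (simp_all add: code_at_append A_def d_def cm)
  obtain s1 H1 where 1: "runs (f + d) (ct a \<rho>) 0 s H s1 H1"
       "pc s1 = p + length A" "rep (ev a \<rho>) H1 s1 (wmem s1 (reg (f + d)))" "hinv H1 s1" "H1 \<le> H + 8 * ct a \<rho>"
    using goodD[OF assms(1) c2(1)[unfolded A_def] s(1-3)] s(4) d_def ct unfolding A_def by auto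
  have "H1 < 2 ^ w" using 1(5) s(4) ct by simp
  then obtain s2 where 2: "runs (f + d) 0 3 s1 H1 s2 H1" "pc s2 = p + length A + 3"
      "rep (ev e \<rho>) H1 s2 (wmem s2 (reg (f + d)))"
    using runs_load_field[OF c2(2) 1(2,4) _ 1(3) assms(2)] ev by auto
  have "runs (f + d) (ct e \<rho>) 0 s H s2 H1"
    using runs_weaken[OF runs_trans[OF 1(1) 2(1)]] ct by simp
  then show "\<exists>s' H'. runs (f + length \<rho>) (ct e \<rho>) 0 s H s' H' \<and>
          pc s' = p + length (compile e p f (length \<rho>)) \<and>
          rep (ev e \<rho>) H' s' (wmem s' (reg (f + length \<rho>)))"
    using 2 by (intro exI[of _ s2] exI[of _ H1]) (auto simp: A_def d_def cm load_field_def)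
qed

lemma good_Lft: "good a \<Longrightarrow> good (Lft a)" and good_Rgt: "good a \<Longrightarrow> good (Rgt a)"
  using good_Field[of a 1 "Lft a"] good_Field[of a 2 "Rgt a"] by simp_all

lemma good_Frame:
  assumes "good a"
  shows "good (Frame k a)"
  unfolding good_def
proof (intro allI impI)
  fix p f \<rho> s H
  assume c: "code_at G p (compile (Frame k a) p f (length \<rho>))" and s: "pc s = p" "hinv H s" "env f \<rho> H s"
    "H + 8 * ct (Frame k a) \<rho> < 2 ^ w"
  define j where "j = length \<rho> - k"
  have c': "code_at G p (compile a p (f + j) (length \<rho> - j))" using c by (simp add: j_def)
  have f: "f + j + (length \<rho> - j) = f + length \<rho>" by (simp add: j_def)
  obtain s1 H1 where 1: "runs (f + length \<rho>) (ct a (drop j \<rho>)) 0 s H s1 H1"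
       "pc s1 = p + length (compile a p (f + j) (length \<rho> - j))"
       "rep (ev a (drop j \<rho>)) H1 s1 (wmem s1 (reg (f + length \<rho>)))"
    using goodD[OF assms c' s(1,2) env_drop[OF s(3)]] s(4) f by (auto simp: j_def)
  then show "\<exists>s' H'. runs (f + length \<rho>) (ct (Frame k a) \<rho>) 0 s H s' H' \<and>
          pc s' = p + length (compile (Frame k a) p f (length \<rho>)) \<and>
          rep (ev (Frame k a) \<rho>) H' s' (wmem s' (reg (f + length \<rho>)))"
    using runs_weaken[OF 1(1)] by (intro exI[of _ s1] exI[of _ H1]) (auto simp: j_def)
qed

lemma good_IfCell:
  assumes g: "good c" "good a" "good b"
  shows "good (IfCell c a b)"
  unfolding good_def
proof (intro allI impI)
  fix p f \<rho> s H
  let ?e = "IfCell c a b"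
  assume c: "code_at G p (compile ?e p f (length \<rho>))" and s: "pc s = p" "hinv H s" "env f \<rho> H s"
    "H + 8 * ct ?e \<rho> < 2 ^ w"
  define d where "d = length \<rho>"
  define C where "C = compile c p f d"
  define B where "B = compile b (p + length C + 3) f d"
  define q where "q = p + length C + 3 + length B + 1"
  define A where "A = compile a q f d"
  have ce: "compile ?e p f d = C @ [WLoad 6 (reg (f + d)), WConst 7 1, JumpWEq 6 7 q] @ B @ [Jump (q + length A)] @ A"
    by (simp add: Let_def C_def B_def A_def q_def)
  have c2: "code_at G p C" "code_at G (p + length C) [WLoad 6 (reg (f + d)), WConst 7 1, JumpWEq 6 7 q]"
     "code_at G (p + length C + 3) B" "code_at G (p + length C + 3 + length B) [Jump (q + length A)]"
     "code_at G q A"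
  proof -
    define T where "T = [WLoad 6 (reg (f + d)), WConst 7 1, JumpWEq 6 7 q]"
    have "length T = 3" by (simp add: T_def)
    then show "code_at G p C" "code_at G (p + length C) [WLoad 6 (reg (f + d)), WConst 7 1, JumpWEq 6 7 q]"
     "code_at G (p + length C + 3) B" "code_at G (p + length C + 3 + length B) [Jump (q + length A)]"
     "code_at G q A"
      using c[folded d_def, unfolded ce, folded T_def] unfolding code_at_append T_def[symmetric]
      by (simp_all add: q_def add.assoc)
  qed
  have ctc: "ct c \<rho> \<le> ct ?e \<rho>" by simp
  obtain s1 H1 where 1: "runs (f + d) (ct c \<rho>) 0 s H s1 H1"
       "pc s1 = p + length C" "rep (ev c \<rho>) H1 s1 (wmem s1 (reg (f + d)))" "env f \<rho> H1 s1" "hinv H1 s1" "H1 \<le> H + 8 * ct c \<rho>"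
    using goodD[OF g(1) c2(1)[unfolded C_def] s(1-3)] s(4) d_def ctc unfolding C_def by fastforce
  have "H1 < 2 ^ w" using 1(6) s(4) ctc by simp
  then obtain s2 where 2: "runs (f + d) 0 3 s1 H1 s2 H1" "pc s2 = (if is_cell (ev c \<rho>) then q else p + length C + 3)"
    using runs_test[OF c2(2) 1(2,5) _ 1(3)] by fastforce
  have e2: "env f \<rho> H1 s2" "hinv H1 s2" using env_runs[OF 2(1) 1(5,4)] runs_hinv[OF 2(1)] d_def by auto
  note r2 = runs_trans[OF 1(1) 2(1)]
  show "\<exists>s' H'. runs (f + length \<rho>) (ct ?e \<rho>) 0 s H s' H' \<and>
          pc s' = p + length (compile ?e p f (length \<rho>)) \<and> rep (ev ?e \<rho>) H' s' (wmem s' (reg (f + length \<rho>)))"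
  proof (cases "is_cell (ev c \<rho>)")
    case True
    then have cte: "ct ?e \<rho> = 1 + ct c \<rho> + ct a \<rho>" by simp
    then have b: "H1 + 8 * ct a \<rho> < 2 ^ w" using 1(6) s(4) by simp
    have pc: "pc s2 = q" using 2(2) True by simp
    obtain s3 H3 where 3: "runs (f + d) (ct a \<rho>) 0 s2 H1 s3 H3" "pc s3 = q + length A"
        "rep (ev a \<rho>) H3 s3 (wmem s3 (reg (f + d)))"
      using goodD[OF g(2) c2(5)[unfolded A_def] pc e2(2,1) _ b] d_def unfolding A_def by auto
    have "runs (f + d) (ct ?e \<rho>) 0 s H s3 H3" unfolding cte
      using runs_weaken[OF runs_trans[OF r2 3(1)]] by simp
    then show ?thesis using 3 True ce d_def by (intro exI[of _ s3] exI[of _ H3]) (auto simp: q_def)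
  next
    case False
    then have cte: "ct ?e \<rho> = 1 + ct c \<rho> + ct b \<rho>" by simp
    then have b: "H1 + 8 * ct b \<rho> < 2 ^ w" using 1(6) s(4) by simp
    have pc: "pc s2 = p + length C + 3" using 2(2) False by simp
    obtain s3 H3 where 3: "runs (f + d) (ct b \<rho>) 0 s2 H1 s3 H3" "pc s3 = p + length C + 3 + length B"
        "rep (ev b \<rho>) H3 s3 (wmem s3 (reg (f + d)))" "hinv H3 s3"
      using goodD[OF g(3) c2(3)[unfolded B_def] pc e2(2,1) _ b] d_def unfolding B_def by auto
    obtain s4 where 4: "runs (f + d + 1) 0 1 s3 H3 s4 H3" "pc s4 = q + length A"
      using runs_jump[OF c2(4) 3(2,4)] by blast
    have "runs (f + d) (ct ?e \<rho>) 0 s H s4 H3" unfolding cte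
      using runs_weaken[OF runs_trans[OF runs_trans[OF r2 3(1)] 4(1)]] by simp
    moreover have "rep (ev b \<rho>) H3 s4 (wmem s4 (reg (f + d)))" using runs_rep[OF 4(1) 3(4,3)] by simp
    ultimately show ?thesis using 4 False ce d_def by (intro exI[of _ s4] exI[of _ H3]) (auto simp: q_def)
  qed
qed

lemma good_IfLess:
  assumes g: "good x" "good y" "good a" "good b"
  shows "good (IfLess x y a b)"
  unfolding good_def
proof (intro allI impI)
  fix p f \<rho> s H
  let ?e = "IfLess x y a b"
  assume c: "code_at G p (compile ?e p f (length \<rho>))" and s: "pc s = p" "hinv H s" "env f \<rho> H s"
    "H + 8 * ct ?e \<rho> < 2 ^ w"
  define d where "d = length \<rho>"
  define X where "X = compile x p f d"
  define Y where "Y = compile y (p + length X) f (d + 1)"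
  define p' where "p' = p + length X + length Y"
  define B where "B = compile b (p' + 13) f d"
  define q where "q = p' + 13 + length B + 1"
  define A where "A = compile a q f d"
  have ce: "compile ?e p f d = X @ Y @ (load_num 1 (reg (f + d)) @ load_num 2 (reg (f + d + 1)) @ [JumpRLess 1 2 q]) @
      B @ [Jump (q + length A)] @ A"
    by (simp add: Let_def X_def Y_def p'_def B_def A_def q_def eval_nat_numeral)
  have c2: "code_at G p X" "code_at G (p + length X) Y"
     "code_at G p' (load_num 1 (reg (f + d)) @ load_num 2 (reg (f + d + 1)) @ [JumpRLess 1 2 q])"
     "code_at G (p' + 13) B" "code_at G (p' + 13 + length B) [Jump (q + length A)]"
     "code_at G q A"
    using c[folded d_def, unfolded ce] unfolding code_at_append
    by (simp_all add: q_def p'_def add.assoc length_load_num)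
  define vx where "vx = ev x \<rho>"
  define vy where "vy = ev y (\<rho> @ [vx])"
  have ctc: "ct x \<rho> + ct y (\<rho> @ [ev x \<rho>]) \<le> ct ?e \<rho>" by simp
  obtain s1 H1 where 1: "runs (f + d) (ct x \<rho> + ct y (\<rho> @ [vx])) 0 s H s1 H1" "pc s1 = p'"
       "rep vx H1 s1 (wmem s1 (reg (f + d)))" "rep vy H1 s1 (wmem s1 (reg (f + d + 1)))"
       "env f \<rho> H1 s1" "hinv H1 s1" "H1 \<le> H + 8 * (ct x \<rho> + ct y (\<rho> @ [vx]))"
    using good_two[OF g(1,2) c2(1)[unfolded X_def] c2(2)[unfolded Y_def X_def] s(1-3)] s(4) d_def ctc
    unfolding Y_def X_def p'_def vx_def vy_def by fastforce
  have "H1 < 2 ^ w" using 1(7) s(4) ctc vx_def by simp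
  then obtain s2 where 2: "runs (f + d) 0 13 s1 H1 s2 H1" "pc s2 = (if num_of vx < num_of vy then q else p' + 13)"
    using runs_less[OF c2(3) 1(2,6) _ 1(3,4)] by blast
  have e2: "env f \<rho> H1 s2" "hinv H1 s2" using env_runs[OF 2(1) 1(6,5)] runs_hinv[OF 2(1)] d_def by auto
  note r2 = runs_trans[OF 1(1) 2(1)]
  show "\<exists>s' H'. runs (f + length \<rho>) (ct ?e \<rho>) 0 s H s' H' \<and>
          pc s' = p + length (compile ?e p f (length \<rho>)) \<and> rep (ev ?e \<rho>) H' s' (wmem s' (reg (f + length \<rho>)))"
  proof (cases "num_of vx < num_of vy")
    case True
    then have cte: "ct ?e \<rho> = 1 + (ct x \<rho> + ct y (\<rho> @ [vx])) + ct a \<rho>" by (simp add: vx_def vy_def)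
    then have b: "H1 + 8 * ct a \<rho> < 2 ^ w" using 1(7) s(4) by simp
    have pc: "pc s2 = q" using 2(2) True by simp
    obtain s3 H3 where 3: "runs (f + d) (ct a \<rho>) 0 s2 H1 s3 H3" "pc s3 = q + length A"
        "rep (ev a \<rho>) H3 s3 (wmem s3 (reg (f + d)))"
      using goodD[OF g(3) c2(6)[unfolded A_def] pc e2(2,1) _ b] d_def unfolding A_def by auto
    have "runs (f + d) (ct ?e \<rho>) 0 s H s3 H3" unfolding cte
      using runs_weaken[OF runs_trans[OF r2 3(1)]] by simp
    then show ?thesis using 3 True ce d_def
      by (intro exI[of _ s3] exI[of _ H3]) (auto simp: q_def p'_def length_load_num vx_def vy_def)
  next
    case False
    then have cte: "ct ?e \<rho> = 1 + (ct x \<rho> + ct y (\<rho> @ [vx])) + ct b \<rho>" by (simp add: vx_def vy_def)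
    then have b: "H1 + 8 * ct b \<rho> < 2 ^ w" using 1(7) s(4) by simp
    have pc: "pc s2 = p' + 13" using 2(2) False by simp
    obtain s3 H3 where 3: "runs (f + d) (ct b \<rho>) 0 s2 H1 s3 H3" "pc s3 = p' + 13 + length B"
        "rep (ev b \<rho>) H3 s3 (wmem s3 (reg (f + d)))" "hinv H3 s3"
      using goodD[OF g(4) c2(4)[unfolded B_def] pc e2(2,1) _ b] d_def unfolding B_def by auto
    obtain s4 where 4: "runs (f + d + 1) 0 1 s3 H3 s4 H3" "pc s4 = q + length A"
      using runs_jump[OF c2(5) 3(2,4)] by blast
    have "runs (f + d) (ct ?e \<rho>) 0 s H s4 H3" unfolding cte
      using runs_weaken[OF runs_trans[OF runs_trans[OF r2 3(1)] 4(1)]] by simp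
    moreover have "rep (ev b \<rho>) H3 s4 (wmem s4 (reg (f + d)))" using runs_rep[OF 4(1) 3(4,3)] by simp
    ultimately show ?thesis using 4 False ce d_def
      by (intro exI[of _ s4] exI[of _ H3]) (auto simp: q_def p'_def length_load_num vx_def vy_def)
  qed
qed


lemma alloc_num:
  assumes c: "code_at G p (K @ store_num 7 @ bump (reg t))" "pc s = p" "list_all (\<lambda>i. \<not> jumps i) K" "length K \<le> 20"
    and H: "hinv H s" "H + 8 < 2 ^ w" and s1: "s1 = execs w xs K s"
    and W: "\<And>x. x \<noteq> 6 \<Longrightarrow> x \<noteq> 7 \<Longrightarrow> wmem s1 x = wmem s x" "wmem s1 7 = n"
    and R: "\<And>x. x mod 8 = 0 \<Longrightarrow> rmem s1 x = rmem s x"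
  shows "\<exists>s'. runs t 1 0 s H s' (H + 8) \<and> pc s' = p + length K + 6 \<and> rep (NumV n) (H + 8) s' (wmem s' (reg t))"
proof -
  define K' where "K' = K @ store_num 7"
  define s2 where "s2 = execs w xs K' s"
  have H': "wmem s 5 = H" "H mod 8 = 0" "H < 2 ^ w" "8 \<le> H" using H by (auto simp: hinv_def)
  have b: "3 mod 2 ^ w = (3::nat)" "(H + 3) mod 2 ^ w = H + 3" using H H' by auto
  have Hx: "H + 3 \<noteq> 6" "H + 3 \<noteq> 7" using H' by auto
  have s2: "wmem s2 = (wmem s1)(6 := H + 3, H + 3 := n)" "rmem s2 = rmem s1"
    using W(1)[of 5] W(2) H' b Hx by (simp_all add: s2_def K'_def execs_append s1 set_w_def store_num_def)
  have z: "wmem s (H + j) = 0" if "j < 4" for j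
    using H(1) mod8_field[OF H'(2), of j] that unfolding hinv_def by auto
  have z': "rmem s H = 0" using H(1) unfolding hinv_def by auto
  have Hy: "H + j \<noteq> 6" "H + j \<noteq> 7" if "j < 4" for j using H'(2) that by presburger+
  have "rep (NumV n) (H + 8) s2 H"
    using s2 W z[of 0] z[of 1] z[of 2] Hy[of 0] Hy[of 1] Hy[of 2] H'(2) z' R[of H] by auto
  moreover have "code_at G p (K' @ bump (reg t))" using c(1) by (simp add: K'_def)
  moreover have "list_all (\<lambda>i. \<not> jumps i) K'" "length K' \<le> 30" "length K' = length K + 3"
    using c(3,4) by (auto simp: K'_def store_num_def)
  moreover have "wmem s2 x = wmem s x" if "x mod 8 \<le> 5" "x < H \<or> H + 8 \<le> x" for x
    using s2(1) W(1)[of x] that by (cases "x = 6 \<or> x = 7") auto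
  moreover have "wmem s2 (reg i) = wmem s (reg i)" for i using s2(1) W(1)[of "reg i"] reg_neq_field[OF H'(2), of 3 i] by simp
  ultimately show ?thesis using alloc[of p K' t s H s2 "NumV n"] c(2) H s2_def s2(2) R
    by (auto simp: add.commute)
qed

lemma good_Num: "good (Num n)"
  unfolding good_def
proof (intro allI impI)
  fix p f \<rho> s H
  let ?e = "Num n"
  assume c: "code_at G p (compile ?e p f (length \<rho>))" and s: "pc s = p" "hinv H s" "env f \<rho> H s"
    "H + 8 * ct ?e \<rho> < 2 ^ w"
  define K where "K = [WConst 7 n]"
  define s1 where "s1 = execs w xs K s"
  have "wmem s1 = (wmem s)(7 := n)" "rmem s1 = rmem s"
    using s(4) by (simp_all add: s1_def K_def set_w_def)
  then obtain s' where "runs (f + length \<rho>) 1 0 s H s' (H + 8)" "pc s' = p + 7"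
     "rep (NumV n) (H + 8) s' (wmem s' (reg (f + length \<rho>)))"
    using alloc_num[of p K "f + length \<rho>" s H s1 n] c s s1_def by (auto simp: K_def)
  then show "\<exists>s' H'. runs (f + length \<rho>) (ct ?e \<rho>) 0 s H s' H' \<and>
          pc s' = p + length (compile ?e p f (length \<rho>)) \<and> rep (ev ?e \<rho>) H' s' (wmem s' (reg (f + length \<rho>)))"
    using runs_weaken[of "f + length \<rho>" 1 0 s H s' "H + 8" "f + length \<rho>" "ct ?e \<rho>" 0]
    by (intro exI[of _ s'] exI[of _ "H + 8"]) (auto simp: bump_def store_num_def)
qed

lemma alloc_real:
  assumes c: "code_at G p (K @ RStore 5 1 # bump (reg t))" "pc s = p" "list_all (\<lambda>i. \<not> jumps i) K" "length K \<le> 20"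
    and H: "hinv H s" "H + 8 < 2 ^ w" and s1: "s1 = execs w xs K s"
    and W: "\<And>x. x \<noteq> 6 \<Longrightarrow> wmem s1 x = wmem s x"
    and R: "\<And>x. x mod 8 = 0 \<Longrightarrow> rmem s1 x = rmem s x" "rmem s1 1 = y"
  shows "\<exists>s'. runs t 1 0 s H s' (H + 8) \<and> pc s' = p + length K + 4 \<and> rep (RealV y) (H + 8) s' (wmem s' (reg t))"
proof -
  define K' where "K' = K @ [RStore 5 1]"
  define s2 where "s2 = execs w xs K' s"
  have H': "wmem s 5 = H" "H mod 8 = 0" using H(1) by (auto simp: hinv_def)
  have s2: "wmem s2 = wmem s1" "rmem s2 = (rmem s1)(H := y)"
    using W[of 5] R(2) H' by (auto simp: s2_def K'_def execs_append s1 set_r_def)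
  have z: "wmem s (H + j) = 0" if "j < 4" for j
    using H(1) mod8_field[OF H'(2), of j] that unfolding hinv_def by auto
  have Hx: "H + j \<noteq> 6" if "j < 4" for j using H'(2) that by presburger
  have "rep (RealV y) (H + 8) s2 H"
    using s2 W z[of 0] z[of 1] z[of 2] z[of 3] Hx[of 0] Hx[of 1] Hx[of 2] Hx[of 3] H'(2) by auto
  moreover have "code_at G p (K' @ bump (reg t))" using c(1) by (simp add: K'_def)
  moreover have "list_all (\<lambda>i. \<not> jumps i) K'" "length K' \<le> 30" using c(3,4) by (auto simp: K'_def)
  moreover have "wmem s2 x = wmem s x" if "x mod 8 \<le> 5" "x < H \<or> H + 8 \<le> x" for x
    using s2(1) W[of x] that by (cases "x = 6") auto
  moreover have "rmem s2 x = rmem s x" if "x mod 8 = 0" "x \<noteq> H" for x using s2(2) R that by simp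
  moreover have "wmem s2 (reg i) = wmem s (reg i)" for i using s2(1) W[of "reg i"] by simp
  ultimately show ?thesis using alloc[of p K' t s H s2 "RealV y"] c(2) H s2_def
    by (auto simp: K'_def add.commute)
qed

lemma good_Root:
  assumes "good a"
  shows "good (Root a)"
  unfolding good_def
proof (intro allI impI)
  fix p f \<rho> s H
  let ?e = "Root a"
  assume c: "code_at G p (compile ?e p f (length \<rho>))" and s: "pc s = p" "hinv H s" "env f \<rho> H s"
    "H + 8 * ct ?e \<rho> < 2 ^ w"
  define d where "d = length \<rho>"
  define A where "A = compile a p f d"
  define K where "K = load_num 1 (reg (f + d)) @ [RSqrt 1 1]"
  have c2: "code_at G p A" "code_at G (p + length A) (K @ RStore 5 1 # bump (reg (f + d)))"
    using c by (simp_all add: code_at_append A_def d_def K_def)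
  obtain s1 H1 where 1: "runs (f + d) (ct a \<rho>) 0 s H s1 H1"
       "pc s1 = p + length A" "rep (ev a \<rho>) H1 s1 (wmem s1 (reg (f + d)))" "hinv H1 s1" "H1 \<le> H + 8 * ct a \<rho>"
    using goodD[OF assms c2(1)[unfolded A_def] s(1-3)] s(4) d_def unfolding A_def by auto
  have H1: "H1 + 8 < 2 ^ w" "H1 < 2 ^ w" using 1(5) s(4) by simp_all
  define s0 where "s0 = execs w xs (load_num 1 (reg (f + d))) s1"
  note E = exec_load_num[OF 1(3,4) H1(2) s0_def]
  define sk where "sk = execs w xs K s1"
  have sk: "wmem sk = wmem s0" "rmem sk = (rmem s0)(1 := sqrt (rmem s0 1))"
    by (simp_all add: sk_def K_def execs_append s0_def set_r_def)
  have "list_all (\<lambda>i. \<not> jumps i) K" "length K \<le> 20" "length K = 7"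
    by (simp_all add: K_def straight_num length_load_num)
  moreover have "rmem sk x = rmem s1 x" if "x mod 8 = 0" for x
    using sk E(2)[of x] that by (cases "x = 1 \<or> x = 3") auto
  ultimately obtain s2 where 2: "runs (f + d) 1 0 s1 H1 s2 (H1 + 8)" "pc s2 = p + length A + 11"
      "rep (ev ?e \<rho>) (H1 + 8) s2 (wmem s2 (reg (f + d)))"
    using alloc_real[OF c2(2) 1(2) _ _ 1(4) H1(1) sk_def, of "sqrt (num_of (ev a \<rho>))"] sk E by auto
  have "runs (f + d) (ct ?e \<rho>) 0 s H s2 (H1 + 8)"
    using runs_weaken[OF runs_trans[OF 1(1) 2(1)]] by simp
  then show "\<exists>s' H'. runs (f + length \<rho>) (ct ?e \<rho>) 0 s H s' H' \<and>
          pc s' = p + length (compile ?e p f (length \<rho>)) \<and>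
          rep (ev ?e \<rho>) H' s' (wmem s' (reg (f + length \<rho>)))"
    using 2 by (intro exI[of _ s2] exI[of _ "H1 + 8"]) (auto simp: A_def d_def bump_def length_load_num)
qed

lemma good_Arith:
  assumes "good a" "good b"
  shows "good (Arith g a b)"
  unfolding good_def
proof (intro allI impI)
  fix p f \<rho> s H
  let ?e = "Arith g a b"
  assume c: "code_at G p (compile ?e p f (length \<rho>))" and s: "pc s = p" "hinv H s" "env f \<rho> H s"
    "H + 8 * ct ?e \<rho> < 2 ^ w"
  define d where "d = length \<rho>"
  define A where "A = compile a p f d"
  define B where "B = compile b (p + length A) f (d + 1)"
  define L where "L = load_num 1 (reg (f + d)) @ load_num 2 (reg (f + d + 1))"
  define K where "K = L @ [RArith g 1 1 2]"
  have c2: "code_at G p A" "code_at G (p + length A) B"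
    "code_at G (p + length A + length B) (K @ RStore 5 1 # bump (reg (f + d)))"
    using c by (simp_all add: code_at_append A_def B_def d_def K_def L_def Let_def add.assoc)
  define v u where "v = ev a \<rho>" and "u = ev b (\<rho> @ [v])"
  obtain s1 H1 where 1: "runs (f + d) (ct a \<rho> + ct b (\<rho> @ [v])) 0 s H s1 H1"
       "pc s1 = p + length A + length B" "rep v H1 s1 (wmem s1 (reg (f + d)))" 
       "rep u H1 s1 (wmem s1 (reg (f + d + 1)))" "hinv H1 s1" "H1 \<le> H + 8 * (ct a \<rho> + ct b (\<rho> @ [v]))"
    using good_two[OF assms c2(1)[unfolded A_def] c2(2)[unfolded A_def B_def] s(1-3)] s(4) d_def
    unfolding A_def B_def u_def v_def by auto
  have H1: "H1 + 8 < 2 ^ w" "H1 < 2 ^ w" using 1(6) s(4) v_def by simp_all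
  define s0 where "s0 = execs w xs L s1"
  note E = exec_load_two[OF 1(3-5) H1(2) s0_def[unfolded L_def]]
  define sk where "sk = execs w xs K s1"
  have sk: "wmem sk = wmem s0" "rmem sk = (rmem s0)(1 := eval_rop g (rmem s0 1) (rmem s0 2))"
    by (auto simp: sk_def K_def execs_append s0_def set_r_def)
  have "list_all (\<lambda>i. \<not> jumps i) K" "length K \<le> 20" "length K = 13"
    by (simp_all add: K_def L_def straight_num length_load_num)
  moreover have "rmem sk x = rmem s1 x" if "x mod 8 = 0" for x
    using sk E(2)[of x] that by (cases "x = 1 \<or> x = 2 \<or> x = 3") auto
  ultimately obtain s2 where 2: "runs (f + d) 1 0 s1 H1 s2 (H1 + 8)" "pc s2 = p + length A + length B + 17"
      "rep (ev ?e \<rho>) (H1 + 8) s2 (wmem s2 (reg (f + d)))"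
    using alloc_real[OF c2(3) 1(2) _ _ 1(5) H1(1) sk_def, of "eval_rop g (num_of v) (num_of u)"] sk E
    by (auto simp: v_def u_def)
  have "runs (f + d) (ct ?e \<rho>) 0 s H s2 (H1 + 8)"
    using runs_weaken[OF runs_trans[OF 1(1) 2(1)]] v_def by simp
  then show "\<exists>s' H'. runs (f + length \<rho>) (ct ?e \<rho>) 0 s H s' H' \<and>
          pc s' = p + length (compile ?e p f (length \<rho>)) \<and>
          rep (ev ?e \<rho>) H' s' (wmem s' (reg (f + length \<rho>)))"
    using 2 by (intro exI[of _ s2] exI[of _ "H1 + 8"]) (auto simp: A_def B_def d_def bump_def length_load_num Let_def)
qed

lemma good_Cell:
  assumes "good a" "good b"
  shows "good (Cell a b)"
  unfolding good_def
proof (intro allI impI)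
  fix p f \<rho> s H
  let ?e = "Cell a b"
  assume c: "code_at G p (compile ?e p f (length \<rho>))" and s: "pc s = p" "hinv H s" "env f \<rho> H s"
    "H + 8 * ct ?e \<rho> < 2 ^ w"
  define d where "d = length \<rho>"
  define A where "A = compile a p f d"
  define B where "B = compile b (p + length A) f (d + 1)"
  define K where "K = store_cell (reg (f + d)) (reg (f + d + 1))"
  have c2: "code_at G p A" "code_at G (p + length A) B"
    "code_at G (p + length A + length B) (K @ bump (reg (f + d)))"
    using c by (simp_all add: code_at_append A_def B_def d_def K_def Let_def add.assoc)
  define v u where "v = ev a \<rho>" and "u = ev b (\<rho> @ [v])"
  obtain s1 H1 where 1: "runs (f + d) (ct a \<rho> + ct b (\<rho> @ [v])) 0 s H s1 H1"
       "pc s1 = p + length A + length B" "rep v H1 s1 (wmem s1 (reg (f + d)))" 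
       "rep u H1 s1 (wmem s1 (reg (f + d + 1)))" "hinv H1 s1" "H1 \<le> H + 8 * (ct a \<rho> + ct b (\<rho> @ [v]))"
    using good_two[OF assms c2(1)[unfolded A_def] c2(2)[unfolded A_def B_def] s(1-3)] s(4) d_def
    unfolding A_def B_def u_def v_def by auto
  have H1: "H1 + 8 < 2 ^ w" "H1 < 2 ^ w" using 1(6) s(4) v_def by simp_all
  define sk where "sk = execs w xs K s1"
  have H: "wmem s1 5 = H1" "H1 mod 8 = 0" "8 \<le> H1" using 1(5) by (auto simp: hinv_def)
  have b: "1 mod 2 ^ w = (1::nat)" "(H1 + 1) mod 2 ^ w = H1 + 1" "(H1 + 2) mod 2 ^ w = H1 + 2"
    using H H1 bounds[OF 1(5) H1(2), of 1] by auto
  have Hx: "H1 + j \<noteq> 5" "H1 + j \<noteq> 6" "H1 + j \<noteq> 7" "(H1 + j) mod 8 = j" if "j < 4" for j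
    using mod8_field[OF H(2), of j] H(3) that by auto
  note Hr = reg_neq_field[OF H(2), of 0] reg_neq_field[OF H(2), of 1] reg_neq_field[OF H(2), of 2]
  define a1 b1 where "a1 = wmem s1 (reg (f + d))" and "b1 = wmem s1 (reg (f + d + 1))"
  have W: "wmem sk = (wmem s1)(7 := 1, H1 := 1, H1 + 1 := a1, 6 := H1 + 2, H1 + 2 := b1)" and R: "rmem sk = rmem s1"
    using b(2,3) H(1) Hx[of 0] Hx[of 1] Hx[of 2] Hr
    by (simp_all add: sk_def K_def store_cell_def set_w_def a1_def b1_def b(1)[simplified])
  have z: "wmem s1 (H1 + 3) = 0"
    using 1(5) mod8_field[OF H(2), of 3] unfolding hinv_def by auto
  have z': "rmem s1 H1 = 0" using 1(5) H unfolding hinv_def by auto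
  have Wk: "wmem sk x = wmem s1 x" if "x mod 8 \<le> 5" "x < H1 \<or> H1 + 8 \<le> x" for x using W that by auto
  have "runs 0 0 0 s1 H1 s1 H1" using 1(5) unfolding runs_def by (auto simp: pres_def)
  have ext: "rep t (H1 + 8) sk h" if "rep t H1 s1 h" for t h
  proof -
    define s3 where "s3 = sk\<lparr>outp := outp s1\<rparr>"
    have "wmem s3 = wmem sk" "rmem s3 = rmem sk" by (simp_all add: s3_def)
    have "pres 0 H1 s1 s3" using Wk R by (auto simp: pres_def s3_def)
    then have "rep t (H1 + 8) s3 h" using rep_pres[of H1 "H1 + 8" 0 s1 s3 t h] H that by simp
    then show ?thesis using rep_cong[of sk s3] by (simp add: s3_def)
  qed
  have "rep (CellV v u) (H1 + 8) sk H1"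
    using W R H Hx[of 1] Hx[of 2] Hx[of 3] Hx[of 0] z z' ext[OF 1(3)] ext[OF 1(4)] by (auto simp: a1_def b1_def)
  moreover have "list_all (\<lambda>i. \<not> jumps i) K" "length K \<le> 30" "length K = 6"
    by (simp_all add: K_def store_cell_def)
  moreover have "wmem sk (reg i) = wmem s1 (reg i)" for i
    using W Hr[of i] by auto
  ultimately obtain s2 where 2: "runs (f + d) 1 0 s1 H1 s2 (H1 + 8)" "pc s2 = p + length A + length B + 9"
      "rep (ev ?e \<rho>) (H1 + 8) s2 (wmem s2 (reg (f + d)))"
    using alloc[OF c2(3) 1(2) _ _ 1(5) H1(1) sk_def Wk, of "CellV v u"] R by (auto simp: v_def u_def)
  have "runs (f + d) (ct ?e \<rho>) 0 s H s2 (H1 + 8)"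
    using runs_weaken[OF runs_trans[OF 1(1) 2(1)]] v_def by simp
  then show "\<exists>s' H'. runs (f + length \<rho>) (ct ?e \<rho>) 0 s H s' H' \<and>
          pc s' = p + length (compile ?e p f (length \<rho>)) \<and>
          rep (ev ?e \<rho>) H' s' (wmem s' (reg (f + length \<rho>)))"
    using 2 by (intro exI[of _ s2] exI[of _ "H1 + 8"]) (auto simp: A_def B_def d_def bump_def store_cell_def Let_def)
qed


declare rep.simps [simp del]

text \<open>Induction on the folded value itself, whose right spine is the list. An exhausted list
  costs 0, yet the final test is still executed; hence the 3 uncharged instructions in the
  conclusion.\<close>

lemma fold_loop:
  assumes g: "good b" and B: "B = compile b (p + 3) f (d + 2)"
    and c: "code_at G p [WLoad 6 (reg (f + d)), WConst 7 0, JumpWEq 6 7 (p + 3 + length B + 5)]"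
      "code_at G (p + 3) B" "code_at G (p + 3 + length B) [WMove (reg (f + d + 1)) (reg (f + d + 2))]"
      "code_at G (p + 3 + length B + 1) (load_field 2 (reg (f + d)))"
      "code_at G (p + 3 + length B + 4) [Jump p]"
    and d: "length \<rho> = d"
  shows "pc s = p \<Longrightarrow> hinv H s \<Longrightarrow> env f \<rho> H s \<Longrightarrow> rep v H s (wmem s (reg (f + d))) \<Longrightarrow>
    rep \<sigma> H s (wmem s (reg (f + d + 1))) \<Longrightarrow>
    H + 8 * lcost (\<lambda>r s. ev b (\<rho> @ [r, s])) (\<lambda>r s. ct b (\<rho> @ [r, s])) v \<sigma> < 2 ^ w \<Longrightarrow>
    \<exists>s' H'. runs (f + d) (lcost (\<lambda>r s. ev b (\<rho> @ [r, s])) (\<lambda>r s. ct b (\<rho> @ [r, s])) v \<sigma>) 3 s H s' H' \<and>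
      pc s' = p + 3 + length B + 5 \<and> rep (lfold (\<lambda>r s. ev b (\<rho> @ [r, s])) v \<sigma>) H' s' (wmem s' (reg (f + d + 1)))"
proof (induction v arbitrary: s H \<sigma>)
  case (NumV n)
  have H: "H < 2 ^ w" using NumV by simp
  obtain s' where "runs (f + d + 2) 0 3 s H s' H" "pc s' = p + 3 + length B + 5"
    using runs_test[OF c(1) NumV(1,2) H NumV(4), of "f + d + 2"] by auto
  then show ?case using runs_weaken[of "f + d + 2" 0 3 s H s' H "f + d" 0 3]
     runs_rep[of "f + d + 2" 0 3 s H s' H \<sigma> "f + d + 1"] NumV by auto
next
  case (RealV n)
  have H: "H < 2 ^ w" using RealV by simp
  obtain s' where "runs (f + d + 2) 0 3 s H s' H" "pc s' = p + 3 + length B + 5"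
    using runs_test[OF c(1) RealV(1,2) H RealV(4), of "f + d + 2"] by auto
  then show ?case using runs_weaken[of "f + d + 2" 0 3 s H s' H "f + d" 0 3]
     runs_rep[of "f + d + 2" 0 3 s H s' H \<sigma> "f + d + 1"] RealV by auto
next
  case (CellV x r)
  let ?v = "CellV x r"
  let ?F = "\<lambda>r s. ev b (\<rho> @ [r, s])"
  let ?C = "\<lambda>r s. ct b (\<rho> @ [r, s])"
  have H: "H < 2 ^ w" using CellV.prems(6) by simp
  obtain s1 where 1: "runs (f + d + 2) 0 3 s H s1 H" "pc s1 = p + 3"
    using runs_test[OF c(1) CellV.prems(1,2) H CellV.prems(4), of "f + d + 2"] by auto
  have h1: "hinv H s1" using runs_hinv[OF 1(1)] by simp
  have r1: "rep ?v H s1 (wmem s1 (reg (f + d)))" "rep \<sigma> H s1 (wmem s1 (reg (f + d + 1)))"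
    using runs_rep[OF 1(1) CellV.prems(2)] CellV.prems(4,5) by auto
  have "env f \<rho> H s1" using env_runs[OF 1(1) CellV.prems(2,3)] d by simp
  then have "env f (\<rho> @ [?v] @ [\<sigma>]) H s1"
    unfolding append_assoc[symmetric] using r1 d by (intro env_snoc) (auto simp: add.assoc)
  then have e1: "env f (\<rho> @ [?v, \<sigma>]) H s1" by simp
  have b1: "H + 8 * ct b (\<rho> @ [?v, \<sigma>]) < 2 ^ w" using CellV.prems(6) by simp
  obtain s2 H2 where 2: "runs (f + (d + 2)) (ct b (\<rho> @ [?v, \<sigma>])) 0 s1 H s2 H2" "pc s2 = p + 3 + length B"
     "rep (?F ?v \<sigma>) H2 s2 (wmem s2 (reg (f + (d + 2))))" "env f (\<rho> @ [?v, \<sigma>]) H2 s2" "hinv H2 s2"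
     "H2 \<le> H + 8 * ct b (\<rho> @ [?v, \<sigma>])"
    using goodD[OF g c(2)[unfolded B] 1(2) h1 e1 _ b1] d B by auto
  have r2: "rep ?v H2 s2 (wmem s2 (reg (f + d)))" using runs_rep[OF 2(1) h1 r1(1)] by simp
  obtain s3 where 3: "runs (f + d + 1) 0 1 s2 H2 s3 H2" "pc s3 = p + 3 + length B + 1"
     "rep (?F ?v \<sigma>) H2 s3 (wmem s3 (reg (f + d + 1)))"
    using runs_move[OF c(3) 2(2,5)] 2(3) by (auto simp: add.assoc)
  have h3: "hinv H2 s3" using runs_hinv[OF 3(1)] by simp
  have r3: "rep ?v H2 s3 (wmem s3 (reg (f + d)))" using runs_rep[OF 3(1) 2(5) r2] by simp
  have H2: "H2 < 2 ^ w" using 2(6) CellV.prems(6) by simp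
  obtain s4 where 4: "runs (f + d) 0 3 s3 H2 s4 H2" "pc s4 = p + 3 + length B + 4"
     "rep r H2 s4 (wmem s4 (reg (f + d)))"
     "\<forall>u i. i \<noteq> f + d \<longrightarrow> rep u H2 s3 (wmem s3 (reg i)) \<longrightarrow> rep u H2 s4 (wmem s4 (reg i))"
    using runs_load_field[OF c(4) 3(2) h3 H2 r3] by auto
  have h4: "hinv H2 s4" using runs_hinv[OF 4(1)] by simp
  have r4: "rep (?F ?v \<sigma>) H2 s4 (wmem s4 (reg (f + d + 1)))" using 4(4) 3(3) by simp
  obtain s5 where 5: "runs (f + d + 2) 0 1 s4 H2 s5 H2" "pc s5 = p"
    using runs_jump[OF c(5) 4(2) h4] by blast
  have h5: "hinv H2 s5" using runs_hinv[OF 5(1)] by simp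
  have r5: "rep (?F ?v \<sigma>) H2 s5 (wmem s5 (reg (f + d + 1)))" "rep r H2 s5 (wmem s5 (reg (f + d)))"
    using runs_rep[OF 5(1) h4] r4 4(3) by auto
  have "runs (f + d) (ct b (\<rho> @ [?v, \<sigma>])) 8 s H s5 H2"
  proof -
    have "runs (f + d) 0 3 s H s1 H" using runs_weaken[OF 1(1), of "f + d" 0 3] by simp
    from runs_trans[OF this 2(1)] have "runs (f + d) (ct b (\<rho> @ [?v, \<sigma>])) 3 s H s2 H2" by simp
    from runs_trans[OF runs_trans[OF runs_trans[OF this 3(1)] 4(1)] 5(1)] show ?thesis
      by (simp add: eval_nat_numeral)
  qed
  \<comment> \<open>Test, move, load and jump are 3 + 1 + 3 + 1 uncharged instructions; the 1 that
    \<open>lcost\<close> adds per element pays for them.\<close>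
  then have it: "runs (f + d) (1 + ct b (\<rho> @ [?v, \<sigma>])) 0 s H s5 H2" using runs_weaken by fastforce
  have e5: "env f \<rho> H2 s5" using env_runs[OF it CellV.prems(2,3)] d by simp
  have bb: "H2 + 8 * lcost ?F ?C r (?F ?v \<sigma>) < 2 ^ w" using CellV.prems(6) 2(6) by simp
  obtain s6 H6 where 6: "runs (f + d) (lcost ?F ?C r (?F ?v \<sigma>)) 3 s5 H2 s6 H6" "pc s6 = p + 3 + length B + 5"
      "rep (lfold ?F r (?F ?v \<sigma>)) H6 s6 (wmem s6 (reg (f + d + 1)))"
    using CellV.IH(2)[OF 5(2) h5 e5 r5(2,1) bb] by blast
  from runs_trans[OF it 6(1)] 6 show ?case by (auto simp: add.assoc)
qed

lemma good_Fold:
  assumes g: "good l" "good i" "good b"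
  shows "good (Fold l i b)"
  unfolding good_def
proof (intro allI impI)
  fix p f \<rho> s H
  let ?e = "Fold l i b"
  assume c: "code_at G p (compile ?e p f (length \<rho>))" and s: "pc s = p" "hinv H s" "env f \<rho> H s"
    "H + 8 * ct ?e \<rho> < 2 ^ w"
  define d where "d = length \<rho>"
  define L where "L = compile l p f d"
  define I where "I = compile i (p + length L) f (d + 1)"
  define p' where "p' = p + length L + length I"
  define B where "B = compile b (p' + 3) f (d + 2)"
  define T where "T = [WLoad 6 (reg (f + d)), WConst 7 0, JumpWEq 6 7 (p' + 3 + length B + 5)]"
  have ce: "compile ?e p f d = L @ I @ T @ B @ [WMove (reg (f + d + 1)) (reg (f + d + 2))] @
      load_field 2 (reg (f + d)) @ [Jump p'] @ [WMove (reg (f + d)) (reg (f + d + 1))]"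
    by (simp add: Let_def L_def I_def p'_def B_def T_def)
  have len: "length T = 3" "length (load_field 2 (reg (f + d))) = 3" by (simp_all add: T_def load_field_def)
  have c2: "code_at G p L" "code_at G (p + length L) I" "code_at G p' T" "code_at G (p' + 3) B"
      "code_at G (p' + 3 + length B) [WMove (reg (f + d + 1)) (reg (f + d + 2))]"
      "code_at G (p' + 3 + length B + 1) (load_field 2 (reg (f + d)))"
      "code_at G (p' + 3 + length B + 4) [Jump p']"
      "code_at G (p' + 3 + length B + 5) [WMove (reg (f + d)) (reg (f + d + 1))]"
    using c[folded d_def, unfolded ce] len unfolding code_at_append by (simp_all add: p'_def ac_simps)
  define vl vi where "vl = ev l \<rho>" and "vi = ev i (\<rho> @ [vl])"
  let ?F = "\<lambda>r s. ev b (\<rho> @ [r, s])"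
  let ?C = "\<lambda>r s. ct b (\<rho> @ [r, s])"
  have cte: "ct ?e \<rho> = 1 + (ct l \<rho> + ct i (\<rho> @ [vl])) + lcost ?F ?C vl vi" by (simp add: vl_def vi_def)
  obtain s1 H1 where 1: "runs (f + d) (ct l \<rho> + ct i (\<rho> @ [vl])) 0 s H s1 H1" "pc s1 = p'"
       "rep vl H1 s1 (wmem s1 (reg (f + d)))" "rep vi H1 s1 (wmem s1 (reg (f + d + 1)))"
       "env f \<rho> H1 s1" "hinv H1 s1" "H1 \<le> H + 8 * (ct l \<rho> + ct i (\<rho> @ [vl]))"
    using good_two[OF g(1,2) c2(1)[unfolded L_def] c2(2)[unfolded L_def I_def] s(1-3)] s(4) d_def cte
    unfolding I_def L_def p'_def vl_def vi_def by fastforce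
  have "H1 + 8 * lcost ?F ?C vl vi < 2 ^ w" using 1(7) s(4) cte by simp
  then obtain s2 H2 where 2: "runs (f + d) (lcost ?F ?C vl vi) 3 s1 H1 s2 H2" "pc s2 = p' + 3 + length B + 5"
      "rep (lfold ?F vl vi) H2 s2 (wmem s2 (reg (f + d + 1)))"
    using fold_loop[OF g(3) B_def c2(3)[unfolded T_def] c2(4-7) d_def[symmetric] 1(2,6,5,3,4)] by auto
  have h2: "hinv H2 s2" using runs_hinv[OF 2(1)] by simp
  obtain s3 where 3: "runs (f + d) 0 1 s2 H2 s3 H2" "pc s3 = p' + 3 + length B + 6"
      "rep (lfold ?F vl vi) H2 s3 (wmem s3 (reg (f + d)))"
    using runs_move[OF c2(8) 2(2) h2 2(3)] by auto
  have le: "length (compile ?e p f d) = length L + length I + 3 + length B + 6"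
    using len by (simp add: ce del: compile.simps)
  have "runs (f + d) (ct ?e \<rho>) 0 s H s3 H2"
    using runs_weaken[OF runs_trans[OF runs_trans[OF 1(1) 2(1)] 3(1)]] unfolding cte by simp
  then show "\<exists>s' H'. runs (f + length \<rho>) (ct ?e \<rho>) 0 s H s' H' \<and>
          pc s' = p + length (compile ?e p f (length \<rho>)) \<and> rep (ev ?e \<rho>) H' s' (wmem s' (reg (f + length \<rho>)))"
    using 3 le by (intro exI[of _ s3] exI[of _ H2])
      (simp add: d_def[symmetric] p'_def vl_def vi_def del: compile.simps)
qed

theorem compile_correct: "good e"
  by (induction e)
    (simp_all add: good_Var good_Bind good_Num good_Arith good_Root good_Cell good_Lft good_Rgt
      good_IfCell good_IfLess good_Fold good_Frame)

end

section \<open>Input of the points and output of the edges\<close>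

primrec vl :: "val list \<Rightarrow> val" where
  "vl [] = NumV 0"
| "vl (x # xs) = CellV x (vl xs)"

definition entry :: "real list \<Rightarrow> nat \<Rightarrow> val" where
  "entry xs k = CellV (NumV k) (CellV (RealV (xs ! (2 * k))) (RealV (xs ! (2 * k + 1))))"

text \<open>The input length arrives at address 0, which has to become the zero record. It is moved
  to \<open>reg 0\<close> and serves as a countdown; the heap starts at 8.\<close>

definition read_head :: "instr list" where
  "read_head = [WMove (reg 0) 0, WConst 0 0, WConst 5 8]"

definition read_index :: "instr list" where
  "read_index = [WConst 7 1, WArith WSub (reg 0) (reg 0) 7, WArith WSub (reg 0) (reg 0) 7]"

text \<open>The points are read from the last to the first, so that prepending restores their order.
  The counter is the position of the first coordinate in the input, and half of it is the index of
  the point.\<close>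

definition read_body :: "instr list" where
  "read_body = ([WConst 7 2, WArith WDiv 7 (reg 0) 7] @ store_num 7 @ bump (reg 2)) @
     ([RInput 1 (reg 0)] @ RStore 5 1 # bump (reg 3)) @
     ([WConst 6 1, WArith WAdd 6 (reg 0) 6, RInput 1 6] @ RStore 5 1 # bump (reg 4))"

definition cons_entry :: exp where
  "cons_entry = Cell (Cell (Var 1) (Cell (Var 2) (Var 3))) (Var 0)"

text \<open>Address 28 is 3 + 2 + 3 + 20, the length of the code in front. The frame starts at
  register 1 with the list built so far, followed by the three components of the new entry, so the
  extended list appears in register 5. \<open>length B + 6\<close> is the address just behind the
  final jump.\<close>

definition reader :: "instr list" where
  "reader = (let B = read_index @ read_body @ compile cons_entry 28 1 4 @ [WMove (reg 1) (reg 5)] in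
     read_head @ [WConst 7 0, JumpWEq (reg 0) 7 (length B + 6)] @ B @ [Jump 3])"

definition writer :: "nat \<Rightarrow> instr list" where
  "writer p = [WLoad 6 (reg 2), WConst 7 0, JumpWEq 6 7 (p + 15)] @
     [WMove (reg 3) (reg 2)] @ load_field 1 (reg 3) @
     [WConst 6 3, WArith WAdd 6 (reg 3) 6, WLoad (reg 3) 6] @ [Emit (reg 3)] @ load_field 2 (reg 2) @ [Jump p]"

definition program_of :: "exp \<Rightarrow> program" where
  "program_of e = (let P = reader; C = compile e (length P) 1 1 in P @ C @ writer (length P + length C))"

lemma lengths: "length read_index = 3" "length read_body = 8 + 5 + 7"
  by (simp_all add: read_index_def read_body_def store_num_def bump_def)

context machine
begin

lemma emit_loop:
  assumes c: "code_at G p (writer p)"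
  shows "pc s = p \<Longrightarrow> hinv H s \<Longrightarrow> H < 2 ^ w \<Longrightarrow> rep (vl (map NumV ns)) H s (wmem s (reg 2)) \<Longrightarrow>
    \<exists>n\<le>15 * length ns + 3. pc (steps G w xs n s) = p + 15 \<and> outp (steps G w xs n s) = outp s @ ns"
proof (induction ns arbitrary: s)
  let ?T = "[WLoad 6 (reg 2), WConst 7 0, JumpWEq 6 7 (p + 15)]"
  let ?N = "[WConst 6 3, WArith WAdd 6 (reg 3) 6, WLoad (reg 3) 6]"
  have c2: "code_at G p ?T" "code_at G (p + 3) [WMove (reg 3) (reg 2)]"
     "code_at G (p + 4) (load_field 1 (reg 3))" "code_at G (p + 7) ?N"
     "code_at G (p + 10) [Emit (reg 3)]" "code_at G (p + 11) (load_field 2 (reg 2))" "code_at G (p + 14) [Jump p]"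
  proof -
    define T N L1 L2 where "T = ?T" and "N = ?N" and "L1 = load_field 1 (reg 3)" and "L2 = load_field 2 (reg 2)"
    have len: "length T = 3" "length N = 3" "length L1 = 3" "length L2 = 3"
      by (simp_all add: T_def N_def L1_def L2_def load_field_def)
    show "code_at G p ?T" "code_at G (p + 3) [WMove (reg 3) (reg 2)]"
     "code_at G (p + 4) (load_field 1 (reg 3))" "code_at G (p + 7) ?N"
     "code_at G (p + 10) [Emit (reg 3)]" "code_at G (p + 11) (load_field 2 (reg 2))" "code_at G (p + 14) [Jump p]"
      using c[unfolded writer_def, folded T_def N_def L1_def L2_def] len
      unfolding T_def[symmetric] N_def[symmetric] L1_def[symmetric] L2_def[symmetric] code_at_append
      by (simp_all add: ac_simps)
  qed
  {
    case Nil
    obtain s' where s': "runs 0 0 3 s H s' H" "pc s' = p + 15"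
      using runs_test[OF c2(1) Nil(1-4), of 0] by auto
    then obtain n where "n \<le> 3" "steps G w xs n s = s'" unfolding runs_def by auto
    moreover have "outp s' = outp s" using s'(1) by (simp add: runs_def pres_def)
    ultimately show ?case using s' by (intro exI[of _ n]) auto
  next
    case (Cons m ns)
    let ?v = "vl (map NumV (m # ns))"
    obtain s1 where 1: "runs 3 0 3 s H s1 H" "pc s1 = p + 3"
      using runs_test[OF c2(1) Cons.prems, of 3] by auto
    have h1: "hinv H s1" and r1: "rep ?v H s1 (wmem s1 (reg 2))"
      using runs_hinv[OF 1(1)] runs_rep[OF 1(1) Cons.prems(2,4)] by auto
    obtain s2 where 2: "runs 3 0 1 s1 H s2 H" "pc s2 = p + 4" "rep ?v H s2 (wmem s2 (reg 3))"
      using runs_move[OF c2(2) 1(2) h1 r1] by auto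
    have h2: "hinv H s2" and r2: "rep ?v H s2 (wmem s2 (reg 2))"
      using runs_hinv[OF 2(1)] runs_rep[OF 2(1) h1 r1] by auto
    obtain s3 where 3: "runs 3 0 3 s2 H s3 H" "pc s3 = p + 7" "rep (NumV m) H s3 (wmem s3 (reg 3))"
      using runs_load_field[OF c2(3) 2(2) h2 Cons.prems(3) 2(3)] by auto
    have h3: "hinv H s3" and r3: "rep ?v H s3 (wmem s3 (reg 2))"
      using runs_hinv[OF 3(1)] runs_rep[OF 3(1) h2 r2] by auto
    define s4 where "s4 = execs w xs ?N s3"
    have b: "3 mod 2 ^ w = (3::nat)" "(wmem s3 (reg 3) + 3) mod 2 ^ w = wmem s3 (reg 3) + 3"
      using bounds[OF h3 Cons.prems(3), of 3] rep_bounds[OF 3(3) h3 Cons.prems(3), of 3] by simp_all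
    have x6: "wmem s3 (reg 3) + 3 \<noteq> 6" using rep_lt[OF 3(3)] by auto
    have W4: "wmem s4 = (wmem s3)(6 := wmem s3 (reg 3) + 3, reg 3 := m)" and R4: "rmem s4 = rmem s3"
      using b x6 3(3) by (simp_all add: s4_def set_w_def rep.simps)
    have 4: "runs 3 0 3 s3 H s4 H" "pc s4 = p + 10"
    proof -
      have W: "wmem s4 x = wmem s3 x" if "x mod 8 \<le> 5" "x \<noteq> reg 3" for x
        using W4 that by (cases "x = 6") auto
      have R: "rmem s4 x = rmem s3 x" for x using R4 by simp
      have N: "list_all (\<lambda>i. \<not> jumps i) ?N" "length ?N = 3" by simp_all
      have "runs 3 0 (length ?N) s3 H s4 H \<and> pc s4 = p + 7 + length ?N"
        by (rule runs_straight[OF c2(4) 3(2) N(1) h3 s4_def]) (rule W R; assumption)+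
      then show "runs 3 0 3 s3 H s4 H" "pc s4 = p + 10" unfolding N(2) by simp_all
    qed
    \<comment> \<open>\<open>Emit\<close> changes the output, which \<open>pres\<close> forbids, so
      this step is treated outside \<open>runs\<close>.\<close>
    define s5 where "s5 = s4\<lparr>outp := outp s4 @ [wmem s4 (reg 3)], pc := pc s4 + 1\<rparr>"
    have st5: "step G w xs s4 = s5" using step_code[OF c2(5) 4(2)] by (simp add: s5_def)
    have h4: "hinv H s4" and r4: "rep ?v H s4 (wmem s4 (reg 2))"
      using runs_hinv[OF 4(1)] runs_rep[OF 4(1) h3 r3] by auto
    have h5: "hinv H s5" and r5: "rep ?v H s5 (wmem s5 (reg 2))" and pc5: "pc s5 = p + 11"
      and o5: "outp s5 = outp s @ [m]"
      using h4 r4 rep_cong[of s5 s4 ?v H "wmem s4 (reg 2)"] hinv_cong[of s5 s4 H] 4(2) W4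
        1(1) 2(1) 3(1) 4(1) by (auto simp: s5_def runs_def pres_def)
    obtain s6 where 6: "runs 2 0 3 s5 H s6 H" "pc s6 = p + 14" "rep (vl (map NumV ns)) H s6 (wmem s6 (reg 2))"
      using runs_load_field[OF c2(6) pc5 h5 Cons.prems(3) r5] by auto
    have h6: "hinv H s6" using runs_hinv[OF 6(1)] by simp
    obtain s7 where 7: "runs 3 0 1 s6 H s7 H" "pc s7 = p" using runs_jump[OF c2(7) 6(2) h6] by blast
    have h7: "hinv H s7" and r7: "rep (vl (map NumV ns)) H s7 (wmem s7 (reg 2))"
      using runs_hinv[OF 7(1)] runs_rep[OF 7(1) h6 6(3)] by auto
    obtain n where n: "n \<le> 15 * length ns + 3" "pc (steps G w xs n s7) = p + 15"
      "outp (steps G w xs n s7) = outp s7 @ ns"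
      using Cons.IH[OF 7(2) h7 Cons.prems(3) r7] by auto
    have "runs 3 0 10 s H s4 H" using runs_trans[OF runs_trans[OF runs_trans[OF 1(1) 2(1)] 3(1)] 4(1)] by simp
    then obtain k where k: "k \<le> 10" "steps G w xs k s = s4" unfolding runs_def by auto
    have "runs 2 0 4 s5 H s7 H" using runs_trans[OF 6(1) 7(1)] by simp
    then obtain k' where k': "k' \<le> 4" "steps G w xs k' s5 = s7" "outp s7 = outp s5"
      unfolding runs_def pres_def by auto
    have st: "steps G w xs (n + (k' + (1 + k))) s = steps G w xs n s7"
    proof -
      have "steps G w xs (1 + k) s = s5" using k(2) st5 by simp
      then have "steps G w xs (k' + (1 + k)) s = s7" using k'(2) by (simp only: funpow_add[of k'] o_apply)
      then show ?thesis by (simp only: funpow_add[of n] o_apply)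
    qed
    have "n + (k' + (1 + k)) \<le> 15 * length (m # ns) + 3" using n(1) k(1) k'(1) by simp
    then show ?case using n(2,3) k'(3) o5 by (intro exI[of _ "n + (k' + (1 + k))"]) (simp only: st, simp)
  }
qed

lemma read_loop:
  assumes c: "code_at G 3 ([WConst 7 0, JumpWEq (reg 0) 7 q] @
      (read_index @ read_body @ compile cons_entry 28 1 4 @ [WMove (reg 1) (reg 5)]) @ [Jump 3])"
    and q: "q = length (read_index @ read_body @ compile cons_entry 28 1 4 @ [WMove (reg 1) (reg 5)]) + 6"
    and len: "length xs = 2 * n"
  shows "pc s = 3 \<Longrightarrow> hinv H s \<Longrightarrow> wmem s (reg 0) = 2 * m \<Longrightarrow> m \<le> n \<Longrightarrow> 2 * n < 2 ^ w \<Longrightarrow>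
    rep (vl (map (entry xs) [m..<n])) H s (wmem s (reg 1)) \<Longrightarrow> H + 120 * m < 2 ^ w \<Longrightarrow>
    \<exists>s' H'. runs 0 (15 * m) 2 s H s' H' \<and> pc s' = q \<and> rep (vl (map (entry xs) [0..<n])) H' s' (wmem s' (reg 1))"
proof (induction m arbitrary: s H)
  define E where "E = compile cons_entry 28 1 4"
  define K1 where "K1 = [WConst 7 2, WArith WDiv 7 (reg 0) 7]"
  define K2 where "K2 = [RInput 1 (reg 0)]"
  define K3 where "K3 = [WConst 6 1, WArith WAdd 6 (reg 0) 6, RInput 1 6]"
  define A1 A2 A3 where "A1 = K1 @ store_num 7 @ bump (reg 2)" and "A2 = K2 @ RStore 5 1 # bump (reg 3)"
    and "A3 = K3 @ RStore 5 1 # bump (reg 4)"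
  have lens: "length A1 = 8" "length A2 = 5" "length A3 = 7" "length K1 = 2" "length K2 = 1" "length K3 = 3"
    by (simp_all add: A1_def A2_def A3_def K1_def K2_def K3_def store_num_def bump_def)
  have q': "q = length E + 30" using q by (simp add: E_def lengths)
  have c2: "code_at G 3 [WConst 7 0]" "code_at G 4 [JumpWEq (reg 0) 7 q]" "code_at G 5 read_index"
    "code_at G 8 A1" "code_at G 16 A2" "code_at G 21 A3" "code_at G 28 E"
    "code_at G (28 + length E) [WMove (reg 1) (reg 5)]" "code_at G (29 + length E) [Jump 3]"
  proof -
    have rb: "read_body = A1 @ A2 @ A3" by (simp add: read_body_def A1_def A2_def A3_def K1_def K2_def K3_def)
    have c': "code_at G 3 ([WConst 7 0] @ [JumpWEq (reg 0) 7 q] @ read_index @ A1 @ A2 @ A3 @ E @ [WMove (reg 1) (reg 5)] @ [Jump 3])"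
      using c unfolding rb E_def by simp
    show "code_at G 3 [WConst 7 0]" "code_at G 4 [JumpWEq (reg 0) 7 q]" "code_at G 5 read_index"
    "code_at G 8 A1" "code_at G 16 A2" "code_at G 21 A3" "code_at G 28 E"
    "code_at G (28 + length E) [WMove (reg 1) (reg 5)]" "code_at G (29 + length E) [Jump 3]"
      using c' lens unfolding code_at_append by (simp_all add: lengths ac_simps)
  qed
  {
    fix s H and m :: nat
    assume s: "pc s = 3" "hinv H s" "wmem s (reg 0) = 2 * m" "H < 2 ^ w"
    define s1 where "s1 = execs w xs [WConst 7 0] s"
    have W: "wmem s1 = (wmem s)(7 := 0)" and R: "rmem s1 = rmem s" by (simp_all add: s1_def set_w_def)
    have r: "runs b 0 1 s H s1 H" "pc s1 = 4" for b
    proof -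
      have W': "wmem s1 x = wmem s x" if "x mod 8 \<le> 5" "x \<noteq> reg b" for x
        using W that by (cases "x = 7") auto
      have R': "rmem s1 x = rmem s x" for x using R by simp
      have N: "list_all (\<lambda>i. \<not> jumps i) [WConst 7 0]" by simp
      have "runs b 0 (length [WConst 7 0]) s H s1 H \<and> pc s1 = 3 + length [WConst 7 0]"
        by (rule runs_straight[OF c2(1) s(1) N s(2) s1_def]) (rule W' R'; assumption)+
      then show "runs b 0 1 s H s1 H" "pc s1 = 4" by simp_all
    qed
    define s2 where "s2 = branch (wmem s1 (reg 0) = wmem s1 7) q s1"
    have st: "step G w xs s1 = s2" using step_code[OF c2(2) r(2)] by (simp add: s2_def)
    have f: "wmem s2 = wmem s1" "rmem s2 = rmem s1" "outp s2 = outp s1" by (simp_all add: s2_def branch_def)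
    have "runs b 0 1 s1 H s2 H" for b using st f r(1) unfolding runs_def
      by (intro conjI exI[of _ 1]) (auto simp: hinv_def pres_def)
    then have "runs b 0 2 s H s2 H" for b
      using runs_trans[OF r(1)[of b] \<open>\<And>b. runs b 0 1 s1 H s2 H\<close>[of b]] by (simp add: eval_nat_numeral)
    moreover have "pc s2 = (if m = 0 then q else 5)" using W s(3) r(2) by (auto simp: s2_def branch_def)
    ultimately have "\<exists>s'. (\<forall>b. runs b 0 2 s H s' H) \<and> pc s' = (if m = 0 then q else 5)" by blast
  } note test = this
  {
    case 0
    have "H < 2 ^ w" using 0 by simp
    then obtain s' where s': "\<forall>b. runs b 0 2 s H s' H" "pc s' = q" using test[of s H 0] 0(1-3) by auto
    have "rep (vl (map (entry xs) [0..<n])) H s' (wmem s' (reg 1))"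
      using runs_rep[OF s'(1)[rule_format, of 2] 0(2) 0(6)] by simp
    then show ?case using s' by (intro exI[of _ s'] exI[of _ H]) simp
  next
    case (Suc m)
    let ?l = "vl (map (entry xs) [Suc m..<n])"
    have H: "H < 2 ^ w" using Suc.prems by simp
    obtain s1 where 1: "\<And>b. runs b 0 2 s H s1 H" "pc s1 = 5" using test[OF Suc.prems(1-3) H] by auto
    have h1: "hinv H s1" and r1: "rep ?l H s1 (wmem s1 (reg 1))" and j1: "wmem s1 (reg 0) = 2 * m + 2"
      using runs_hinv[OF 1(1)] runs_rep[OF 1(1)[of 2] Suc.prems(2) Suc.prems(6)] 1(1)[of 1] Suc.prems(3)
      by (auto simp: runs_def pres_def)
    define s2 where "s2 = execs w xs read_index s1"
    have b: "(2 * m + 2) mod 2 ^ w = 2 * m + 2" "(1::nat) mod 2 ^ w = 1" "(2 * m + 1) mod 2 ^ w = 2 * m + 1"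
       "(2 * m) mod 2 ^ w = 2 * m" "(2::nat) mod 2 ^ w = 2"
      using Suc.prems(4,5) bounds[OF h1 H, of 1] bounds[OF h1 H, of 2] by auto
    have sub: "int a mod 2 ^ w = int a" if "a < 2 ^ w" for a :: nat
    proof -
      have "int a < int (2 ^ w)" using that by (simp only: of_nat_less_iff)
      then show ?thesis using mod_pos_pos_trivial[of "int a" "2 ^ w"] by simp
    qed
    have sub1: "(1 + 2 * int m) mod 2 ^ w = 1 + 2 * int m" "2 * int m mod 2 ^ w = 2 * int m"
      using sub[of "1 + 2 * m"] sub[of "2 * m"] Suc.prems(4,5) by simp_all
    have "nat (2 * int m) = 2 * m" by simp
    note sub1 = sub1 this
    have W2: "wmem s2 = (wmem s1)(7 := 1, reg 0 := 2 * m)" and R2: "rmem s2 = rmem s1"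
      using b j1 sub1 by (simp_all add: s2_def read_index_def set_w_def)
    have r2: "runs 0 0 3 s1 H s2 H" "pc s2 = 8"
    proof -
      have W: "wmem s2 x = wmem s1 x" if "x mod 8 \<le> 5" "x \<noteq> reg 0" for x
        using W2 that by (cases "x = 7") auto
      have R: "rmem s2 x = rmem s1 x" for x using R2 by simp
      have N: "list_all (\<lambda>i. \<not> jumps i) read_index" by (simp add: read_index_def)
      have "runs 0 0 (length read_index) s1 H s2 H \<and> pc s2 = 5 + length read_index"
        by (rule runs_straight[OF c2(3) 1(2) N h1 s2_def]) (rule W R; assumption)+
      then show "runs 0 0 3 s1 H s2 H" "pc s2 = 8" unfolding lengths by simp_all
    qed
    have h2: "hinv H s2" using runs_hinv[OF r2(1)] by simp
    have l2: "rep ?l H s2 (wmem s2 (reg 1))"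
    proof -
      have W: "wmem s2 x = wmem s1 x" if "x mod 8 < 4" for x using W2 mod8_reg[OF that] by simp
      have "rep ?l H s2 (wmem s1 (reg 1))" by (rule rep_cong[OF W _ r1]) (simp_all add: R2)
      then show ?thesis using W2 by simp
    qed
    define s3 where "s3 = execs w xs K1 s2"
    have W3: "wmem s3 = (wmem s2)(7 := m)" and R3: "rmem s3 = rmem s2"
      using b W2 by (simp_all add: s3_def K1_def set_w_def)
    have HH: "H + 120 \<le> H + 120 * Suc m" by simp
    have Hb: "H + 8 < 2 ^ w" "H + 8 + 8 < 2 ^ w" "H + 16 + 8 < 2 ^ w" "H + 24 + 8 * ct cons_entry \<rho> < 2 ^ w" if "length \<rho> = 4" for \<rho>
      using Suc.prems(7) that by (auto simp: cons_entry_def)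
    obtain s4 where 4: "runs 2 1 0 s2 H s4 (H + 8)" "pc s4 = 16" "rep (NumV m) (H + 8) s4 (wmem s4 (reg 2))"
      using alloc_num[OF c2(4)[unfolded A1_def] r2(2) _ _ h2 Hb(1)[of "replicate 4 (NumV 0)"] s3_def, of m] W3 R3 lens by (auto simp: K1_def)
    have h4: "hinv (H + 8) s4" and l4: "rep ?l (H + 8) s4 (wmem s4 (reg 1))" and j4: "wmem s4 (reg 0) = 2 * m"
      using runs_hinv[OF 4(1)] runs_rep[OF 4(1) h2 l2] 4(1) W2 by (auto simp: runs_def pres_def)
    define s5 where "s5 = execs w xs K2 s4"
    have i: "2 * m < length xs" "2 * m + 1 < length xs" using Suc.prems(4) len by auto
    have W5: "wmem s5 = wmem s4" and R5: "rmem s5 = (rmem s4)(1 := xs ! (2 * m))"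
      using j4 i by (simp_all add: s5_def K2_def set_r_def)
    obtain s6 where 6: "runs 3 1 0 s4 (H + 8) s6 (H + 16)" "pc s6 = 21"
        "rep (RealV (xs ! (2 * m))) (H + 16) s6 (wmem s6 (reg 3))"
    proof -
      have R: "rmem s5 x = rmem s4 x" if "x mod 8 = 0" for x using R5 that by (cases "x = 1") auto
      have N: "list_all (\<lambda>i. \<not> jumps i) K2" "length K2 \<le> 20" by (simp_all add: K2_def)
      show ?thesis using that alloc_real[OF c2(5)[unfolded A2_def] 4(2) N h4 Hb(2)[of "replicate 4 (NumV 0)"] s5_def _ R,
          of "xs ! (2 * m)"] W5 R5 lens by (auto simp: add.assoc)
    qed
    have h6: "hinv (H + 16) s6" and l6: "rep ?l (H + 16) s6 (wmem s6 (reg 1))" and j6: "wmem s6 (reg 0) = 2 * m"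
      and k6: "rep (NumV m) (H + 16) s6 (wmem s6 (reg 2))"
      using runs_hinv[OF 6(1)] runs_rep[OF 6(1) h4 l4] runs_rep[OF 6(1) h4 4(3)] 6(1) j4 by (auto simp: runs_def pres_def)
    define s7 where "s7 = execs w xs K3 s6"
    have W7: "wmem s7 = (wmem s6)(6 := 2 * m + 1)" and R7: "rmem s7 = (rmem s6)(1 := xs ! (2 * m + 1))"
      using j6 i b by (simp_all add: s7_def K3_def set_r_def set_w_def)
    obtain s8 where 8: "runs 4 1 0 s6 (H + 16) s8 (H + 24)" "pc s8 = 28"
        "rep (RealV (xs ! (2 * m + 1))) (H + 24) s8 (wmem s8 (reg 4))"
    proof -
      have R: "rmem s7 x = rmem s6 x" if "x mod 8 = 0" for x using R7 that by (cases "x = 1") auto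
      have W: "wmem s7 x = wmem s6 x" if "x \<noteq> 6" for x using W7 that by simp
      have y: "rmem s7 1 = xs ! (2 * m + 1)" using R7 by simp
      have N: "list_all (\<lambda>i. \<not> jumps i) K3" "length K3 \<le> 20" by (simp_all add: K3_def)
      show ?thesis using that alloc_real[OF c2(6)[unfolded A3_def] 6(2) N h6 Hb(3)[of "replicate 4 (NumV 0)"] s7_def W R y]
          lens by (auto simp: add.assoc)
    qed
    define \<rho> where "\<rho> = [?l, NumV m, RealV (xs ! (2 * m)), RealV (xs ! (2 * m + 1))]"
    have h8: "hinv (H + 24) s8" and j8: "wmem s8 (reg 0) = 2 * m"
      using runs_hinv[OF 8(1)] 8(1) j6 by (simp_all add: runs_def pres_def)
    have e8: "env 1 \<rho> (H + 24) s8"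
    proof -
      have "env 1 ((([] @ [?l]) @ [NumV m]) @ [RealV (xs ! (2 * m))]) (H + 24) s8"
        using runs_rep[OF 8(1) h6 l6] runs_rep[OF 8(1) h6 k6] runs_rep[OF 8(1) h6 6(3)]
        by (intro env_snoc) (auto simp: env_def eval_nat_numeral)
      then have "env 1 (((([] @ [?l]) @ [NumV m]) @ [RealV (xs ! (2 * m))]) @ [RealV (xs ! (2 * m + 1))]) (H + 24) s8"
        by (rule env_snoc) (use 8(3) in \<open>simp add: eval_nat_numeral\<close>)
      then show ?thesis by (simp add: \<rho>_def)
    qed
    have cte: "ct cons_entry \<rho> = 7" and eve: "ev cons_entry \<rho> = CellV (entry xs m) ?l"
      by (simp_all add: cons_entry_def \<rho>_def entry_def)
    obtain s9 H9 where 9: "runs 5 7 0 s8 (H + 24) s9 H9" "pc s9 = 28 + length E" "H9 \<le> H + 24 + 56"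
        "rep (CellV (entry xs m) ?l) H9 s9 (wmem s9 (reg 5))"
      using goodD[OF compile_correct c2(7)[unfolded E_def] 8(2) h8 e8] Hb(4)[of \<rho>] cte eve
      by (auto simp: \<rho>_def E_def)
    have h9: "hinv H9 s9" and j9: "wmem s9 (reg 0) = 2 * m"
      using runs_hinv[OF 9(1)] 9(1) j8 by (auto simp: runs_def pres_def)
    obtain s10 where 10: "runs 1 0 1 s9 H9 s10 H9" "pc s10 = 29 + length E"
        "rep (CellV (entry xs m) ?l) H9 s10 (wmem s10 (reg 1))"
      using runs_move[OF c2(8) 9(2) h9 9(4)] by auto
    have h10: "hinv H9 s10" and j10: "wmem s10 (reg 0) = 2 * m"
      using runs_hinv[OF 10(1)] 10(1) j9 by (auto simp: runs_def pres_def)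
    obtain s11 where 11: "runs 2 0 1 s10 H9 s11 H9" "pc s11 = 3"
      using runs_jump[OF c2(9) 10(2) h10] by blast
    have h11: "hinv H9 s11" and j11: "wmem s11 (reg 0) = 2 * m"
      and l11: "rep (CellV (entry xs m) ?l) H9 s11 (wmem s11 (reg 1))"
      using runs_hinv[OF 11(1)] 11(1) j10 runs_rep[OF 11(1) h10 10(3)] by (auto simp: runs_def pres_def)
    have "CellV (entry xs m) ?l = vl (map (entry xs) [m..<n])"
      using Suc.prems(4) by (simp add: upt_conv_Cons)
    then obtain s' H' where s': "runs 0 (15 * m) 2 s11 H9 s' H'" "pc s' = q"
      "rep (vl (map (entry xs) [0..<n])) H' s' (wmem s' (reg 1))"
      using Suc.IH[OF 11(2) h11 j11 _ Suc.prems(5)] l11 Suc.prems(4,7) 9(3) by auto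
    have "runs 0 10 7 s H s11 H9"
      using runs_trans[OF runs_trans[OF runs_trans[OF runs_trans[OF runs_trans[OF runs_trans[OF runs_trans[OF
        1(1)[of 0] r2(1)] 4(1)] 6(1)] 8(1)] 9(1)] 10(1)] 11(1)] by simp
    from runs_trans[OF this s'(1)] have "runs 0 (15 * Suc m) 2 s H s' H'" using runs_weaken by fastforce
    then show ?case using s' by blast
  }
qed


text \<open>Reading a point is charged 15 cost units, which gives 15 * 8 = 120 addresses and 15 * 40
  = 600 instructions. Every number emitted takes 15 more instructions.\<close>

lemma program_outputs:
  assumes G: "G = program_of e"
    and len: "length xs = 2 * n" and e: "ev e [vl (map (entry xs) [0..<n])] = vl (map NumV ns)"
    and w: "8 + 120 * n + 8 * ct e [vl (map (entry xs) [0..<n])] < 2 ^ w"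
    and t: "10 + 600 * n + 40 * ct e [vl (map (entry xs) [0..<n])] + 15 * length ns \<le> t"
  shows "outputs_within G w xs t ns"
proof -
  define inp where "inp = vl (map (entry xs) [0..<n])"
  define B where "B = read_index @ read_body @ compile cons_entry 28 1 4 @ [WMove (reg 1) (reg 5)]"
  define q where "q = length B + 6"
  have rd: "reader = read_head @ ([WConst 7 0, JumpWEq (reg 0) 7 q] @ B @ [Jump 3])"
    by (simp add: reader_def Let_def B_def q_def)
  have lrh: "length read_head = 3" by (simp add: read_head_def)
  have lr: "length reader = q" unfolding rd using lrh by (simp add: q_def)
  define C where "C = compile e q 1 1"
  have Ge: "G = reader @ C @ writer (q + length C)" by (simp add: G program_of_def Let_def lr C_def)
  have lG: "length G = q + length C + 15" by (simp add: Ge lr writer_def load_field_def)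
  have c: "code_at G 0 reader" "code_at G q C" "code_at G (q + length C) (writer (q + length C))"
  proof -
    have "code_at G 0 G" by (simp add: code_at_def)
    then have "code_at G 0 (reader @ C @ writer (q + length C))" using Ge by simp
    then show "code_at G 0 reader" "code_at G q C" "code_at G (q + length C) (writer (q + length C))"
      unfolding code_at_append using lr by simp_all
  qed
  have c0: "code_at G 0 read_head" "code_at G 3 ([WConst 7 0, JumpWEq (reg 0) 7 q] @ B @ [Jump 3])"
    using c(1) unfolding rd code_at_append using lrh by simp_all
  define s0 where "s0 = init w xs"
  define s1 where "s1 = execs w xs read_head s0"
  have N: "list_all (\<lambda>i. \<not> jumps i) read_head" by (simp add: read_head_def)
  have st1: "steps G w xs 3 s0 = s1" "pc s1 = 3" "outp s1 = []"
    using straight[OF c0(1) _ N, of s0] lrh by (simp_all add: s0_def init_def s1_def)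
  have "8 < (2::nat) ^ w" "2 * n < 2 ^ w" using w by auto
  then have m1: "wmem s1 = (\<lambda>_. 0)(reg 0 := 2 * n, 5 := 8)" "rmem s1 = (\<lambda>_. 0)"
    by (auto simp: s1_def s0_def read_head_def set_w_def init_def len fun_eq_iff reg_def)
  have h1: "hinv 8 s1" using m1 reg_simps(1)[of 0] by (auto simp: hinv_def)
  have r1: "rep (vl (map (entry xs) [n..<n])) 8 s1 (wmem s1 (reg 1))" using m1 h1 by (auto simp: rep_zero)
  obtain s2 H2 where 2: "runs 0 (15 * n) 2 s1 8 s2 H2" "pc s2 = q" "rep inp H2 s2 (wmem s2 (reg 1))"
    using read_loop[OF c0(2)[unfolded B_def] q_def[unfolded B_def] len st1(2) h1, of n] m1 r1 w
    unfolding inp_def by fastforce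
  have h2: "hinv H2 s2" "H2 \<le> 8 + 120 * n" using runs_hinv[OF 2(1)] by auto
  have e2: "env 1 [inp] H2 s2" using 2(3) by (simp add: env_def)
  obtain s3 H3 where 3: "runs 2 (ct e [inp]) 0 s2 H2 s3 H3" "pc s3 = q + length C" "H3 \<le> H2 + 8 * ct e [inp]"
     "rep (vl (map NumV ns)) H3 s3 (wmem s3 (reg 2))" "hinv H3 s3"
    using goodD[OF compile_correct c(2)[unfolded C_def] 2(2) h2(1) e2] e w h2(2)
    unfolding C_def inp_def by (auto simp: numeral_2_eq_2)
  have "H3 < 2 ^ w" using 3(3) h2(2) w by (simp add: inp_def)
  then obtain k where k: "k \<le> 15 * length ns + 3" "pc (steps G w xs k s3) = length G"
      "outp (steps G w xs k s3) = outp s3 @ ns"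
    using emit_loop[OF c(3) 3(2,5) _ 3(4)] lG by auto
  have "runs 0 (15 * n + ct e [inp]) 2 s1 8 s3 H3" using runs_trans[OF 2(1) 3(1)] by simp
  then obtain j where j: "j \<le> 40 * (15 * n + ct e [inp]) + 2" "steps G w xs j s1 = s3" "outp s3 = outp s1"
    unfolding runs_def pres_def by auto
  have "steps G w xs (j + 3) s0 = s3" using st1(1) j(2) by (simp only: funpow_add[of j] o_apply)
  then have s: "steps G w xs (k + (j + 3)) s0 = steps G w xs k s3" by (simp only: funpow_add[of k] o_apply)
  show ?thesis unfolding outputs_within_def Let_def s0_def[symmetric]
  proof (intro exI[of _ "k + (j + 3)"] conjI)
    show "k + (j + 3) \<le> t" using k(1) j(1) t by (simp add: inp_def)
    show "halted G (steps G w xs (k + (j + 3)) s0)" unfolding s using k(2) by (simp add: halted_def)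
    show "outp (steps G w xs (k + (j + 3)) s0) = ns" unfolding s using k(3) j(3) st1(3) by simp
  qed
qed

end

section \<open>Library of list programs\<close>

definition call1 :: "exp \<Rightarrow> exp \<Rightarrow> exp" where "call1 f a = Bind a (Frame 1 f)"
definition call2 :: "exp \<Rightarrow> exp \<Rightarrow> exp \<Rightarrow> exp" where "call2 f a b = Bind a (Bind b (Frame 2 f))"
definition call3 :: "exp \<Rightarrow> exp \<Rightarrow> exp \<Rightarrow> exp \<Rightarrow> exp" where
  "call3 f a b c = Bind a (Bind b (Bind c (Frame 3 f)))"

lemma ev_call [simp]:
  "ev (call1 f a) \<rho> = ev f [ev a \<rho>]"
  "ev (call2 f a b) \<rho> = ev f [ev a \<rho>, ev b (\<rho> @ [ev a \<rho>])]"
  "ev (call3 f a b c) \<rho> = ev f [ev a \<rho>, ev b (\<rho> @ [ev a \<rho>]), ev c (\<rho> @ [ev a \<rho>, ev b (\<rho> @ [ev a \<rho>])])]"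
  by (simp_all add: call1_def call2_def call3_def)

lemma ct_call [simp]:
  "ct (call1 f a) \<rho> = 2 + ct a \<rho> + ct f [ev a \<rho>]"
  "ct (call2 f a b) \<rho> = 3 + ct a \<rho> + ct b (\<rho> @ [ev a \<rho>]) + ct f [ev a \<rho>, ev b (\<rho> @ [ev a \<rho>])]"
  "ct (call3 f a b c) \<rho> = 4 + ct a \<rho> + ct b (\<rho> @ [ev a \<rho>]) + ct c (\<rho> @ [ev a \<rho>, ev b (\<rho> @ [ev a \<rho>])]) +
     ct f [ev a \<rho>, ev b (\<rho> @ [ev a \<rho>]), ev c (\<rho> @ [ev a \<rho>, ev b (\<rho> @ [ev a \<rho>])])]"
  by (simp_all add: call1_def call2_def call3_def)

section \<open>Bounds for the cost of folds\<close>

primrec loopfree :: "exp \<Rightarrow> bool" where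
  "loopfree (Var k) = True"
| "loopfree (Bind a b) = (loopfree a \<and> loopfree b)"
| "loopfree (Num n) = True"
| "loopfree (Arith f a b) = (loopfree a \<and> loopfree b)"
| "loopfree (Root a) = loopfree a"
| "loopfree (Cell a b) = (loopfree a \<and> loopfree b)"
| "loopfree (Lft a) = loopfree a"
| "loopfree (Rgt a) = loopfree a"
| "loopfree (IfCell c a b) = (loopfree c \<and> loopfree a \<and> loopfree b)"
| "loopfree (IfLess x y a b) = (loopfree x \<and> loopfree y \<and> loopfree a \<and> loopfree b)"
| "loopfree (Fold l i b) = False"
| "loopfree (Frame k a) = loopfree a"

primrec sz :: "exp \<Rightarrow> nat" where
  "sz (Var k) = 1"
| "sz (Bind a b) = 1 + sz a + sz b"
| "sz (Num n) = 1 + n"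
| "sz (Arith f a b) = 1 + sz a + sz b"
| "sz (Root a) = 1 + sz a"
| "sz (Cell a b) = 1 + sz a + sz b"
| "sz (Lft a) = 1 + sz a"
| "sz (Rgt a) = 1 + sz a"
| "sz (IfCell c a b) = 1 + sz c + max (sz a) (sz b)"
| "sz (IfLess x y a b) = 1 + sz x + sz y + max (sz a) (sz b)"
| "sz (Fold l i b) = 0"
| "sz (Frame k a) = 1 + sz a"

lemma ct_le_sz: "loopfree e \<Longrightarrow> ct e \<rho> \<le> sz e"
proof (induction e arbitrary: \<rho>)
  case (IfLess x y a b)
  then show ?case by (simp add: add_mono max.coboundedI1 max.coboundedI2)
next
  case (IfCell c a b)
  then show ?case by (simp add: add_mono max.coboundedI1 max.coboundedI2)
qed (auto intro: add_mono max.coboundedI1 max.coboundedI2 simp: add_mono)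

lemma loopfree_call [simp]:
  "loopfree (call1 f a) = (loopfree a \<and> loopfree f)"
  "loopfree (call2 f a b) = (loopfree a \<and> loopfree b \<and> loopfree f)"
  "sz (call1 f a) = 2 + sz a + sz f" "sz (call2 f a b) = 3 + sz a + sz b + sz f"
  by (simp_all add: call1_def call2_def)

lemma lfold_sim:
  assumes "\<And>x r s. f (CellV x (vl r)) (E s) = E (h x s)"
  shows "lfold f (vl xs) (E s) = E (fold h xs s)"
  by (induction xs arbitrary: s) (simp_all add: assms)

lemma lfold_sim_map:
  assumes "\<And>x r s. f (CellV (g x) (vl (map g r))) (E s) = E (h x s)"
  shows "lfold f (vl (map g xs)) (E s) = E (fold h xs s)"
  by (induction xs arbitrary: s) (simp_all add: assms)

lemma lcost_const:
  assumes "\<And>x r s. c (CellV x (vl r)) s \<le> k"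
  shows "lcost f c (vl xs) s \<le> (k + 1) * length xs"
proof (induction xs arbitrary: s)
  case (Cons x xs)
  show ?case using add_mono[OF assms[of x xs s] Cons[of "f (CellV x (vl xs)) s"]] by simp
qed simp

text \<open>Amortized analysis: the potential \<Phi> of the unread list and the accumulator drops by
  at least the cost of each iteration. This handles iterations of very different cost; the invariant
  \<open>I\<close> limits the states that occur.\<close>

lemma fold_potential:
  assumes "\<And>x r a. I (x # r) a \<Longrightarrow> f (CellV (g x) (vl (map g r))) (E a) = E (h x a) \<and> I r (h x a) \<and>
      1 + c (CellV (g x) (vl (map g r))) (E a) + \<Phi> r (h x a) \<le> (\<Phi> (x # r) a :: nat)"
    and "I xs a"
  shows "lfold f (vl (map g xs)) (E a) = E (fold h xs a) \<and> lcost f c (vl (map g xs)) (E a) \<le> \<Phi> xs a"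
  using assms(2)
proof (induction xs arbitrary: a)
  case (Cons x xs)
  show ?case using assms(1)[OF Cons.prems] Cons.IH[of "h x a"] by simp
qed simp

lemma ct_fold_potential:
  assumes "\<And>x r a. I (x # r) a \<Longrightarrow> ev b (\<rho> @ [CellV (g x) (vl (map g r)), E a]) = E (h x a) \<and> I r (h x a) \<and>
      1 + ct b (\<rho> @ [CellV (g x) (vl (map g r)), E a]) + \<Phi> r (h x a) \<le> (\<Phi> (x # r) a :: nat)"
    and "I xs a" "ev l \<rho> = vl (map g xs)" "ev i (\<rho> @ [vl (map g xs)]) = E a"
  shows "ct (Fold l i b) \<rho> \<le> 1 + ct l \<rho> + ct i (\<rho> @ [vl (map g xs)]) + \<Phi> xs a"
  using fold_potential[of I "\<lambda>r s. ev b (\<rho> @ [r, s])" g E h "\<lambda>r s. ct b (\<rho> @ [r, s])" \<Phi> xs a] assms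
  by simp

text \<open>The uses choose for \<open>k\<close> a round number above the size of the body; the
  large constants in the later bounds are roundings of the same kind.\<close>

lemma ct_fold_loopfree:
  assumes "ev l \<rho> = vl xs" "loopfree b" "sz b < k"
  shows "ct (Fold l i b) \<rho> \<le> 1 + ct l \<rho> + ct i (\<rho> @ [vl xs]) + k * length xs"
proof -
  have "lcost (\<lambda>r s. ev b (\<rho> @ [r, s])) (\<lambda>r s. ct b (\<rho> @ [r, s])) (vl xs) (ev i (\<rho> @ [vl xs])) \<le> (sz b + 1) * length xs"
    by (rule lcost_const) (rule ct_le_sz[OF assms(2)])
  also have "\<dots> \<le> k * length xs" using assms(3) by (intro mult_le_mono1) simp
  finally show ?thesis using assms by simp
qed

declare ct.simps(11) [simp del]

subsection \<open>Reversing and appending\<close>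

definition revE :: exp where
  "revE = Fold (Var 0) (Num 0) (Cell (Lft (Var 1)) (Var 2))"

definition revappE :: exp where
  "revappE = Fold (Var 0) (Var 1) (Cell (Lft (Var 2)) (Var 3))"

definition appendE :: exp where
  "appendE = call2 revappE (call1 revE (Var 0)) (Var 1)"

lemma ev_revapp [simp]: "ev revappE [vl xs, vl ys] = vl (rev xs @ ys)"
  using lfold_sim[where f = "\<lambda>r s. CellV (lft r) s" and E = vl and h = "\<lambda>x s. x # s"]
  by (simp add: revappE_def fold_Cons_rev)

lemma ev_rev [simp]: "ev revE [vl xs] = vl (rev xs)"
  using lfold_sim[where f = "\<lambda>r s. CellV (lft r) s" and E = vl and h = "\<lambda>x s. x # s" and s = "[]"]
  by (simp add: revE_def fold_Cons_rev)

lemma ev_append [simp]: "ev appendE [vl xs, vl ys] = vl (xs @ ys)"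
  by (simp add: appendE_def)

lemma ct_rev: "ct revE [vl xs] \<le> 10 * (length xs + 1)"
  using ct_fold_loopfree[of "Var 0" "[vl xs]" xs "Cell (Lft (Var 1)) (Var 2)" 10 "Num 0"] by (simp add: revE_def)

lemma ct_revapp: "ct revappE [vl xs, y] \<le> 10 * (length xs + 1)"
  using ct_fold_loopfree[of "Var 0" "[vl xs, y]" xs "Cell (Lft (Var 2)) (Var 3)" 10 "Var 1"] by (simp add: revappE_def)

lemma ct_append: "ct appendE [vl xs, y] \<le> 30 * (length xs + 1)"
  using ct_rev[of xs] ct_revapp[of "rev xs" y] by (simp add: appendE_def)

subsection \<open>Logarithms\<close>

text \<open>The binary logarithm rounded up, with value 0 at 0 and 1: the number of passes after
  which \<open>m\<close> blocks, joined in pairs, have become at most one.\<close>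

definition lg :: "nat \<Rightarrow> nat" where
  "lg m = (LEAST k. m \<le> 2 ^ k)"

lemma lg_le: "m \<le> 2 ^ k \<Longrightarrow> lg m \<le> k"
  unfolding lg_def by (rule Least_le)

lemma le_two_lg: "m \<le> 2 ^ lg m"
  unfolding lg_def by (rule LeastI[of _ m]) (simp add: less_imp_le less_exp)

lemma lg_mono: "m \<le> n \<Longrightarrow> lg m \<le> lg n"
  using lg_le le_two_lg le_trans by blast

lemma lg_le_self: "lg m \<le> m"
  by (rule lg_le) (simp add: less_imp_le less_exp)

text \<open>The result is in unary, because a fold can count only by running along a list. Doubling
  at most once per element of the input suffices, as \<open>lg m \<le> m\<close>.\<close>

definition lgE :: exp where
  "lgE = Bind (Fold (Var 0) (Num 0) (Arith RAdd (Var 2) (Num 1)))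
     (Rgt (Fold (Var 0) (Cell (Num 1) (Num 0))
        (IfLess (Lft (Var 3)) (Var 1)
          (Cell (Arith RAdd (Lft (Var 3)) (Lft (Var 3))) (Cell (Num 0) (Rgt (Var 3)))) (Var 3))))"

abbreviation units :: "nat \<Rightarrow> val" where "units k \<equiv> vl (replicate k (NumV 0))"

lemma lfold_count:
  "num_of (lfold (\<lambda>r s. RealV (num_of s + 1)) (vl xs) s) = num_of s + real (length xs)"
  by (induction xs arbitrary: s) auto

lemma lg_loop:
  assumes "j = min i (lg m)" "num_of a = 2 ^ j" "num_of n = real m"
  shows "rgt (lfold (\<lambda>r s. if num_of (lft s) < num_of n
       then CellV (RealV (num_of (lft s) + num_of (lft s))) (CellV (NumV 0) (rgt s)) else s) (vl xs) (CellV a (units j))) =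
     units (min (i + length xs) (lg m))"
  using assms
proof (induction xs arbitrary: a j i)
  case (Cons x xs)
  have "(2::real) ^ j < real m \<longleftrightarrow> j < lg m"
  proof
    assume "2 ^ j < real m"
    then have "2 ^ j < m" by (metis of_nat_less_iff of_nat_numeral of_nat_power)
    then have "(2::nat) ^ j < 2 ^ lg m" using le_two_lg[of m] by linarith
    then show "j < lg m" by simp
  next
    assume "j < lg m"
    then have "\<not> m \<le> 2 ^ j" using lg_le leD by blast
    then show "2 ^ j < real m" by (metis not_le of_nat_less_iff of_nat_numeral of_nat_power)
  qed
  then show ?case
    using Cons.prems Cons.IH[of "Suc j" "Suc i" "RealV (num_of a + num_of a)"] Cons.IH[of j "Suc i" a]
    by (cases "i < lg m") (simp_all add: min_def)
qed simp

lemma ev_lg [simp]: "ev lgE [vl xs] = units (lg (length xs))"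
  using lg_loop[of 0 0 "length xs" "NumV 1" "lfold (\<lambda>r s. RealV (num_of s + 1)) (vl xs) (NumV 0)" xs]
    lfold_count[of xs "NumV 0"] lg_le_self[of "length xs"]
  by (simp add: lgE_def min_absorb2 cong: if_cong)

lemma ct_lg: "ct lgE [vl xs] \<le> 100 * (length xs + 1)"
proof -
  define b1 where "b1 = Arith RAdd (Var 2) (Num 1)"
  define b2 where "b2 = IfLess (Lft (Var 3)) (Var 1)
          (Cell (Arith RAdd (Lft (Var 3)) (Lft (Var 3))) (Cell (Num 0) (Rgt (Var 3)))) (Var 3)"
  have s: "loopfree b1" "loopfree b2" "sz b1 < 40" "sz b2 < 40" by (simp_all add: b1_def b2_def)
  let ?f1 = "Fold (Var 0) (Num 0) b1" and ?f2 = "Fold (Var 0) (Cell (Num 1) (Num 0)) b2"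
  have A: "ct ?f1 [vl xs] \<le> 10 + 40 * length xs"
    using ct_fold_loopfree[OF _ s(1,3), of "Var 0" "[vl xs]" xs "Num 0"] by simp
  have B: "ct ?f2 [vl xs, n] \<le> 10 + 40 * length xs" for n
    using ct_fold_loopfree[OF _ s(2,4), of "Var 0" "[vl xs, n]" xs "Cell (Num 1) (Num 0)"] by simp
  have "ct lgE [vl xs] = 2 + ct ?f1 [vl xs] + ct ?f2 [vl xs, ev ?f1 [vl xs]]"
    by (simp add: lgE_def b1_def b2_def)
  also have "\<dots> \<le> 2 + (10 + 40 * length xs) + (10 + 40 * length xs)" by (intro add_mono A B order_refl)
  finally show ?thesis by simp
qed


subsection \<open>Lexicographic sorting without repetitions\<close>

text \<open>One sorting procedure serves three kinds of records: points with two coordinates and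
  their input index as third key, scored candidates with source index, squared distance and target
  index, and edges with two indices and third key 0.\<close>

definition key1 :: "val \<Rightarrow> real" where "key1 v = num_of (lft v)"
definition key2 :: "val \<Rightarrow> real" where "key2 v = num_of (lft (rgt v))"
definition key3 :: "val \<Rightarrow> real" where "key3 v = num_of (lft (rgt (rgt v)))"

definition lexlt :: "val \<Rightarrow> val \<Rightarrow> bool" where
  "lexlt a b \<longleftrightarrow> key1 a < key1 b \<or> key1 a = key1 b \<and>
     (key2 a < key2 b \<or> key2 a = key2 b \<and> key3 a < key3 b)"

definition ifLex :: "exp \<Rightarrow> exp \<Rightarrow> exp \<Rightarrow> exp \<Rightarrow> exp" where
  "ifLex a b t e = IfLess (Lft a) (Lft b) t (IfLess (Lft b) (Lft a) e
     (IfLess (Lft (Rgt a)) (Lft (Rgt b)) t (IfLess (Lft (Rgt b)) (Lft (Rgt a)) e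
     (IfLess (Lft (Rgt (Rgt a))) (Lft (Rgt (Rgt b))) t e))))"

lemma ev_ifLex:
  assumes "\<And>x. ev a (\<rho> @ [x]) = ev a \<rho>" "\<And>x. ev b (\<rho> @ [x]) = ev b \<rho>"
  shows "ev (ifLex a b t e) \<rho> = (if lexlt (ev a \<rho>) (ev b \<rho>) then ev t \<rho> else ev e \<rho>)"
  by (auto simp: ifLex_def assms lexlt_def key1_def key2_def key3_def)

lemma loopfree_ifLex [simp]:
  "loopfree (ifLex a b t e) = (loopfree a \<and> loopfree b \<and> loopfree t \<and> loopfree e)"
  "sz (ifLex a b t e) \<le> 5 * (sz a + sz b) + sz t + sz e + 30"
  by (auto simp: ifLex_def)

lemma lexlt_trans: "lexlt a b \<Longrightarrow> lexlt b c \<Longrightarrow> lexlt a c"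
  by (auto simp: lexlt_def)

lemma lexlt_irrefl: "\<not> lexlt a a"
  by (auto simp: lexlt_def)

text \<open>Of two elements with equal keys only one is kept. Sorting thereby also removes
  repetitions, which arise when a candidate is found several times or an edge comes from two
  wedges.\<close>

fun mrg :: "val list \<Rightarrow> val list \<Rightarrow> val list" where
  "mrg [] ys = ys"
| "mrg xs [] = xs"
| "mrg (x # xs) (y # ys) = (if lexlt x y then x # mrg xs (y # ys)
     else if lexlt y x then y # mrg (x # xs) ys else x # mrg xs ys)"

lemma mrg_Nil2 [simp]: "mrg xs [] = xs"
  by (cases xs) auto

fun mstep :: "val list \<times> val list \<times> val list \<Rightarrow> val list \<times> val list \<times> val list" where
  "mstep ([], [], acc) = ([], [], acc)"
| "mstep ([], y # ys, acc) = ([], ys, y # acc)"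
| "mstep (x # xs, [], acc) = (xs, [], x # acc)"
| "mstep (x # xs, y # ys, acc) = (if lexlt x y then (xs, y # ys, x # acc)
     else if lexlt y x then (x # xs, ys, y # acc) else (xs, ys, x # acc))"

fun menc :: "val list \<times> val list \<times> val list \<Rightarrow> val" where
  "menc (x, y, acc) = CellV (vl x) (CellV (vl y) (vl acc))"

definition mergestepE :: "exp \<Rightarrow> exp" where
  "mergestepE s = (let x = Lft s; y = Lft (Rgt s); acc = Rgt (Rgt s);
     takex = Cell (Rgt x) (Cell y (Cell (Lft x) acc));
     takey = Cell x (Cell (Rgt y) (Cell (Lft y) acc));
     both = Cell (Rgt x) (Cell (Rgt y) (Cell (Lft x) acc)) in
     IfCell x (IfCell y (ifLex (Lft x) (Lft y) takex (ifLex (Lft y) (Lft x) takey both)) takex)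
       (IfCell y takey s))"

text \<open>A merge step may consume an element of either list, so neither list controls the loop.
  Both act as mere clocks: \<open>length xs + length ys\<close> steps suffice, and steps after the
  end change nothing.\<close>

definition mergeE :: exp where
  "mergeE = call1 revE (Rgt (Rgt (Bind (Fold (Var 0) (Cell (Var 0) (Cell (Var 1) (Num 0))) (mergestepE (Var 3)))
     (Fold (Var 1) (Var 2) (mergestepE (Var 4))))))"

lemma ev_mergestep:
  assumes "k < length \<rho>" "\<rho> ! k = menc m"
  shows "ev (mergestepE (Var k)) \<rho> = menc (mstep m)"
proof -
  have n: "(\<rho> @ ys) ! k = menc m" for ys using assms by (simp add: nth_append)
  show ?thesis using n assms(1)
    by (cases m rule: mstep.cases) (simp_all add: mergestepE_def Let_def ev_ifLex assms(2) cong: if_cong)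
qed

lemma sz_mergestep: "loopfree (mergestepE (Var k))" "sz (mergestepE (Var k)) < 200"
proof -
  show "loopfree (mergestepE (Var k))" by (simp add: mergestepE_def Let_def)
  show "sz (mergestepE (Var k)) < 200" by (simp add: mergestepE_def Let_def ifLex_def)
qed

lemma mstep_funpow:
  assumes "length x + length y \<le> k"
  shows "(mstep ^^ k) (x, y, acc) = ([], [], rev (mrg x y) @ acc)"
  using assms
proof (induction k arbitrary: x y acc)
  case (Suc k)
  show ?case
  proof (cases "(x, y, acc)" rule: mstep.cases)
    case (1 acc')
    have "(mstep ^^ k) ([], [], acc) = ([], [], acc)" by (induction k) auto
    then show ?thesis using 1 by (simp add: funpow_swap1)
  qed (use Suc in \<open>auto simp: funpow_Suc_right simp del: funpow.simps\<close>)
qed simp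

lemma lfold_funpow:
  assumes "\<And>r s. f r (E s) = E (h s)"
  shows "lfold f (vl xs) (E s) = E ((h ^^ length xs) s)"
  by (induction xs arbitrary: s) (simp_all add: assms funpow_swap1)

lemma length_mrg: "length (mrg xs ys) \<le> length xs + length ys"
  by (induction xs ys rule: mrg.induct) auto

lemma ev_merge_state:
  "ev (Bind (Fold (Var 0) (Cell (Var 0) (Cell (Var 1) (Num 0))) (mergestepE (Var 3)))
     (Fold (Var 1) (Var 2) (mergestepE (Var 4)))) [vl xs, vl ys] = menc ([], [], rev (mrg xs ys))"
proof -
  have 1: "ev (mergestepE (Var 3)) [vl xs, vl ys, r, menc m] = menc (mstep m)" for r m
    by (rule ev_mergestep) simp_all
  have 2: "ev (mergestepE (Var 4)) [vl xs, vl ys, t, r, menc m] = menc (mstep m)" for t r m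
    by (rule ev_mergestep) simp_all
  have "(mstep ^^ length ys) ((mstep ^^ length xs) (xs, ys, [])) = ([], [], rev (mrg xs ys))"
    using mstep_funpow[of xs ys "length ys + length xs" "[]"] by (simp add: funpow_add del: funpow.simps)
  moreover have "lfold (\<lambda>r s. ev (mergestepE (Var 4)) [vl xs, vl ys, t, r, s]) (vl ys) (menc m) =
      menc ((mstep ^^ length ys) m)" for t m
    by (rule lfold_funpow) (rule 2)
  moreover have "lfold (\<lambda>r s. ev (mergestepE (Var 3)) [vl xs, vl ys, r, s]) (vl xs) (menc (xs, ys, [])) =
      menc ((mstep ^^ length xs) (xs, ys, []))"
    by (rule lfold_funpow) (rule 1)
  ultimately show ?thesis by simp
qed

lemma ev_merge [simp]: "ev mergeE [vl xs, vl ys] = vl (mrg xs ys)"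
  unfolding mergeE_def ev_call ev.simps(8) ev_merge_state by simp

lemma ct_merge: "ct mergeE [vl xs, vl ys] \<le> 300 * (length xs + length ys + 1)"
proof -
  let ?f1 = "Fold (Var 0) (Cell (Var 0) (Cell (Var 1) (Num 0))) (mergestepE (Var 3))"
  let ?f2 = "Fold (Var 1) (Var 2) (mergestepE (Var 4))"
  have A: "ct ?f1 [vl xs, vl ys] \<le> 10 + 200 * length xs"
    using ct_fold_loopfree[OF _ sz_mergestep, of "Var 0" "[vl xs, vl ys]" xs "Cell (Var 0) (Cell (Var 1) (Num 0))" 3] by simp
  have B: "ct ?f2 [vl xs, vl ys, n] \<le> 10 + 200 * length ys" for n
    using ct_fold_loopfree[OF _ sz_mergestep, of "Var 1" "[vl xs, vl ys, n]" ys "Var 2" 4] by simp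
  have C: "ct revE [ev (Rgt (Rgt (Bind ?f1 ?f2))) [vl xs, vl ys]] \<le> 10 * (length xs + length ys + 1)"
    unfolding ev.simps(8) ev_merge_state using ct_rev[of "rev (mrg xs ys)"] length_mrg[of xs ys] by simp
  have "ct mergeE [vl xs, vl ys] = 5 + ct ?f1 [vl xs, vl ys] + ct ?f2 [vl xs, vl ys, ev ?f1 [vl xs, vl ys]]
      + ct revE [ev (Rgt (Rgt (Bind ?f1 ?f2))) [vl xs, vl ys]]"
    by (simp add: mergeE_def)
  also have "\<dots> \<le> 5 + (10 + 200 * length xs) + (10 + 200 * length ys) + 10 * (length xs + length ys + 1)"
    by (intro add_mono A B C order_refl)
  finally show ?thesis by simp
qed

subsection \<open>Bottom-up combination of blocks\<close>

definition pairstepE :: "exp \<Rightarrow> exp" where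
  "pairstepE cmb = (let rest = Lft (Var 3); new = Lft (Rgt (Var 3)); out = Rgt (Rgt (Var 3)) in
     IfCell rest
       (IfCell (Rgt rest)
         (Bind (call3 cmb (Lft rest) (Lft (Rgt rest)) out)
           (Cell (Rgt (Rgt rest)) (Cell (Cell (Lft (Var 4)) new) (Rgt (Var 4)))))
         (Cell (Rgt rest) (Cell (Cell (Lft rest) new) out)))
       (Var 3))"

definition passE :: "exp \<Rightarrow> exp" where
  "passE cmb = Bind (Fold (Var 0) (Cell (Var 0) (Cell (Num 0) (Var 1))) (pairstepE cmb))
     (Cell (call1 revE (Lft (Rgt (Var 2)))) (Rgt (Rgt (Var 2))))"

definition treeE :: "exp \<Rightarrow> exp" where
  "treeE cmb = Fold (call1 lgE (Var 0)) (Cell (Var 0) (Var 1)) (call2 (passE cmb) (Lft (Var 3)) (Rgt (Var 3)))"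

abbreviation vll :: "val list list \<Rightarrow> val" where "vll bs \<equiv> vl (map vl bs)"

abbreviation tlen :: "val list list \<Rightarrow> nat" where "tlen bs \<equiv> sum_list (map length bs)"

text \<open>Merge sort and both levels of the decomposition are instances of one bottom-up scheme,
  in which passes over a list of blocks replace recursion. \<open>Mf\<close> joins two neighbouring
  blocks and \<open>Of\<close> extends an output list on that occasion. The length bound keeps the
  total size of the blocks from growing.\<close>

locale combiner =
  fixes cmb :: exp and Mf :: "val list \<Rightarrow> val list \<Rightarrow> val list"
    and Of :: "val list \<Rightarrow> val list \<Rightarrow> val list \<Rightarrow> val list"
  assumes comb: "ev cmb [vl a, vl b, vl out] = CellV (vl (Mf a b)) (vl (Of a b out))"
    and length_Mf: "length (Mf a b) \<le> length a + length b"
begin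

fun pairup :: "val list list \<Rightarrow> val list list" where
  "pairup (a # b # bs) = Mf a b # pairup bs"
| "pairup bs = bs"

fun pouts :: "val list list \<Rightarrow> val list \<Rightarrow> val list" where
  "pouts (a # b # bs) out = pouts bs (Of a b out)"
| "pouts bs out = out"

fun pstep :: "val list list \<times> val list list \<times> val list \<Rightarrow> val list list \<times> val list list \<times> val list" where
  "pstep (a # b # rest, new, out) = (rest, Mf a b # new, Of a b out)"
| "pstep ([a], new, out) = ([], a # new, out)"
| "pstep ([], new, out) = ([], new, out)"

fun penc :: "val list list \<times> val list list \<times> val list \<Rightarrow> val" where
  "penc (rest, new, out) = CellV (vll rest) (CellV (vll new) (vl out))"

lemma ev_pairstep: "ev (pairstepE cmb) [x, y, r, penc p] = penc (pstep p)"
  by (cases p rule: pstep.cases) (simp_all add: pairstepE_def Let_def comb)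

lemma pstep_funpow:
  "length bs \<le> k \<Longrightarrow> (pstep ^^ k) (bs, new, out) = ([], rev (pairup bs) @ new, pouts bs out)"
proof (induction bs arbitrary: new out k rule: pairup.induct)
  case (1 a b bs)
  then obtain k' where "k = Suc k'" by (cases k) auto
  then show ?case using 1 by (simp add: funpow_swap1 del: funpow.simps) (simp add: funpow_Suc_right del: funpow.simps)
next
  case "2_1"
  have "(pstep ^^ k) ([], new, out) = ([], new, out)" for new out k by (induction k) auto
  then show ?case by simp
next
  case ("2_2" v)
  have n: "(pstep ^^ k) ([], new, out) = ([], new, out)" for new out k by (induction k) auto
  obtain k' where "k = Suc k'" using "2_2" by (cases k) auto
  then show ?case using n by (simp add: funpow_Suc_right del: funpow.simps)
qed

lemma ev_pass_state:
  "ev (Fold (Var 0) (Cell (Var 0) (Cell (Num 0) (Var 1))) (pairstepE cmb)) [vll bs, vl out] =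
     penc ([], rev (pairup bs), pouts bs out)"
  using lfold_funpow[of "\<lambda>r s. ev (pairstepE cmb) [vll bs, vl out, r, s]" penc pstep "map vl bs" "(bs, [], out)"]
    pstep_funpow[of bs "length bs" "[]" out] by (simp add: ev_pairstep)

lemma ev_pass [simp]: "ev (passE cmb) [vll bs, vl out] = CellV (vll (pairup bs)) (vl (pouts bs out))"
  unfolding passE_def ev.simps(2) ev_pass_state by (simp add: rev_map[symmetric])

fun passf :: "val list list \<times> val list \<Rightarrow> val list list \<times> val list" where
  "passf (bs, out) = (pairup bs, pouts bs out)"

definition tree :: "val list list \<Rightarrow> val list \<Rightarrow> val list list \<times> val list" where
  "tree bs out = (passf ^^ lg (length bs)) (bs, out)"

fun tenc :: "val list list \<times> val list \<Rightarrow> val" where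
  "tenc (bs, out) = CellV (vll bs) (vl out)"

lemma tenc_eq: "tenc t = CellV (vll (fst t)) (vl (snd t))"
  by (cases t) simp

lemma ev_tree [simp]: "ev (treeE cmb) [vll bs, vl out] = tenc (tree bs out)"
proof -
  have "ev (call2 (passE cmb) (Lft (Var 3)) (Rgt (Var 3))) [x, y, r, tenc t] = tenc (passf t)" for x y r t
    by (cases t) (simp add: numeral_eq_Suc)
  then show ?thesis
    using lfold_funpow[of "\<lambda>r s. ev (call2 (passE cmb) (Lft (Var 3)) (Rgt (Var 3))) [vll bs, vl out, r, s]"
        tenc passf "replicate (lg (length bs)) (NumV 0)" "(bs, out)"] ev_lg[of "map vl bs"]
    by (simp add: treeE_def tree_def del: ev_lg)
qed

lemma tlen_pairup: "tlen (pairup bs) \<le> tlen bs" "length (pairup bs) \<le> length bs"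
  "length (pairup bs) = (length bs + 1) div 2"
  by (induction bs rule: pairup.induct) (auto simp: add_mono intro: le_trans[OF add_mono[OF length_Mf]])

lemma ct_pass:
  assumes c: "\<And>a b out. length a + length b \<le> N \<Longrightarrow> ct cmb [vl a, vl b, vl out] \<le> \<kappa> * (length a + length b + 1)"
    and N: "tlen bs \<le> N"
  shows "ct (passE cmb) [vll bs, vl out] \<le> (\<kappa> + 200) * (tlen bs + length bs + 1)"
proof -
  \<comment> \<open>100 for every remaining iteration, and \<kappa> for every element and every
    block not yet combined.\<close>
  define \<Phi> where "\<Phi> r p = 100 * length r + \<kappa> * (tlen (fst p) + length (fst p))"
    for r :: "val list" and p :: "val list list \<times> val list list \<times> val list"
  have step: "ev (pairstepE cmb) ([vll bs, vl out] @ [CellV x (vl (map (\<lambda>x. x) r)), penc a]) = penc (pstep a) \<and>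
      tlen (fst (pstep a)) \<le> N \<and>
      1 + ct (pairstepE cmb) ([vll bs, vl out] @ [CellV x (vl (map (\<lambda>x. x) r)), penc a]) + \<Phi> r (pstep a) \<le> \<Phi> (x # r) a"
    if t: "tlen (fst a) \<le> N" for x r and a :: "val list list \<times> val list list \<times> val list"
  proof (cases a rule: pstep.cases)
    case (1 u v rest new o')
    have "ct cmb [vl u, vl v, vl o'] \<le> \<kappa> * (length u + length v + 1)" using c t 1 by simp
    moreover have "ct (pairstepE cmb) [vll bs, vl out, CellV x (vl r), penc a] \<le> 90 + ct cmb [vl u, vl v, vl o']"
      by (simp add: pairstepE_def Let_def 1)
    ultimately show ?thesis using 1 t ev_pairstep[of "vll bs" "vl out" "CellV x (vl r)" a]
      by (simp add: \<Phi>_def algebra_simps)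
  next
    case (2 u new o')
    have "ct (pairstepE cmb) [vll bs, vl out, CellV x (vl r), penc a] \<le> 90"
      by (simp add: pairstepE_def Let_def 2)
    then show ?thesis using 2 t ev_pairstep[of "vll bs" "vl out" "CellV x (vl r)" a]
      by (simp add: \<Phi>_def algebra_simps)
  next
    case (3 new o')
    have "ct (pairstepE cmb) [vll bs, vl out, CellV x (vl r), penc a] \<le> 90"
      by (simp add: pairstepE_def Let_def 3)
    then show ?thesis using 3 t ev_pairstep[of "vll bs" "vl out" "CellV x (vl r)" a]
      by (simp add: \<Phi>_def algebra_simps)
  qed
  let ?f = "Fold (Var 0) (Cell (Var 0) (Cell (Num 0) (Var 1))) (pairstepE cmb)"
  have "ct ?f [vll bs, vl out] \<le> 1 + 1 + 5 + \<Phi> (map vl bs) (bs, [], out)"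
    using ct_fold_potential[where I = "\<lambda>r p. tlen (fst p) \<le> N" and b = "pairstepE cmb" and \<rho> = "[vll bs, vl out]" and
        g = "\<lambda>x. x" and E = penc and h = "\<lambda>x. pstep" and \<Phi> = \<Phi> and xs = "map vl bs" and a = "(bs, [], out)" and
        l = "Var 0" and i = "Cell (Var 0) (Cell (Num 0) (Var 1))", OF step] N
    by simp
  then have f: "ct ?f [vll bs, vl out] \<le> 7 + 100 * length bs + \<kappa> * (tlen bs + length bs)" by (simp add: \<Phi>_def)
  have r: "ct revE [vl (rev (map vl (pairup bs)))] \<le> 10 * (length bs + 1)"
    using ct_rev[of "rev (map vl (pairup bs))"] tlen_pairup(2)[of bs] by simp
  have "ct (passE cmb) [vll bs, vl out] = 10 + ct ?f [vll bs, vl out] + ct revE [vl (rev (map vl (pairup bs)))]"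
    unfolding passE_def ct.simps(2) ev_pass_state by (simp add: rev_map ev_pass_state)
  also have "\<dots> \<le> 10 + (7 + 100 * length bs + \<kappa> * (tlen bs + length bs)) + 10 * (length bs + 1)"
    by (intro add_mono f r order_refl)
  also have "\<dots> \<le> (\<kappa> + 200) * (tlen bs + length bs + 1)" by (simp add: algebra_simps)
  finally show ?thesis .
qed

lemma ct_tree:
  assumes c: "\<And>a b out. length a + length b \<le> N \<Longrightarrow> ct cmb [vl a, vl b, vl out] \<le> \<kappa> * (length a + length b + 1)"
    and N: "tlen bs \<le> N"
  shows "ct (treeE cmb) [vll bs, vl out] \<le> (\<kappa> + 300) * (tlen bs + length bs + 1) * (lg (length bs) + 1)"
proof -
  define S where "S = tlen bs + length bs + 1"
  define M where "M = (\<kappa> + 200) * S"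
  define \<Phi> where "\<Phi> r p = (M + 10) * length r" for r :: "val list" and p :: "val list list \<times> val list"
  let ?b = "call2 (passE cmb) (Lft (Var 3)) (Rgt (Var 3))"
  define I where "I p \<longleftrightarrow> tlen (fst p) \<le> tlen bs \<and> length (fst p) \<le> length bs" for p :: "val list list \<times> val list"
  have step: "ev ?b ([vll bs, vl out] @ [CellV x (vl (map (\<lambda>x. x) r)), tenc a]) = tenc (passf a) \<and> I (passf a) \<and>
      1 + ct ?b ([vll bs, vl out] @ [CellV x (vl (map (\<lambda>x. x) r)), tenc a]) + \<Phi> r (passf a) \<le> \<Phi> (x # r) a"
    if t: "I a" for x r and a :: "val list list \<times> val list"
  proof -
    obtain bs' o' where a: "a = (bs', o')" by (cases a)
    have "ct (passE cmb) [vll bs', vl o'] \<le> (\<kappa> + 200) * (tlen bs' + length bs' + 1)"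
      using ct_pass[OF c, of N bs' o'] t N by (simp add: I_def a)
    also have "\<dots> \<le> M" using t unfolding M_def by (intro mult_le_mono2) (simp add: S_def I_def a)
    finally show ?thesis using t tlen_pairup(1,2)[of bs'] by (simp add: a \<Phi>_def I_def)
  qed
  have l: "ev (call1 lgE (Var 0)) [vll bs, vl out] = units (lg (length bs))" using ev_lg[of "map vl bs"] by simp
  have cl: "ct (call1 lgE (Var 0)) [vll bs, vl out] \<le> 3 + 100 * (length bs + 1)" using ct_lg[of "map vl bs"] by simp
  have "ct (treeE cmb) [vll bs, vl out] \<le> 1 + ct (call1 lgE (Var 0)) [vll bs, vl out] + 3 + \<Phi> (replicate (lg (length bs)) (NumV 0)) (bs, out)"
    using ct_fold_potential[where I = "\<lambda>r. I" and b = ?b and \<rho> = "[vll bs, vl out]" and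
        g = "\<lambda>x. x" and E = tenc and h = "\<lambda>x. passf" and \<Phi> = \<Phi> and xs = "replicate (lg (length bs)) (NumV 0)"
        and a = "(bs, out)" and l = "call1 lgE (Var 0)" and i = "Cell (Var 0) (Var 1)", OF step] l
    by (simp add: treeE_def I_def)
  also have "\<dots> \<le> 1 + (3 + 100 * (length bs + 1)) + 3 + (M + 10) * lg (length bs)"
    using cl by (intro add_mono) (simp_all add: \<Phi>_def)
  also have "\<dots> \<le> 107 * S + (M + 10 * S) * lg (length bs)"
    by (intro add_mono mult_le_mono1) (simp_all add: S_def)
  also have "\<dots> \<le> (\<kappa> + 300) * S * (lg (length bs) + 1)" by (simp add: M_def algebra_simps)
  finally show ?thesis unfolding S_def .
qed

end

subsection \<open>Sorting\<close>

definition lexinj :: "val set \<Rightarrow> bool" where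
  "lexinj S \<longleftrightarrow> (\<forall>a\<in>S. \<forall>b\<in>S. \<not> lexlt a b \<longrightarrow> \<not> lexlt b a \<longrightarrow> a = b)"

lemma lexinj_subset: "lexinj S \<Longrightarrow> T \<subseteq> S \<Longrightarrow> lexinj T"
  by (auto simp: lexinj_def)

lemma set_mrg_subset: "set (mrg xs ys) \<subseteq> set xs \<union> set ys"
  by (induction xs ys rule: mrg.induct) auto

text \<open>Under \<open>lexinj\<close>, an element dropped in favour of one with equal keys is the
  same element, so nothing gets lost.\<close>

lemma set_mrg: "lexinj (set xs \<union> set ys) \<Longrightarrow> set (mrg xs ys) = set xs \<union> set ys"
proof (induction xs ys rule: mrg.induct)
  case (3 x xs y ys)
  have s: "lexinj (set xs \<union> set (y # ys))" "lexinj (set (x # xs) \<union> set ys)" "lexinj (set xs \<union> set ys)"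
    using 3(4) by (auto intro: lexinj_subset)
  consider (a) "lexlt x y" | (b) "\<not> lexlt x y" "lexlt y x" | (c) "\<not> lexlt x y" "\<not> lexlt y x" by blast
  then show ?case
  proof cases
    case a
    then show ?thesis using 3(1)[OF a s(1)] by auto
  next
    case b
    then have "mrg (x # xs) (y # ys) = y # mrg (x # xs) ys" by simp
    then show ?thesis using 3(2)[OF b s(2)] by (simp only: list.set) blast
  next
    case c
    have "x \<in> set (x # xs) \<union> set (y # ys)" "y \<in> set (x # xs) \<union> set (y # ys)" by simp_all
    then have xy: "y = x" using 3(4) c unfolding lexinj_def by blast
    have m: "mrg (x # xs) (y # ys) = x # mrg xs ys" using c by simp
    have "set (mrg xs ys) = set xs \<union> set ys" using 3(3)[OF c s(3)] .
    then show ?thesis unfolding m unfolding list.set(2) xy by simp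
  qed
qed auto

lemma lexlt_keys: "\<not> lexlt a b \<Longrightarrow> \<not> lexlt b a \<Longrightarrow> key1 a = key1 b \<and> key2 a = key2 b \<and> key3 a = key3 b"
  unfolding lexlt_def by linarith

lemma lexlt_cases:
  assumes "\<not> lexlt a b" "\<not> lexlt b a" "lexlt b c"
  shows "lexlt a c"
proof -
  have "key1 a = key1 b" "key2 a = key2 b" "key3 a = key3 b" using lexlt_keys[OF assms(1,2)] by auto
  then show ?thesis using assms(3) by (simp add: lexlt_def)
qed

lemma sorted_mrg: "sorted_wrt lexlt xs \<Longrightarrow> sorted_wrt lexlt ys \<Longrightarrow> sorted_wrt lexlt (mrg xs ys)"
proof (induction xs ys rule: mrg.induct)
  case (3 x xs y ys)
  have x: "\<forall>z\<in>set xs. lexlt x z" and y: "\<forall>z\<in>set ys. lexlt y z" using 3(4,5) by auto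
  consider (a) "lexlt x y" | (b) "\<not> lexlt x y" "lexlt y x" | (c) "\<not> lexlt x y" "\<not> lexlt y x" by blast
  then show ?case
  proof cases
    case a
    then have "\<forall>z\<in>set (mrg xs (y # ys)). lexlt x z"
      using set_mrg_subset[of xs "y # ys"] x y lexlt_trans[of x y] by fastforce
    then show ?thesis using 3 a by simp
  next
    case b
    then have "\<forall>z\<in>set (mrg (x # xs) ys). lexlt y z"
      using set_mrg_subset[of "x # xs" ys] x y lexlt_trans[of y x] by fastforce
    then show ?thesis using 3 b by simp
  next
    case c
    then have "\<forall>z\<in>set (mrg xs ys). lexlt x z"
      using set_mrg_subset[of xs ys] x y lexlt_cases[of x y] by fastforce
    then show ?thesis using 3 c by simp
  qed
qed auto

context combiner
begin

lemma length_passes: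
  "length bs \<le> 2 ^ k \<Longrightarrow> length (fst ((passf ^^ k) (bs, out))) \<le> 1"
proof (induction k arbitrary: bs out)
  case (Suc k)
  have "length (pairup bs) \<le> 2 ^ k" using Suc.prems tlen_pairup(3)[of bs] by simp
  from Suc.IH[OF this] show ?case by (simp add: funpow_Suc_right del: funpow.simps)
qed simp

lemma length_tree: "length (fst (tree bs out)) \<le> 1"
  unfolding tree_def by (rule length_passes) (rule le_two_lg)

end

lemma (in combiner) tlen_tree: "tlen (fst (tree bs out)) \<le> tlen bs"
proof -
  have "tlen (fst ((passf ^^ k) (bs, out))) \<le> tlen bs" for k
  proof (induction k arbitrary: bs out)
    case (Suc k)
    show ?case using Suc[of "pairup bs" "pouts bs out"] tlen_pairup(1)[of bs]
      by (simp add: funpow_Suc_right del: funpow.simps)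
  qed simp
  then show ?thesis by (simp add: tree_def)
qed

lemma (in combiner) length_pouts:
  assumes "\<And>a b out. length a + length b \<le> N \<Longrightarrow> length (Of a b out) \<le> length out + \<kappa> * (length a + length b + 1)"
  shows "tlen bs \<le> N \<Longrightarrow> length (pouts bs out) \<le> length out + \<kappa> * (tlen bs + length bs)"
proof (induction bs out rule: pouts.induct)
  case (1 a b bs out)
  have "length (Of a b out) \<le> length out + \<kappa> * (length a + length b + 1)" using 1(2) assms by simp
  then show ?case using 1 by (simp add: algebra_simps)
qed auto

lemma (in combiner) length_tree_out:
  assumes "\<And>a b out. length a + length b \<le> N \<Longrightarrow> length (Of a b out) \<le> length out + \<kappa> * (length a + length b + 1)"
    "tlen bs \<le> N"
  shows "length (snd (tree bs out)) \<le> length out + \<kappa> * (tlen bs + length bs) * lg (length bs)"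
proof -
  have "length (snd ((passf ^^ k) (bs', out))) \<le> length out + \<kappa> * (tlen bs + length bs) * k"
    if "tlen bs' \<le> tlen bs" "length bs' \<le> length bs" for k bs' out
    using that
  proof (induction k arbitrary: bs' out)
    case (Suc k)
    have "length (pouts bs' out) \<le> length out + \<kappa> * (tlen bs' + length bs')"
      using length_pouts[OF assms(1), of N bs' out] Suc.prems assms(2) by simp
    also have "\<dots> \<le> length out + \<kappa> * (tlen bs + length bs)"
      using Suc.prems by (intro add_mono mult_le_mono) auto
    finally have "length (pouts bs' out) \<le> length out + \<kappa> * (tlen bs + length bs)" .
    moreover have "length (snd ((passf ^^ k) (pairup bs', pouts bs' out))) \<le>
        length (pouts bs' out) + \<kappa> * (tlen bs + length bs) * k"
      using Suc.prems tlen_pairup(1,2)[of bs'] by (intro Suc.IH) auto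
    ultimately show ?case by (simp add: funpow_Suc_right del: funpow.simps)
  qed simp
  then show ?thesis by (simp add: tree_def)
qed

definition singles :: "val list \<Rightarrow> val list list" where
  "singles xs = map (\<lambda>x. [x]) xs"

lemma singles_simps [simp]: "length (singles xs) = length xs" "tlen (singles xs) = length xs"
  "concat (singles xs) = xs" "singles [] = []" "singles (x # xs) = [x] # singles xs"
  by (induction xs) (auto simp: singles_def)

definition singlesE :: exp where
  "singlesE = call1 revE (Fold (Var 0) (Num 0) (Cell (Cell (Lft (Var 1)) (Num 0)) (Var 2)))"

lemma lfold_Cons:
  assumes "\<And>x r s. f (CellV x (vl r)) s = CellV (g x) s"
  shows "lfold f (vl xs) (vl ys) = vl (rev (map g xs) @ ys)"
proof (induction xs arbitrary: ys)
  case (Cons x xs)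
  from Cons[of "g x # ys"] show ?case by (simp add: assms)
qed simp

lemma ev_singles [simp]: "ev singlesE [vl xs] = vll (singles xs)"
  using lfold_Cons[where f = "\<lambda>r s. CellV (CellV (lft r) (NumV 0)) s" and g = "\<lambda>x. vl [x]" and ys = "[]" and xs = xs]
  by (simp add: singlesE_def singles_def rev_map[symmetric] comp_def)

lemma ct_singles: "ct singlesE [vl xs] \<le> 40 * (length xs + 1)"
proof -
  let ?f = "Fold (Var 0) (Num 0) (Cell (Cell (Lft (Var 1)) (Num 0)) (Var 2))"
  have A: "ct ?f [vl xs] \<le> 10 + 10 * length xs"
    using ct_fold_loopfree[of "Var 0" "[vl xs]" xs "Cell (Cell (Lft (Var 1)) (Num 0)) (Var 2)" 10 "Num 0"] by simp
  have "ev ?f [vl xs] = vl (rev (map (\<lambda>x. vl [x]) xs))"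
    using lfold_Cons[where f = "\<lambda>r s. CellV (CellV (lft r) (NumV 0)) s" and g = "\<lambda>x. vl [x]" and ys = "[]" and xs = xs] by simp
  then have B: "ct revE [ev ?f [vl xs]] \<le> 10 * (length xs + 1)" using ct_rev[of "rev (map (\<lambda>x. vl [x]) xs)"] by (simp only:) simp
  have "ct singlesE [vl xs] = 2 + ct ?f [vl xs] + ct revE [ev ?f [vl xs]]" by (simp add: singlesE_def)
  also have "\<dots> \<le> 2 + (10 + 10 * length xs) + 10 * (length xs + 1)" by (intro add_mono A B order_refl)
  finally show ?thesis by simp
qed

definition mergecombE :: exp where
  "mergecombE = Cell (call2 mergeE (Var 0) (Var 1)) (Var 2)"

interpretation msort: combiner mergecombE mrg "\<lambda>a b out. out"
  by unfold_locales (simp_all add: mergecombE_def length_mrg)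

definition sortE :: exp where
  "sortE = Lft (Lft (call2 (treeE mergecombE) (call1 singlesE (Var 0)) (Num 0)))"

definition srt :: "val list \<Rightarrow> val list" where
  "srt xs = concat (fst (msort.tree (singles xs) []))"

lemma ev_sort [simp]: "ev sortE [vl xs] = vl (srt xs)"
proof -
  obtain bs out where t: "msort.tree (singles xs) [] = (bs, out)" by fastforce
  have "bs = [] \<or> (\<exists>b. bs = [b])" using msort.length_tree[of "singles xs" "[]"] t by (cases bs) auto
  moreover have "ev (treeE mergecombE) [vll (singles xs), vl []] = CellV (vll bs) (vl out)"
    unfolding msort.ev_tree t by simp
  ultimately show ?thesis using t by (auto simp: sortE_def srt_def)
qed

lemma sort_invariant:
  assumes "\<And>b. b \<in> set bs \<Longrightarrow> sorted_wrt lexlt b" "lexinj (set (concat bs))"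
  shows "(\<forall>b\<in>set (msort.pairup bs). sorted_wrt lexlt b) \<and> set (concat (msort.pairup bs)) = set (concat bs)"
  using assms
proof (induction bs rule: msort.pairup.induct)
  case (1 a b bs)
  have "set (mrg a b) = set a \<union> set b" by (rule set_mrg, rule lexinj_subset[OF 1(3)]) auto
  moreover have "lexinj (set (concat bs))" by (rule lexinj_subset[OF 1(3)]) auto
  ultimately show ?case using 1 by (auto simp: sorted_mrg)
qed auto

lemma srt_spec:
  assumes "lexinj (set xs)"
  shows "sorted_wrt lexlt (srt xs)" "set (srt xs) = set xs"
proof -
  have gen: "(\<forall>b\<in>set (fst ((msort.passf ^^ k) (bs, out))). sorted_wrt lexlt b) \<and>
     set (concat (fst ((msort.passf ^^ k) (bs, out)))) = set (concat bs)"
    if "\<And>b. b \<in> set bs \<Longrightarrow> sorted_wrt lexlt b" "lexinj (set (concat bs))" for k bs out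
    using that
  proof (induction k arbitrary: bs out)
    case (Suc k)
    have i: "(\<forall>b\<in>set (msort.pairup bs). sorted_wrt lexlt b) \<and> set (concat (msort.pairup bs)) = set (concat bs)"
      by (rule sort_invariant) (use Suc.prems in auto)
    have "(\<forall>b\<in>set (fst ((msort.passf ^^ k) (msort.pairup bs, msort.pouts bs out))). sorted_wrt lexlt b) \<and>
     set (concat (fst ((msort.passf ^^ k) (msort.pairup bs, msort.pouts bs out)))) = set (concat (msort.pairup bs))"
      by (rule Suc.IH) (use i Suc.prems in auto)
    then show ?case using i by (simp add: funpow_Suc_right del: funpow.simps)
  qed auto
  have "(\<forall>b\<in>set (fst ((msort.passf ^^ lg (length xs)) (singles xs, []))). sorted_wrt lexlt b) \<and>
     set (concat (fst ((msort.passf ^^ lg (length xs)) (singles xs, [])))) = set (concat (singles xs))"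
    by (rule gen) (use assms in \<open>auto simp: singles_def\<close>)
  then have *: "(\<forall>b\<in>set (fst (msort.tree (singles xs) [])). sorted_wrt lexlt b) \<and> set (srt xs) = set xs"
    by (simp add: msort.tree_def srt_def)
  then show "set (srt xs) = set xs" ..
  show "sorted_wrt lexlt (srt xs)"
    using * msort.length_tree[of "singles xs" "[]"] unfolding srt_def
    by (cases "fst (msort.tree (singles xs) [])") auto
qed

lemma length_srt: "length (srt xs) \<le> length xs"
proof -
  show ?thesis using msort.tlen_tree[of "singles xs" "[]"] by (simp add: srt_def length_concat)
qed

lemma sorted_lexlt_distinct: "sorted_wrt lexlt xs \<Longrightarrow> distinct xs"
  by (induction xs) (auto simp: lexlt_irrefl)

lemma ct_sort: "ct sortE [vl xs] \<le> 2000 * (length xs + 1) * (lg (length xs) + 1)"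
proof -
  have c: "ct mergecombE [vl a, vl b, vl out] \<le> 310 * (length a + length b + 1)" for a b out
    using ct_merge[of a b] by (simp add: mergecombE_def)
  let ?bs = "singles xs"
  have A: "ct (treeE mergecombE) [vll ?bs, vl []] \<le> (310 + 300) * (length xs + length xs + 1) * (lg (length xs) + 1)"
    using msort.ct_tree[of "length xs" 310 ?bs "[]", OF c] by simp
  have "ct sortE [vl xs] = 9 + ct singlesE [vl xs] + ct (treeE mergecombE) [vll ?bs, vl []]"
    by (simp add: sortE_def)
  also have "\<dots> \<le> 9 + 40 * (length xs + 1) + 610 * (length xs + length xs + 1) * (lg (length xs) + 1)"
    using A ct_singles[of xs] by (intro add_mono order_refl) auto
  also have "\<dots> \<le> 2000 * (length xs + 1) * (lg (length xs) + 1)" by (simp add: algebra_simps)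
  finally show ?thesis .
qed

subsection \<open>Separating pairs\<close>

text \<open>Two elements in different blocks stay separated until their blocks are combined with
  each other; this relation traces the pair through the passes.\<close>

fun sep :: "val \<Rightarrow> val \<Rightarrow> val list list \<Rightarrow> bool" where
  "sep x y [] \<longleftrightarrow> False"
| "sep x y (b # bs) \<longleftrightarrow> x \<in> set b \<and> y \<in> set (concat bs) \<or> sep x y bs"

lemma sep_singles: "sep x y (singles (p @ x # q @ y # r))"
  by (induction p) auto

lemma sep_length: "sep x y bs \<Longrightarrow> 2 \<le> length bs"
  by (cases bs rule: remdups_adj.cases) auto

text \<open>Here the blocks are consecutive pieces of a list sorted beforehand, so joining them is
  appending. \<open>Cd a b\<close> is what the combination of \<open>a\<close> with \<open>b\<close>
  contributes to the output.\<close>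

locale appender = combiner cmb "(@)" Of
  for cmb Of +
  fixes Cd :: "val list \<Rightarrow> val list \<Rightarrow> val set"
  assumes set_Of: "set (Of a b out) = Cd a b \<union> set out"
begin

fun pairs :: "val list list \<Rightarrow> (val list \<times> val list) set" where
  "pairs (a # b # bs) = insert (a, b) (pairs bs)"
| "pairs bs = {}"

fun allpairs :: "nat \<Rightarrow> val list list \<Rightarrow> (val list \<times> val list) set" where
  "allpairs 0 bs = {}"
| "allpairs (Suc k) bs = pairs bs \<union> allpairs k (pairup bs)"

lemma concat_pairup: "concat (pairup bs) = concat bs"
  by (induction bs rule: pairup.induct) auto

lemma set_pouts: "set (pouts bs out) = (\<Union>(a, b)\<in>pairs bs. Cd a b) \<union> set out"
  by (induction bs out rule: pouts.induct) (auto simp: set_Of)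

lemma set_passes: "set (snd ((passf ^^ k) (bs, out))) = (\<Union>(a, b)\<in>allpairs k bs. Cd a b) \<union> set out"
  by (induction k arbitrary: bs out) (auto simp: funpow_Suc_right set_pouts simp del: funpow.simps)

lemma sep_pairup: "sep x y bs \<Longrightarrow> (\<exists>(a, b)\<in>pairs bs. x \<in> set a \<and> y \<in> set b) \<or> sep x y (pairup bs)"
  by (induction bs rule: pairup.induct) (auto simp: concat_pairup simp flip: set_concat)

text \<open>A pair cannot be separated once at most one block is left, so some pass combines a block
  of \<open>x\<close> with a block of \<open>y\<close>.\<close>

lemma sep_allpairs: "sep x y bs \<Longrightarrow> length bs \<le> 2 ^ k \<Longrightarrow> \<exists>(a, b)\<in>allpairs k bs. x \<in> set a \<and> y \<in> set b"
proof (induction k arbitrary: bs)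
  case 0
  then show ?case using sep_length by fastforce
next
  case (Suc k)
  have "length (pairup bs) \<le> 2 ^ k" using Suc.prems tlen_pairup(3)[of bs] by simp
  then show ?case using sep_pairup[OF Suc.prems(1)] Suc.IH[of "pairup bs"] by auto
qed

lemma pairs_consecutive: "(a, b) \<in> pairs bs \<Longrightarrow> \<exists>p q. concat bs = p @ a @ b @ q"
proof (induction bs rule: pairs.induct)
  case (1 u v bs)
  show ?case
  proof (cases "(a, b) = (u, v)")
    case False
    then obtain p q where "concat bs = p @ a @ b @ q" using 1 by auto
    then show ?thesis by (intro exI[of _ "u @ v @ p"] exI[of _ q]) simp
  next
    case True
    then show ?thesis by (intro exI[of _ "[]"] exI[of _ "concat bs"]) simp
  qed
qed auto

lemma allpairs_consecutive: "(a, b) \<in> allpairs k bs \<Longrightarrow> \<exists>p q. concat bs = p @ a @ b @ q"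
  using pairs_consecutive concat_pairup by (induction k arbitrary: bs) fastforce+

lemma tree_singles:
  assumes "tree (singles xs) [] = (bs, out)"
  shows "\<And>x y p q r. xs = p @ x # q @ y # r \<Longrightarrow>
      \<exists>a b p' q'. xs = p' @ a @ b @ q' \<and> x \<in> set a \<and> y \<in> set b \<and> Cd a b \<subseteq> set out"
    and "\<And>c. c \<in> set out \<Longrightarrow> \<exists>a b p' q'. xs = p' @ a @ b @ q' \<and> c \<in> Cd a b"
proof -
  let ?P = "allpairs (lg (length xs)) (singles xs)"
  have out: "set out = (\<Union>(a, b)\<in>?P. Cd a b)"
    using assms set_passes[of "lg (length xs)" "singles xs" "[]"] by (simp add: tree_def)
  have con: "\<exists>p q. xs = p @ a @ b @ q" if "(a, b) \<in> ?P" for a b using allpairs_consecutive[OF that] by simp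
  show "\<exists>a b p' q'. xs = p' @ a @ b @ q' \<and> x \<in> set a \<and> y \<in> set b \<and> Cd a b \<subseteq> set out"
    if "xs = p @ x # q @ y # r" for x y p q r
  proof -
    have "sep x y (singles xs)" unfolding that by (rule sep_singles)
    then obtain a b where "(a, b) \<in> ?P" "x \<in> set a" "y \<in> set b"
      using sep_allpairs[of x y "singles xs" "lg (length xs)"] le_two_lg[of "length xs"] by auto
    moreover from this(1) have "Cd a b \<subseteq> set out" unfolding out by auto
    moreover obtain p' q' where "xs = p' @ a @ b @ q'" using con[OF \<open>(a, b) \<in> ?P\<close>] by auto
    ultimately show ?thesis by blast
  qed
  show "\<exists>a b p' q'. xs = p' @ a @ b @ q' \<and> c \<in> Cd a b" if co: "c \<in> set out" for c
  proof -
    obtain z where z: "z \<in> ?P" "c \<in> (case z of (a, b) \<Rightarrow> Cd a b)" using co unfolding out by blast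
    obtain a b where "z = (a, b)" by (cases z)
    then have "(a, b) \<in> ?P" "c \<in> Cd a b" using z by simp_all
    then show ?thesis using con[of a b] by auto
  qed
qed

end

section \<open>Closest dominating points\<close>

subsection \<open>Staircases\<close>

text \<open>The quadratic form \<open>u^2 + u*v + v^2\<close> belonging to axes at 60 degrees. In
  wedge coordinates it is three times the squared distance, which serves equally well for
  comparisons and needs no root.\<close>

definition sqd :: "val \<Rightarrow> val \<Rightarrow> real" where
  "sqd a b = (key2 b - key2 a) * ((key2 b - key2 a) + (key1 b - key1 a)) + (key1 b - key1 a) * (key1 b - key1 a)"

definition sqdE :: exp where
  "sqdE = Bind (Arith RSub (Lft (Rgt (Var 1))) (Lft (Rgt (Var 0)))) (Bind (Arith RSub (Lft (Var 1)) (Lft (Var 0)))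
     (Arith RAdd (Arith RMul (Var 2) (Arith RAdd (Var 2) (Var 3))) (Arith RMul (Var 3) (Var 3))))"

lemma ev_sqd [simp]: "ev sqdE [a, b] = RealV (sqd a b)"
  by (simp add: sqdE_def sqd_def key1_def key2_def)

lemma sz_sqd [simp]: "loopfree sqdE" "sz sqdE = 23"
  by (simp_all add: sqdE_def)

text \<open>The points arrive in lexicographic order, so a new point is minimal unless its second
  key is at least the smallest one so far, and that is the second key of the point kept last. The
  sweep for maximal points runs backwards.\<close>

definition minstep :: "val \<Rightarrow> val list \<Rightarrow> val list" where
  "minstep x s = (case s of [] \<Rightarrow> [x] | y # _ \<Rightarrow> if key2 x < key2 y then x # s else s)"

definition maxstep :: "val \<Rightarrow> val list \<Rightarrow> val list" where
  "maxstep x s = (case s of [] \<Rightarrow> [x] | y # _ \<Rightarrow> if key2 y < key2 x then x # s else s)"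

definition mins :: "val list \<Rightarrow> val list" where "mins B = rev (fold minstep B [])"
definition maxs :: "val list \<Rightarrow> val list" where "maxs A = fold maxstep (rev A) []"

definition minE :: exp where
  "minE = call1 revE (Fold (Var 0) (Num 0) (IfCell (Var 2)
     (IfLess (Lft (Rgt (Lft (Var 1)))) (Lft (Rgt (Lft (Var 2)))) (Cell (Lft (Var 1)) (Var 2)) (Var 2))
     (Cell (Lft (Var 1)) (Var 2))))"

definition maxE :: exp where
  "maxE = Fold (call1 revE (Var 0)) (Num 0) (IfCell (Var 2)
     (IfLess (Lft (Rgt (Lft (Var 2)))) (Lft (Rgt (Lft (Var 1)))) (Cell (Lft (Var 1)) (Var 2)) (Var 2))
     (Cell (Lft (Var 1)) (Var 2)))"

lemma ev_min_state:
  "ev (Fold (Var 0) (Num 0) (IfCell (Var 2)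
     (IfLess (Lft (Rgt (Lft (Var 1)))) (Lft (Rgt (Lft (Var 2)))) (Cell (Lft (Var 1)) (Var 2)) (Var 2))
     (Cell (Lft (Var 1)) (Var 2)))) [vl B] = vl (fold minstep B [])"
  using lfold_sim[where E = vl and h = minstep and s = "[]" and xs = B]
  by (simp add: minstep_def key2_def split: list.split)

lemma ev_min [simp]: "ev minE [vl B] = vl (mins B)"
  unfolding minE_def ev_call ev_min_state by (simp add: mins_def)

lemma ev_max [simp]: "ev maxE [vl A] = vl (maxs A)"
  using lfold_sim[where E = vl and h = maxstep and s = "[]" and xs = "rev A"]
  by (simp add: maxE_def maxs_def maxstep_def key2_def split: list.split)

lemma measure_fold:
  assumes "\<And>x s. m (f x s) \<le> Suc (m s)"
  shows "m (fold f xs s) \<le> length xs + m s"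
proof (induction xs arbitrary: s)
  case (Cons x xs)
  show ?case using Cons[of "f x s"] assms[of x s] by simp
qed simp

lemma length_fold_steps:
  "length (fold minstep B s) \<le> length B + length s" "length (fold maxstep B s) \<le> length B + length s"
  by (rule measure_fold; simp add: minstep_def maxstep_def split: list.split)+

lemma length_mins: "length (mins B) \<le> length B" and length_maxs: "length (maxs A) \<le> length A"
  using length_fold_steps(1)[of B "[]"] length_fold_steps(2)[of "rev A" "[]"] by (simp_all add: mins_def maxs_def)

lemma ct_min: "ct minE [vl B] \<le> 100 * (length B + 1)"
proof -
  define b where "b = IfCell (Var 2)
     (IfLess (Lft (Rgt (Lft (Var 1)))) (Lft (Rgt (Lft (Var 2)))) (Cell (Lft (Var 1)) (Var 2)) (Var 2))
     (Cell (Lft (Var 1)) (Var 2))"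
  have A: "ct (Fold (Var 0) (Num 0) b) [vl B] \<le> 10 + 50 * length B"
    using ct_fold_loopfree[of "Var 0" "[vl B]" B b 50 "Num 0"] by (simp add: b_def)
  have C: "ct revE [ev (Fold (Var 0) (Num 0) b) [vl B]] \<le> 10 * (length B + 1)"
    unfolding b_def ev_min_state using ct_rev[of "fold minstep B []"] length_fold_steps(1)[of B "[]"] by simp
  have "ct minE [vl B] = 2 + ct (Fold (Var 0) (Num 0) b) [vl B] + ct revE [ev (Fold (Var 0) (Num 0) b) [vl B]]"
    by (simp add: minE_def b_def)
  also have "\<dots> \<le> 2 + (10 + 50 * length B) + 10 * (length B + 1)" by (intro add_mono A C order_refl)
  finally show ?thesis by simp
qed

lemma ct_max: "ct maxE [vl A] \<le> 100 * (length A + 1)"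
  using ct_fold_loopfree[of "call1 revE (Var 0)" "[vl A]" "rev A" "IfCell (Var 2)
     (IfLess (Lft (Rgt (Lft (Var 2)))) (Lft (Rgt (Lft (Var 1)))) (Cell (Lft (Var 1)) (Var 2)) (Var 2))
     (Cell (Lft (Var 1)) (Var 2))" 50 "Num 0"] ct_rev[of A]
  by (simp add: maxE_def)

subsection \<open>Removing a subsequence\<close>

text \<open>Points are identified by their index; two strict comparisons stand in for an equality
  test.\<close>

definition ifSame :: "exp \<Rightarrow> exp \<Rightarrow> exp \<Rightarrow> exp \<Rightarrow> exp" where
  "ifSame a b t e = IfLess (Lft (Rgt (Rgt a))) (Lft (Rgt (Rgt b))) e (IfLess (Lft (Rgt (Rgt b))) (Lft (Rgt (Rgt a))) e t)"

lemma ev_ifSame: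
  assumes "\<And>x. ev a (\<rho> @ [x]) = ev a \<rho>" "\<And>x. ev b (\<rho> @ [x]) = ev b \<rho>"
  shows "ev (ifSame a b t e) \<rho> = (if key3 (ev a \<rho>) = key3 (ev b \<rho>) then ev t \<rho> else ev e \<rho>)"
  by (auto simp: ifSame_def assms key3_def)

definition rmstep :: "val \<Rightarrow> val list \<times> val list \<Rightarrow> val list \<times> val list" where
  "rmstep x = (\<lambda>(ys, kept). case ys of [] \<Rightarrow> ([], x # kept)
     | y # ys' \<Rightarrow> if key3 y = key3 x then (ys', kept) else (ys, x # kept))"

definition removes :: "val list \<Rightarrow> val list \<Rightarrow> val list" where
  "removes ys B = rev (snd (fold rmstep B (ys, [])))"

fun enc2 :: "val list \<times> val list \<Rightarrow> val" where
  "enc2 (a, b) = CellV (vl a) (vl b)"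

lemma enc2_eq: "enc2 p = CellV (vl (fst p)) (vl (snd p))"
  by (cases p) simp

definition removestepE :: exp where
  "removestepE = (let push = Cell (Lft (Var 3)) (Cell (Lft (Var 2)) (Rgt (Var 3))) in
     IfCell (Lft (Var 3)) (ifSame (Lft (Lft (Var 3))) (Lft (Var 2)) (Cell (Rgt (Lft (Var 3))) (Rgt (Var 3))) push) push)"

definition removeE :: exp where
  "removeE = call1 revE (Rgt (Fold (Var 1) (Cell (Var 0) (Num 0)) removestepE))"

lemma ev_removestep: "ev removestepE [p, q, CellV x r, enc2 s] = enc2 (rmstep x s)"
  by (cases s) (simp add: removestepE_def Let_def ev_ifSame rmstep_def split: list.split)

lemma ev_remove_state:
  "ev (Fold (Var 1) (Cell (Var 0) (Num 0)) removestepE) [vl ys, vl B] = enc2 (fold rmstep B (ys, []))"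
  using lfold_sim[where E = enc2 and h = rmstep and s = "(ys, [])" and xs = B, OF ev_removestep] by simp

lemma ev_remove [simp]: "ev removeE [vl ys, vl B] = vl (removes ys B)"
  unfolding removeE_def ev_call ev.simps(8) ev_remove_state by (simp add: removes_def enc2_eq)

lemma length_removes: "length (removes ys B) \<le> length B"
proof -
  have "length (snd (fold rmstep B p)) \<le> length B + length (snd p)" for p
    by (rule measure_fold) (auto simp: rmstep_def split: list.split prod.split)
  from this[of "(ys, [])"] show ?thesis by (simp add: removes_def)
qed

lemma ct_remove: "ct removeE [vl ys, vl B] \<le> 100 * (length B + 1)"
proof -
  let ?f = "Fold (Var 1) (Cell (Var 0) (Num 0)) removestepE"
  have A: "ct ?f [vl ys, vl B] \<le> 10 + 70 * length B"
    using ct_fold_loopfree[of "Var 1" "[vl ys, vl B]" B removestepE 70 "Cell (Var 0) (Num 0)"]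
    by (simp add: removestepE_def Let_def ifSame_def)
  have "length (snd (fold rmstep B (ys, []))) \<le> length B" using length_removes[of ys B] by (simp add: removes_def)
  then have C: "ct revE [ev (Rgt ?f) [vl ys, vl B]] \<le> 10 * (length B + 1)"
    unfolding ev.simps(8) ev_remove_state enc2_eq using ct_rev[of "snd (fold rmstep B (ys, []))"] by simp
  have "ct removeE [vl ys, vl B] = 3 + ct ?f [vl ys, vl B] + ct revE [ev (Rgt ?f) [vl ys, vl B]]"
    by (simp add: removeE_def)
  also have "\<dots> \<le> 3 + (10 + 70 * length B) + 10 * (length B + 1)" by (intro add_mono A C order_refl)
  finally show ?thesis by simp
qed

subsection \<open>Row minima\<close>

fun enc3 :: "bool \<times> val list \<times> val list \<Rightarrow> val" where
  "enc3 (f, a, b) = CellV (if f then CellV (NumV 0) (NumV 0) else NumV 0) (CellV (vl a) (vl b))"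

text \<open>While the list is traversed, \<open>rest\<close> advances on every second step only and
  so ends up halfway. The front half comes out reversed, which puts its last row, the pivot of the
  divide and conquer, at the head.\<close>

definition halfstep :: "val \<Rightarrow> bool \<times> val list \<times> val list \<Rightarrow> bool \<times> val list \<times> val list" where
  "halfstep x = (\<lambda>(f, front, rest). if f then (case rest of [] \<Rightarrow> (False, NumV 0 # front, [])
     | y # ys \<Rightarrow> (False, y # front, ys)) else (True, front, rest))"

definition halvesE :: exp where
  "halvesE = Rgt (Fold (Var 0) (Cell (Num 0) (Cell (Num 0) (Var 0)))
     (let front = Lft (Rgt (Var 2)); rest = Rgt (Rgt (Var 2)) in
      IfCell (Lft (Var 2)) (Cell (Num 0) (Cell (Cell (Lft rest) front) (Rgt rest)))
        (Cell (Cell (Num 0) (Num 0)) (Rgt (Var 2)))))"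

lemma fold_halfstep:
  "length ys div 2 \<le> length rest \<Longrightarrow> fold halfstep ys (False, front, rest) =
     (odd (length ys), rev (take (length ys div 2) rest) @ front, drop (length ys div 2) rest)"
proof (induction ys arbitrary: front rest rule: induct_list012)
  case (3 a b ys)
  then obtain z rest' where "rest = z # rest'" by (cases rest) auto
  then show ?case using 3 by (simp add: halfstep_def)
qed (auto simp: halfstep_def)

lemma ev_halves [simp]:
  "ev halvesE [vl xs] = CellV (vl (rev (take (length xs div 2) xs))) (vl (drop (length xs div 2) xs))"
  using lfold_sim[where E = enc3 and h = halfstep and s = "(False, [], xs)" and xs = xs] fold_halfstep[of xs xs "[]"]
  by (simp add: halvesE_def Let_def halfstep_def split: list.split prod.split)

lemma ct_halves: "ct halvesE [vl xs] \<le> 100 * (length xs + 1)"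
  using ct_fold_loopfree[of "Var 0" "[vl xs]" xs "(let front = Lft (Rgt (Var 2)); rest = Rgt (Rgt (Var 2)) in
      IfCell (Lft (Var 2)) (Cell (Num 0) (Cell (Cell (Lft rest) front) (Rgt rest)))
        (Cell (Cell (Num 0) (Num 0)) (Rgt (Var 2))))" 50 "Cell (Num 0) (Cell (Num 0) (Var 0))"]
  by (simp add: halvesE_def Let_def)

text \<open>The split column is the last minimum of row \<open>p\<close> and belongs to both parts,
  the first of which is reversed. It has to be the last one because \<open>p\<close> stays with the
  rows of the first part: an earlier choice would cut off minima of \<open>p\<close> itself.\<close>

fun spl :: "val \<Rightarrow> val list \<Rightarrow> val list \<times> val list \<times> val list \<Rightarrow> val list \<times> val list \<times> val list" where
  "spl p [] st = st"
| "spl p (x # xs) (pre, l, r) = spl p xs (if l = [] \<or> \<not> sqd p (hd l) < sqd p x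
     then (x # pre, x # pre, x # xs) else (x # pre, l, r))"

definition splitE :: exp where
  "splitE = Rgt (Fold (Var 1) (Cell (Num 0) (Cell (Num 0) (Num 0)))
     (Bind (Cell (Lft (Var 2)) (Lft (Var 3)))
       (let new = Cell (Var 4) (Cell (Var 4) (Var 2)) in
        IfCell (Lft (Rgt (Var 3)))
         (IfLess (call2 sqdE (Var 0) (Lft (Lft (Rgt (Var 3))))) (call2 sqdE (Var 0) (Lft (Var 2)))
            (Cell (Var 4) (Rgt (Var 3))) new) new)))"

lemma ev_split [simp]: "ev splitE [p, vl xs] = enc2 (snd (spl p xs ([], [], [])))"
proof -
  have "lfold (\<lambda>r s. if is_cell (lft (rgt s))
      then if sqd p (lft (lft (rgt s))) < sqd p (lft r) then CellV (CellV (lft r) (lft s)) (rgt s)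
           else CellV (CellV (lft r) (lft s)) (CellV (CellV (lft r) (lft s)) r)
      else CellV (CellV (lft r) (lft s)) (CellV (CellV (lft r) (lft s)) r)) (vl ys) (menc st) = menc (spl p ys st)" for ys st
  proof (induction ys arbitrary: st)
    case (Cons y ys)
    obtain pre l r where st: "st = (pre, l, r)" by (cases st)
    show ?case
    proof (cases l)
      case Nil
      then show ?thesis using Cons[of "(y # pre, y # pre, y # ys)"] by (simp add: st)
    next
      case (Cons z l')
      then show ?thesis using Cons.IH[of "(y # pre, y # pre, y # ys)"] Cons.IH[of "(y # pre, z # l', r)"]
        by (simp add: st)
    qed
  qed simp
  from this[of xs "([], [], [])"] show ?thesis
    by (cases "spl p xs ([], [], [])") (simp add: splitE_def Let_def cong: if_cong)
qed

lemma ct_split: "ct splitE [p, vl xs] \<le> 200 * (length xs + 1)"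
  using ct_fold_loopfree[of "Var 1" "[p, vl xs]" xs "(Bind (Cell (Lft (Var 2)) (Lft (Var 3)))
       (let new = Cell (Var 4) (Cell (Var 4) (Var 2)) in
        IfCell (Lft (Rgt (Var 3)))
         (IfLess (call2 sqdE (Var 0) (Lft (Lft (Rgt (Var 3))))) (call2 sqdE (Var 0) (Lft (Var 2)))
            (Cell (Var 4) (Rgt (Var 3))) new) new))" 150 "Cell (Num 0) (Cell (Num 0) (Num 0))"]
  by (simp add: splitE_def Let_def)

lemma spl_spec:
  "xs \<noteq> [] \<Longrightarrow> \<exists>a x b. xs = a @ x # b \<and> snd (spl p xs ([], [], [])) = (x # rev a, x # b) \<and>
     (\<forall>y\<in>set a. sqd p x \<le> sqd p y) \<and> (\<forall>y\<in>set b. sqd p x < sqd p y)"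
proof -
  define inv where "inv st ys \<longleftrightarrow> (\<exists>a x b. xs = a @ x # b @ ys \<and> st = (rev (a @ x # b), x # rev a, x # b @ ys) \<and>
     (\<forall>y\<in>set a. sqd p x \<le> sqd p y) \<and> (\<forall>y\<in>set b. sqd p x < sqd p y))" for st ys
  have "inv (spl p ys st) []" if "inv st ys" for ys st
    using that
  proof (induction ys arbitrary: st)
    case (Cons y ys)
    obtain a x b where i: "xs = a @ x # b @ y # ys" "st = (rev (a @ x # b), x # rev a, x # b @ y # ys)"
      "\<forall>z\<in>set a. sqd p x \<le> sqd p z" "\<forall>z\<in>set b. sqd p x < sqd p z"
      using Cons.prems unfolding inv_def by blast
    show ?case
    proof (cases "sqd p x < sqd p y")
      case True
      have "inv (rev (a @ x # b @ [y]), x # rev a, x # b @ y # ys) ys"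
        unfolding inv_def using i True by (intro exI[of _ a] exI[of _ x] exI[of _ "b @ [y]"]) simp
      from Cons.IH[OF this] show ?thesis using True by (simp add: i(2))
    next
      case False
      then have "inv (y # rev (a @ x # b), y # rev (a @ x # b), y # ys) ys"
        unfolding inv_def using i by (intro exI[of _ "a @ x # b"] exI[of _ y] exI[of _ "[]"]) auto
      from Cons.IH[OF this] show ?thesis using False by (simp add: i(2))
    qed
  qed simp
  moreover assume "xs \<noteq> []"
  then obtain x ys where xs: "xs = x # ys" by (cases xs) auto
  moreover have "inv ([x], [x], x # ys) ys"
    unfolding inv_def xs by (intro exI[of _ "[]"] exI[of _ x]) simp
  ultimately have "inv (spl p xs ([], [], [])) []" by simp
  then show ?thesis unfolding inv_def by auto
qed

lemma spl_lengths:
  assumes "snd (spl p xs ([], [], [])) = (l, r)"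
  shows "length l + length r \<le> length xs + 1"
proof (cases "xs = []")
  case False
  then obtain a x b where "xs = a @ x # b" "(l, r) = (x # rev a, x # b)" using spl_spec[OF False, of p] assms by auto
  then show ?thesis by simp
qed (use assms in simp)

type_synonym task = "val list \<times> val list"

definition taskstep :: "task \<Rightarrow> task list \<Rightarrow> task list" where
  "taskstep = (\<lambda>(rws, cls) s. if 2 \<le> length rws then
     let h = length rws div 2; lr = snd (spl (last (take h rws)) cls ([], [], [])) in
       (drop h rws, snd lr) # (take h rws, rev (fst lr)) # s
     else (rws, cls) # s)"

definition taskpass :: "task list \<Rightarrow> task list" where
  "taskpass ts = rev (fold taskstep ts [])"

definition rowmin :: "val list \<Rightarrow> val list \<Rightarrow> task list" where
  "rowmin rws cls = (taskpass ^^ lg (length rws)) [(rws, cls)]"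

abbreviation vlt :: "task list \<Rightarrow> val" where "vlt ts \<equiv> vl (map enc2 ts)"

definition taskstepE :: exp where
  "taskstepE = (let rws = Lft (Lft (Var 1)); cls = Rgt (Lft (Var 1)) in
     IfCell (Rgt rws)
       (Bind (call1 halvesE rws)
         (Bind (call2 splitE (Lft (Lft (Var 3))) cls)
           (Cell (Cell (Rgt (Var 3)) (Rgt (Var 4)))
             (Cell (Cell (call1 revE (Lft (Var 3))) (call1 revE (Lft (Var 4)))) (Var 2)))))
       (Cell (Lft (Var 1)) (Var 2)))"

definition taskpassE :: exp where
  "taskpassE = call1 revE (Fold (Var 0) (Num 0) taskstepE)"

definition rowminE :: exp where
  "rowminE = Fold (call1 lgE (Var 0)) (Cell (Cell (Var 0) (Var 1)) (Num 0)) (call1 taskpassE (Var 3))"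

lemma hd_rev_vl: "xs \<noteq> [] \<Longrightarrow> lft (vl (rev xs)) = last xs"
  by (cases xs rule: rev_cases) auto

lemma ev_taskstep: "ev taskstepE [q, CellV (enc2 t) r, vlt s] = vlt (taskstep t s)"
proof -
  obtain rws cls where t: "t = (rws, cls)" by (cases t)
  show ?thesis
  proof (cases "2 \<le> length rws")
    case True
    then obtain a b rws' where rws: "rws = a # b # rws'" by (cases rws rule: remdups_adj.cases) auto
    define h where "h = length rws div 2"
    have h: "take h rws \<noteq> []" using True by (auto simp: h_def)
    have ic: "is_cell (rgt (vl rws))" by (simp add: rws)
    show ?thesis using True h ic
      by (simp add: taskstepE_def Let_def t taskstep_def hd_rev_vl[OF h] enc2_eq flip: h_def)
  next
    case False
    then have "\<not> is_cell (rgt (vl rws))" by (cases rws rule: remdups_adj.cases) auto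
    then show ?thesis using False by (simp add: taskstepE_def Let_def t taskstep_def)
  qed
qed

definition tasksize :: "task list \<Rightarrow> nat" where
  "tasksize ts = (\<Sum>(rws, cls)\<leftarrow>ts. length rws + length cls + 1)"

lemma ct_taskstep:
  "ct taskstepE [q, CellV (enc2 (rws, cls)) r, s] \<le> 500 * (length rws + length cls + 1)"
proof (cases "is_cell (rgt (vl rws))")
  case True
  define h where "h = length rws div 2"
  define p where "p = lft (vl (rev (take h rws)))"
  have s: "length (fst (snd (spl p cls ([], [], [])))) \<le> length cls + 1"
    using spl_lengths[of p cls] by (metis add_leD1 prod.collapse)
  have "ct taskstepE [q, CellV (enc2 (rws, cls)) r, s] \<le> 60 + ct halvesE [vl rws] + ct splitE [p, vl cls] +
      ct revE [vl (rev (take h rws))] + ct revE [vl (fst (snd (spl p cls ([], [], []))))]"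
    using True by (simp add: taskstepE_def Let_def enc2_eq flip: h_def p_def)
  also have "\<dots> \<le> 60 + 100 * (length rws + 1) + 200 * (length cls + 1) +
      10 * (length rws + 1) + 10 * (length cls + 2)"
    using ct_rev[of "rev (take h rws)"] ct_rev[of "fst (snd (spl p cls ([], [], [])))"] s
    by (intro add_mono ct_halves ct_split) auto
  finally show ?thesis by simp
next
  case False
  then show ?thesis by (simp add: taskstepE_def Let_def)
qed

lemma ev_taskpass_state: "ev (Fold (Var 0) (Num 0) taskstepE) [vlt ts] = vlt (fold taskstep ts [])"
  using lfold_sim_map[where g = enc2 and E = vlt and h = taskstep and s = "[]" and xs = ts] by (simp add: ev_taskstep)

lemma ev_taskpass [simp]: "ev taskpassE [vlt ts] = vlt (taskpass ts)"
  unfolding taskpassE_def ev_call ev_taskpass_state by (simp add: taskpass_def rev_map)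

lemma length_fold_taskstep: "length (fold taskstep ts s) \<le> 2 * length ts + length s"
proof (induction ts arbitrary: s)
  case (Cons t ts)
  have "length (taskstep t s) \<le> length s + 2" by (auto simp: taskstep_def Let_def split: prod.split)
  then show ?case using Cons[of "taskstep t s"] by simp
qed simp

lemma ct_taskpass: "ct taskpassE [vlt ts] \<le> 600 * (tasksize ts + 1)"
proof -
  let ?f = "Fold (Var 0) (Num 0) taskstepE"
  have step: "ev taskstepE ([vlt ts] @ [CellV (enc2 x) (vlt r), vlt a]) = vlt (taskstep x a) \<and> True \<and>
      1 + ct taskstepE ([vlt ts] @ [CellV (enc2 x) (vlt r), vlt a]) + 501 * tasksize r \<le> 501 * tasksize (x # r)" for x r a
    using ct_taskstep[of "vlt ts" "fst x" "snd x" "vlt r" "vlt a"] ev_taskstep[of "vlt ts" x]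
    by (simp add: tasksize_def split_def)
  have A: "ct ?f [vlt ts] \<le> 10 + 501 * tasksize ts"
    using ct_fold_potential[where I = "\<lambda>r a. True" and b = taskstepE and \<rho> = "[vlt ts]" and g = enc2 and E = vlt
       and h = taskstep and \<Phi> = "\<lambda>r a. 501 * tasksize r" and xs = ts and a = "[]" and l = "Var 0" and i = "Num 0",
       OF step] by simp
  have "length ts \<le> tasksize ts" by (induction ts) (auto simp: tasksize_def)
  then have "length (fold taskstep ts []) \<le> 2 * tasksize ts" using length_fold_taskstep[of ts "[]"] by simp
  then have C: "ct revE [ev ?f [vlt ts]] \<le> 10 * (2 * tasksize ts + 1)"
    unfolding ev_taskpass_state using ct_rev[of "map enc2 (fold taskstep ts [])"] by simp
  have "ct taskpassE [vlt ts] = 2 + ct ?f [vlt ts] + ct revE [ev ?f [vlt ts]]" by (simp add: taskpassE_def)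
  also have "\<dots> \<le> 2 + (10 + 501 * tasksize ts) + 10 * (2 * tasksize ts + 1)" by (intro add_mono A C order_refl)
  finally show ?thesis by simp
qed

lemma ev_rowmin [simp]: "ev rowminE [vl rws, vl cls] = vlt (rowmin rws cls)"
  using lfold_funpow[of "\<lambda>r s. ev (call1 taskpassE (Var 3)) [vl rws, vl cls, r, s]" vlt taskpass
      "replicate (lg (length rws)) (NumV 0)" "[(rws, cls)]"]
  by (simp add: rowminE_def rowmin_def)

lemma fold_taskstep_sums:
  "(\<Sum>(rws, cls)\<leftarrow>fold taskstep ts s. length rws) = (\<Sum>(rws, cls)\<leftarrow>ts. length rws) + (\<Sum>(rws, cls)\<leftarrow>s. length rws) \<and>
   (\<Sum>(rws, cls)\<leftarrow>fold taskstep ts s. length cls) + length ts + length s \<le>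
     (\<Sum>(rws, cls)\<leftarrow>ts. length cls) + (\<Sum>(rws, cls)\<leftarrow>s. length cls) + length (fold taskstep ts s)"
proof (induction ts arbitrary: s)
  case (Cons t ts)
  obtain rws cls where t: "t = (rws, cls)" by (cases t)
  show ?case
  proof (cases "2 \<le> length rws")
    case True
    define h where "h = length rws div 2"
    obtain l r where lr: "snd (spl (last (take h rws)) cls ([], [], [])) = (l, r)" by fastforce
    have "length l + length r \<le> length cls + 1" using spl_lengths[OF lr] .
    moreover have "taskstep t s = (drop h rws, r) # (take h rws, rev l) # s"
      using True lr by (simp add: taskstep_def t Let_def h_def)
    ultimately show ?thesis using Cons[of "(drop h rws, r) # (take h rws, rev l) # s"] by (simp add: t h_def)
  next
    case False
    then have "taskstep t s = (rws, cls) # s" by (simp add: taskstep_def t)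
    then show ?thesis using Cons[of "(rws, cls) # s"] by (simp add: t)
  qed
qed simp


text \<open>A split repeats at most one column and adds one task, so the surplus of columns is less
  than the number of tasks. Each task keeps a row, which bounds the number of tasks by the number of
  rows; the last alternative covers a start without rows.\<close>

definition tinv :: "nat \<Rightarrow> nat \<Rightarrow> task list \<Rightarrow> bool" where
  "tinv R C ts \<longleftrightarrow> (\<Sum>(rws, cls)\<leftarrow>ts. length rws) = R \<and> (\<Sum>(rws, cls)\<leftarrow>ts. length cls) + 1 \<le> C + length ts \<and>
     ((\<forall>t\<in>set ts. fst t \<noteq> []) \<or> (\<exists>c. ts = [([], c)]))"

lemma sum_list_rev_pairs: "(\<Sum>(a, b)\<leftarrow>rev ts. f a b) = (\<Sum>(a, b)\<leftarrow>ts. (f a b :: nat))"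
  by (simp add: rev_map[symmetric] sum_list_rev)

lemma fold_taskstep_nonempty:
  "\<forall>t\<in>set ts. fst t \<noteq> [] \<Longrightarrow> \<forall>t\<in>set s. fst t \<noteq> [] \<Longrightarrow> \<forall>t\<in>set (fold taskstep ts s). fst t \<noteq> []"
proof (induction ts arbitrary: s)
  case (Cons t ts)
  have "\<forall>u\<in>set (taskstep t s). fst u \<noteq> []"
  proof -
    obtain rws cls where t: "t = (rws, cls)" by (cases t)
    show ?thesis
    proof (cases "2 \<le> length rws")
      case True
      define h where "h = length rws div 2"
      obtain l r where lr: "snd (spl (last (take h rws)) cls ([], [], [])) = (l, r)" by fastforce
      have "taskstep t s = (drop h rws, r) # (take h rws, rev l) # s"
        using True lr by (simp add: taskstep_def t Let_def h_def)
      moreover have "0 < h" "h < length rws" using True unfolding h_def by linarith+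
      then have "drop h rws \<noteq> []" "take h rws \<noteq> []" by auto
      ultimately show ?thesis using Cons.prems(2) by simp
    next
      case False
      then show ?thesis using Cons.prems by (simp add: taskstep_def t)
    qed
  qed
  moreover have "\<forall>t\<in>set ts. fst t \<noteq> []" using Cons.prems(1) by (meson list.set_intros(2))
  ultimately show ?case unfolding fold_simps by (intro Cons.IH)
qed simp

lemma tinv_taskpass: "tinv R C ts \<Longrightarrow> tinv R C (taskpass ts)"
proof -
  assume t: "tinv R C ts"
  have s: "(\<Sum>(rws, cls)\<leftarrow>taskpass ts. length rws) = R" "(\<Sum>(rws, cls)\<leftarrow>taskpass ts. length cls) + 1 \<le> C + length (taskpass ts)"
    using t fold_taskstep_sums[of ts "[]"] by (simp_all add: tinv_def taskpass_def sum_list_rev_pairs)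
  have "(\<forall>t\<in>set (taskpass ts). fst t \<noteq> []) \<or> (\<exists>c. taskpass ts = [([], c)])"
  proof (cases "\<forall>t\<in>set ts. fst t \<noteq> []")
    case True
    then show ?thesis using fold_taskstep_nonempty[of ts "[]"] by (auto simp: taskpass_def)
  next
    case False
    then obtain c where "ts = [([], c)]" using t by (auto simp: tinv_def)
    then show ?thesis by (simp add: taskpass_def taskstep_def)
  qed
  then show ?thesis using s by (simp add: tinv_def)
qed

lemma tinv_tasksize: "tinv R C ts \<Longrightarrow> tasksize ts \<le> 3 * R + C + 1"
proof -
  assume t: "tinv R C ts"
  have ts: "tasksize ts = (\<Sum>(rws, cls)\<leftarrow>ts. length rws) + (\<Sum>(rws, cls)\<leftarrow>ts. length cls) + length ts"
    by (induction ts) (auto simp: tasksize_def)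
  have "length ts \<le> R \<or> length ts = 1"
  proof (cases "\<forall>t\<in>set ts. fst t \<noteq> []")
    case True
    then have "length ts \<le> (\<Sum>(rws, cls)\<leftarrow>ts. length rws)"
    proof (induction ts)
      case (Cons a ts)
      then have "1 \<le> length (fst a)" by (cases "fst a") auto
      then show ?case using Cons by (simp add: split_def)
    qed simp
    then show ?thesis using t by (simp add: tinv_def)
  qed (use t in \<open>auto simp: tinv_def\<close>)
  then show ?thesis using t ts by (auto simp: tinv_def)
qed

lemma tinv_init: "tinv (length rws) (length cls) [(rws, cls)]"
  by (auto simp: tinv_def)

lemma tinv_passes: "tinv R C ts \<Longrightarrow> tinv R C ((taskpass ^^ k) ts)"
  by (induction k) (auto simp: tinv_taskpass)

lemma ct_rowmin:
  "ct rowminE [vl rws, vl cls] \<le> 3000 * (length rws + length cls + 1) * (lg (length rws) + 1)"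
proof -
  let ?b = "call1 taskpassE (Var 3)"
  define M where "M = length rws + length cls + 1"
  define \<Phi> where "\<Phi> r p = 2500 * M * length r" for r :: "val list" and p :: "task list"
  define us where "us = replicate (lg (length rws)) (NumV 0)"
  have step: "ev ?b ([vl rws, vl cls] @ [CellV x (vl (map (\<lambda>x. x) r)), vlt a]) = vlt (taskpass a) \<and>
      tinv (length rws) (length cls) (taskpass a) \<and>
      1 + ct ?b ([vl rws, vl cls] @ [CellV x (vl (map (\<lambda>x. x) r)), vlt a]) + \<Phi> r (taskpass a) \<le> \<Phi> (x # r) a"
    if t: "tinv (length rws) (length cls) a" for x r a
  proof -
    have "ct taskpassE [vlt a] \<le> 600 * (tasksize a + 1)" by (rule ct_taskpass)
    also have "\<dots> \<le> 600 * (3 * length rws + length cls + 1 + 1)"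
      using tinv_tasksize[OF t] by (intro mult_le_mono2) simp
    also have "\<dots> \<le> 2400 * M" by (simp add: M_def)
    finally have "4 + ct taskpassE [vlt a] \<le> 2500 * M" by (simp add: M_def)
    then show ?thesis using tinv_taskpass[OF t] by (simp add: \<Phi>_def algebra_simps)
  qed
  have l: "ev (call1 lgE (Var 0)) [vl rws, vl cls] = vl (map (\<lambda>x. x) us)" by (simp add: us_def)
  have "ct rowminE [vl rws, vl cls] \<le> 1 + ct (call1 lgE (Var 0)) [vl rws, vl cls] + 5 + \<Phi> us [(rws, cls)]"
    using ct_fold_potential[where I = "\<lambda>r. tinv (length rws) (length cls)" and b = ?b and \<rho> = "[vl rws, vl cls]" and
        g = "\<lambda>x. x" and E = vlt and h = "\<lambda>x. taskpass" and \<Phi> = \<Phi> and xs = us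
        and a = "[(rws, cls)]" and l = "call1 lgE (Var 0)" and i = "Cell (Cell (Var 0) (Var 1)) (Num 0)", OF step tinv_init l]
    by (simp add: rowminE_def)
  also have "\<dots> \<le> 1 + (3 + 100 * (length rws + 1)) + 5 + 2500 * M * lg (length rws)"
    using ct_lg[of rws] by (intro add_mono) (simp_all add: \<Phi>_def us_def)
  also have "\<dots> \<le> 500 * M + 2500 * M * lg (length rws)" by (intro add_mono) (simp_all add: M_def)
  also have "\<dots> \<le> 3000 * M * (lg (length rws) + 1)" by (simp add: algebra_simps)
  finally show ?thesis unfolding M_def .
qed

lemma tasksize_rowmin: "tasksize (rowmin rws cls) \<le> 3 * length rws + length cls + 1"
  unfolding rowmin_def by (intro tinv_tasksize tinv_passes tinv_init)

subsection \<open>Minimizers of the rows\<close>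

text \<open>All minimizers are kept, not just one. If a column tied for the minimum survived the
  round, the removed columns need not include a strictly closer one, and the count behind the 17
  rounds would fail.\<close>

definition amstep :: "val \<Rightarrow> val \<Rightarrow> val list \<Rightarrow> val list" where
  "amstep p x s = (case s of [] \<Rightarrow> [x] | y # _ \<Rightarrow>
     if sqd p x < sqd p y then [x] else if sqd p y < sqd p x then s else x # s)"

definition amin :: "val \<Rightarrow> val list \<Rightarrow> val list" where
  "amin p cls = fold (amstep p) cls []"

definition aminE :: exp where
  "aminE = Fold (Var 1) (Num 0)
     (let x = Lft (Var 2) in IfCell (Var 3)
       (IfLess (call2 sqdE (Var 0) x) (call2 sqdE (Var 0) (Lft (Var 3))) (Cell x (Num 0))
         (IfLess (call2 sqdE (Var 0) (Lft (Var 3))) (call2 sqdE (Var 0) x) (Var 3) (Cell x (Var 3))))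
       (Cell x (Num 0)))"

lemma ev_amin [simp]: "ev aminE [p, vl cls] = vl (amin p cls)"
  using lfold_sim[where E = vl and h = "amstep p" and s = "[]" and xs = cls]
  by (simp add: aminE_def amin_def amstep_def Let_def split: list.split cong: if_cong)

lemma ct_amin: "ct aminE [p, vl cls] \<le> 200 * (length cls + 1)"
  using ct_fold_loopfree[of "Var 1" "[p, vl cls]" cls "(let x = Lft (Var 2) in IfCell (Var 3)
       (IfLess (call2 sqdE (Var 0) x) (call2 sqdE (Var 0) (Lft (Var 3))) (Cell x (Num 0))
         (IfLess (call2 sqdE (Var 0) (Lft (Var 3))) (call2 sqdE (Var 0) x) (Var 3) (Cell x (Var 3))))
       (Cell x (Num 0)))" 200 "Num 0"]
  by (simp add: aminE_def Let_def)

lemma amin_spec: "rev (amin p cls) = filter (\<lambda>x. \<forall>y\<in>set cls. sqd p x \<le> sqd p y) cls"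
proof (induction cls rule: rev_induct)
  case (snoc x xs)
  show ?case
  proof (cases "amin p xs")
    case Nil
    have "xs = []"
    proof (rule ccontr)
      assume "xs \<noteq> []"
      then obtain z where "z \<in> set xs" "\<forall>y\<in>set xs. sqd p z \<le> sqd p y"
        using ex_min_if_finite[of "sqd p ` set xs"] by (force simp: not_less)
      moreover have "filter (\<lambda>x. \<forall>y\<in>set xs. sqd p x \<le> sqd p y) xs = []" using snoc Nil by simp
      ultimately show False unfolding filter_empty_conv by blast
    qed
    then show ?thesis by (simp add: amin_def amstep_def)
  next
    case (Cons z zs)
    then have "z \<in> set (filter (\<lambda>x. \<forall>y\<in>set xs. sqd p x \<le> sqd p y) xs)" using snoc by (metis list.set_intros(1) set_rev)
    then have z: "z \<in> set xs" "\<forall>y\<in>set xs. sqd p z \<le> sqd p y" by auto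
    have a: "amin p (xs @ [x]) = amstep p x (z # zs)" by (simp add: amin_def Cons[unfolded amin_def])
    consider "sqd p x < sqd p z" | "sqd p z < sqd p x" | "sqd p x = sqd p z" by linarith
    then show ?thesis
    proof cases
      case 1
      then have "filter (\<lambda>u. (\<forall>y\<in>set xs. sqd p u \<le> sqd p y) \<and> sqd p u \<le> sqd p x) xs = []"
        using z by (auto simp: filter_empty_conv not_le intro: le_less_trans)
      moreover have "\<forall>y\<in>set xs. sqd p x \<le> sqd p y" using 1 z by (auto intro: less_imp_le order_trans)
      ultimately show ?thesis using 1 by (simp add: a amstep_def conj_commute)
    next
      case 2
      then have "filter (\<lambda>u. (\<forall>y\<in>set xs. sqd p u \<le> sqd p y) \<and> sqd p u \<le> sqd p x) xs =
          filter (\<lambda>u. \<forall>y\<in>set xs. sqd p u \<le> sqd p y) xs"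
        using z by (intro filter_cong) (auto intro: less_imp_le order_trans)
      moreover have "\<not> (\<forall>y\<in>set xs. sqd p x \<le> sqd p y)" using 2 z by (auto simp: not_le)
      ultimately show ?thesis using 2 snoc Cons by (auto simp: a amstep_def conj_commute)
    next
      case 3
      then have "filter (\<lambda>u. (\<forall>y\<in>set xs. sqd p u \<le> sqd p y) \<and> sqd p u \<le> sqd p x) xs =
          filter (\<lambda>u. \<forall>y\<in>set xs. sqd p u \<le> sqd p y) xs"
        using z by (intro filter_cong) auto
      moreover have "\<forall>y\<in>set xs. sqd p x \<le> sqd p y" using 3 z by auto
      ultimately show ?thesis using 3 snoc Cons by (auto simp: a amstep_def conj_commute)
    qed
  qed
qed (simp add: amin_def)

lemma length_amin: "length (amin p cls) \<le> length cls"
  using arg_cong[OF amin_spec[of p cls], of length] length_filter_le[of _ cls] by simp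

type_synonym block = "val \<times> val list"

fun encb :: "block \<Rightarrow> val" where
  "encb (p, b) = CellV p (vl b)"

abbreviation vlb :: "block list \<Rightarrow> val" where "vlb bs \<equiv> vl (map encb bs)"

definition blocksize :: "block list \<Rightarrow> nat" where
  "blocksize bs = (\<Sum>(p, b)\<leftarrow>bs. length b + 1)"

definition leafstep :: "task \<Rightarrow> block list \<Rightarrow> block list" where
  "leafstep = (\<lambda>(rws, cls) s. case rws of [] \<Rightarrow> s | p # _ \<Rightarrow> (p, amin p cls) # s)"

definition leaves :: "task list \<Rightarrow> block list" where
  "leaves ts = fold leafstep ts []"

definition leafstepE :: exp where
  "leafstepE = IfCell (Lft (Lft (Var 1))) (Cell (Cell (Lft (Lft (Lft (Var 1))))
     (call2 aminE (Lft (Lft (Lft (Var 1)))) (Rgt (Lft (Var 1))))) (Var 2)) (Var 2)"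

definition leavesE :: exp where
  "leavesE = Fold (Var 0) (Num 0) leafstepE"

lemma ev_leafstep: "ev leafstepE [q, CellV (enc2 t) r, vlb s] = vlb (leafstep t s)"
  by (cases t) (simp add: leafstepE_def leafstep_def split: list.split)

lemma ev_leaves [simp]: "ev leavesE [vlt ts] = vlb (leaves ts)"
  using lfold_sim_map[where g = enc2 and E = vlb and h = leafstep and s = "[]" and xs = ts]
  by (simp add: ev_leafstep leavesE_def leaves_def)

lemma ct_leaves: "ct leavesE [vlt ts] \<le> 300 * (tasksize ts + 1)"
proof -
  have c: "ct leafstepE [q, CellV (enc2 t) r, s] \<le> 240 * (length (snd t) + 1)" for q t r s
  proof (cases "fst t")
    case Nil
    then show ?thesis by (cases t) (simp add: leafstepE_def)
  next
    case (Cons p ps)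
    then show ?thesis using ct_amin[of p "snd t"] by (cases t) (simp add: leafstepE_def)
  qed
  have step: "ev leafstepE ([vlt ts] @ [CellV (enc2 x) (vlt r), vlb a]) = vlb (leafstep x a) \<and> True \<and>
      1 + ct leafstepE ([vlt ts] @ [CellV (enc2 x) (vlt r), vlb a]) + 250 * tasksize r \<le> 250 * tasksize (x # r)" for x r a
    using c[of "vlt ts" x "vlt r" "vlb a"] ev_leafstep[of "vlt ts" x] by (simp add: tasksize_def split_def)
  show ?thesis
    using ct_fold_potential[where I = "\<lambda>r a. True" and b = leafstepE and \<rho> = "[vlt ts]" and g = enc2 and E = vlb
       and h = leafstep and \<Phi> = "\<lambda>r a. 250 * tasksize r" and xs = ts and a = "[]" and l = "Var 0" and i = "Num 0",
       OF step] by (simp add: leavesE_def)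
qed

lemma blocksize_leaves: "blocksize (leaves ts) \<le> tasksize ts"
proof -
  have "blocksize (fold leafstep ts s) \<le> tasksize ts + blocksize s" for s
  proof (induction ts arbitrary: s)
    case (Cons t ts)
    obtain rws cls where t: "t = (rws, cls)" by (cases t)
    have "blocksize (leafstep t s) \<le> length cls + 1 + blocksize s"
      using length_amin[of "hd rws" cls] by (auto simp: leafstep_def blocksize_def t split: list.split)
    then show ?case using Cons[of "leafstep t s"] by (simp add: tasksize_def t)
  qed (simp add: tasksize_def)
  from this[of "[]"] show ?thesis by (simp add: leaves_def blocksize_def)
qed

text \<open>\<open>leaves\<close> lists the rows backwards, with their minima in descending order.
  Reversing both gives the sweep in the opposite direction, so that each row meets the minima of the
  rows on either side.\<close>

definition flips :: "block list \<Rightarrow> block list" where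
  "flips bs = rev (map (\<lambda>(p, b). (p, rev b)) bs)"

definition flipE :: exp where
  "flipE = Fold (Var 0) (Num 0) (Cell (Cell (Lft (Lft (Var 1))) (call1 revE (Rgt (Lft (Var 1))))) (Var 2))"

lemma fold_flip: "fold (\<lambda>x s. (case x of (p, b) \<Rightarrow> (p, rev b)) # s) bs s = flips bs @ s"
  by (induction bs arbitrary: s) (auto simp: flips_def)

lemma ev_flip [simp]: "ev flipE [vlb bs] = vlb (flips bs)"
  using lfold_sim_map[where g = encb and E = vlb and h = "\<lambda>x s. (case x of (p, b) \<Rightarrow> (p, rev b)) # s" and s = "[]" and xs = bs]
  by (simp add: flipE_def fold_flip split: prod.split)


lemma ct_flip: "ct flipE [vlb bs] \<le> 40 * (blocksize bs + 1)"
proof -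
  let ?b = "Cell (Cell (Lft (Lft (Var 1))) (call1 revE (Rgt (Lft (Var 1))))) (Var 2)"
  define h where "h = (\<lambda>x s. (case x of (p, b) \<Rightarrow> (p, rev b)) # s :: block list)"
  have step: "ev ?b ([vlb bs] @ [CellV (encb x) (vlb r), vlb a]) = vlb (h x a) \<and> True \<and>
      1 + ct ?b ([vlb bs] @ [CellV (encb x) (vlb r), vlb a]) + 30 * blocksize r \<le> 30 * blocksize (x # r)" for x r a
    using ct_rev[of "snd x"] by (cases x) (simp add: blocksize_def h_def)
  show ?thesis
    using ct_fold_potential[where I = "\<lambda>r a. True" and b = ?b and \<rho> = "[vlb bs]" and g = encb and E = vlb
       and h = h and \<Phi> = "\<lambda>r a. 30 * blocksize r" and xs = bs and a = "[]" and l = "Var 0" and i = "Num 0",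
       OF step] by (simp add: flipE_def)
qed

lemma blocksize_flips: "blocksize (flips bs) = blocksize bs"
  unfolding blocksize_def flips_def sum_list_rev_pairs by (simp add: comp_def split_def)

subsection \<open>Windows around the minimizers\<close>

primrec unitsE :: "nat \<Rightarrow> exp" where
  "unitsE 0 = Num 0"
| "unitsE (Suc k) = Cell (Num 0) (unitsE k)"

lemma ev_units [simp]: "ev (unitsE k) \<rho> = units k"
  by (induction k arbitrary: \<rho>) auto

lemma ct_units: "ct (unitsE k) \<rho> = 2 * k + 1"
  by (induction k arbitrary: \<rho>) auto

definition takestep :: "val \<Rightarrow> val list \<times> val list \<Rightarrow> val list \<times> val list" where
  "takestep p = (\<lambda>(acc, out). case acc of [] \<Rightarrow> ([], out) | c # cs \<Rightarrow> (cs, CellV p c # out))"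

definition takeE :: exp where
  "takeE = Rgt (Fold (unitsE 17) (Cell (Var 1) (Var 2))
     (IfCell (Lft (Var 4)) (Cell (Rgt (Lft (Var 4))) (Cell (Cell (Var 0) (Lft (Lft (Var 4)))) (Rgt (Var 4)))) (Var 4)))"

lemma takestep_funpow: "(takestep p ^^ k) (acc, out) = (drop k acc, rev (map (CellV p) (take k acc)) @ out)"
proof (induction k arbitrary: acc out)
  case (Suc k)
  then show ?case by (cases acc) (simp_all add: takestep_def funpow_Suc_right del: funpow.simps)
qed simp

lemma ev_take [simp]: "ev takeE [p, vl acc, vl out] = vl (rev (map (CellV p) (take 17 acc)) @ out)"
proof -
  let ?b = "IfCell (Lft (Var 4)) (Cell (Rgt (Lft (Var 4))) (Cell (Cell (Var 0) (Lft (Lft (Var 4)))) (Rgt (Var 4)))) (Var 4)"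
  have "ev ?b [p, vl acc, vl out, r, enc2 s] = enc2 (takestep p s)" for r s
    by (cases s) (simp add: takestep_def split: list.split)
  from lfold_funpow[of "\<lambda>r s. ev ?b [p, vl acc, vl out, r, s]" enc2 "takestep p" "replicate 17 (NumV 0)" "(acc, out)", OF this]
  have "ev (Fold (unitsE 17) (Cell (Var 1) (Var 2)) ?b) [p, vl acc, vl out] = enc2 ((takestep p ^^ 17) (acc, out))"
    by (simp del: ev.simps(9))
  then show ?thesis unfolding takeE_def ev.simps(8) takestep_funpow by simp
qed

lemma ct_take: "ct takeE [p, acc, out] \<le> 1000"
proof -
  let ?b = "IfCell (Lft (Var 4)) (Cell (Rgt (Lft (Var 4))) (Cell (Cell (Var 0) (Lft (Lft (Var 4)))) (Rgt (Var 4)))) (Var 4)"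
  show ?thesis
    using ct_fold_loopfree[of "unitsE 17" "[p, acc, out]" "replicate 17 (NumV 0)" ?b 40 "Cell (Var 1) (Var 2)"]
    by (simp add: takeE_def ct_units)
qed

definition pairsE :: exp where
  "pairsE = Fold (Var 1) (Var 2) (Cell (Cell (Var 0) (Lft (Var 3))) (Var 4))"

lemma ev_pairs [simp]: "ev pairsE [p, vl b, vl out] = vl (rev (map (CellV p) b) @ out)"
  using lfold_Cons[where f = "\<lambda>r s. CellV (CellV p (lft r)) s" and g = "CellV p" and xs = b and ys = out]
  by (simp add: pairsE_def)

lemma ct_pairs: "ct pairsE [p, vl b, out] \<le> 20 * (length b + 1)"
  using ct_fold_loopfree[of "Var 1" "[p, vl b, out]" b "Cell (Cell (Var 0) (Lft (Var 3))) (Var 4)" 20 "Var 2"]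
  by (simp add: pairsE_def)

text \<open>By total monotonicity the minima of a row can repeat only the column on top of the
  stack, so a comparison with the top is enough to avoid repetitions.\<close>

definition pushstep :: "val \<Rightarrow> val list \<Rightarrow> val list" where
  "pushstep x s = (case s of [] \<Rightarrow> [x] | y # _ \<Rightarrow> if key3 x = key3 y then s else x # s)"

definition pushE :: exp where
  "pushE = Fold (Var 0) (Var 1) (IfCell (Var 3)
     (ifSame (Lft (Var 2)) (Lft (Var 3)) (Var 3) (Cell (Lft (Var 2)) (Var 3))) (Cell (Lft (Var 2)) (Var 3)))"

lemma ev_push [simp]: "ev pushE [vl b, vl acc] = vl (fold pushstep b acc)"
  using lfold_sim[where E = vl and h = pushstep and s = acc and xs = b]
  by (simp add: pushE_def pushstep_def ev_ifSame split: list.split)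

lemma ct_push: "ct pushE [vl b, acc] \<le> 100 * (length b + 1)"
  using ct_fold_loopfree[of "Var 0" "[vl b, acc]" b "IfCell (Var 3)
     (ifSame (Lft (Var 2)) (Lft (Var 3)) (Var 3) (Cell (Lft (Var 2)) (Var 3))) (Cell (Lft (Var 2)) (Var 3))" 70 "Var 1"]
  by (simp add: pushE_def ifSame_def)

text \<open>The window is cut from the stack before the minima of the row itself are pushed. Those
  are all paired with the row anyway, so the 17 places go to columns of rows visited before.\<close>

definition winstep :: "block \<Rightarrow> val list \<times> val list \<Rightarrow> val list \<times> val list" where
  "winstep = (\<lambda>(p, b) (acc, out). (fold pushstep b acc,
     rev (map (CellV p) b) @ rev (map (CellV p) (take 17 acc)) @ out))"

definition winE :: exp where
  "winE = Fold (Var 0) (Cell (Num 0) (Var 1))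
     (Cell (call2 pushE (Rgt (Lft (Var 2))) (Lft (Var 3)))
       (call3 pairsE (Lft (Lft (Var 2))) (Rgt (Lft (Var 2)))
         (call3 takeE (Lft (Lft (Var 2))) (Lft (Var 3)) (Rgt (Var 3)))))"

lemma ev_winstep: "ev (Cell (call2 pushE (Rgt (Lft (Var 2))) (Lft (Var 3)))
       (call3 pairsE (Lft (Lft (Var 2))) (Rgt (Lft (Var 2)))
         (call3 takeE (Lft (Lft (Var 2))) (Lft (Var 3)) (Rgt (Var 3))))) [q, t, CellV (encb x) r, enc2 s] = enc2 (winstep x s)"
  by (cases x; cases s) (simp add: winstep_def)

lemma ev_win [simp]: "ev winE [vlb bs, vl out] = enc2 (fold winstep bs ([], out))"
  using lfold_sim_map[where g = encb and E = enc2 and h = winstep and s = "([], out)" and xs = bs, OF ev_winstep]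
  by (simp add: winE_def)

lemma ct_win: "ct winE [vlb bs, vl out] \<le> 1500 * (blocksize bs + 1)"
proof -
  let ?b = "Cell (call2 pushE (Rgt (Lft (Var 2))) (Lft (Var 3)))
       (call3 pairsE (Lft (Lft (Var 2))) (Rgt (Lft (Var 2)))
         (call3 takeE (Lft (Lft (Var 2))) (Lft (Var 3)) (Rgt (Var 3))))"
  have step: "ev ?b ([vlb bs, vl out] @ [CellV (encb x) (vlb r), enc2 a]) = enc2 (winstep x a) \<and> True \<and>
      1 + ct ?b ([vlb bs, vl out] @ [CellV (encb x) (vlb r), enc2 a]) + 1400 * blocksize r \<le> 1400 * blocksize (x # r)" for x r a
  proof -
    obtain p b where x: "x = (p, b)" by (cases x)
    have "ct ?b [vlb bs, vl out, CellV (encb x) (vlb r), enc2 a] \<le> 50 + ct pushE [vl b, vl (fst a)] +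
       ct takeE [p, vl (fst a), vl (snd a)] + ct pairsE [p, vl b, vl (rev (map (CellV p) (take 17 (fst a))) @ snd a)]"
      by (simp add: x enc2_eq)
    also have "\<dots> \<le> 50 + 100 * (length b + 1) + 1000 + 20 * (length b + 1)"
      by (intro add_mono ct_push ct_take ct_pairs order_refl)
    finally show ?thesis using ev_winstep[of "vlb bs" "vl out" x "vlb r" a] by (simp add: blocksize_def x)
  qed
  show ?thesis
    using ct_fold_potential[where I = "\<lambda>r a. True" and b = ?b and \<rho> = "[vlb bs, vl out]" and g = encb and E = enc2
       and h = winstep and \<Phi> = "\<lambda>r a. 1400 * blocksize r" and xs = bs and a = "([], out)" and l = "Var 0"
       and i = "Cell (Num 0) (Var 1)", OF step] by (simp add: winE_def)
qed

subsection \<open>The complete bipartite case\<close>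

definition leaves_of :: "val list \<Rightarrow> val list \<Rightarrow> block list" where
  "leaves_of rws B = leaves (rowmin rws (mins B))"

definition roundf :: "val list \<Rightarrow> val list \<times> val list \<Rightarrow> val list \<times> val list" where
  "roundf rws = (\<lambda>(B, out). let lv = leaves_of rws B; w = fold winstep (flips lv) ([], out) in
     (removes (rev (fst w)) B, snd (fold winstep lv ([], snd w))))"

definition roundE :: exp where
  "roundE = Bind (call1 minE (Var 1))
     (Bind (call1 leavesE (call2 rowminE (Var 0) (Var 3)))
     (Bind (call2 winE (call1 flipE (Var 4)) (Var 2))
     (Bind (call2 winE (Var 4) (Rgt (Var 5)))
     (Cell (call2 removeE (call1 revE (Lft (Var 5))) (Var 1)) (Rgt (Var 6))))))"

lemma ev_round: "ev roundE [vl rws, vl B, vl out] = enc2 (roundf rws (B, out))"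
  by (simp add: roundE_def roundf_def leaves_of_def enc2_eq Let_def)

lemma length_roundf: "length (fst (roundf rws s)) \<le> length (fst s)"
  by (cases s) (simp add: roundf_def Let_def length_removes)

lemma length_win_acc: "length (fst (fold winstep bs s)) \<le> blocksize bs + length (fst s)"
proof (induction bs arbitrary: s)
  case (Cons x bs)
  obtain p b acc out where xs: "x = (p, b)" "s = (acc, out)" by (cases x; cases s)
  have "length (fold pushstep b acc) \<le> length b + length acc"
    by (rule measure_fold) (simp add: pushstep_def split: list.split)
  then show ?case using Cons[of "winstep x s"] by (simp add: xs winstep_def blocksize_def)
qed simp

lemma ct_round:
  "ct roundE [vl rws, vl B, vl out] \<le> 30000 * (length rws + length B + 1) * (lg (length rws) + 1)"
proof -
  define C where "C = mins B"
  define ts where "ts = rowmin rws C"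
  define lv where "lv = leaves ts"
  define w where "w = fold winstep (flips lv) ([], out)"
  define M where "M = length rws + length B + 1"
  have C: "length C \<le> length B" by (simp add: C_def length_mins)
  have ts: "tasksize ts + 1 \<le> 4 * M" using tasksize_rowmin[of rws C] C by (simp add: M_def ts_def)
  then have lv: "blocksize lv + 1 \<le> 4 * M" using blocksize_leaves[of ts] by (simp add: lv_def)
  have acc: "length (fst w) + 1 \<le> 4 * M"
    using length_win_acc[of "flips lv" "([], out)"] lv by (simp add: w_def blocksize_flips)
  have "ct roundE [vl rws, vl B, vl out] \<le> 60 + ct minE [vl B] + ct rowminE [vl rws, vl C] + ct leavesE [vlt ts] +
     ct flipE [vlb lv] + ct winE [vlb (flips lv), vl out] + ct winE [vlb lv, vl (snd w)] + ct revE [vl (fst w)] +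
     ct removeE [vl (rev (fst w)), vl B]"
    by (simp add: roundE_def enc2_eq C_def ts_def lv_def w_def)
  also have "\<dots> \<le> 60 + 100 * (length B + 1) + 3000 * (length rws + length C + 1) * (lg (length rws) + 1) +
     300 * (tasksize ts + 1) + 40 * (blocksize lv + 1) + 1500 * (blocksize (flips lv) + 1) + 1500 * (blocksize lv + 1) +
     10 * (length (fst w) + 1) + 100 * (length B + 1)"
    by (intro add_mono ct_min ct_rowmin ct_leaves ct_flip ct_win ct_rev ct_remove order_refl)
  also have "\<dots> \<le> 60 * M + 100 * M + 3000 * M * (lg (length rws) + 1) + 300 * (4 * M) + 40 * (4 * M) + 1500 * (4 * M) +
     1500 * (4 * M) + 10 * (4 * M) + 100 * M"
    using ts lv acc C by (intro add_mono mult_le_mono order_refl) (simp_all add: M_def blocksize_flips)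
  also have "\<dots> \<le> 30000 * M * (lg (length rws) + 1)" by (simp add: algebra_simps)
  finally show ?thesis unfolding M_def .
qed

definition rounds :: "val list \<Rightarrow> val list \<Rightarrow> val list \<Rightarrow> val list" where
  "rounds rws B out = snd ((roundf rws ^^ 17) (B, out))"

definition roundsE :: exp where
  "roundsE = Rgt (Fold (unitsE 17) (Cell (Var 1) (Var 2)) (call3 roundE (Var 0) (Lft (Var 4)) (Rgt (Var 4))))"

lemma ev_rounds_step: "ev (call3 roundE (Var 0) (Lft (Var 4)) (Rgt (Var 4))) [vl rws, p, q, r, enc2 s] = enc2 (roundf rws s)"
  using ev_round[of rws "fst s" "snd s"] by (simp add: enc2_eq)

lemma ev_rounds [simp]: "ev roundsE [vl rws, vl B, vl out] = vl (rounds rws B out)"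
proof -
  have "ev (Fold (unitsE 17) (Cell (Var 1) (Var 2)) (call3 roundE (Var 0) (Lft (Var 4)) (Rgt (Var 4)))) [vl rws, vl B, vl out]
      = enc2 ((roundf rws ^^ 17) (B, out))"
    using lfold_funpow[of "\<lambda>r s. ev (call3 roundE (Var 0) (Lft (Var 4)) (Rgt (Var 4))) [vl rws, vl B, vl out, r, s]"
      enc2 "roundf rws" "replicate 17 (NumV 0)" "(B, out)", OF ev_rounds_step] by simp
  then show ?thesis unfolding roundsE_def rounds_def ev.simps(8) by (simp add: enc2_eq)
qed

lemma ct_rounds:
  "ct roundsE [vl rws, vl B, vl out] \<le> 600000 * (length rws + length B + 1) * (lg (length rws) + 1)"
proof -
  let ?b = "call3 roundE (Var 0) (Lft (Var 4)) (Rgt (Var 4))"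
  define K where "K = 30000 * (length rws + length B + 1) * (lg (length rws) + 1)"
  define us where "us = replicate 17 (NumV 0)"
  have step: "ev ?b ([vl rws, vl B, vl out] @ [CellV x (vl (map (\<lambda>x. x) r)), enc2 a]) = enc2 (roundf rws a) \<and>
      length (fst (roundf rws a)) \<le> length B \<and>
      1 + ct ?b ([vl rws, vl B, vl out] @ [CellV x (vl (map (\<lambda>x. x) r)), enc2 a]) + (K + 20) * length r \<le> (K + 20) * length (x # r)"
    if t: "length (fst a) \<le> length B" for x r a
  proof -
    have "ct roundE [vl rws, vl (fst a), vl (snd a)] \<le> 30000 * (length rws + length (fst a) + 1) * (lg (length rws) + 1)"
      by (rule ct_round)
    also have "\<dots> \<le> K" unfolding K_def using t by (intro mult_le_mono) auto
    finally show ?thesis using ev_rounds_step[of rws "vl B" "vl out" "CellV x (vl r)" a] length_roundf[of rws a] t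
      by (simp add: enc2_eq)
  qed
  have l: "ev (unitsE 17) [vl rws, vl B, vl out] = vl (map (\<lambda>x. x) us)" unfolding us_def by simp
  have "ct (Fold (unitsE 17) (Cell (Var 1) (Var 2)) ?b) [vl rws, vl B, vl out] \<le> 1 + 35 + 3 + (K + 20) * length us"
    using ct_fold_potential[where I = "\<lambda>r a. length (fst a) \<le> length B" and b = ?b and \<rho> = "[vl rws, vl B, vl out]" and
        g = "\<lambda>x. x" and E = enc2 and h = "\<lambda>x. roundf rws" and \<Phi> = "\<lambda>r a. (K + 20) * length r" and xs = us
        and a = "(B, out)" and l = "unitsE 17" and i = "Cell (Var 1) (Var 2)", OF step _ l]
    by (simp add: ct_units)
  then have "ct roundsE [vl rws, vl B, vl out] \<le> 40 + (K + 20) * 17" by (simp add: roundsE_def us_def)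
  also have "\<dots> \<le> 20 * K" by (simp add: K_def)
  finally show ?thesis unfolding K_def by (simp add: algebra_simps)
qed

definition nodestep :: "val list \<Rightarrow> val list \<times> val list \<Rightarrow> val list \<times> val list" where
  "nodestep B = (\<lambda>(A, out). (removes (maxs A) A, rounds (maxs A) B out))"

definition nodef :: "val list \<Rightarrow> val list \<Rightarrow> val list \<Rightarrow> val list" where
  "nodef A B out = snd ((nodestep B ^^ 17) (A, out))"

definition nodestepE :: exp where
  "nodestepE = Bind (call1 maxE (Lft (Var 4)))
     (Cell (call2 removeE (Var 5) (Lft (Var 4))) (call3 roundsE (Var 5) (Var 1) (Rgt (Var 4))))"

definition nodeE :: exp where
  "nodeE = Rgt (Fold (unitsE 17) (Cell (Var 0) (Var 2)) nodestepE)"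

lemma ev_nodestep: "ev nodestepE [p, vl B, q, r, enc2 s] = enc2 (nodestep B s)"
  by (cases s) (simp add: nodestepE_def nodestep_def)

lemma ev_node [simp]: "ev nodeE [vl A, vl B, vl out] = vl (nodef A B out)"
proof -
  have "ev (Fold (unitsE 17) (Cell (Var 0) (Var 2)) nodestepE) [vl A, vl B, vl out] = enc2 ((nodestep B ^^ 17) (A, out))"
    using lfold_funpow[of "\<lambda>r s. ev nodestepE [vl A, vl B, vl out, r, s]" enc2 "nodestep B" "replicate 17 (NumV 0)" "(A, out)",
       OF ev_nodestep] by simp
  then show ?thesis unfolding nodeE_def nodef_def ev.simps(8) by (simp add: enc2_eq)
qed

lemma ct_node:
  "ct nodeE [vl A, vl B, vl out] \<le> 20000000 * (length A + length B + 1) * (lg (length A) + 1)"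
proof -
  define K where "K = 700000 * (length A + length B + 1) * (lg (length A) + 1)"
  define us where "us = replicate 17 (NumV 0)"
  have step: "ev nodestepE ([vl A, vl B, vl out] @ [CellV x (vl (map (\<lambda>x. x) r)), enc2 a]) = enc2 (nodestep B a) \<and>
      length (fst (nodestep B a)) \<le> length A \<and>
      1 + ct nodestepE ([vl A, vl B, vl out] @ [CellV x (vl (map (\<lambda>x. x) r)), enc2 a]) + K * length r \<le> K * length (x # r)"
    if t: "length (fst a) \<le> length A" for x r a
  proof -
    obtain A' out' where a: "a = (A', out')" by (cases a)
    have m: "length (maxs A') \<le> length A" using length_maxs[of A'] t a by simp
    have "1 + ct nodestepE [vl A, vl B, vl out, CellV x (vl r), enc2 a] \<le> 60 + ct maxE [vl A'] +
        ct removeE [vl (maxs A'), vl A'] + ct roundsE [vl (maxs A'), vl B, vl out']"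
      by (simp add: nodestepE_def a)
    also have "\<dots> \<le> 60 + 100 * (length A' + 1) + 100 * (length A' + 1) +
        600000 * (length (maxs A') + length B + 1) * (lg (length (maxs A')) + 1)"
      by (intro add_mono ct_max ct_remove ct_rounds order_refl)
    also have "\<dots> \<le> 260 * ((length A + length B + 1) * (lg (length A) + 1)) +
        600000 * (length A + length B + 1) * (lg (length A) + 1)"
      using t a m lg_mono[OF m] by (intro add_mono mult_le_mono) auto
    also have "\<dots> \<le> K" unfolding K_def by (simp add: algebra_simps)
    finally show ?thesis using ev_nodestep[of "vl A" B "vl out" "CellV x (vl r)" a] t length_removes[of "maxs A'" A']
      by (simp add: a nodestep_def)
  qed
  have l: "ev (unitsE 17) [vl A, vl B, vl out] = vl (map (\<lambda>x. x) us)" unfolding us_def by simp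
  have "ct (Fold (unitsE 17) (Cell (Var 0) (Var 2)) nodestepE) [vl A, vl B, vl out] \<le> 1 + 35 + 3 + K * length us"
    using ct_fold_potential[where I = "\<lambda>r a. length (fst a) \<le> length A" and b = nodestepE and \<rho> = "[vl A, vl B, vl out]" and
        g = "\<lambda>x. x" and E = enc2 and h = "\<lambda>x. nodestep B" and \<Phi> = "\<lambda>r a. K * length r" and xs = us
        and a = "(A, out)" and l = "unitsE 17" and i = "Cell (Var 0) (Var 2)", OF step _ l]
    by (simp add: ct_units)
  then have "ct nodeE [vl A, vl B, vl out] \<le> 40 + K * 17" by (simp add: nodeE_def us_def)
  also have "\<dots> \<le> 20 * K" by (simp add: K_def)
  also have "\<dots> \<le> 20000000 * (length A + length B + 1) * (lg (length A) + 1)"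
    unfolding K_def by (simp add: algebra_simps)
  finally show ?thesis .
qed


subsection \<open>The number of candidates\<close>

lemma length_win_out: "length (snd (fold winstep bs s)) \<le> length (snd s) + 17 * blocksize bs"
proof (induction bs arbitrary: s)
  case (Cons x bs)
  obtain p b acc out where xs: "x = (p, b)" "s = (acc, out)" by (cases x; cases s)
  show ?case using Cons[of "winstep x s"] by (simp add: xs winstep_def blocksize_def)
qed simp

lemma blocksize_leaves_of: "blocksize (leaves_of rws B) \<le> 3 * (length rws + length B + 1)"
  using blocksize_leaves[of "rowmin rws (mins B)"] tasksize_rowmin[of rws "mins B"] length_mins[of B]
  by (simp add: leaves_of_def)

text \<open>102 = 2 * 17 * 3: two sweeps, at most 17 pairs per unit of block size, and a block size
  of at most three times the rows and points plus one. Below, 1734 = 17 * 102 and 17 * 1734 <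
  30000.\<close>

lemma length_round_out: "length (snd (roundf rws s)) \<le> length (snd s) + 102 * (length rws + length (fst s) + 1)"
proof -
  obtain B out where s: "s = (B, out)" by (cases s)
  define lv where "lv = leaves_of rws B"
  define w where "w = fold winstep (flips lv) ([], out)"
  have "length (snd (roundf rws s)) = length (snd (fold winstep lv ([], snd w)))"
    by (simp add: roundf_def s Let_def lv_def w_def)
  then show ?thesis
    using length_win_out[of lv "([], snd w)"] length_win_out[of "flips lv" "([], out)"] blocksize_leaves_of[of rws B]
    by (simp add: s blocksize_flips flip: lv_def w_def)
qed

lemma length_rounds: "length (rounds rws B out) \<le> length out + 1734 * (length rws + length B + 1)"
proof -
  have "length (snd ((roundf rws ^^ k) s)) \<le> length (snd s) + k * (102 * (length rws + length B + 1))"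
    if "length (fst s) \<le> length B" for k s
    using that
  proof (induction k arbitrary: s)
    case (Suc k)
    have "length (snd ((roundf rws ^^ k) (roundf rws s))) \<le>
       length (snd (roundf rws s)) + k * (102 * (length rws + length B + 1))"
      using Suc.prems length_roundf[of rws s] by (intro Suc.IH) simp
    moreover have "length (snd (roundf rws s)) \<le> length (snd s) + 102 * (length rws + length B + 1)"
      using length_round_out[of rws s] Suc.prems by simp
    ultimately show ?case by (simp add: funpow_Suc_right del: funpow.simps)
  qed simp
  from this[of "(B, out)" 17] show ?thesis by (simp add: rounds_def)
qed

lemma length_nodef: "length (nodef A B out) \<le> length out + 30000 * (length A + length B + 1)"
proof -
  have "length (snd ((nodestep B ^^ k) s)) \<le> length (snd s) + k * (1734 * (length A + length B + 1))"
    if "length (fst s) \<le> length A" for k s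
    using that
  proof (induction k arbitrary: s)
    case (Suc k)
    obtain A' out' where s: "s = (A', out')" by (cases s)
    have "length (snd ((nodestep B ^^ k) (nodestep B s))) \<le>
       length (snd (nodestep B s)) + k * (1734 * (length A + length B + 1))"
      using Suc.prems length_removes[of "maxs A'" A'] by (intro Suc.IH) (simp add: s nodestep_def)
    moreover have "length (snd (nodestep B s)) \<le> length (snd s) + 1734 * (length A + length B + 1)"
      using length_rounds[of "maxs A'" B out'] length_maxs[of A'] Suc.prems by (simp add: s nodestep_def)
    ultimately show ?case by (simp add: funpow_Suc_right del: funpow.simps)
  qed simp
  from this[of "(A, out)" 17] show ?thesis by (simp add: nodef_def)
qed

subsection \<open>Candidates do not depend on the accumulator\<close>

lemma win_acc: "fst (fold winstep bs (acc, out)) = fst (fold winstep bs (acc, []))"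
  "snd (fold winstep bs (acc, out)) = snd (fold winstep bs (acc, [])) @ out"
proof -
  have "fst (fold winstep bs (acc, out @ o')) = fst (fold winstep bs (acc, out)) \<and>
     snd (fold winstep bs (acc, out @ o')) = snd (fold winstep bs (acc, out)) @ o'" for out o'
  proof (induction bs arbitrary: acc out)
    case (Cons x bs)
    obtain p b where x: "x = (p, b)" by (cases x)
    show ?case using Cons[of "fold pushstep b acc" "rev (map (CellV p) b) @ rev (map (CellV p) (take 17 acc)) @ out"]
      by (simp add: x winstep_def)
  qed simp
  from this[of "[]" out] show "fst (fold winstep bs (acc, out)) = fst (fold winstep bs (acc, []))"
    "snd (fold winstep bs (acc, out)) = snd (fold winstep bs (acc, [])) @ out" by simp_all
qed

text \<open>Stages only prepend to their output, so each contribution can be studied from the empty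
  accumulator.\<close>

lemma funpow_acc:
  fixes f :: "'a \<times> 'b list \<Rightarrow> 'a \<times> 'b list"
  assumes "\<And>a out. f (a, out) = (fst (f (a, [])), snd (f (a, [])) @ out)"
  shows "(f ^^ k) (a, out) = (fst ((f ^^ k) (a, [])), snd ((f ^^ k) (a, [])) @ out)"
proof -
  have "fst ((f ^^ k) (a, out @ o')) = fst ((f ^^ k) (a, out)) \<and> snd ((f ^^ k) (a, out @ o')) = snd ((f ^^ k) (a, out)) @ o'" for a out o'
  proof (induction k arbitrary: a out)
    case (Suc k)
    have "f (a, out @ o') = (fst (f (a, out)), snd (f (a, out)) @ o')"
      using assms[of a "out @ o'"] assms[of a out] by simp
    then show ?case using Suc[of "fst (f (a, out))" "snd (f (a, out))"]
      by (simp add: funpow_Suc_right del: funpow.simps)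
  qed simp
  from this[of a "[]" out] show ?thesis by (simp add: prod_eq_iff)
qed

lemma roundf_acc: "roundf rws (B, out) = (fst (roundf rws (B, [])), snd (roundf rws (B, [])) @ out)"
  using win_acc[of "flips (leaves_of rws B)" "[]" out]
    win_acc(2)[of "leaves_of rws B" "[]" "snd (fold winstep (flips (leaves_of rws B)) ([], []))"]
    win_acc(2)[of "leaves_of rws B" "[]" "snd (fold winstep (flips (leaves_of rws B)) ([], [])) @ out"]
  by (simp add: roundf_def Let_def)

lemma rounds_acc: "rounds rws B out = rounds rws B [] @ out"
  unfolding rounds_def by (subst funpow_acc) (auto intro: roundf_acc)

lemma nodef_acc: "nodef A B out = nodef A B [] @ out"
  unfolding nodef_def
proof (subst funpow_acc)
  show "nodestep B (a, out) = (fst (nodestep B (a, [])), snd (nodestep B (a, [])) @ out)" for a out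
    using rounds_acc[of "maxs a" B out] by (simp add: nodestep_def)
qed simp

subsection \<open>Range-tree decomposition\<close>

definition tagged :: "val \<Rightarrow> bool" where "tagged x = is_cell (rgt (rgt (rgt x)))"

definition selE :: "bool \<Rightarrow> exp" where
  "selE b = call1 revE (Fold (Var 0) (Num 0) (let push = Cell (Lft (Var 1)) (Var 2) in
     IfCell (Rgt (Rgt (Rgt (Lft (Var 1))))) (if b then push else Var 2) (if b then Var 2 else push)))"

lemma fold_filter: "fold (\<lambda>x s. if P x then x # s else s) xs s = rev (filter P xs) @ s"
  by (induction xs arbitrary: s) auto

lemma ev_sel_state:
  "ev (Fold (Var 0) (Num 0) (let push = Cell (Lft (Var 1)) (Var 2) in
     IfCell (Rgt (Rgt (Rgt (Lft (Var 1))))) (if b then push else Var 2) (if b then Var 2 else push))) [vl xs] =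
   vl (rev (filter (\<lambda>x. tagged x = b) xs))"
  using lfold_sim[where E = vl and h = "\<lambda>x s. if tagged x = b then x # s else s" and s = "[]" and xs = xs]
  by (simp add: fold_filter tagged_def Let_def)

lemma ev_sel [simp]: "ev (selE b) [vl xs] = vl (filter (\<lambda>x. tagged x = b) xs)"
  unfolding selE_def ev_call ev_sel_state by simp

lemma ct_sel: "ct (selE b) [vl xs] \<le> 50 * (length xs + 1)"
proof -
  define e where "e = (let push = Cell (Lft (Var 1)) (Var 2) in
     IfCell (Rgt (Rgt (Rgt (Lft (Var 1))))) (if b then push else Var 2) (if b then Var 2 else push))"
  have A: "ct (Fold (Var 0) (Num 0) e) [vl xs] \<le> 10 + 30 * length xs"
  proof -
    have "loopfree e" "sz e < 30" by (cases b; simp add: e_def Let_def)+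
    from ct_fold_loopfree[OF _ this, of "Var 0" "[vl xs]" xs "Num 0"] show ?thesis by simp
  qed
  have C: "ct revE [ev (Fold (Var 0) (Num 0) e) [vl xs]] \<le> 10 * (length xs + 1)"
  proof -
    define F where "F = filter (\<lambda>x. tagged x = b) xs"
    have "length F \<le> length xs" by (simp add: F_def)
    then show ?thesis unfolding e_def ev_sel_state F_def[symmetric] using ct_rev[of "rev F"] by simp
  qed
  have "ct (selE b) [vl xs] = 2 + ct (Fold (Var 0) (Num 0) e) [vl xs] + ct revE [ev (Fold (Var 0) (Num 0) e) [vl xs]]"
    by (simp add: selE_def e_def)
  also have "\<dots> \<le> 2 + (10 + 30 * length xs) + 10 * (length xs + 1)" by (intro add_mono A C order_refl)
  finally show ?thesis by simp
qed

text \<open>Block \<open>a\<close> precedes \<open>b\<close> in the inner order, and the tags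
  remember the sides of the outer merge. An untagged point of \<open>a\<close> and a tagged point of
  \<open>b\<close> are ordered the right way in both.\<close>

definition combine2E :: exp where
  "combine2E = Cell (call2 appendE (Var 0) (Var 1)) (call3 nodeE (call1 (selE False) (Var 0)) (call1 (selE True) (Var 1)) (Var 2))"

definition out2 :: "val list \<Rightarrow> val list \<Rightarrow> val list \<Rightarrow> val list" where
  "out2 a b out = nodef (filter (\<lambda>x. tagged x = False) a) (filter (\<lambda>x. tagged x = True) b) out"

interpretation inner: appender combine2E out2 "\<lambda>a b. set (out2 a b [])"
proof unfold_locales
  show "set (out2 a b out) = set (out2 a b []) \<union> set out" for a b out
    unfolding out2_def by (subst nodef_acc) simp
qed (simp_all add: combine2E_def out2_def)

lemma ct_combine2:
  assumes "length a + length b \<le> N"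
  shows "ct combine2E [vl a, vl b, vl out] \<le> 30000000 * (lg N + 1) * (length a + length b + 1)"
proof -
  define A B where "A = filter (\<lambda>x. tagged x = False) a" and "B = filter (\<lambda>x. tagged x = True) b"
  have len: "length A \<le> length a" "length B \<le> length b" by (simp_all add: A_def B_def)
  have l: "lg (length A) \<le> lg N" using len assms by (intro lg_mono) simp
  have "ct combine2E [vl a, vl b, vl out] \<le> 30 + ct appendE [vl a, vl b] + ct (selE False) [vl a] + ct (selE True) [vl b] +
      ct nodeE [vl A, vl B, vl out]"
    by (simp add: combine2E_def A_def B_def)
  also have "\<dots> \<le> 30 + 30 * (length a + 1) + 50 * (length a + 1) + 50 * (length b + 1) +
      20000000 * (length A + length B + 1) * (lg (length A) + 1)"
    by (intro add_mono ct_append ct_sel ct_node order_refl)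
  also have "\<dots> \<le> 200 * ((length a + length b + 1) * (lg N + 1)) + 20000000 * (length a + length b + 1) * (lg N + 1)"
    using len l by (intro add_mono mult_le_mono) (auto simp: algebra_simps)
  also have "\<dots> \<le> 30000000 * (lg N + 1) * (length a + length b + 1)" by (simp add: algebra_simps)
  finally show ?thesis .
qed

lemma length_out2: "length (out2 a b out) \<le> length out + 30000 * (length a + length b + 1)"
proof -
  define A B where "A = filter (\<lambda>x. tagged x = False) a" and "B = filter (\<lambda>x. tagged x = True) b"
  have "length A \<le> length a" "length B \<le> length b" by (simp_all add: A_def B_def)
  then show ?thesis using length_nodef[of A B out] unfolding out2_def A_def[symmetric] B_def[symmetric] by simp
qed

text \<open>With the coordinates exchanged, the same lexicographic sort produces the inner order.
  Dominance and \<open>sqd\<close> are symmetric in the coordinates and hence unaffected. The last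
  component records the side of the outer merge.\<close>

definition retag :: "bool \<Rightarrow> val \<Rightarrow> val" where
  "retag b x = CellV (lft (rgt x)) (CellV (lft x) (CellV (lft (rgt (rgt x)))
     (if b then CellV (NumV 0) (NumV 0) else NumV 0)))"

definition tagE :: "bool \<Rightarrow> exp" where
  "tagE b = Fold (Var 0) (Var 1) (let x = Lft (Var 2) in Cell (Cell (Lft (Rgt x)) (Cell (Lft x) (Cell (Lft (Rgt (Rgt x)))
     (if b then Cell (Num 0) (Num 0) else Num 0)))) (Var 3))"

lemma ev_tag [simp]: "ev (tagE b) [vl xs, vl acc] = vl (rev (map (retag b) xs) @ acc)"
  using lfold_Cons[where g = "retag b" and xs = xs and ys = acc] by (cases b) (simp_all add: tagE_def retag_def Let_def)

lemma ct_tag: "ct (tagE b) [vl xs, acc] \<le> 50 * (length xs + 1)"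
  using ct_fold_loopfree[of "Var 0" "[vl xs, acc]" xs "(let x = Lft (Var 2) in Cell (Cell (Lft (Rgt x)) (Cell (Lft x) (Cell (Lft (Rgt (Rgt x)))
     (if b then Cell (Num 0) (Num 0) else Num 0)))) (Var 3))" 40 "Var 1"]
  by (cases b) (simp_all add: tagE_def Let_def)

definition level2E :: exp where
  "level2E = Rgt (call2 (treeE combine2E) (call1 singlesE (call1 sortE
     (call2 (tagE True) (Var 1) (call2 (tagE False) (Var 0) (Num 0))))) (Var 2))"

definition tagsort :: "val list \<Rightarrow> val list \<Rightarrow> val list" where
  "tagsort L R = srt (rev (map (retag True) R) @ rev (map (retag False) L))"

definition level2 :: "val list \<Rightarrow> val list \<Rightarrow> val list \<Rightarrow> val list" where
  "level2 L R out = snd (inner.tree (singles (tagsort L R)) out)"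

lemma ev_tag_Nil: "ev (tagE b) [vl xs, NumV 0] = vl (rev (map (retag b) xs))"
  using ev_tag[of b xs "[]"] by (simp del: ev_tag)

lemma ev_level2 [simp]: "ev level2E [vl L, vl R, vl out] = vl (level2 L R out)"
  by (simp add: level2E_def level2_def inner.tenc_eq tagsort_def ev_tag_Nil)

lemma length_tagsort: "length (tagsort L R) \<le> length L + length R"
  using length_srt[of "rev (map (retag True) R) @ rev (map (retag False) L)"] by (simp add: tagsort_def)

text \<open>One logarithm counts the inner passes, the other one the passes of \<open>rowmin\<close>
  inside every combination; the outer passes will contribute the third.\<close>

lemma ct_level2:
  "ct level2E [vl L, vl R, vl out] \<le> 100000000 * (length L + length R + 1) * (lg (length L + length R) + 1) ^ 2"
proof -
  define m where "m = length L + length R"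
  define l where "l = lg m + 1"
  define M where "M = (m + 1) * l"
  define X where "X = rev (map (retag True) R) @ rev (map (retag False) L)"
  define S where "S = tagsort L R"
  have X: "length X = m" by (simp add: X_def m_def)
  have S: "length S \<le> m" using length_tagsort[of L R] by (simp add: S_def m_def)
  have l1: "1 \<le> l" by (simp add: l_def)
  have t: "ct (treeE combine2E) [vll (singles S), vl out] \<le>
      (30000000 * (lg m + 1) + 300) * (tlen (singles S) + length (singles S) + 1) * (lg (length (singles S)) + 1)"
    using S by (intro inner.ct_tree[of m, OF ct_combine2]) auto
  also have "\<dots> \<le> (30000300 * l) * (2 * m + 1) * l"
    using S lg_mono[OF S] l1 by (intro mult_le_mono) (auto simp: l_def)
  also have "\<dots> \<le> 60000600 * M * l" by (simp add: M_def algebra_simps)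
  finally have t: "ct (treeE combine2E) [vll (singles S), vl out] \<le> 60000600 * M * l" .
  have "ct level2E [vl L, vl R, vl out] \<le> 40 + ct (tagE False) [vl L, NumV 0] + ct (tagE True) [vl R, vl (rev (map (retag False) L))] +
     ct sortE [vl X] + ct singlesE [vl S] + ct (treeE combine2E) [vll (singles S), vl out]"
    by (simp add: level2E_def ev_tag_Nil X_def S_def tagsort_def)
  also have "\<dots> \<le> 40 + 50 * (length L + 1) + 50 * (length R + 1) + 2000 * (length X + 1) * (lg (length X) + 1) +
     40 * (length S + 1) + 60000600 * M * l"
    by (intro add_mono ct_tag ct_sort ct_singles t order_refl)
  also have "\<dots> \<le> 40 * M + 50 * M + 50 * M + 2000 * M + 40 * M + 60000600 * M * l"
  proof -
    have 1: "m + 1 \<le> M" using mult_le_mono2[OF l1, of "m + 1"] by (simp only: M_def mult_1_right)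
    then have 2: "1 \<le> M" "length L + 1 \<le> M" "length R + 1 \<le> M" "length S + 1 \<le> M" using S by (auto simp: m_def)
    have 3: "2000 * (length X + 1) * (lg (length X) + 1) = 2000 * M" by (simp add: M_def X l_def algebra_simps)
    show ?thesis unfolding 3 using 2 by (intro add_mono order_refl) auto
  qed
  also have "\<dots> \<le> 100000000 * M * l"
  proof -
    have "M \<le> M * l" using l1 by simp
    then show ?thesis by linarith
  qed
  also have "\<dots> = 100000000 * (length L + length R + 1) * (lg (length L + length R) + 1) ^ 2"
    by (simp add: M_def l_def m_def power2_eq_square algebra_simps)
  finally show ?thesis .
qed

lemma length_level2:
  "length (level2 L R out) \<le> length out + 60000 * (lg (length L + length R) + 1) * (length L + length R + 1)"
proof -
  define S where "S = tagsort L R"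
  have S: "length S \<le> length L + length R" using length_tagsort[of L R] by (simp add: S_def)
  have "length (level2 L R out) \<le> length out + 30000 * (tlen (singles S) + length (singles S)) * lg (length (singles S))"
    unfolding level2_def S_def[symmetric] by (rule inner.length_tree_out[where N = "length S", OF length_out2]) simp
  also have "\<dots> \<le> length out + 30000 * (2 * (length L + length R + 1)) * (lg (length L + length R) + 1)"
    using S lg_mono[OF S] by (intro add_mono mult_le_mono) auto
  finally show ?thesis by (simp add: algebra_simps)
qed

lemma inner_tree_acc: "inner.tree bs out = (fst (inner.tree bs []), snd (inner.tree bs []) @ out)"
  unfolding inner.tree_def
proof (rule funpow_acc)
  have acc: "inner.pouts bs (o1 @ o2) = inner.pouts bs o1 @ o2" for bs o1 o2
  proof (induction bs o1 rule: inner.pouts.induct)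
    case (1 a b bs o1)
    have "out2 a b (o1 @ o2) = out2 a b o1 @ o2"
      unfolding out2_def by (subst (1 2) nodef_acc) simp
    then show ?case using 1 by simp
  qed auto
  show "inner.passf (bs, out) = (fst (inner.passf (bs, [])), snd (inner.passf (bs, [])) @ out)" for bs out
    using acc[of bs "[]" out] by simp
qed

definition combine1E :: exp where
  "combine1E = Cell (call2 appendE (Var 0) (Var 1)) (call3 level2E (Var 0) (Var 1) (Var 2))"

interpretation outer: appender combine1E level2 "\<lambda>a b. set (level2 a b [])"
proof unfold_locales
  show "set (level2 a b out) = set (level2 a b []) \<union> set out" for a b out
    unfolding level2_def by (subst inner_tree_acc) simp
qed (simp_all add: combine1E_def)

lemma ct_combine1:
  assumes "length a + length b \<le> N"
  shows "ct combine1E [vl a, vl b, vl out] \<le> 200000000 * (lg N + 1) ^ 2 * (length a + length b + 1)"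
proof -
  have l: "lg (length a + length b) \<le> lg N" using assms by (intro lg_mono) simp
  have "ct combine1E [vl a, vl b, vl out] \<le> 30 + ct appendE [vl a, vl b] + ct level2E [vl a, vl b, vl out]"
    by (simp add: combine1E_def)
  also have "\<dots> \<le> 30 + 30 * (length a + 1) + 100000000 * (length a + length b + 1) * (lg (length a + length b) + 1) ^ 2"
    by (intro add_mono ct_append ct_level2 order_refl)
  also have "\<dots> \<le> 60 * (length a + length b + 1) * (lg N + 1) ^ 2 + 100000000 * (length a + length b + 1) * (lg N + 1) ^ 2"
  proof (intro add_mono mult_le_mono order_refl power_mono)
    have "30 + 30 * (length a + 1) \<le> 60 * (length a + length b + 1) * 1" by simp
    also have "\<dots> \<le> 60 * (length a + length b + 1) * (lg N + 1) ^ 2" by (intro mult_le_mono2) simp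
    finally show "30 + 30 * (length a + 1) \<le> 60 * (length a + length b + 1) * (lg N + 1) ^ 2" .
  qed (use l in auto)
  also have "\<dots> \<le> 200000000 * (lg N + 1) ^ 2 * (length a + length b + 1)"
    by (simp add: algebra_simps)
  finally show ?thesis .
qed

definition candE :: exp where
  "candE = Rgt (call2 (treeE combine1E) (call1 singlesE (call1 sortE (Var 0))) (Num 0))"

definition cands :: "val list \<Rightarrow> val list" where
  "cands xs = snd (outer.tree (singles (srt xs)) [])"

lemma ev_cand [simp]: "ev candE [vl xs] = vl (cands xs)"
  using outer.ev_tree[of "singles (srt xs)" "[]"] by (simp add: candE_def cands_def outer.tenc_eq)

lemma ct_cand: "ct candE [vl xs] \<le> 1000000000 * (length xs + 1) * (lg (length xs) + 1) ^ 3"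
proof -
  define n where "n = length xs"
  define l where "l = lg n + 1"
  define S where "S = srt xs"
  define M where "M = (n + 1) * l"
  have S: "length S \<le> n" using length_srt[of xs] by (simp add: S_def n_def)
  have l1: "1 \<le> l" by (simp add: l_def)
  have t: "ct (treeE combine1E) [vll (singles S), vl []] \<le>
      (200000000 * (lg n + 1) ^ 2 + 300) * (tlen (singles S) + length (singles S) + 1) * (lg (length (singles S)) + 1)"
    using S by (intro outer.ct_tree[of n, OF ct_combine1]) auto
  also have "\<dots> \<le> (200000300 * l ^ 2) * (2 * (n + 1)) * l"
    using S lg_mono[OF S] l1 by (intro mult_le_mono) (auto simp: l_def)
  also have "\<dots> = 400000600 * M * l ^ 2" by (simp add: M_def algebra_simps)
  finally have t: "ct (treeE combine1E) [vll (singles S), vl []] \<le> 400000600 * M * l ^ 2" .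
  have "ct candE [vl xs] \<le> 20 + ct sortE [vl xs] + ct singlesE [vl S] + ct (treeE combine1E) [vll (singles S), vl []]"
    by (simp add: candE_def S_def)
  also have "\<dots> \<le> 20 + 2000 * (length xs + 1) * (lg (length xs) + 1) + 40 * (length S + 1) + 400000600 * M * l ^ 2"
    by (intro add_mono ct_sort ct_singles t order_refl)
  also have "\<dots> \<le> 20 * M + 2000 * M + 40 * M + 400000600 * M * l ^ 2"
  proof -
    have "n + 1 \<le> M" using mult_le_mono2[OF l1, of "n + 1"] by (simp only: M_def mult_1_right)
    then have 2: "1 \<le> M" "length S + 1 \<le> M" using S by auto
    have 3: "2000 * (length xs + 1) * (lg (length xs) + 1) = 2000 * M" by (simp add: M_def n_def l_def algebra_simps)
    show ?thesis unfolding 3 using 2 by (intro add_mono order_refl) auto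
  qed
  also have "\<dots> \<le> 1000000000 * M * l ^ 2"
  proof -
    have "M \<le> M * l ^ 2" using l1 by simp
    then show ?thesis by linarith
  qed
  also have "\<dots> = 1000000000 * (length xs + 1) * (lg (length xs) + 1) ^ 3"
    by (simp add: M_def n_def l_def power2_eq_square power3_eq_cube algebra_simps)
  finally show ?thesis .
qed

lemma length_cands: "length (cands xs) \<le> 200000 * (length xs + 1) * (lg (length xs) + 1) ^ 2"
proof -
  define n where "n = length xs"
  define l where "l = lg n + 1"
  define S where "S = srt xs"
  have S: "length S \<le> n" using length_srt[of xs] by (simp add: S_def n_def)
  have c: "length (level2 a b out) \<le> length out + (60000 * l) * (length a + length b + 1)"
    if "length a + length b \<le> n" for a b out
  proof -
    have "length (level2 a b out) \<le> length out + 60000 * (lg (length a + length b) + 1) * (length a + length b + 1)"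
      by (rule length_level2)
    also have "\<dots> \<le> length out + (60000 * l) * (length a + length b + 1)"
      using lg_mono[OF that] by (intro add_mono mult_le_mono order_refl) (simp add: l_def)
    finally show ?thesis .
  qed
  have "length (cands xs) \<le> length ([] :: val list) + (60000 * l) * (tlen (singles S) + length (singles S)) * lg (length (singles S))"
    unfolding cands_def S_def[symmetric] by (rule outer.length_tree_out[of n, OF c]) (use S in auto)
  also have "\<dots> \<le> 0 + (60000 * l) * (2 * (n + 1)) * l"
    using S lg_mono[OF S] by (intro add_mono mult_le_mono) (auto simp: l_def)
  also have "\<dots> = 120000 * (n + 1) * l ^ 2" by (simp add: power2_eq_square algebra_simps)
  also have "\<dots> \<le> 200000 * (n + 1) * l ^ 2" by (intro mult_le_mono1) simp
  finally show ?thesis by (simp add: n_def l_def)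
qed


subsection \<open>Selecting the closest candidates\<close>

text \<open>Sorting these records groups the candidates by source and orders each group by distance.
  The target index ensures that equal keys mean the same candidate, so repetitions disappear in the
  sort.\<close>

definition keyed :: "val \<Rightarrow> val" where
  "keyed c = CellV (lft (rgt (rgt (lft c)))) (CellV (RealV (sqd (lft c) (rgt c))) (CellV (lft (rgt (rgt (rgt c)))) (NumV 0)))"

definition keyE :: exp where
  "keyE = Fold (Var 0) (Num 0) (let a = Lft (Lft (Var 1)); b = Rgt (Lft (Var 1)) in
     Cell (Cell (Lft (Rgt (Rgt a))) (Cell (call2 sqdE a b) (Cell (Lft (Rgt (Rgt b))) (Num 0)))) (Var 2))"

lemma ev_key [simp]: "ev keyE [vl cs] = vl (rev (map keyed cs))"
  using lfold_Cons[where g = keyed and xs = cs and ys = "[]"] by (simp add: keyE_def keyed_def Let_def)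

lemma ct_key: "ct keyE [vl cs] \<le> 100 * (length cs + 1)"
  using ct_fold_loopfree[of "Var 0" "[vl cs]" cs "(let a = Lft (Lft (Var 1)); b = Rgt (Lft (Var 1)) in
     Cell (Cell (Lft (Rgt (Rgt a))) (Cell (call2 sqdE a b) (Cell (Lft (Rgt (Rgt b))) (Num 0)))) (Var 2))" 90 "Num 0"]
  by (simp add: keyE_def Let_def)

type_synonym threshold = "val option \<times> nat \<times> val \<times> val list"

fun enct :: "threshold \<Rightarrow> val" where
  "enct (cur, k, t, out) = CellV (case cur of None \<Rightarrow> NumV 0 | Some p \<Rightarrow> CellV p (NumV 0)) (CellV (units k) (CellV t (vl out)))"

definition edge_rec :: "val \<Rightarrow> val" where
  "edge_rec z = CellV (lft z) (CellV (lft (rgt (rgt z))) (NumV 0))"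

text \<open>Within one source the first 17 records have at most 16 closer ones; \<open>k\<close>
  starts at 16 because the first is emitted at once. Afterwards \<open>t\<close> stays at the
  distance of the 17th, and a record qualifies exactly if it is not farther than that, which lets
  ties through.\<close>

definition thstep :: "val \<Rightarrow> threshold \<Rightarrow> threshold" where
  "thstep z = (\<lambda>(cur, k, t, out).
     if cur = None \<or> num_of (the cur) < key1 z then (Some (lft z), 16, lft (rgt z), edge_rec z # out)
     else if 0 < k then (cur, k - 1, lft (rgt z), edge_rec z # out)
     else if num_of t < key2 z then (cur, k, t, out) else (cur, k, t, edge_rec z # out))"

definition thstepE :: exp where
  "thstepE = (let z = Lft (Var 2); s = Var 3; cur = Lft s; k = Lft (Rgt s); t = Lft (Rgt (Rgt s)); out = Rgt (Rgt (Rgt s));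
     new = Cell (Cell (Lft z) (Cell (Lft (Rgt (Rgt z))) (Num 0))) out;
     fresh = Cell (Cell (Lft z) (Num 0)) (Cell (unitsE 16) (Cell (Lft (Rgt z)) new));
     same = IfCell k (Cell cur (Cell (Rgt k) (Cell (Lft (Rgt z)) new)))
       (IfLess t (Lft (Rgt z)) s (Cell cur (Cell k (Cell t new)))) in
     IfCell cur (IfLess (Lft cur) (Lft z) fresh same) fresh)"

definition thrE :: exp where
  "thrE = Rgt (Rgt (Rgt (Fold (Var 0) (Cell (Num 0) (Cell (Num 0) (Cell (Num 0) (Var 1)))) thstepE)))"

definition thr :: "val list \<Rightarrow> val list \<Rightarrow> val list" where
  "thr zs out = snd (snd (snd (fold thstep zs (None, 0, NumV 0, out))))"

lemma ev_thstep: "ev thstepE [p, q, CellV z r, enct s] = enct (thstep z s)"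
proof -
  obtain cur k t out where s: "s = (cur, k, t, out)" by (cases s) auto
  show ?thesis
  proof (cases cur)
    case None
    then show ?thesis by (simp add: thstepE_def Let_def s thstep_def edge_rec_def)
  next
    case (Some c)
    show ?thesis
      by (cases k) (simp_all add: thstepE_def Let_def s thstep_def edge_rec_def Some key1_def key2_def)
  qed
qed

lemma ev_thr [simp]: "ev thrE [vl zs, vl out] = vl (thr zs out)"
proof -
  have "ev (Fold (Var 0) (Cell (Num 0) (Cell (Num 0) (Cell (Num 0) (Var 1)))) thstepE) [vl zs, vl out] =
      enct (fold thstep zs (None, 0, NumV 0, out))"
    using lfold_sim[where E = enct and h = thstep and s = "(None, 0, NumV 0, out)" and xs = zs, OF ev_thstep] by simp
  then show ?thesis unfolding thrE_def ev.simps(8) thr_def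
    by (cases "fold thstep zs (None, 0, NumV 0, out)") (simp del: ev.simps)
qed

lemma sz_units: "loopfree (unitsE k)" "sz (unitsE k) = 2 * k + 1"
  by (induction k) auto

lemma ct_thr: "ct thrE [vl zs, out] \<le> 200 * (length zs + 1)"
proof -
  have "loopfree thstepE" "sz thstepE < 150" by (simp_all add: thstepE_def Let_def sz_units)
  from ct_fold_loopfree[OF _ this, of "Var 0" "[vl zs, out]" zs "Cell (Num 0) (Cell (Num 0) (Cell (Num 0) (Var 1)))"]
  show ?thesis by (simp add: thrE_def)
qed

lemma length_thr: "length (thr zs out) \<le> length zs + length out"
proof -
  have "length (snd (snd (snd (fold thstep zs s)))) \<le> length zs + length (snd (snd (snd s)))" for s
    by (rule measure_fold) (auto simp: thstep_def split: prod.split)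
  from this[of "(None, 0, NumV 0, out)"] show ?thesis by (simp add: thr_def)
qed

definition onef :: "val list \<Rightarrow> val list \<Rightarrow> val list" where
  "onef xs out = thr (srt (rev (map keyed (cands xs)))) out"

definition oneE :: exp where
  "oneE = call2 thrE (call1 sortE (call1 keyE (call1 candE (Var 0)))) (Var 1)"

lemma ev_one [simp]: "ev oneE [vl xs, vl out] = vl (onef xs out)"
  by (simp add: oneE_def onef_def)

lemma lg_mult: "lg (a * b) \<le> lg a + lg b"
  by (rule lg_le) (simp add: power_add mult_le_mono le_two_lg)

lemma lg_Suc: "lg (n + 1) \<le> lg n + 1"
proof (rule lg_le)
  have "(1::nat) \<le> 2 ^ lg n" by simp
  moreover have "(2::nat) ^ (lg n + 1) = 2 * 2 ^ lg n" by simp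
  ultimately show "n + 1 \<le> 2 ^ (lg n + 1)" using le_two_lg[of n] by linarith
qed

lemma lg_two_power: "lg (2 ^ k) \<le> k"
  by (rule lg_le) simp

text \<open>The number of candidates is polynomial in \<open>n\<close>, so its logarithm exceeds
  \<open>lg n + 1\<close> only by a constant factor and sorting them stays within the time
  bound.\<close>

lemma lg_poly: "m \<le> 2 ^ c * (n + 1) * (lg n + 1) ^ 2 \<Longrightarrow> lg m \<le> c + 3 * (lg n + 1)"
proof -
  assume "m \<le> 2 ^ c * (n + 1) * (lg n + 1) ^ 2"
  also have "\<dots> \<le> 2 ^ c * (n + 1) * (n + 1) ^ 2" using lg_le_self[of n] by (intro mult_le_mono power_mono) auto
  also have "\<dots> = 2 ^ c * ((n + 1) * ((n + 1) * (n + 1)))" by (simp only: power2_eq_square mult.assoc)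
  finally have "lg m \<le> lg (2 ^ c * ((n + 1) * ((n + 1) * (n + 1))))" by (rule lg_mono)
  also have "\<dots> \<le> lg (2 ^ c) + (lg (n + 1) + (lg (n + 1) + lg (n + 1)))"
    by (intro order_trans[OF lg_mult] add_mono order_refl)
  also have "\<dots> \<le> c + 3 * (lg n + 1)" using lg_two_power[of c] lg_Suc[of n] by simp
  finally show ?thesis .
qed

lemma one_le_pow: "1 \<le> (a::nat) \<Longrightarrow> a \<le> a ^ 3 \<and> a ^ 2 \<le> a ^ 3 \<and> 1 \<le> a ^ 3"
  by (auto simp: power2_eq_square power3_eq_cube)

lemma ct_one: "ct oneE [vl xs, vl out] \<le> 100000000000 * (length xs + 1) * (lg (length xs) + 1) ^ 3"
proof -
  define n where "n = length xs"
  define l where "l = lg n + 1"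
  define N where "N = length (cands xs)"
  define Z where "Z = rev (map keyed (cands xs))"
  define M where "M = (n + 1) * l ^ 3"
  have Z: "length Z = N" by (simp add: Z_def N_def)
  have N: "N \<le> 200000 * (n + 1) * l ^ 2" using length_cands[of xs] by (simp add: N_def n_def l_def)
  have l1: "1 \<le> l" by (simp add: l_def)
  have "200000 * (n + 1) * l ^ 2 \<le> 2 ^ 18 * (n + 1) * (lg n + 1) ^ 2" unfolding l_def by (intro mult_le_mono1) simp
  then have "lg N \<le> 18 + 3 * (lg n + 1)" using lg_poly[of N 18 n] N by linarith
  then have lN: "lg N + 1 \<le> 22 * l" by (simp add: l_def)
  have M: "(n + 1) * l ^ 2 \<le> M" "1 \<le> M"
    using mult_le_mono2[of "l ^ 2" "l ^ 3" "n + 1"] one_le_pow[OF l1] by (simp_all add: M_def)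
  have "(N + 1) * (lg N + 1) \<le> (200001 * ((n + 1) * l ^ 2)) * (22 * l)"
  proof (intro mult_le_mono lN)
    have "1 \<le> (n + 1) * l ^ 2" using mult_le_mono[of 1 "n + 1" 1 "l ^ 2"] l1 by simp
    then show "N + 1 \<le> 200001 * ((n + 1) * l ^ 2)" using N by linarith
  qed
  also have "\<dots> = 4400022 * M" by (simp add: M_def power2_eq_square power3_eq_cube algebra_simps)
  finally have S: "(N + 1) * (lg N + 1) \<le> 4400022 * M" .
  have N1: "N + 1 \<le> 200001 * M" using N M by linarith
  have "ct oneE [vl xs, vl out] \<le> 20 + ct candE [vl xs] + ct keyE [vl (cands xs)] + ct sortE [vl Z] + ct thrE [vl (srt Z), vl out]"
    by (simp add: oneE_def Z_def)
  also have "\<dots> \<le> 20 + 1000000000 * (length xs + 1) * (lg (length xs) + 1) ^ 3 + 100 * (length (cands xs) + 1) +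
       2000 * (length Z + 1) * (lg (length Z) + 1) + 200 * (length (srt Z) + 1)"
    by (intro add_mono ct_cand ct_key ct_sort ct_thr order_refl)
  also have "\<dots> \<le> 20 * M + 1000000000 * M + 100 * (200001 * M) + 2000 * (4400022 * M) + 200 * (200001 * M)"
  proof (intro add_mono)
    show "1000000000 * (length xs + 1) * (lg (length xs) + 1) ^ 3 \<le> 1000000000 * M"
      by (simp add: M_def n_def l_def algebra_simps)
    show "2000 * (length Z + 1) * (lg (length Z) + 1) \<le> 2000 * (4400022 * M)"
      using S unfolding Z by (simp only: mult.assoc mult_le_mono2)
    show "200 * (length (srt Z) + 1) \<le> 200 * (200001 * M)" using N1 length_srt[of Z] Z by simp
  qed (use M(2) N1 in \<open>auto simp: N_def\<close>)
  also have "\<dots> \<le> 100000000000 * M" by simp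
  finally show ?thesis by (simp add: M_def n_def l_def algebra_simps)
qed

lemma length_onef: "length (onef xs out) \<le> length out + 200000 * (length xs + 1) * (lg (length xs) + 1) ^ 2"
  using length_thr[of "srt (rev (map keyed (cands xs)))" out] length_srt[of "rev (map keyed (cands xs))"] length_cands[of xs]
  by (simp add: onef_def)

subsection \<open>The complete program\<close>

text \<open>By the addition formulas, increasing the initial angle \<alpha> of the wedge by 60
  degrees turns the two sines into \<open>- key2\<close> and \<open>key1 + key2\<close>. The only
  irrational constant of the program is therefore the \<open>sqrt 3\<close> in
  \<open>initialE\<close>.\<close>

definition rotate_pt :: "val \<Rightarrow> val" where
  "rotate_pt x = CellV (RealV (- key2 x)) (CellV (RealV (key1 x + key2 x)) (rgt (rgt x)))"

definition rotateE :: exp where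
  "rotateE = Fold (Var 0) (Num 0) (let x = Lft (Var 1) in
     Cell (Cell (Arith RSub (Num 0) (Lft (Rgt x))) (Cell (Arith RAdd (Lft x) (Lft (Rgt x))) (Rgt (Rgt x)))) (Var 2))"

lemma ev_rotate [simp]: "ev rotateE [vl xs] = vl (rev (map rotate_pt xs))"
  using lfold_Cons[where g = rotate_pt and xs = xs and ys = "[]"]
  by (simp add: rotateE_def rotate_pt_def Let_def key1_def key2_def)

lemma ct_rotate: "ct rotateE [vl xs] \<le> 50 * (length xs + 1)"
  using ct_fold_loopfree[of "Var 0" "[vl xs]" xs "(let x = Lft (Var 1) in
     Cell (Cell (Arith RSub (Num 0) (Lft (Rgt x))) (Cell (Arith RAdd (Lft x) (Lft (Rgt x))) (Rgt (Rgt x)))) (Var 2))" 40 "Num 0"]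
  by (simp add: rotateE_def Let_def)

definition initial_pt :: "val \<Rightarrow> val" where
  "initial_pt e = CellV (RealV (2 * num_of (rgt (rgt e))))
     (CellV (RealV (sqrt 3 * num_of (lft (rgt e)) - num_of (rgt (rgt e)))) (CellV (lft e) (NumV 0)))"

definition initialE :: exp where
  "initialE = Fold (Var 0) (Num 0) (let e = Lft (Var 1); x = Lft (Rgt e); y = Rgt (Rgt e) in
     Cell (Cell (Arith RMul (Num 2) y) (Cell (Arith RSub (Arith RMul (Root (Num 3)) x) y) (Cell (Lft e) (Num 0)))) (Var 2))"

lemma ev_initial [simp]: "ev initialE [vl xs] = vl (rev (map initial_pt xs))"
  using lfold_Cons[where g = initial_pt and xs = xs and ys = "[]"]
  by (simp add: initialE_def initial_pt_def Let_def)

lemma ct_initial: "ct initialE [vl xs] \<le> 60 * (length xs + 1)"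
  using ct_fold_loopfree[of "Var 0" "[vl xs]" xs "(let e = Lft (Var 1); x = Lft (Rgt e); y = Rgt (Rgt e) in
     Cell (Cell (Arith RMul (Num 2) y) (Cell (Arith RSub (Arith RMul (Root (Num 3)) x) y) (Cell (Lft e) (Num 0)))) (Var 2))" 50 "Num 0"]
  by (simp add: initialE_def Let_def)

definition wedgestep :: "val list \<times> val list \<Rightarrow> val list \<times> val list" where
  "wedgestep = (\<lambda>(xs, out). (rev (map rotate_pt xs), onef xs out))"

definition all_edges :: "val list \<Rightarrow> val list" where
  "all_edges xs = snd ((wedgestep ^^ 6) (rev (map initial_pt xs), []))"

definition wedgestepE :: exp where
  "wedgestepE = Cell (call1 rotateE (Lft (Var 2))) (call2 oneE (Lft (Var 2)) (Rgt (Var 2)))"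

definition mainE :: exp where
  "mainE = Bind (Rgt (Fold (unitsE 6) (Cell (call1 initialE (Var 0)) (Num 0)) wedgestepE))
     (Fold (call1 revE (call1 sortE (Var 1))) (Num 0)
        (Cell (Lft (Lft (Var 2))) (Cell (Lft (Rgt (Lft (Var 2)))) (Var 3))))"

text \<open>A point on the common ray of two adjacent wedges may yield the same edge twice; the
  final sort makes every edge appear once.\<close>

definition output_of :: "val list \<Rightarrow> val list" where
  "output_of xs = concat (map (\<lambda>e. [lft e, lft (rgt e)]) (srt (all_edges xs)))"

lemma ev_wedgestep: "ev wedgestepE [p, r, enc2 s] = enc2 (wedgestep s)"
  by (cases s) (simp add: wedgestepE_def wedgestep_def)

lemma ev_wedges: "ev (Fold (unitsE 6) (Cell (call1 initialE (Var 0)) (Num 0)) wedgestepE) [vl xs] =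
    enc2 ((wedgestep ^^ 6) (rev (map initial_pt xs), []))"
  using lfold_funpow[of "\<lambda>r s. ev wedgestepE [vl xs, r, s]" enc2 wedgestep "replicate 6 (NumV 0)" "(rev (map initial_pt xs), [])",
    OF ev_wedgestep] by simp

lemma lfold_flatten:
  "lfold (\<lambda>r s. CellV (lft (lft r)) (CellV (lft (rgt (lft r))) s)) (vl (rev es)) (vl out) =
     vl (concat (map (\<lambda>e. [lft e, lft (rgt e)]) es) @ out)"
proof (induction es arbitrary: out rule: rev_induct)
  case (snoc e es)
  show ?case using snoc[of "lft e # lft (rgt e) # out"] by simp
qed simp

lemma ev_main: "ev mainE [vl xs] = vl (output_of xs)"
  using lfold_flatten[of "srt (all_edges xs)" "[]"]
  unfolding mainE_def ev.simps(2) ev.simps(8) ev_wedges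
  by (simp add: output_of_def all_edges_def enc2_eq)

lemma wedges_lengths:
  "length (fst ((wedgestep ^^ k) (rev (map initial_pt xs), []))) = length xs"
  "length (snd ((wedgestep ^^ k) (rev (map initial_pt xs), []))) \<le> k * (200000 * (length xs + 1) * (lg (length xs) + 1) ^ 2)"
proof -
  have "length (fst ((wedgestep ^^ k) (rev (map initial_pt xs), []))) = length xs \<and>
    length (snd ((wedgestep ^^ k) (rev (map initial_pt xs), []))) \<le> k * (200000 * (length xs + 1) * (lg (length xs) + 1) ^ 2)"
  proof (induction k)
    case (Suc k)
    obtain ys out where s: "(wedgestep ^^ k) (rev (map initial_pt xs), []) = (ys, out)" by fastforce
    have w: "wedgestep (ys, out) = (rev (map rotate_pt ys), onef ys out)" by (simp add: wedgestep_def)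
    show ?case using Suc length_onef[of ys out] by (simp add: s w)
  qed simp
  then show "length (fst ((wedgestep ^^ k) (rev (map initial_pt xs), []))) = length xs"
    "length (snd ((wedgestep ^^ k) (rev (map initial_pt xs), []))) \<le> k * (200000 * (length xs + 1) * (lg (length xs) + 1) ^ 2)"
    by blast+
qed

lemma length_all_edges: "length (all_edges xs) \<le> 1200000 * (length xs + 1) * (lg (length xs) + 1) ^ 2"
  using wedges_lengths(2)[of 6 xs] by (simp add: all_edges_def mult.assoc[symmetric])

lemma length_output: "length (output_of xs) \<le> 2400000 * (length xs + 1) * (lg (length xs) + 1) ^ 2"
proof -
  have "length (output_of xs) = 2 * length (srt (all_edges xs))"
    unfolding output_of_def by (induction "srt (all_edges xs)") (auto simp: length_concat sum_list_triv comp_def)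
  then have "length (output_of xs) \<le> 2 * (1200000 * (length xs + 1) * (lg (length xs) + 1) ^ 2)"
    using length_srt[of "all_edges xs"] length_all_edges[of xs] by linarith
  then show ?thesis by (simp add: mult.assoc[symmetric])
qed

lemma ct_main: "ct mainE [vl xs] \<le> 10000000000000 * (length xs + 1) * (lg (length xs) + 1) ^ 3"
proof -
  define n where "n = length xs"
  define l where "l = lg n + 1"
  define M where "M = (n + 1) * l ^ 3"
  define E where "E = all_edges xs"
  have l1: "1 \<le> l" by (simp add: l_def)
  have M: "(n + 1) * l ^ 2 \<le> M" "1 \<le> M" "n + 1 \<le> M"
    using mult_le_mono2[of "l ^ 2" "l ^ 3" "n + 1"] mult_le_mono2[of 1 "l ^ 3" "n + 1"] one_le_pow[OF l1]
    by (simp_all add: M_def)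
  have step: "ev wedgestepE ([vl xs] @ [CellV x (vl (map (\<lambda>x. x) r)), enc2 a]) = enc2 (wedgestep a) \<and>
      length (fst (wedgestep a)) = n \<and>
      1 + ct wedgestepE ([vl xs] @ [CellV x (vl (map (\<lambda>x. x) r)), enc2 a]) + 200000000000 * M * length r \<le>
        200000000000 * M * length (x # r)"
    if t: "length (fst a) = n" for x r a
  proof -
    obtain ys out where a: "a = (ys, out)" by (cases a)
    have "ct rotateE [vl ys] \<le> 50 * M" using ct_rotate[of ys] t M(3) a by simp
    moreover have "ct oneE [vl ys, vl out] \<le> 100000000000 * M" using ct_one[of ys out] t a
      by (simp add: M_def l_def algebra_simps)
    ultimately have "20 + ct rotateE [vl ys] + ct oneE [vl ys, vl out] \<le> 200000000000 * M" using M(2) by linarith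
    then show ?thesis using t ev_wedgestep[of "vl xs" "CellV x (vl r)" a]
      by (simp add: a wedgestepE_def wedgestep_def)
  qed
  define us where "us = replicate 6 (NumV 0)"
  have l: "ev (unitsE 6) [vl xs] = vl (map (\<lambda>x. x) us)" unfolding us_def by simp
  let ?f = "Fold (unitsE 6) (Cell (call1 initialE (Var 0)) (Num 0)) wedgestepE"
  have "ct ?f [vl xs] \<le> 1 + 13 + (5 + ct initialE [vl xs]) + 200000000000 * M * length us"
    using ct_fold_potential[where I = "\<lambda>r a. length (fst a) = n" and b = wedgestepE and \<rho> = "[vl xs]" and
        g = "\<lambda>x. x" and E = enc2 and h = "\<lambda>x. wedgestep" and \<Phi> = "\<lambda>r a. 200000000000 * M * length r" and xs = us
        and a = "(rev (map initial_pt xs), [])" and l = "unitsE 6" and i = "Cell (call1 initialE (Var 0)) (Num 0)", OF step _ l]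
    by (simp add: ct_units n_def)
  also have "\<dots> \<le> 19 * M + 60 * M + 200000000000 * M * 6"
  proof -
    have "ct initialE [vl xs] \<le> 60 * M" using ct_initial[of xs] M(3) by (simp add: n_def)
    moreover have "length us = 6" by (simp add: us_def)
    ultimately show ?thesis using M(2) by simp
  qed
  finally have f: "ct ?f [vl xs] \<le> 2000000000000 * M" by simp
  define N where "N = length E"
  have N: "N \<le> 1200000 * (n + 1) * l ^ 2" using length_all_edges[of xs] by (simp add: N_def E_def n_def l_def)
  have "1200000 * (n + 1) * l ^ 2 \<le> 2 ^ 21 * (n + 1) * (lg n + 1) ^ 2" unfolding l_def by (intro mult_le_mono1) simp
  then have "lg N \<le> 21 + 3 * (lg n + 1)" using lg_poly[of N 21 n] N by linarith
  then have lN: "lg N + 1 \<le> 25 * l" by (simp add: l_def)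
  have "(N + 1) * (lg N + 1) \<le> (1200001 * ((n + 1) * l ^ 2)) * (25 * l)"
  proof (intro mult_le_mono lN)
    have "1 \<le> (n + 1) * l ^ 2" using mult_le_mono[of 1 "n + 1" 1 "l ^ 2"] l1 by simp
    then show "N + 1 \<le> 1200001 * ((n + 1) * l ^ 2)" using N by linarith
  qed
  also have "\<dots> = 30000025 * M" by (simp add: M_def power2_eq_square power3_eq_cube algebra_simps)
  finally have S: "(N + 1) * (lg N + 1) \<le> 30000025 * M" .
  have N1: "N + 1 \<le> 1200001 * M" using N M by linarith
  have sE: "length (srt E) \<le> N" using length_srt[of E] by (simp add: N_def)
  let ?b = "Cell (Lft (Lft (Var 2))) (Cell (Lft (Rgt (Lft (Var 2)))) (Var 3))"
  have g: "ct (Fold (call1 revE (call1 sortE (Var 1))) (Num 0) ?b) [vl xs, vl E] \<le>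
      10 + ct sortE [vl E] + ct revE [vl (srt E)] + 20 * length (srt E)"
    using ct_fold_loopfree[of "call1 revE (call1 sortE (Var 1))" "[vl xs, vl E]" "rev (srt E)" ?b 20 "Num 0"] by simp
  have "ct mainE [vl xs] = 2 + ct ?f [vl xs] + ct (Fold (call1 revE (call1 sortE (Var 1))) (Num 0) ?b) [vl xs, vl E]"
    unfolding mainE_def ct.simps(2) ct.simps(8) ev.simps(8) ev_wedges
    by (simp add: E_def all_edges_def enc2_eq)
  also have "\<dots> \<le> 2 + 2000000000000 * M + (10 + ct sortE [vl E] + ct revE [vl (srt E)] + 20 * length (srt E))"
    by (intro add_mono f g order_refl)
  also have "\<dots> \<le> 2 * M + 2000000000000 * M + (10 * M + 2000 * (30000025 * M) + 10 * (1200001 * M) + 20 * (1200001 * M))"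
  proof (intro add_mono order_refl)
    show "ct sortE [vl E] \<le> 2000 * (30000025 * M)"
      using ct_sort[of E] S unfolding N_def[symmetric] by (simp only: mult.assoc)
    show "ct revE [vl (srt E)] \<le> 10 * (1200001 * M)" using ct_rev[of "srt E"] sE N1 by simp
  qed (use M(2) N1 sE in auto)
  also have "\<dots> \<le> 10000000000000 * M" by simp
  finally show ?thesis by (simp add: M_def n_def l_def algebra_simps)
qed

section \<open>Correctness of the bipartite case\<close>

subsection \<open>The strict Monge property\<close>

text \<open>The Cartesian position belonging to coordinates along axes at 60 degrees. It makes
  \<open>sqd\<close> a squared Euclidean distance and thus gives access to the triangle
  inequality.\<close>

definition plane :: "real \<Rightarrow> real \<Rightarrow> real \<times> real" where
  "plane u v = (u + v / 2, sqrt 3 / 2 * v)"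

lemma norm_plane: "norm (plane u v) = sqrt (u * (u + v) + v * v)"
proof -
  have "(u + v / 2)\<^sup>2 + (sqrt 3 / 2 * v)\<^sup>2 = u * (u + v) + v * v"
    by (simp add: power2_eq_square algebra_simps)
  then show ?thesis by (simp only: plane_def norm_prod_def real_norm_def power2_abs fst_conv snd_conv)
qed

lemma plane_linear: "plane (u + u') (v + v') = plane u v + plane u' v'" "plane (c * u) (c * v) = c *\<^sub>R plane u v"
  "plane (u - u') (v - v') = plane u v - plane u' v'"
  by (simp_all add: plane_def algebra_simps add_divide_distrib diff_divide_distrib)

lemma plane_eq: "plane u v = plane u' v' \<longleftrightarrow> u = u' \<and> v = v'"
  by (auto simp: plane_def)

lemma dist_segment:
  fixes a b :: "'a::real_normed_vector"
  assumes "0 \<le> s" "s \<le> 1" "x = a + s *\<^sub>R (b - a)"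
  shows "dist a x + dist x b = dist a b"
proof -
  have "a - x = s *\<^sub>R (a - b)" "x - b = (1 - s) *\<^sub>R (a - b)"
    by (simp_all add: assms(3) algebra_simps)
  then have "dist a x + dist x b = s * norm (a - b) + (1 - s) * norm (a - b)"
    using assms(1,2) by (simp only: dist_norm norm_scaleR abs_of_nonneg diff_ge_0_iff_ge)
  also have "\<dots> = dist a b" by (simp add: dist_norm algebra_simps)
  finally show ?thesis .
qed

text \<open>Cramer's rule: \<open>D\<close> is the determinant of the linear system for the two
  parameters, \<open>S\<close> and \<open>T\<close> are the numerators. The quotients lie between 0
  and 1 because \<open>S\<close>, \<open>T\<close>, \<open>D - S\<close> and \<open>D - T\<close>
  are sums of nonnegative products.\<close>

lemma segments_cross:
  fixes p1 p2 q1 q2 r1 r2 s1 s2 :: real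
  assumes "q1 < q2" "p2 < p1" "s1 < s2" "r2 < r1" "p1 \<le> r2" "q2 \<le> s1"
  obtains s t where "0 \<le> s" "s \<le> 1" "0 \<le> t" "t \<le> 1"
    "p1 + s * (r2 - p1) = p2 + t * (r1 - p2)" "q1 + s * (s2 - q1) = q2 + t * (s1 - q2)"
proof -
  define D where "D = (s2 - q1) * (r1 - p2) - (r2 - p1) * (s1 - q2)"
  define S where "S = (q2 - q1) * (r1 - p2) - (p2 - p1) * (s1 - q2)"
  define T where "T = (q2 - q1) * (r2 - p1) - (p2 - p1) * (s2 - q1)"
  have "(r2 - p1) * (s1 - q2) \<le> (r2 - p1) * (s2 - q1)" using assms by (intro mult_left_mono) auto
  also have "\<dots> < (r1 - p2) * (s2 - q1)" using assms by (intro mult_strict_right_mono) auto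
  finally have D: "0 < D" by (simp add: D_def mult.commute)
  have S: "0 \<le> S" unfolding S_def using assms mult_nonneg_nonneg[of "q2 - q1" "r1 - p2"] mult_nonneg_nonneg[of "p1 - p2" "s1 - q2"]
    by (simp add: algebra_simps)
  have T: "0 \<le> T" unfolding T_def using assms mult_nonneg_nonneg[of "q2 - q1" "r2 - p1"] mult_nonneg_nonneg[of "p1 - p2" "s2 - q1"]
    by (simp add: algebra_simps)
  have "D - S = (r2 - p2) * (s2 - s1) + (s2 - q2) * (r1 - r2)" by (simp add: D_def S_def algebra_simps)
  then have SD: "S \<le> D" using assms mult_nonneg_nonneg[of "r2 - p2" "s2 - s1"] mult_nonneg_nonneg[of "s2 - q2" "r1 - r2"] by linarith
  have "D - T = (r2 - p1) * (s2 - s1) + (s2 - q1) * (r1 - r2)" by (simp add: D_def T_def algebra_simps)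
  then have TD: "T \<le> D" using assms mult_nonneg_nonneg[of "r2 - p1" "s2 - s1"] mult_nonneg_nonneg[of "s2 - q1" "r1 - r2"] by linarith
  show ?thesis
  proof (rule that[of "S / D" "T / D"])
    show "0 \<le> S / D" "S / D \<le> 1" "0 \<le> T / D" "T / D \<le> 1" using D S T SD TD by auto
    have "D * p1 + S * (r2 - p1) = D * p2 + T * (r1 - p2)" by (simp add: D_def S_def T_def algebra_simps)
    then show "p1 + S / D * (r2 - p1) = p2 + T / D * (r1 - p2)" using D by (simp add: field_simps)
    have "D * q1 + S * (s2 - q1) = D * q2 + T * (s1 - q2)" by (simp add: D_def S_def T_def algebra_simps)
    then show "q1 + S / D * (s2 - q1) = q2 + T / D * (s1 - q2)" using D by (simp add: field_simps)
  qed
qed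

text \<open>If \<open>x\<close> lay beyond \<open>(p, q)\<close> on the segments to both \<open>(r1, s1)\<close> and \<open>(r2, s2)\<close>, these two
  points would be on a common ray and hence comparable.\<close>

lemma no_common_ray:
  assumes s: "0 \<le> s" "x = plane (p + s * (r2 - p)) (q + s * (s2 - q))"
    and le: "p \<le> r2" "q \<le> s2" and st: "s1 < s2" "r2 < r1"
    and eq: "dist (plane p q) (plane r1 s1) = dist (plane p q) x + dist x (plane r1 s1)"
  shows "x = plane p q"
proof (rule ccontr)
  assume ne: "x \<noteq> plane p q"
  define a where "a = plane p q"
  have xa: "x - a = s *\<^sub>R plane (r2 - p) (s2 - q)"
    by (simp add: s(2) a_def plane_linear[symmetric])
  have s0: "0 < s" using ne s(1) xa by (cases "s = 0") (auto simp: a_def)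
  from eq[unfolded dist_triangle_eq] have "norm (a - x) *\<^sub>R (x - plane r1 s1) = norm (x - plane r1 s1) *\<^sub>R (a - x)"
    by (simp add: a_def)
  moreover have n: "0 < norm (a - x)" using ne by (simp add: a_def)
  ultimately have "x - plane r1 s1 = (norm (x - plane r1 s1) / norm (a - x)) *\<^sub>R (a - x)"
    by (simp add: divide_inverse_commute flip: scaleR_scaleR) (metis (no_types) n less_irrefl scaleR_scaleR left_inverse scaleR_one)
  then obtain c where c: "0 \<le> c" "x - plane r1 s1 = c *\<^sub>R (a - x)" using n by (metis divide_nonneg_pos norm_ge_zero)
  have "plane r1 s1 - a = (1 + c) *\<^sub>R (x - a)" using c(2) by (simp add: algebra_simps)
  then have "plane (r1 - p) (s1 - q) = plane ((1 + c) * s * (r2 - p)) ((1 + c) * s * (s2 - q))"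
    unfolding xa by (simp add: a_def plane_linear mult.assoc)
  then have e: "r1 - p = k * (r2 - p)" "s1 - q = k * (s2 - q)" if "k = (1 + c) * s" for k
    using that unfolding plane_eq by auto
  define k where "k = (1 + c) * s"
  note e = e[OF k_def]
  have "\<not> k \<le> 1"
  proof
    assume "k \<le> 1"
    then have "k * (r2 - p) \<le> r2 - p" using mult_right_mono[OF \<open>k \<le> 1\<close>, of "r2 - p"] le(1) by simp
    then show False using e(1) st(2) by linarith
  qed
  then have "1 \<le> k" by simp
  then have "s2 - q \<le> k * (s2 - q)" using mult_right_mono[OF \<open>1 \<le> k\<close>, of "s2 - q"] le(2) by simp
  then show False using e(2) st(1) by linarith
qed

definition stair :: "val \<Rightarrow> val \<Rightarrow> bool" where
  "stair a b \<longleftrightarrow> key1 a < key1 b \<and> key2 b < key2 a"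

definition dominated :: "val \<Rightarrow> val \<Rightarrow> bool" where
  "dominated a b \<longleftrightarrow> key1 a \<le> key1 b \<and> key2 a \<le> key2 b"

definition pos :: "val \<Rightarrow> real \<times> real" where "pos a = plane (key2 a) (key1 a)"

lemma sqd_dist: "sqd a b = (dist (pos a) (pos b))\<^sup>2"
proof -
  have "dist (pos a) (pos b) = norm (plane (key2 b - key2 a) (key1 b - key1 a))"
    unfolding pos_def plane_linear by (simp add: dist_norm norm_minus_commute)
  moreover have "0 \<le> (key2 b - key2 a) * ((key2 b - key2 a) + (key1 b - key1 a)) + (key1 b - key1 a) * (key1 b - key1 a)"
    using norm_plane[of "key2 b - key2 a" "key1 b - key1 a"] by (metis norm_ge_zero real_sqrt_ge_0_iff)
  ultimately show ?thesis unfolding norm_plane by (simp add: sqd_def)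
qed

lemma sqd_le: "sqd a b \<le> sqd a' b' \<longleftrightarrow> dist (pos a) (pos b) \<le> dist (pos a') (pos b')"
  by (simp add: sqd_dist power_mono_iff)

lemma sqd_less: "sqd a b < sqd a' b' \<longleftrightarrow> dist (pos a) (pos b) < dist (pos a') (pos b')"
  using sqd_le[of a' b' a b] by linarith

text \<open>The segments from \<open>a1\<close> to \<open>b2\<close> and from \<open>a2\<close> to \<open>b1\<close> cross, so that uncrossing them
  shortens the total length.\<close>

lemma strict_monge:
  assumes a: "stair a1 a2" and b: "stair b1 b2" and d: "dominated a1 b2" "dominated a2 b1"
  shows "dist (pos a1) (pos b1) + dist (pos a2) (pos b2) < dist (pos a1) (pos b2) + dist (pos a2) (pos b1)"
proof -
  obtain s t where st: "0 \<le> s" "s \<le> 1" "0 \<le> t" "t \<le> 1"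
    "key2 a1 + s * (key2 b2 - key2 a1) = key2 a2 + t * (key2 b1 - key2 a2)"
    "key1 a1 + s * (key1 b2 - key1 a1) = key1 a2 + t * (key1 b1 - key1 a2)"
    using segments_cross[of "key1 a1" "key1 a2" "key2 a2" "key2 a1" "key1 b1" "key1 b2" "key2 b2" "key2 b1"] a b d
    unfolding stair_def dominated_def by blast
  define x where "x = plane (key2 a1 + s * (key2 b2 - key2 a1)) (key1 a1 + s * (key1 b2 - key1 a1))"
  have x2: "x = plane (key2 a2 + t * (key2 b1 - key2 a2)) (key1 a2 + t * (key1 b1 - key1 a2))"
    using st by (simp add: x_def)
  have "x = pos a1 + s *\<^sub>R (pos b2 - pos a1)" by (simp only: x_def pos_def plane_linear)
  then have 1: "dist (pos a1) x + dist x (pos b2) = dist (pos a1) (pos b2)" using dist_segment st by blast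
  have "x = pos a2 + t *\<^sub>R (pos b1 - pos a2)" by (simp only: x2 pos_def plane_linear)
  then have 2: "dist (pos a2) x + dist x (pos b1) = dist (pos a2) (pos b1)" using dist_segment st by blast
  have t1: "dist (pos a1) (pos b1) \<le> dist (pos a1) x + dist x (pos b1)"
    and t2: "dist (pos a2) (pos b2) \<le> dist (pos a2) x + dist x (pos b2)" by (rule dist_triangle)+
  show ?thesis
  proof (rule ccontr)
    \<comment> \<open>If uncrossing gains nothing, both triangle inequalities at the crossing point
      are equalities. Then this point is the start of both segments, so that \<open>a1\<close> and
      \<open>a2\<close> have the same position, which \<open>stair\<close> excludes.\<close>
    assume "\<not> ?thesis"
    then have e1: "dist (pos a1) (pos b1) = dist (pos a1) x + dist x (pos b1)"
      and e2: "dist (pos a2) (pos b2) = dist (pos a2) x + dist x (pos b2)" using 1 2 t1 t2 by linarith+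
    have "x = pos a1" unfolding pos_def
      by (rule no_common_ray[OF st(1) x_def, of "key1 b1" "key2 b1"]) (use e1 b d in \<open>auto simp: pos_def stair_def dominated_def\<close>)
    moreover have "x = pos a2"
    proof -
      \<comment> \<open>\<open>no_common_ray\<close> covers one order of the two targets. Seen from
        \<open>a2\<close> they come in the opposite order, so the coordinates are exchanged, a
        reflection that preserves distances.\<close>
      have sw: "plane u v = plane u' v' \<Longrightarrow> plane v u = plane v' u'" for u v u' v' by (simp add: plane_eq)
      have ds: "dist (plane u v) (plane u' v') = dist (plane v u) (plane v' u')" for u v u' v'
        by (simp add: dist_norm norm_plane algebra_simps flip: plane_linear(3))
      define y where "y = plane (key1 a2 + t * (key1 b1 - key1 a2)) (key2 a2 + t * (key2 b1 - key2 a2))"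
      have "y = plane (key1 a2) (key2 a2)"
        by (rule no_common_ray[OF st(3) y_def, of "key2 b2" "key1 b2"])
          (use e2 b d in \<open>auto simp: pos_def stair_def dominated_def x2 y_def ds[of "key1 a2"] ds[of "key1 b2"] ds[of _ _ "key1 b2"]\<close>)
      then show ?thesis unfolding x2 pos_def y_def by (rule sw)
    qed
    ultimately show False using a by (auto simp: pos_def plane_eq stair_def)
  qed
qed

text \<open>Strict total monotonicity: the Monge inequality and the hypothesis on \<open>a1\<close>
  combine to a statement on \<open>a2\<close> alone, and strictness turns even a tie for
  \<open>a1\<close> into a strict preference for \<open>a2\<close>.\<close>

lemma monotone_rows:
  assumes "stair a1 a2" "stair b1 b2" "dominated a1 b2" "dominated a2 b1" "sqd a1 b2 \<le> sqd a1 b1"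
  shows "sqd a2 b2 < sqd a2 b1"
  using strict_monge[OF assms(1-4)] assms(5) unfolding sqd_less sqd_le by linarith

lemma monotone_rows':
  assumes "stair a1 a2" "stair b1 b2" "dominated a1 b2" "dominated a2 b1" "sqd a2 b1 \<le> sqd a2 b2"
  shows "sqd a1 b1 < sqd a1 b2"
  using strict_monge[OF assms(1-4)] assms(5) unfolding sqd_less sqd_le by linarith

text \<open>The form \<open>u^2 + u*v + v^2\<close> increases strictly in each coordinate as long as
  both are nonnegative, the angle between the axes being acute.\<close>

lemma dominated_closer:
  assumes "dominated a c" "dominated c b" "key1 c \<noteq> key1 b \<or> key2 c \<noteq> key2 b"
  shows "sqd a c < sqd a b"
proof -
  define x y x' y' where "x = key1 c - key1 a" and "y = key2 c - key2 a" and "x' = key1 b - key1 c" and "y' = key2 b - key2 c"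
  have n: "0 \<le> x" "0 \<le> y" "0 \<le> x'" "0 \<le> y'" "0 < x' \<or> 0 < y'"
    using assms by (auto simp: dominated_def x_def y_def x'_def y'_def)
  have "sqd a b - sqd a c = 2 * (y * y') + 2 * (x * x') + y' * x + y * x' + (y' * y' + y' * x' + x' * x')"
    by (simp add: sqd_def x_def y_def x'_def y'_def algebra_simps)
  moreover have "0 \<le> y * y'" "0 \<le> x * x'" "0 \<le> y' * x" "0 \<le> y * x'" "0 \<le> y' * x'" using n by auto
  moreover have "0 < y' * y' + x' * x'" using n(5) by (metis add_nonneg_pos add_pos_nonneg mult_pos_pos zero_le_square)
  ultimately show ?thesis by linarith
qed

subsection \<open>Minimal and maximal points\<close>

lemma stair_trans: "stair a b \<Longrightarrow> stair b c \<Longrightarrow> stair a c"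
  by (auto simp: stair_def)

lemma mins_spec:
  assumes "sorted_wrt lexlt B"
  shows "sorted_wrt stair (mins B)" "set (mins B) \<subseteq> set B" "b \<in> set B \<Longrightarrow> \<exists>c\<in>set (mins B). dominated c b"
proof -
  have "sorted_wrt (\<lambda>x y. stair y x) (fold minstep B []) \<and> set (fold minstep B []) \<subseteq> set B \<and>
      (\<forall>b\<in>set B. \<exists>c\<in>set (fold minstep B []). dominated c b)"
    using assms
  proof (induction B rule: rev_induct)
    case (snoc x B)
    define s where "s = fold minstep B []"
    have i: "sorted_wrt (\<lambda>x y. stair y x) s" "set s \<subseteq> set B" "\<forall>b\<in>set B. \<exists>c\<in>set s. dominated c b"
      using snoc by (auto simp: s_def sorted_wrt_append)
    have x: "lexlt b x" if "b \<in> set B" for b using snoc.prems that by (auto simp: sorted_wrt_append)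
    have f: "fold minstep (B @ [x]) [] = minstep x s" by (simp add: s_def)
    show ?case
    proof (cases s)
      case Nil
      then have "B = []" using i(3) by (cases B) auto
      then show ?thesis unfolding f using Nil by (simp add: minstep_def dominated_def)
    next
      case (Cons y ys)
      have yx: "lexlt y x" using x i(2) Cons by auto
      show ?thesis
      proof (cases "key2 x < key2 y")
        case True
        then have sx: "stair y x" using yx by (auto simp: lexlt_def stair_def)
        then have "\<forall>z\<in>set s. stair z x" using i(1) Cons stair_trans by auto
        then show ?thesis unfolding f using i True Cons by (auto simp: minstep_def dominated_def)
      next
        case False
        then have "dominated y x" using yx by (auto simp: lexlt_def dominated_def)
        then show ?thesis unfolding f using i False Cons by (auto simp: minstep_def)
      qed
    qed
  qed simp
  then show "sorted_wrt stair (mins B)" "set (mins B) \<subseteq> set B" "b \<in> set B \<Longrightarrow> \<exists>c\<in>set (mins B). dominated c b"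
    by (auto simp: mins_def sorted_wrt_rev)
qed

lemma maxs_spec:
  assumes "sorted_wrt lexlt A"
  shows "sorted_wrt stair (maxs A)" "set (maxs A) \<subseteq> set A" "a \<in> set A \<Longrightarrow> a \<notin> set (maxs A) \<Longrightarrow> \<exists>c\<in>set (maxs A). dominated a c"
proof -
  have "sorted_wrt stair (maxs A) \<and> set (maxs A) \<subseteq> set A \<and> (\<forall>a\<in>set A. a \<in> set (maxs A) \<or> (\<exists>c\<in>set (maxs A). dominated a c))"
    using assms
  proof (induction A)
    case (Cons x A)
    define s where "s = maxs A"
    have i: "sorted_wrt stair s" "set s \<subseteq> set A" "\<forall>a\<in>set A. a \<in> set s \<or> (\<exists>c\<in>set s. dominated a c)"
      using Cons by (auto simp: s_def)
    have x: "lexlt x b" if "b \<in> set A" for b using Cons.prems that by auto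
    have f: "maxs (x # A) = maxstep x s" by (simp add: s_def maxs_def)
    show ?case
    proof (cases s)
      case Nil
      then have "A = []" using i(3) by (cases A) auto
      then show ?thesis unfolding f using Nil by (simp add: maxstep_def)
    next
      case (Cons y ys)
      have yx: "lexlt x y" using x i(2) Cons by auto
      show ?thesis
      proof (cases "key2 y < key2 x")
        case True
        then have sx: "stair x y" using yx by (auto simp: lexlt_def stair_def)
        then have "\<forall>z\<in>set s. stair x z" using i(1) Cons stair_trans by auto
        then show ?thesis unfolding f using i True Cons by (auto simp: maxstep_def)
      next
        case False
        then have "dominated x y" using yx by (auto simp: lexlt_def dominated_def)
        then show ?thesis unfolding f using i False Cons by (auto simp: maxstep_def)
      qed
    qed
  qed (simp add: maxs_def)
  then show "sorted_wrt stair (maxs A)" "set (maxs A) \<subseteq> set A" "a \<in> set A \<Longrightarrow> a \<notin> set (maxs A) \<Longrightarrow> \<exists>c\<in>set (maxs A). dominated a c"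
    by auto
qed

lemma stair_lexlt: "sorted_wrt stair xs \<Longrightarrow> sorted_wrt lexlt xs"
  by (rule sorted_wrt_mono_rel[of _ stair]) (auto simp: stair_def lexlt_def)

text \<open>One simultaneous pass suffices because both lists are sorted by the same strict order:
  if the head of \<open>ys\<close> differs from the current element of \<open>B\<close>, it comes
  later in \<open>B\<close>, and so does the rest of \<open>ys\<close>.\<close>

lemma removes_filter:
  assumes "sorted_wrt lexlt ys" "sorted_wrt lexlt B" "set ys \<subseteq> set B" "inj_on key3 (set B)"
  shows "removes ys B = filter (\<lambda>x. x \<notin> set ys) B"
proof -
  have "snd (fold rmstep B (ys, kept)) = rev (filter (\<lambda>x. x \<notin> set ys) B) @ kept" for kept
    using assms
  proof (induction B arbitrary: ys kept)
    case (Cons x B)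
    have inj: "inj_on key3 (set B)" using Cons.prems(4) by (auto intro: inj_on_subset)
    have xB: "\<forall>z\<in>set B. lexlt x z" and sB: "sorted_wrt lexlt B" using Cons.prems(2) by auto
    show ?case
    proof (cases ys)
      case Nil
      then show ?thesis using Cons.IH[of "[]" "x # kept"] sB inj by (simp add: rmstep_def)
    next
      case ys: (Cons y ys')
      have yB: "y = x \<or> y \<in> set B" using Cons.prems(3) ys by auto
      show ?thesis
      proof (cases "y = x")
        case True
        have "x \<notin> set ys'" using Cons.prems(1) ys True lexlt_irrefl by auto
        then have "set ys' \<subseteq> set B" using Cons.prems(3) ys by auto
        moreover have "x \<notin> set B" using xB lexlt_irrefl by auto
        then have "filter (\<lambda>z. z \<notin> set ys') B = filter (\<lambda>z. z \<noteq> x \<and> z \<notin> set ys') B" by (intro filter_cong) auto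
        ultimately show ?thesis using Cons.IH[of ys' kept] Cons.prems(1) sB inj True ys by (simp add: rmstep_def)
      next
        case False
        then have k: "key3 y \<noteq> key3 x" using yB Cons.prems(4) by (auto simp: inj_on_def)
        have yx: "lexlt x y" using yB False xB by auto
        have "x \<notin> set ys"
        proof
          assume "x \<in> set ys"
          then have "lexlt y x" using Cons.prems(1) ys False by auto
          then show False using yx lexlt_trans lexlt_irrefl by blast
        qed
        moreover from this have "set ys \<subseteq> set B" using Cons.prems(3) by auto
        ultimately show ?thesis using Cons.IH[of ys "x # kept"] Cons.prems(1) sB inj k ys by (simp add: rmstep_def)
      qed
    qed
  qed simp
  from this[of "[]"] show ?thesis by (simp add: removes_def rev_filter[symmetric])
qed

subsection \<open>Divide and conquer for row minima\<close>

definition nearest :: "val \<Rightarrow> val set \<Rightarrow> val set" where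
  "nearest a X = {x \<in> X. \<forall>y\<in>X. sqd a x \<le> sqd a y}"

lemma nearest_nonempty:
  assumes "finite X" "X \<noteq> {}"
  obtains x where "x \<in> nearest a X"
  using arg_min_if_finite[OF assms, of "sqd a"] by (auto simp: nearest_def not_less)

text \<open>The minimizers are taken over all of \<open>C\<close> and not over the columns of the
  task; in this form the condition passes unchanged to subtasks.\<close>

definition covers :: "val list \<Rightarrow> task \<Rightarrow> bool" where
  "covers C = (\<lambda>(r, c). sorted_wrt stair c \<and> set c \<subseteq> set C \<and> (\<forall>a\<in>set r. nearest a (set C) \<subseteq> set c))"

definition all_dominated :: "val list \<Rightarrow> val list \<Rightarrow> bool" where
  "all_dominated A B \<longleftrightarrow> (\<forall>a\<in>set A. \<forall>b\<in>set B. dominated a b)"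

lemma taskstep_covers:
  assumes r: "sorted_wrt stair r" and d: "all_dominated r C"
    and c: "covers C (r, c)" and m: "length r \<le> 2 * m" "1 \<le> m"
  shows "concat (map fst (rev (taskstep (r, c) []))) = r \<and>
    (\<forall>t\<in>set (taskstep (r, c) []). covers C t \<and> length (fst t) \<le> m)"
proof (cases "2 \<le> length r")
  case False
  then show ?thesis using c m by (simp add: taskstep_def)
next
  case True
  define h where "h = length r div 2"
  define p where "p = last (take h r)"
  have h: "1 \<le> h" "h < length r" "length r - h \<le> m" "h \<le> m" using True m unfolding h_def by linarith+
  have "take h r \<noteq> []" using h by auto
  then have ph: "p \<in> set (take h r)" unfolding p_def by (rule last_in_set)
  have before: "a = p \<or> stair a p" if "a \<in> set (take h r)" for a
  proof -
    have t: "take h r = butlast (take h r) @ [p]" using ph unfolding p_def by (metis append_butlast_last_id empty_iff list.set(1))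
    have "sorted_wrt stair (take h r)" using r by (rule sorted_wrt_take)
    then have "\<forall>a\<in>set (butlast (take h r)). stair a p" by (subst (asm) t) (simp add: sorted_wrt_append)
    then show ?thesis using that by (subst (asm) t) auto
  qed
  have after: "stair p a" if "a \<in> set (drop h r)" for a
    using r that ph append_take_drop_id[of h r] by (metis sorted_wrt_append)
  have dm: "dominated a x" if "a \<in> set r" "x \<in> set C" for a x using d that by (auto simp: all_dominated_def)
  have pr: "p \<in> set r" using ph by (rule in_set_takeD)
  have cc: "sorted_wrt stair c" "set c \<subseteq> set C" "\<And>a. a \<in> set r \<Longrightarrow> nearest a (set C) \<subseteq> set c"
    using c by (auto simp: covers_def)
  obtain left right where lr: "snd (spl p c ([], [], [])) = (left, right)" by fastforce
  have st: "taskstep (r, c) [] = [(drop h r, right), (take h r, rev left)]"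
    using True lr by (simp add: taskstep_def Let_def h_def p_def)
  have "covers C (take h r, rev left) \<and> covers C (drop h r, right)"
  proof (cases "c = []")
    case True
    then have "left = []" "right = []" using lr by auto
    then show ?thesis using cc(3) True by (auto simp: covers_def dest: in_set_takeD in_set_dropD)
  next
    case False
    obtain a' x b' where x: "c = a' @ x # b'" "left = x # rev a'" "right = x # b'"
      "\<forall>y\<in>set a'. sqd p x \<le> sqd p y" "\<forall>y\<in>set b'. sqd p x < sqd p y"
      using spl_spec[OF False, of p] lr by auto
    have xC: "x \<in> set C" using cc(2) x(1) by auto
    have "nearest a (set C) \<subseteq> insert x (set a')" if a: "a \<in> set (take h r)" for a
    proof
      fix y assume y: "y \<in> nearest a (set C)"
      have yC: "y \<in> set C" "sqd a y \<le> sqd a x" using y xC by (auto simp: nearest_def)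
      have ar: "a \<in> set r" using a by (rule in_set_takeD)
      have "y \<notin> set b'"
      proof
        assume yb: "y \<in> set b'"
        then have xy: "stair x y" using cc(1) x(1) by (auto simp: sorted_wrt_append)
        \<comment> \<open>Here it matters that \<open>x\<close> is the last minimum of
          \<open>p\<close>: the strict inequality excludes \<open>a = p\<close>, and every other row
          of the first half precedes \<open>p\<close>, so that \<open>monotone_rows'\<close>
          applies.\<close>
        have l: "sqd p x < sqd p y" using x(5) yb by blast
        then have "a \<noteq> p" using yC(2) by auto
        then have "stair a p" using before[OF a] by blast
        from monotone_rows'[OF this xy dm dm less_imp_le[OF l]] ar pr xC yC show False by auto
      qed
      then show "y \<in> insert x (set a')" using cc(3)[OF ar] y x(1) by auto
    qed
    moreover have "nearest a (set C) \<subseteq> insert x (set b')" if a: "a \<in> set (drop h r)" for a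
    proof
      fix y assume y: "y \<in> nearest a (set C)"
      have yC: "y \<in> set C" "sqd a y \<le> sqd a x" using y xC by (auto simp: nearest_def)
      have ar: "a \<in> set r" using a by (rule in_set_dropD)
      have "y \<notin> set a'"
      proof
        assume ya: "y \<in> set a'"
        then have yx: "stair y x" using cc(1) x(1) by (auto simp: sorted_wrt_append)
        have l: "sqd p x \<le> sqd p y" using x(4) ya by blast
        from monotone_rows[OF after[OF a] yx dm dm l] ar pr xC yC show False by auto
      qed
      then show "y \<in> insert x (set b')" using cc(3)[OF ar] y x(1) by auto
    qed
    ultimately show ?thesis using cc(1,2) x(1-3) by (auto simp: covers_def sorted_wrt_append)
  qed
  then show ?thesis unfolding st using h by simp
qed

lemma taskpass_Cons: "taskpass (t # ts) = rev (taskstep t []) @ taskpass ts"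
proof -
  have acc: "taskstep t s = taskstep t [] @ s" for t s
    by (cases t) (simp add: taskstep_def Let_def)
  have "fold taskstep ts s = fold taskstep ts [] @ s" for s
  proof (induction ts arbitrary: s)
    case (Cons t ts)
    show ?case using Cons[of "taskstep t s"] Cons[of "taskstep t []"] acc[of t s] by simp
  qed simp
  from this[of "taskstep t []"] show ?thesis by (simp add: taskpass_def)
qed

lemma taskpass_covers:
  assumes "sorted_wrt stair (concat (map fst ts))" "all_dominated (concat (map fst ts)) C"
    "\<forall>t\<in>set ts. covers C t \<and> length (fst t) \<le> 2 * m" "1 \<le> m"
  shows "concat (map fst (taskpass ts)) = concat (map fst ts) \<and> (\<forall>t\<in>set (taskpass ts). covers C t \<and> length (fst t) \<le> m)"
  using assms
proof (induction ts)
  case (Cons t ts)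
  obtain r c where t: "t = (r, c)" by (cases t)
  have "concat (map fst (rev (taskstep (r, c) []))) = r \<and>
    (\<forall>t\<in>set (taskstep (r, c) []). covers C t \<and> length (fst t) \<le> m)"
    using Cons.prems unfolding t by (intro taskstep_covers) (auto simp: sorted_wrt_append all_dominated_def)
  moreover have "concat (map fst (taskpass ts)) = concat (map fst ts) \<and> (\<forall>t\<in>set (taskpass ts). covers C t \<and> length (fst t) \<le> m)"
    using Cons.prems by (intro Cons.IH) (auto simp: sorted_wrt_append all_dominated_def)
  ultimately show ?case unfolding taskpass_Cons t map_append concat_append set_append
    by auto
qed (simp add: taskpass_def)

lemma taskpasses_covers:
  assumes "sorted_wrt stair (concat (map fst ts))" "all_dominated (concat (map fst ts)) C"
    "\<forall>t\<in>set ts. covers C t \<and> length (fst t) \<le> 2 ^ k"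
  shows "concat (map fst ((taskpass ^^ k) ts)) = concat (map fst ts) \<and>
    (\<forall>t\<in>set ((taskpass ^^ k) ts). covers C t \<and> length (fst t) \<le> 1)"
  using assms
proof (induction k arbitrary: ts)
  case (Suc k)
  have p: "concat (map fst (taskpass ts)) = concat (map fst ts)" "\<forall>t\<in>set (taskpass ts). covers C t \<and> length (fst t) \<le> 2 ^ k"
    using taskpass_covers[OF Suc.prems(1,2), of "2 ^ k"] Suc.prems(3) by auto
  show ?case unfolding funpow_Suc_right comp_apply
    using Suc.IH[of "taskpass ts", unfolded p(1), OF Suc.prems(1,2) p(2)] .
qed simp

lemma leaves_spec:
  assumes "\<forall>t\<in>set ts. length (fst t) \<le> 1"
  shows "map fst (leaves ts) = rev (concat (map fst ts))"
    "set (leaves ts) \<subseteq> (\<Union>(r, c)\<in>set ts. (\<lambda>a. (a, amin a c)) ` set r)"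
proof -
  have "map fst (fold leafstep ts s) = rev (concat (map fst ts)) @ map fst s \<and>
      set (fold leafstep ts s) \<subseteq> set s \<union> (\<Union>(r, c)\<in>set ts. (\<lambda>a. (a, amin a c)) ` set r)" for s
    using assms
  proof (induction ts arbitrary: s)
    case (Cons t ts)
    obtain r c where t: "t = (r, c)" by (cases t)
    have l: "\<forall>t\<in>set ts. length (fst t) \<le> 1" using Cons.prems by (meson list.set_intros(2))
    show ?case
    proof (cases r)
      case Nil
      have f: "fold leafstep (t # ts) s = fold leafstep ts s" by (simp add: t Nil leafstep_def)
      show ?thesis unfolding f using Cons.IH[OF l, of s] by (simp add: t Nil)
    next
      case r: (Cons p r')
      then have r': "r = [p]" using Cons.prems by (simp add: t)
      have f: "fold leafstep (t # ts) s = fold leafstep ts ((p, amin p c) # s)" by (simp add: t r' leafstep_def)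
      show ?thesis unfolding f using Cons.IH[OF l, of "(p, amin p c) # s"] by (simp add: t r' insert_commute)
    qed
  qed simp
  from this[of "[]"] show "map fst (leaves ts) = rev (concat (map fst ts))"
    "set (leaves ts) \<subseteq> (\<Union>(r, c)\<in>set ts. (\<lambda>a. (a, amin a c)) ` set r)"
    by (simp_all add: leaves_def)
qed

lemma rowmin_spec:
  assumes "sorted_wrt stair rws" "sorted_wrt stair C" "all_dominated rws C"
  shows "map fst (leaves (rowmin rws C)) = rev rws"
    "(a, b) \<in> set (leaves (rowmin rws C)) \<Longrightarrow> sorted_wrt (\<lambda>x y. stair y x) b \<and> set b = nearest a (set C)"
proof -
  define ts where "ts = rowmin rws C"
  have "covers C (rws, C)" using assms(2) by (auto simp: covers_def nearest_def)
  then have c: "\<forall>t\<in>set [(rws, C)]. covers C t \<and> length (fst t) \<le> 2 ^ lg (length rws)"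
    using le_two_lg by simp
  have k: "concat (map fst [(rws, C)]) = rws" by simp
  have ts: "concat (map fst ts) = rws" "\<forall>t\<in>set ts. covers C t \<and> length (fst t) \<le> 1"
    using taskpasses_covers[of "[(rws, C)]" C, unfolded k, OF assms(1,3) c] by (simp_all add: ts_def rowmin_def)
  have l: "\<forall>t\<in>set ts. length (fst t) \<le> 1" using ts(2) by blast
  show "map fst (leaves (rowmin rws C)) = rev rws"
    using leaves_spec(1)[OF l] ts(1) unfolding ts_def[symmetric] by simp
  assume "(a, b) \<in> set (leaves (rowmin rws C))"
  then obtain r c where rc: "(r, c) \<in> set ts" "a \<in> set r" "b = amin a c"
    using leaves_spec(2)[OF l] unfolding ts_def[symmetric] by blast
  have c: "sorted_wrt stair c" "set c \<subseteq> set C" "nearest a (set C) \<subseteq> set c"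
  proof -
    have "covers C (r, c)" using ts(2) rc(1) by blast
    then show "sorted_wrt stair c" "set c \<subseteq> set C" "nearest a (set C) \<subseteq> set c" using rc(2) by (auto simp: covers_def)
  qed
  have "sorted_wrt stair (rev b)" unfolding rc(3) amin_spec by (rule sorted_wrt_filter[OF c(1)])
  moreover have "set b = nearest a (set c)" using arg_cong[OF amin_spec[of a c], of set] rc(3) by (auto simp: nearest_def)
  \<comment> \<open>As \<open>c\<close> contains a minimizer over \<open>C\<close>, minimizing over
    \<open>c\<close> or over \<open>C\<close> gives the same set.\<close>
  moreover have "nearest a (set c) = nearest a (set C)"
  proof (cases "set C = {}")
    case False
    obtain m where "m \<in> nearest a (set C)" using nearest_nonempty[OF finite_set False] .
    then have m: "m \<in> set c" "\<forall>y\<in>set C. sqd a m \<le> sqd a y" using c(3) by (auto simp: nearest_def)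
    then show ?thesis using c(2,3) unfolding nearest_def by (blast intro: order_trans)
  qed (use c in simp)
  ultimately show "sorted_wrt (\<lambda>x y. stair y x) b \<and> set b = nearest a (set C)" by (simp add: sorted_wrt_rev)
qed

subsection \<open>Columns near the minima of a row\<close>

lemma fold_pushstep:
  assumes "sorted_wrt (\<lambda>x y. R y x) acc" "sorted_wrt R b" "\<forall>y\<in>set acc. \<forall>x\<in>set b. y = x \<or> R y x"
    "inj_on key3 (set acc \<union> set b)" "transp R"
  shows "sorted_wrt (\<lambda>x y. R y x) (fold pushstep b acc) \<and> set (fold pushstep b acc) = set acc \<union> set b"
  using assms(1-4)
proof (induction b arbitrary: acc)
  case (Cons x b)
  have x: "\<forall>z\<in>set b. R x z" "sorted_wrt R b" using Cons.prems(2) by auto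
  show ?case
  proof (cases "\<exists>acc'. acc = x # acc'")
    case True
    then have p: "pushstep x acc = acc" "x \<in> set acc" by (auto simp: pushstep_def)
    have "inj_on key3 (set acc \<union> set b)" using Cons.prems(4) by (rule inj_on_subset) auto
    from Cons.IH[OF Cons.prems(1) x(2) _ this] show ?thesis using Cons.prems(3) p by auto
  next
    case False
    have p: "pushstep x acc = x # acc"
    proof (cases acc)
      case (Cons y acc')
      then have "y \<noteq> x" using False by auto
      then have "key3 x \<noteq> key3 y" using inj_onD[OF Cons.prems(4), of x y] Cons by auto
      then show ?thesis by (simp add: pushstep_def Cons)
    qed (simp add: pushstep_def)
    have "\<forall>z\<in>set acc. R z x"
    proof (cases acc)
      case (Cons y acc')
      then have "R y x" using False Cons.prems(3) by auto
      moreover have "\<forall>z\<in>set acc'. R z y" using Cons.prems(1) Cons by auto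
      ultimately show ?thesis using Cons assms(5) by (auto dest: transpD)
    qed simp
    then have "sorted_wrt (\<lambda>x y. R y x) (x # acc)" using Cons.prems(1) by simp
    from Cons.IH[OF this x(2)] show ?thesis using Cons.prems(3,4) p x(1) by auto
  qed
qed simp

lemma in_take_if_few_before:
  assumes "sorted_wrt R xs" "c \<in> set xs" "finite S" "\<And>y. y \<in> set xs \<Longrightarrow> R y c \<Longrightarrow> y \<in> S" "card S \<le> k"
    "irreflp R"
  shows "c \<in> set (take (Suc k) xs)"
proof -
  obtain pre post where xs: "xs = pre @ c # post" using assms(2) by (meson split_list)
  have "set pre \<subseteq> S" using assms(1,4) by (auto simp: xs sorted_wrt_append)
  moreover have "distinct pre"
    using assms(1,6) by (auto simp: xs sorted_wrt_append strict_sorted_iff) (induction pre, auto dest: irreflpD)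
  ultimately have "length pre \<le> k" using card_mono[OF assms(3)] assms(5) by (metis distinct_card le_trans)
  then show ?thesis by (simp add: xs take_Cons')
qed

text \<open>Stated for an arbitrary order \<open>R\<close>, because the two sweeps use it with
  \<open>stair\<close> and with the converse of \<open>stair\<close>. Each sweep captures the pairs
  in which the column is nearest to the row itself or to a row visited before.\<close>

lemma windows:
  assumes R: "transp R" "irreflp R" and C: "finite C" "inj_on key3 C" "\<And>x y. x \<in> C \<Longrightarrow> y \<in> C \<Longrightarrow> x = y \<or> R x y \<or> R y x"
    and tm: "\<And>a1 a2 c1 c2. a1 \<in> A \<Longrightarrow> a2 \<in> A \<Longrightarrow> c1 \<in> C \<Longrightarrow> c2 \<in> C \<Longrightarrow> R a1 a2 \<Longrightarrow> R c1 c2 \<Longrightarrow>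
      sqd a1 c2 \<le> sqd a1 c1 \<Longrightarrow> sqd a2 c2 < sqd a2 c1"
    and bs: "sorted_wrt R (map fst bs)" "fst ` set bs \<subseteq> A" "\<forall>(a, b)\<in>set bs. sorted_wrt R b \<and> set b = nearest a C"
  shows "sorted_wrt (\<lambda>x y. R y x) (fst (fold winstep bs ([], out))) \<and>
    set (fst (fold winstep bs ([], out))) = (\<Union>a\<in>fst ` set bs. nearest a C) \<and>
    (\<forall>a\<in>fst ` set bs. \<forall>a'\<in>fst ` set bs. \<forall>c\<in>nearest a' C. a' = a \<or> R a' a \<longrightarrow>
       card {y \<in> C. sqd a y < sqd a c} \<le> 16 \<longrightarrow> CellV a c \<in> set (snd (fold winstep bs ([], out)))) \<and>
    set (snd (fold winstep bs ([], out))) \<subseteq> set out \<union> {CellV a c | a c. a \<in> fst ` set bs \<and> c \<in> C} \<and>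
    set out \<subseteq> set (snd (fold winstep bs ([], out)))"
  using bs
proof (induction bs rule: rev_induct)
  case (snoc x bs)
  obtain a b where x: "x = (a, b)" by (cases x)
  obtain acc o1 where w: "fold winstep bs ([], out) = (acc, o1)" by fastforce
  have i: "sorted_wrt (\<lambda>x y. R y x) acc" "set acc = (\<Union>a\<in>fst ` set bs. nearest a C)"
    "\<And>a a' c. a \<in> fst ` set bs \<Longrightarrow> a' \<in> fst ` set bs \<Longrightarrow> c \<in> nearest a' C \<Longrightarrow> a' = a \<or> R a' a \<Longrightarrow>
       card {y \<in> C. sqd a y < sqd a c} \<le> 16 \<Longrightarrow> CellV a c \<in> set o1"
    "set o1 \<subseteq> set out \<union> {CellV a c | a c. a \<in> fst ` set bs \<and> c \<in> C}" "set out \<subseteq> set o1"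
    using snoc unfolding w by (auto simp: sorted_wrt_append)
  have Ra: "R a' a" "a' \<in> A" if "a' \<in> fst ` set bs" for a'
    using snoc.prems(1,2) that by (auto simp: x sorted_wrt_append)
  have aA: "a \<in> A" using snoc.prems(2) by (simp add: x)
  have b: "sorted_wrt R b" "set b = nearest a C" using snoc.prems(3) by (auto simp: x)
  have f: "fold winstep (bs @ [x]) ([], out) = (fold pushstep b acc, rev (map (CellV a) b) @ rev (map (CellV a) (take 17 acc)) @ o1)"
  proof -
    have "winstep (a, b) (acc, o1) = (fold pushstep b acc, rev (map (CellV a) b) @ rev (map (CellV a) (take 17 acc)) @ o1)"
      by (simp add: winstep_def)
    then show ?thesis by (simp add: w x)
  qed
  \<comment> \<open>If \<open>z\<close> preceded \<open>y\<close>, total monotonicity would turn the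
    preference of the earlier row for \<open>y\<close> into a strict one of \<open>a\<close>, and
    \<open>z\<close> would be no minimum of \<open>a\<close>. Hence the stack stays sorted.\<close>
  have ord: "y = z \<or> R y z" if y: "y \<in> set acc" and z: "z \<in> set b" for y z
  proof (rule ccontr)
    assume n: "\<not> (y = z \<or> R y z)"
    obtain a' where a': "a' \<in> fst ` set bs" "y \<in> nearest a' C" using y i(2) by auto
    have C': "y \<in> C" "z \<in> C" "sqd a' y \<le> sqd a' z" "sqd a z \<le> sqd a y"
      using a'(2) z b(2) by (auto simp: nearest_def)
    then have "R z y" using n C(3)[of y z] by auto
    from tm[OF Ra(2)[OF a'(1)] aA C'(2,1) Ra(1)[OF a'(1)] this C'(3)] C'(4) show False by simp
  qed
  have sub: "set acc \<union> set b \<subseteq> C" using i(2) b(2) by (auto simp: nearest_def)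
  have p: "sorted_wrt (\<lambda>x y. R y x) (fold pushstep b acc)" "set (fold pushstep b acc) = set acc \<union> set b"
    using fold_pushstep[OF i(1) b(1) _ inj_on_subset[OF C(2) sub] R(1)] ord by auto
  have cap: "CellV u c \<in> set (snd (fold winstep (bs @ [x]) ([], out)))"
    if u: "u \<in> fst ` set (bs @ [x])" "u' \<in> fst ` set (bs @ [x])" "c \<in> nearest u' C" "u' = u \<or> R u' u"
      and few: "card {y \<in> C. sqd u y < sqd u c} \<le> 16" for u u' c
  proof (cases "u \<in> fst ` set bs")
    case True
    have "u' \<noteq> a" using Ra(1)[OF True] u(4) R by (auto dest: transpD irreflpD)
    then have "u' \<in> fst ` set bs" using u(2) by (auto simp: x)
    from i(3)[OF True this u(3,4) few] show ?thesis unfolding f by simp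
  next
    case False
    then have ua: "u = a" using u(1) by (auto simp: x)
    show ?thesis
    proof (cases "c \<in> set b")
      case True
      then show ?thesis unfolding f by (simp add: ua)
    next
      case False
      then have "u' \<in> fst ` set bs" using u(2,3) b(2) by (auto simp: x)
      then have ca: "c \<in> set acc" "c \<in> C" using u(3) i(2) by (auto simp: nearest_def)
      \<comment> \<open>The columns above \<open>c\<close> on the stack are minima of earlier rows,
        so by total monotonicity they are strictly closer to \<open>a\<close> than \<open>c\<close>
        is. There are at most 16 of them, hence \<open>c\<close> is among the top 17.\<close>
      have "c \<in> set (take (Suc 16) acc)"
      proof (rule in_take_if_few_before[OF i(1) ca(1) _ _ few])
        fix y assume y: "y \<in> set acc" "R c y"
        obtain a' where a': "a' \<in> fst ` set bs" "y \<in> nearest a' C" using y i(2) by auto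
        then have y': "y \<in> C" "sqd a' y \<le> sqd a' c" using ca(2) by (auto simp: nearest_def)
        from tm[OF Ra(2)[OF a'(1)] aA ca(2) y'(1) Ra(1)[OF a'(1)] y(2) y'(2)]
        show "y \<in> {y \<in> C. sqd u y < sqd u c}" using y' by (simp add: ua)
      qed (use C(1) R(2) in \<open>auto simp: irreflp_def\<close>)
      then show ?thesis unfolding f by (simp add: ua)
    qed
  qed
  have "set (snd (fold winstep (bs @ [x]) ([], out))) \<subseteq> set out \<union> {CellV a c | a c. a \<in> fst ` set (bs @ [x]) \<and> c \<in> C}"
  proof
    fix z assume "z \<in> set (snd (fold winstep (bs @ [x]) ([], out)))"
    then have "z \<in> set o1 \<or> z \<in> CellV a ` (set b \<union> set acc)" unfolding f by (auto dest: in_set_takeD)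
    then show "z \<in> set out \<union> {CellV a c | a c. a \<in> fst ` set (bs @ [x]) \<and> c \<in> C}"
    proof
      assume "z \<in> set o1"
      then have "z \<in> set out \<or> z \<in> {CellV a c | a c. a \<in> fst ` set bs \<and> c \<in> C}" using i(4) by blast
      moreover have "fst ` set bs \<subseteq> fst ` set (bs @ [x])" by auto
      ultimately show ?thesis by blast
    next
      assume "z \<in> CellV a ` (set b \<union> set acc)"
      then obtain y where "y \<in> C" "z = CellV a y" using sub by blast
      moreover have "a \<in> fst ` set (bs @ [x])" by (simp add: x)
      ultimately show ?thesis by blast
    qed
  qed
  moreover have "set (fst (fold winstep (bs @ [x]) ([], out))) = (\<Union>a\<in>fst ` set (bs @ [x]). nearest a C)"
    using p(2) i(2) b(2) unfolding f by (auto simp: x)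
  moreover have "set out \<subseteq> set (snd (fold winstep (bs @ [x]) ([], out)))" using i(5) unfolding f by auto
  ultimately show ?case using p(1) cap by (simp only: f fst_conv snd_conv) blast
qed simp

lemma fst_flips: "map fst (flips bs) = rev (map fst bs)"
  by (simp add: flips_def rev_map[symmetric] comp_def split_def)

lemma in_flips: "(a, b) \<in> set (flips bs) \<longleftrightarrow> (a, rev b) \<in> set bs"
  by (force simp: flips_def)

lemma roundf_spec:
  assumes rws: "sorted_wrt stair rws" and B: "sorted_wrt lexlt B" "inj_on key3 (set B)" and dom: "all_dominated rws B"
  defines "opt \<equiv> (\<Union>a\<in>set rws. nearest a (set (mins B)))"
  shows "fst (roundf rws (B, [])) = filter (\<lambda>x. x \<notin> opt) B"
    "a \<in> set rws \<Longrightarrow> c \<in> opt \<Longrightarrow> card {y \<in> set B. sqd a y < sqd a c} \<le> 16 \<Longrightarrow> CellV a c \<in> set (snd (roundf rws (B, [])))"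
    "set (snd (roundf rws (B, []))) \<subseteq> {CellV a c | a c. a \<in> set rws \<and> c \<in> set B}"
proof -
  define C where "C = mins B"
  define lv where "lv = leaves_of rws B"
  define w where "w = fold winstep (flips lv) ([], [])"
  define v where "v = fold winstep lv ([], snd w)"
  have r: "roundf rws (B, []) = (removes (rev (fst w)) B, snd v)"
    by (simp add: roundf_def Let_def w_def v_def lv_def)
  have C: "sorted_wrt stair C" "set C \<subseteq> set B" using mins_spec[OF B(1)] by (auto simp: C_def)
  have dC: "all_dominated rws C" using dom C(2) by (auto simp: all_dominated_def)
  then have dd: "a \<in> set rws \<Longrightarrow> c \<in> set C \<Longrightarrow> dominated a c" for a c by (auto simp: all_dominated_def)
  have lv: "map fst lv = rev rws"
    "(a, b) \<in> set lv \<Longrightarrow> sorted_wrt (\<lambda>x y. stair y x) b \<and> set b = nearest a (set C)" for a b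
    using rowmin_spec[OF rws C(1) dC] unfolding lv_def leaves_of_def C_def[symmetric] by blast+
  have tot: "x = y \<or> stair x y \<or> stair y x" if "x \<in> set C" "y \<in> set C" for x y
    using C(1) that by (induction C) auto
  have sl: "fst ` set lv = set rws" "fst ` set (flips lv) = set rws"
    using arg_cong[OF lv(1), of set] fst_flips[of lv] by (simp_all flip: set_map)
  have k: "inj_on key3 (set C)" using B(2) C(2) by (rule inj_on_subset)
  have tr: "transp stair" "irreflp stair" "transp (\<lambda>x y. stair y x)" "irreflp (\<lambda>x y. stair y x)"
    by (auto simp: transp_def irreflp_def stair_def)
  have W: "sorted_wrt (\<lambda>x y. stair y x) (fst w) \<and> set (fst w) = opt \<and>
    (\<forall>a\<in>set rws. \<forall>a'\<in>set rws. \<forall>c\<in>nearest a' (set C). a' = a \<or> stair a' a \<longrightarrow>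
       card {y \<in> set C. sqd a y < sqd a c} \<le> 16 \<longrightarrow> CellV a c \<in> set (snd w)) \<and>
    set (snd w) \<subseteq> set [] \<union> {CellV a c | a c. a \<in> set rws \<and> c \<in> set C} \<and> set [] \<subseteq> set (snd w)"
    unfolding w_def opt_def sl(2)[symmetric] C_def[symmetric]
  proof (rule windows[where A = "set rws", OF tr(1,2) _ k tot])
    show "sqd a2 c2 < sqd a2 c1" if "a1 \<in> set rws" "a2 \<in> set rws" "c1 \<in> set C" "c2 \<in> set C"
      "stair a1 a2" "stair c1 c2" "sqd a1 c2 \<le> sqd a1 c1" for a1 a2 c1 c2
      by (rule monotone_rows[OF that(5,6) dd dd that(7)]) (use that in auto)
    show "sorted_wrt stair (map fst (flips lv))" by (simp add: fst_flips lv(1) rws)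
    show "\<forall>(a, b)\<in>set (flips lv). sorted_wrt stair b \<and> set b = nearest a (set C)"
      using lv(2) by (fastforce simp: in_flips sorted_wrt_rev)
  qed (use sl in auto)
  have V: "sorted_wrt (\<lambda>x y. stair x y) (fst v) \<and> set (fst v) = opt \<and>
    (\<forall>a\<in>set rws. \<forall>a'\<in>set rws. \<forall>c\<in>nearest a' (set C). a' = a \<or> stair a a' \<longrightarrow>
       card {y \<in> set C. sqd a y < sqd a c} \<le> 16 \<longrightarrow> CellV a c \<in> set (snd v)) \<and>
    set (snd v) \<subseteq> set (snd w) \<union> {CellV a c | a c. a \<in> set rws \<and> c \<in> set C} \<and> set (snd w) \<subseteq> set (snd v)"
    unfolding v_def opt_def sl(1)[symmetric] C_def[symmetric]
  proof (rule windows[where A = "set rws" and R = "\<lambda>x y. stair y x", OF tr(3,4) _ k])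
    show "sqd a2 c2 < sqd a2 c1" if "a1 \<in> set rws" "a2 \<in> set rws" "c1 \<in> set C" "c2 \<in> set C"
      "stair a2 a1" "stair c2 c1" "sqd a1 c2 \<le> sqd a1 c1" for a1 a2 c1 c2
      by (rule monotone_rows'[OF that(5,6) dd dd that(7)]) (use that in auto)
    show "sorted_wrt (\<lambda>x y. stair y x) (map fst lv)" by (simp add: lv(1) sorted_wrt_rev rws)
    show "\<forall>(a, b)\<in>set lv. sorted_wrt (\<lambda>x y. stair y x) b \<and> set b = nearest a (set C)"
      using lv(2) by blast
    show "x = y \<or> stair y x \<or> stair x y" if "x \<in> set C" "y \<in> set C" for x y using tot[OF that] by blast
  qed (use sl in auto)
  have rw: "sorted_wrt stair (rev (fst w))" "set (rev (fst w)) = opt"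
    using conjunct1[OF W] conjunct1[OF conjunct2[OF W]] by (simp_all add: sorted_wrt_rev)
  have "opt \<subseteq> set B" using C(2) by (auto simp: opt_def nearest_def C_def)
  then show "fst (roundf rws (B, [])) = filter (\<lambda>x. x \<notin> opt) B"
    using removes_filter[OF stair_lexlt[OF rw(1)] B(1) _ B(2)] rw(2) by (simp add: r)
  show "set (snd (roundf rws (B, []))) \<subseteq> {CellV a c | a c. a \<in> set rws \<and> c \<in> set B}"
  proof
    fix z assume "z \<in> set (snd (roundf rws (B, [])))"
    then have "z \<in> set (snd w) \<union> {CellV a c | a c. a \<in> set rws \<and> c \<in> set C}"
      using conjunct1[OF conjunct2[OF conjunct2[OF conjunct2[OF V]]]] by (simp add: r subset_iff)
    then have "z \<in> {CellV a c | a c. a \<in> set rws \<and> c \<in> set C}"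
      using conjunct1[OF conjunct2[OF conjunct2[OF conjunct2[OF W]]]] by auto
    then show "z \<in> {CellV a c | a c. a \<in> set rws \<and> c \<in> set B}" using C(2) by auto
  qed
  assume a: "a \<in> set rws" and c: "c \<in> opt" and few: "card {y \<in> set B. sqd a y < sqd a c} \<le> 16"
  obtain a' where a': "a' \<in> set rws" "c \<in> nearest a' (set C)" using c by (auto simp: opt_def C_def)
  have "card {y \<in> set C. sqd a y < sqd a c} \<le> card {y \<in> set B. sqd a y < sqd a c}"
    using C(2) by (intro card_mono) auto
  then have few': "card {y \<in> set C. sqd a y < sqd a c} \<le> 16" using few by simp
  \<comment> \<open>The row to which \<open>c\<close> is nearest is \<open>a\<close> itself or lies
    on one side of it; one of the two sweeps pairs \<open>a\<close> with \<open>c\<close> in each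
    case.\<close>
  have "a = a' \<or> stair a a' \<or> stair a' a" using rws a a'(1) by (induction rws) auto
  then have "CellV a c \<in> set (snd v)"
  proof (elim disjE)
    assume "stair a' a"
    then have "CellV a c \<in> set (snd w)" using W a a' few' by blast
    then show ?thesis using V by blast
  qed (use V a a' few' in blast)+
  then show "CellV a c \<in> set (snd (roundf rws (B, [])))" by (simp add: r)
qed

subsection \<open>Rounds and layers\<close>

definition plane_inj :: "val set \<Rightarrow> bool" where
  "plane_inj X \<longleftrightarrow> (\<forall>x\<in>X. \<forall>y\<in>X. key1 x = key1 y \<longrightarrow> key2 x = key2 y \<longrightarrow> x = y)"

text \<open>A point of \<open>B\<close> that survives a round has lost a point closer to \<open>a\<close>, namely a nearest
  minimal point; 17 rounds therefore reach every point with at most 16 closer ones.\<close>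

lemma rounds_spec:
  assumes rws: "sorted_wrt stair rws" and B: "sorted_wrt lexlt B" "inj_on key3 (set B)" "plane_inj (set B)"
    and dom: "all_dominated rws B"
  shows "a \<in> set rws \<Longrightarrow> b \<in> set B \<Longrightarrow> card {y \<in> set B. sqd a y < sqd a b} \<le> 16 \<Longrightarrow> CellV a b \<in> set (rounds rws B [])"
    "set (rounds rws B []) \<subseteq> {CellV a c | a c. a \<in> set rws \<and> c \<in> set B}"
proof -
  define f where "f k = (roundf rws ^^ k) (B, [])" for k
  have "sorted_wrt lexlt (fst (f k)) \<and> set (fst (f k)) \<subseteq> set B \<and>
      set (snd (f k)) \<subseteq> {CellV a c | a c. a \<in> set rws \<and> c \<in> set B} \<and>
      (\<forall>a\<in>set rws. \<forall>b\<in>set B. card {y \<in> set B. sqd a y < sqd a b} \<le> 16 \<longrightarrow> CellV a b \<in> set (snd (f k)) \<or>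
        b \<in> set (fst (f k)) \<and> k \<le> card {y \<in> set B - set (fst (f k)). sqd a y < sqd a b})" for k
  proof (induction k)
    case (Suc k)
    define B' where "B' = fst (f k)"
    define opt where "opt = (\<Union>a\<in>set rws. nearest a (set (mins B')))"
    have B': "sorted_wrt lexlt B'" "set B' \<subseteq> set B" and o: "set (snd (f k)) \<subseteq> {CellV a c | a c. a \<in> set rws \<and> c \<in> set B}"
      using Suc by (simp_all add: B'_def)
    have i: "CellV a b \<in> set (snd (f k)) \<or> b \<in> set B' \<and> k \<le> card {y \<in> set B - set B'. sqd a y < sqd a b}"
      if "a \<in> set rws" "b \<in> set B" "card {y \<in> set B. sqd a y < sqd a b} \<le> 16" for a b
      using Suc that unfolding B'_def by blast
    have kinj: "inj_on key3 (set B')" using B(2) B'(2) by (rule inj_on_subset)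
    have dom': "all_dominated rws B'" using dom B'(2) by (auto simp: all_dominated_def)
    note r = roundf_spec[OF rws B'(1) kinj dom', folded opt_def]
    have s: "f (Suc k) = (filter (\<lambda>x. x \<notin> opt) B', snd (roundf rws (B', [])) @ snd (f k))"
    proof -
      have "f (Suc k) = roundf rws (B', snd (f k))" by (simp add: f_def B'_def)
      then show ?thesis by (subst (asm) roundf_acc) (simp add: r(1))
    qed
    have step: "CellV a b \<in> set (snd (f (Suc k))) \<or>
        b \<in> set (fst (f (Suc k))) \<and> Suc k \<le> card {y \<in> set B - set (fst (f (Suc k))). sqd a y < sqd a b}"
      if ab: "a \<in> set rws" "b \<in> set B" and few: "card {y \<in> set B. sqd a y < sqd a b} \<le> 16" for a b
      using i[OF ab few]
    proof (elim disjE conjE)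
      assume bB: "b \<in> set B'" and k: "k \<le> card {y \<in> set B - set B'. sqd a y < sqd a b}"
      show ?thesis
      proof (cases "b \<in> opt")
        case True
        have "card {y \<in> set B'. sqd a y < sqd a b} \<le> card {y \<in> set B. sqd a y < sqd a b}"
          using B'(2) by (intro card_mono) auto
        then have "CellV a b \<in> set (snd (roundf rws (B', [])))" using few by (intro r(2)[OF ab(1) True]) simp
        then show ?thesis by (simp add: s)
      next
        case False
        obtain c where c: "c \<in> set (mins B')" "dominated c b" using mins_spec(3)[OF B'(1) bB] by blast
        have mB: "set (mins B') \<subseteq> set B'" by (rule mins_spec(2)[OF B'(1)])
        have ne: "set (mins B') \<noteq> {}" using c(1) by auto
        obtain m where m: "m \<in> nearest a (set (mins B'))" using nearest_nonempty[OF finite_set ne] .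
        then have mo: "m \<in> opt" "m \<in> set B'" using ab(1) mB by (auto simp: opt_def nearest_def)
        have "sqd a m < sqd a b"
        proof (cases "c = b")
          case True
          \<comment> \<open>All nearest columns are in \<open>opt\<close>, also the tied ones; a
            minimal point outside \<open>opt\<close> is therefore strictly farther than the
            minimum.\<close>
          then have "b \<notin> nearest a (set (mins B'))" using False ab(1) by (auto simp: opt_def)
          then obtain y where "y \<in> set (mins B')" "sqd a y < sqd a b" using c(1) True by (auto simp: nearest_def)
          then show ?thesis using m by (force simp: nearest_def)
        next
          case False
          have "dominated a c" using dom' ab(1) c(1) mB by (auto simp: all_dominated_def)
          moreover have "key1 c \<noteq> key1 b \<or> key2 c \<noteq> key2 b"
            using B(3) False c(1) mB B'(2) ab(2) unfolding plane_inj_def by blast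
          ultimately have "sqd a c < sqd a b" using c(2) by (intro dominated_closer)
          moreover have "sqd a m \<le> sqd a c" using m c(1) by (auto simp: nearest_def)
          ultimately show ?thesis by simp
        qed
        then have "insert m {y \<in> set B - set B'. sqd a y < sqd a b} \<subseteq> {y \<in> set B - set (fst (f (Suc k))). sqd a y < sqd a b}"
          using mo B'(2) by (auto simp: s)
        then have "card (insert m {y \<in> set B - set B'. sqd a y < sqd a b}) \<le> card {y \<in> set B - set (fst (f (Suc k))). sqd a y < sqd a b}"
          by (intro card_mono) auto
        then have "Suc k \<le> card {y \<in> set B - set (fst (f (Suc k))). sqd a y < sqd a b}" using k mo(2) by simp
        moreover have "b \<in> set (fst (f (Suc k)))" using bB False by (simp add: s)
        ultimately show ?thesis by blast
      qed
    qed (simp add: s)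
    have "sorted_wrt lexlt (fst (f (Suc k)))" using B'(1) by (simp add: s sorted_wrt_filter)
    moreover have "set (fst (f (Suc k))) \<subseteq> set B" using B'(2) by (auto simp: s)
    moreover have "set (snd (f (Suc k))) \<subseteq> {CellV a c | a c. a \<in> set rws \<and> c \<in> set B}"
      using r(3) o B'(2) unfolding s snd_conv set_append by blast
    ultimately show ?case using step by blast
  qed (use B(1) in \<open>simp add: f_def\<close>)
  note f = this[of 17]
  have rf: "rounds rws B [] = snd (f 17)" by (simp add: rounds_def f_def)
  show "set (rounds rws B []) \<subseteq> {CellV a c | a c. a \<in> set rws \<and> c \<in> set B}" using f unfolding rf by blast
  assume ab: "a \<in> set rws" "b \<in> set B" and few: "card {y \<in> set B. sqd a y < sqd a b} \<le> 16"
  have "card {y \<in> set B - set (fst (f 17)). sqd a y < sqd a b} \<le> card {y \<in> set B. sqd a y < sqd a b}"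
    by (intro card_mono) auto
  then have "\<not> 17 \<le> card {y \<in> set B - set (fst (f 17)). sqd a y < sqd a b}" using few by simp
  then show "CellV a b \<in> set (rounds rws B [])" using f ab few unfolding rf by blast
qed

text \<open>A point of \<open>A\<close> that survives the removal of a layer is dominated by a point of that layer,
  which is closer to it than every point of \<open>B\<close>.\<close>

lemma nodef_spec:
  assumes A: "sorted_wrt lexlt A" "inj_on key3 (set A)" and B: "sorted_wrt lexlt B" "inj_on key3 (set B)"
    and AB: "plane_inj (set A \<union> set B)" "set A \<inter> set B = {}" "all_dominated A B"
  shows "a \<in> set A \<Longrightarrow> b \<in> set B \<Longrightarrow>
      card {c \<in> set A \<union> set B. dominated a c \<and> c \<noteq> a \<and> sqd a c < sqd a b} \<le> 16 \<Longrightarrow> CellV a b \<in> set (nodef A B [])"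
    "set (nodef A B []) \<subseteq> {CellV a c | a c. a \<in> set A \<and> c \<in> set B}"
proof -
  define f where "f k = (nodestep B ^^ k) (A, [])" for k
  define near where "near a b = {c \<in> set A \<union> set B. dominated a c \<and> c \<noteq> a \<and> sqd a c < sqd a b}" for a b
  have fin: "finite (near a b)" for a b by (simp add: near_def)
  have "sorted_wrt lexlt (fst (f k)) \<and> set (fst (f k)) \<subseteq> set A \<and>
      set (snd (f k)) \<subseteq> {CellV a c | a c. a \<in> set A \<and> c \<in> set B} \<and>
      (\<forall>a\<in>set A. \<forall>b\<in>set B. card (near a b) \<le> 16 \<longrightarrow> CellV a b \<in> set (snd (f k)) \<or>
        a \<in> set (fst (f k)) \<and> k \<le> card (near a b - set (fst (f k)) - set B))" for k
  proof (induction k)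
    case (Suc k)
    define A' where "A' = fst (f k)"
    have A': "sorted_wrt lexlt A'" "set A' \<subseteq> set A" and o: "set (snd (f k)) \<subseteq> {CellV a c | a c. a \<in> set A \<and> c \<in> set B}"
      using Suc by (simp_all add: A'_def)
    have i: "CellV a b \<in> set (snd (f k)) \<or> a \<in> set A' \<and> k \<le> card (near a b - set A' - set B)"
      if "a \<in> set A" "b \<in> set B" "card (near a b) \<le> 16" for a b
      using Suc that unfolding A'_def by blast
    have kinj: "inj_on key3 (set A')" using A(2) A'(2) by (rule inj_on_subset)
    note m = maxs_spec[OF A'(1)]
    have rem: "removes (maxs A') A' = filter (\<lambda>x. x \<notin> set (maxs A')) A'"
      by (rule removes_filter[OF stair_lexlt[OF m(1)] A'(1) m(2) kinj])
    have s: "f (Suc k) = (filter (\<lambda>x. x \<notin> set (maxs A')) A', rounds (maxs A') B [] @ snd (f k))"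
    proof -
      have "f (Suc k) = nodestep B (A', snd (f k))" by (simp add: f_def A'_def)
      then show ?thesis using rounds_acc[of "maxs A'" B "snd (f k)"] by (simp add: nodestep_def rem)
    qed
    have pB: "plane_inj (set B)" using AB(1) by (auto simp: plane_inj_def)
    have dm: "all_dominated (maxs A') B" using AB(3) m(2) A'(2) by (auto simp: all_dominated_def)
    note r = rounds_spec[OF m(1) B pB dm]
    have step: "CellV a b \<in> set (snd (f (Suc k))) \<or>
        a \<in> set (fst (f (Suc k))) \<and> Suc k \<le> card (near a b - set (fst (f (Suc k))) - set B)"
      if ab: "a \<in> set A" "b \<in> set B" and few: "card (near a b) \<le> 16" for a b
      using i[OF ab few]
    proof (elim disjE conjE)
      assume aA: "a \<in> set A'" and k: "k \<le> card (near a b - set A' - set B)"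
      show ?thesis
      proof (cases "a \<in> set (maxs A')")
        case True
        have "{y \<in> set B. sqd a y < sqd a b} \<subseteq> near a b"
          using AB(2,3) ab by (auto simp: near_def all_dominated_def)
        then have "card {y \<in> set B. sqd a y < sqd a b} \<le> 16" using card_mono[OF fin] few le_trans by blast
        from r(1)[OF True ab(2) this] show ?thesis by (simp add: s)
      next
        case False
        obtain c where c: "c \<in> set (maxs A')" "dominated a c" using m(3)[OF aA False] by blast
        have cA: "c \<in> set A" using c(1) m(2) A'(2) by auto
        have "c \<noteq> b" using cA ab(2) AB(2) by auto
        then have "key1 c \<noteq> key1 b \<or> key2 c \<noteq> key2 b"
          using AB(1) cA ab(2) unfolding plane_inj_def by blast
        moreover have "dominated c b" using AB(3) cA ab(2) by (auto simp: all_dominated_def)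
        ultimately have "sqd a c < sqd a b" using c(2) by (intro dominated_closer)
        then have "c \<in> near a b" using c False cA by (auto simp: near_def)
        then have "insert c (near a b - set A' - set B) \<subseteq> near a b - set (fst (f (Suc k))) - set B"
          using c(1) cA AB(2) by (auto simp: s)
        then have "card (insert c (near a b - set A' - set B)) \<le> card (near a b - set (fst (f (Suc k))) - set B)"
          using fin by (intro card_mono) auto
        moreover have "c \<notin> near a b - set A' - set B" using c(1) m(2) by auto
        ultimately have "Suc k \<le> card (near a b - set (fst (f (Suc k))) - set B)" using k fin by simp
        then show ?thesis using aA False by (simp add: s)
      qed
    qed (simp add: s)
    have "sorted_wrt lexlt (fst (f (Suc k)))" using A'(1) by (simp add: s sorted_wrt_filter)
    moreover have "set (fst (f (Suc k))) \<subseteq> set A" using A'(2) by (auto simp: s)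
    moreover have "set (snd (f (Suc k))) \<subseteq> {CellV a c | a c. a \<in> set A \<and> c \<in> set B}"
      using r(2) o m(2) A'(2) unfolding s snd_conv set_append by blast
    ultimately show ?case using step by blast
  qed (use A(1) in \<open>simp add: f_def\<close>)
  note f = this[of 17]
  have nf: "nodef A B [] = snd (f 17)" by (simp add: nodef_def f_def)
  show "set (nodef A B []) \<subseteq> {CellV a c | a c. a \<in> set A \<and> c \<in> set B}" using f unfolding nf by blast
  assume ab: "a \<in> set A" "b \<in> set B" and "card {c \<in> set A \<union> set B. dominated a c \<and> c \<noteq> a \<and> sqd a c < sqd a b} \<le> 16"
  then have few: "card (near a b) \<le> 16" by (simp add: near_def)
  have "card (near a b - set (fst (f 17)) - set B) \<le> card (near a b)" using fin by (intro card_mono) auto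
  then have "\<not> 17 \<le> card (near a b - set (fst (f 17)) - set B)" using few by simp
  then show "CellV a b \<in> set (nodef A B [])" using f ab few unfolding nf by blast
qed

section \<open>Correctness of the candidate search\<close>

definition near :: "val set \<Rightarrow> val \<Rightarrow> val \<Rightarrow> val set" where
  "near S x y = {z \<in> S. dominated x z \<and> z \<noteq> x \<and> sqd x z < sqd x y}"

lemma retag_simps [simp]: "key1 (retag b x) = key2 x" "key2 (retag b x) = key1 x" "key3 (retag b x) = key3 x"
  "tagged (retag b x) = b" "sqd (retag b x) (retag b' y) = sqd x y" "dominated (retag b x) (retag b' y) = dominated x y"
  "lft (rgt (rgt (retag b x))) = lft (rgt (rgt x))"
  by (auto simp: retag_def key1_def key2_def key3_def tagged_def sqd_def dominated_def algebra_simps)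

lemma lexinj_plane: "plane_inj S \<Longrightarrow> lexinj S"
  unfolding lexinj_def plane_inj_def lexlt_def by (metis linorder_neqE_linordered_idom)

lemma plane_inj_subset: "plane_inj S \<Longrightarrow> T \<subseteq> S \<Longrightarrow> plane_inj T"
  by (auto simp: plane_inj_def)

lemma plane_injD: "plane_inj S \<Longrightarrow> x \<in> S \<Longrightarrow> y \<in> S \<Longrightarrow> x \<noteq> y \<Longrightarrow> key1 x \<noteq> key1 y \<or> key2 x \<noteq> key2 y"
  by (auto simp: plane_inj_def)

lemma sorted_split:
  assumes "sorted_wrt lexlt xs" "x \<in> set xs" "y \<in> set xs" "lexlt x y"
  obtains p q r where "xs = p @ x # q @ y # r"
proof -
  obtain p s where ps: "xs = p @ x # s" using assms(2) by (meson split_list)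
  have "y \<notin> set p"
  proof
    assume "y \<in> set p"
    then have "lexlt y x" using assms(1) ps by (auto simp: sorted_wrt_append)
    then show False using assms(4) lexlt_trans lexlt_irrefl by blast
  qed
  moreover have "y \<noteq> x" using assms(4) lexlt_irrefl by auto
  ultimately have "y \<in> set s" using assms(3) ps by auto
  then obtain q r where "s = q @ y # r" by (meson split_list)
  then show ?thesis using that ps by blast
qed

text \<open>This is how common coordinates are handled: a tie in the leading coordinate is decided
  by the other one, so a dominating point comes later in both lexicographic orders. Conversely,
  coming later in both yields just the weak inequalities of a closed wedge.\<close>

lemma dominated_lexlt:
  assumes "dominated x y" "key1 x \<noteq> key1 y \<or> key2 x \<noteq> key2 y"
  shows "lexlt x y" "lexlt (retag b x) (retag b' y)"
  using assms by (auto simp: dominated_def lexlt_def)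

context
  fixes S :: "val set" and L R :: "val list"
  assumes S: "plane_inj S" "inj_on key3 S" and LR: "set L \<subseteq> S" "set R \<subseteq> S" "\<And>x y. x \<in> set L \<Longrightarrow> y \<in> set R \<Longrightarrow> lexlt x y"
begin

lemma disjoint_LR: "x \<in> set L \<Longrightarrow> x \<notin> set R"
  using LR(3) lexlt_irrefl by blast

lemma tagsort_spec:
  "sorted_wrt lexlt (tagsort L R)" "set (tagsort L R) = retag False ` set L \<union> retag True ` set R"
  "plane_inj (set (tagsort L R))" "inj_on key3 (set (tagsort L R))"
proof -
  define X where "X = rev (map (retag True) R) @ rev (map (retag False) L)"
  have X: "set X = retag False ` set L \<union> retag True ` set R" by (auto simp: X_def)
  \<comment> \<open>As \<open>L\<close> and \<open>R\<close> are disjoint, the tag is determined by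
    the point, and injectivity of the keys carries over from \<open>S\<close> to the retagged
    points.\<close>
  have XS: "\<exists>z\<in>S. u = retag (z \<in> set R) z" if "u \<in> set X" for u
  proof -
    obtain z where "z \<in> set L \<and> u = retag False z \<or> z \<in> set R \<and> u = retag True z" using \<open>u \<in> set X\<close> unfolding X by blast
    then have "u = retag (z \<in> set R) z" "z \<in> S" using disjoint_LR LR(1,2) by auto
    then show ?thesis by blast
  qed
  have p: "plane_inj (set X)"
    unfolding plane_inj_def
  proof (intro ballI impI)
    fix u v assume "u \<in> set X" "v \<in> set X" and k: "key1 u = key1 v" "key2 u = key2 v"
    then obtain z z' where z: "z \<in> S" "z' \<in> S" "u = retag (z \<in> set R) z" "v = retag (z' \<in> set R) z'" using XS by blast
    then show "u = v" using k plane_injD[OF S(1) z(1,2)] by auto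
  qed
  have k: "inj_on key3 (set X)"
  proof (rule inj_onI)
    fix u v assume "u \<in> set X" "v \<in> set X" and k: "key3 u = key3 v"
    then obtain z z' where z: "z \<in> S" "z' \<in> S" "u = retag (z \<in> set R) z" "v = retag (z' \<in> set R) z'" using XS by blast
    then show "u = v" using k inj_onD[OF S(2) _ z(1,2)] by auto
  qed
  note s = srt_spec[OF lexinj_plane[OF p]]
  show "sorted_wrt lexlt (tagsort L R)" "set (tagsort L R) = retag False ` set L \<union> retag True ` set R"
    "plane_inj (set (tagsort L R))" "inj_on key3 (set (tagsort L R))"
    using s X p k by (simp_all add: tagsort_def X_def)
qed

text \<open>A combination sees retagged copies of some points of \<open>S\<close> only, so a bound
  on the number of closer points in \<open>S\<close> passes on to it.\<close>

lemma out2_spec: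
  assumes t: "tagsort L R = p @ lo @ hi @ q"
  shows "x \<in> set L \<Longrightarrow> y \<in> set R \<Longrightarrow> retag False x \<in> set lo \<Longrightarrow> retag True y \<in> set hi \<Longrightarrow> card (near S x y) \<le> 16 \<Longrightarrow> finite S \<Longrightarrow>
      CellV (retag False x) (retag True y) \<in> set (out2 lo hi [])"
    "set (out2 lo hi []) \<subseteq> {CellV (retag False x) (retag True y) | x y. x \<in> set L \<and> y \<in> set R \<and> dominated x y}"
proof -
  define A where "A = filter (\<lambda>x. tagged x = False) lo"
  define B where "B = filter (\<lambda>x. tagged x = True) hi"
  have o: "out2 lo hi [] = nodef A B []" by (simp add: out2_def A_def B_def)
  have st: "sorted_wrt lexlt lo" "sorted_wrt lexlt hi" "\<And>a b. a \<in> set lo \<Longrightarrow> b \<in> set hi \<Longrightarrow> lexlt a b"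
    using tagsort_spec(1) by (auto simp: t sorted_wrt_append)
  have sub: "set lo \<subseteq> set (tagsort L R)" "set hi \<subseteq> set (tagsort L R)" by (auto simp: t)
  have A: "\<exists>x\<in>set L. a = retag False x" if "a \<in> set A" for a
    using that sub unfolding tagsort_spec(2) A_def by auto
  have B: "\<exists>y\<in>set R. b = retag True y" if "b \<in> set B" for b
    using that sub unfolding tagsort_spec(2) B_def by auto
  have AB: "set A \<subseteq> set (tagsort L R)" "set B \<subseteq> set (tagsort L R)" "set A \<inter> set B = {}"
    using sub by (auto simp: A_def B_def)
  have dom: "all_dominated A B" unfolding all_dominated_def
  proof (intro ballI)
    fix a b assume ab: "a \<in> set A" "b \<in> set B"
    then obtain x y where xy: "x \<in> set L" "y \<in> set R" "a = retag False x" "b = retag True y" using A B by blast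
    \<comment> \<open>The inner order controls the second coordinate, and the outer order, given by
      \<open>LR(3)\<close>, controls the first.\<close>
    have "lexlt a b" using ab st(3) by (auto simp: A_def B_def)
    then show "dominated a b" using LR(3)[OF xy(1,2)] by (auto simp: xy(3,4) dominated_def lexlt_def)
  qed
  note n = nodef_spec[OF sorted_wrt_filter[OF st(1)] inj_on_subset[OF tagsort_spec(4)] sorted_wrt_filter[OF st(2)]
      inj_on_subset[OF tagsort_spec(4)] plane_inj_subset[OF tagsort_spec(3)], of "\<lambda>x. tagged x = False" "\<lambda>x. tagged x = True",
      folded A_def B_def, OF AB(1,2) _ AB(3) dom]
  show "set (out2 lo hi []) \<subseteq> {CellV (retag False x) (retag True y) | x y. x \<in> set L \<and> y \<in> set R \<and> dominated x y}"
  proof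
    fix z assume "z \<in> set (out2 lo hi [])"
    then obtain a b where ab: "a \<in> set A" "b \<in> set B" "z = CellV a b" using n(2) AB unfolding o by blast
    then obtain x y where xy: "x \<in> set L" "y \<in> set R" "a = retag False x" "b = retag True y" using A B by blast
    moreover have "dominated a b" using dom ab(1,2) by (auto simp: all_dominated_def)
    ultimately have "dominated x y" by simp
    then show "z \<in> {CellV (retag False x) (retag True y) | x y. x \<in> set L \<and> y \<in> set R \<and> dominated x y}"
      using xy ab(3) by blast
  qed
  assume x: "x \<in> set L" "retag False x \<in> set lo" and y: "y \<in> set R" "retag True y \<in> set hi"
    and few: "card (near S x y) \<le> 16" and fin: "finite S"
  have "{c \<in> set A \<union> set B. dominated (retag False x) c \<and> c \<noteq> retag False x \<and> sqd (retag False x) c < sqd (retag False x) (retag True y)}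
      \<subseteq> (\<lambda>z. retag (z \<in> set R) z) ` near S x y" (is "?N \<subseteq> _")
  proof
    fix c assume c: "c \<in> ?N"
    then obtain z where z: "z \<in> set L \<and> c = retag False z \<or> z \<in> set R \<and> c = retag True z" using A B by blast
    then have cz: "c = retag (z \<in> set R) z" "z \<in> S" using disjoint_LR LR(1,2) by auto
    moreover have "z \<noteq> x" using c z disjoint_LR x(1) by blast
    ultimately have "z \<in> near S x y" using c by (auto simp: near_def)
    then show "c \<in> (\<lambda>z. retag (z \<in> set R) z) ` near S x y" using cz(1) by blast
  qed
  moreover have fn: "finite (near S x y)" using fin by (simp add: near_def)
  ultimately have "card ?N \<le> card (near S x y)" using card_mono[OF finite_imageI[OF fn]] card_image_le[OF fn] le_trans by blast
  then have "card ?N \<le> 16" using few by simp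
  then show "CellV (retag False x) (retag True y) \<in> set (out2 lo hi [])"
    unfolding o using x y AB by (intro n(1)) (auto simp: A_def B_def)
qed

lemma level2_spec:
  shows "x \<in> set L \<Longrightarrow> y \<in> set R \<Longrightarrow> dominated x y \<Longrightarrow> card (near S x y) \<le> 16 \<Longrightarrow> finite S \<Longrightarrow>
      CellV (retag False x) (retag True y) \<in> set (level2 L R [])"
    "set (level2 L R []) \<subseteq> {CellV (retag False x) (retag True y) | x y. x \<in> set L \<and> y \<in> set R \<and> dominated x y}"
proof -
  obtain bs out where tr: "inner.tree (singles (tagsort L R)) [] = (bs, out)" by fastforce
  have o: "level2 L R [] = out" by (simp add: level2_def tr)
  note i = inner.tree_singles[OF tr]
  show "set (level2 L R []) \<subseteq> {CellV (retag False x) (retag True y) | x y. x \<in> set L \<and> y \<in> set R \<and> dominated x y}"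
    using i(2) out2_spec(2) unfolding o by blast
  assume xy: "x \<in> set L" "y \<in> set R" "dominated x y" and few: "card (near S x y) \<le> 16" "finite S"
  have "x \<noteq> y" using xy disjoint_LR by blast
  then have "lexlt (retag False x) (retag True y)" using dominated_lexlt(2)[OF xy(3)] plane_injD[OF S(1)] LR xy by blast
  moreover have "retag False x \<in> set (tagsort L R)" "retag True y \<in> set (tagsort L R)" using xy tagsort_spec(2) by auto
  ultimately obtain p q r where "tagsort L R = p @ retag False x # q @ retag True y # r"
    using sorted_split[OF tagsort_spec(1)] by blast
  from i(1)[OF this] obtain lo hi p' q' where
    "tagsort L R = p' @ lo @ hi @ q'" "retag False x \<in> set lo" "retag True y \<in> set hi" "set (out2 lo hi []) \<subseteq> set out" by blast
  then show "CellV (retag False x) (retag True y) \<in> set (level2 L R [])"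
    using out2_spec(1)[of p' lo hi q' x y] xy few unfolding o by blast
qed

end

lemma cands_spec:
  assumes S: "plane_inj (set xs)" "inj_on key3 (set xs)"
  shows "x \<in> set xs \<Longrightarrow> y \<in> set xs \<Longrightarrow> x \<noteq> y \<Longrightarrow> dominated x y \<Longrightarrow> card (near (set xs) x y) \<le> 16 \<Longrightarrow>
      CellV (retag False x) (retag True y) \<in> set (cands xs)"
    "set (cands xs) \<subseteq> {CellV (retag False x) (retag True y) | x y. x \<in> set xs \<and> y \<in> set xs \<and> x \<noteq> y \<and> dominated x y}"
proof -
  obtain bs out where tr: "outer.tree (singles (srt xs)) [] = (bs, out)" by fastforce
  have o: "cands xs = out" by (simp add: cands_def tr)
  note i = outer.tree_singles[OF tr]
  note s = srt_spec[OF lexinj_plane[OF S(1)]]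
  have LR: "set L \<subseteq> set xs" "set R \<subseteq> set xs" "\<And>x y. x \<in> set L \<Longrightarrow> y \<in> set R \<Longrightarrow> lexlt x y"
    if "srt xs = p @ L @ R @ q" for p L R q
    using s that by (auto simp: sorted_wrt_append)
  show "set (cands xs) \<subseteq> {CellV (retag False x) (retag True y) | x y. x \<in> set xs \<and> y \<in> set xs \<and> x \<noteq> y \<and> dominated x y}"
  proof
    fix c assume "c \<in> set (cands xs)"
    then obtain L R p q where t: "srt xs = p @ L @ R @ q" "c \<in> set (level2 L R [])" using i(2) unfolding o by blast
    then obtain x y where xy: "x \<in> set L" "y \<in> set R" "dominated x y" "c = CellV (retag False x) (retag True y)"
      using level2_spec(2)[OF S LR[OF t(1)]] by blast
    have "x \<noteq> y" using LR(3)[OF t(1) xy(1,2)] lexlt_irrefl by blast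
    then show "c \<in> {CellV (retag False x) (retag True y) | x y. x \<in> set xs \<and> y \<in> set xs \<and> x \<noteq> y \<and> dominated x y}"
      using xy LR(1,2)[OF t(1)] by blast
  qed
  assume xy: "x \<in> set xs" "y \<in> set xs" "x \<noteq> y" "dominated x y" "card (near (set xs) x y) \<le> 16"
  have "lexlt x y" using dominated_lexlt(1)[OF xy(4)] plane_injD[OF S(1)] xy by blast
  then obtain p q r where "srt xs = p @ x # q @ y # r" using sorted_split[OF s(1)] xy s(2) by blast
  from i(1)[OF this] obtain L R p' q' where
    t: "srt xs = p' @ L @ R @ q'" "x \<in> set L" "y \<in> set R" "set (level2 L R []) \<subseteq> set out" by blast
  then show "CellV (retag False x) (retag True y) \<in> set (cands xs)"
    using level2_spec(1)[OF S LR[OF t(1)] t(2,3) xy(4,5)] unfolding o by blast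
qed

subsection \<open>Edges among the candidates\<close>

definition closer :: "val set \<Rightarrow> val \<Rightarrow> val set" where
  "closer Z z = {z' \<in> Z. key1 z' = key1 z \<and> key2 z' < key2 z}"

lemma thr_spec:
  assumes "sorted_wrt lexlt zs"
  shows "set (thr zs out) = set out \<union> edge_rec ` {z \<in> set zs. card (closer (set zs) z) \<le> 16}"
proof -
  define grp where "grp ys = filter (\<lambda>z. key1 z = key1 (last ys)) ys" for ys
  \<comment> \<open>\<open>k\<close> counts the free places among the first 17 records of the
    current source, and \<open>t\<close> is the distance of the 17th record, or of the latest one
    while there are fewer; hence the index \<open>min 17 _ - 1\<close>.\<close>
  have "case fold thstep zs (None, 0, NumV 0, out) of (cur, k, t, o') \<Rightarrow>
      (if zs = [] then cur = None else cur \<noteq> None \<and> num_of (the cur) = key1 (last zs) \<and> k = 17 - length (grp zs) \<and>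
        num_of t = key2 (grp zs ! (min 17 (length (grp zs)) - 1))) \<and>
      set o' = set out \<union> edge_rec ` {z \<in> set zs. card (closer (set zs) z) \<le> 16}"
    using assms
  proof (induction zs rule: rev_induct)
    case (snoc z zs)
    obtain cur k t o' where w: "fold thstep zs (None, 0, NumV 0, out) = (cur, k, t, o')" by (metis prod_cases4)
    have srt: "sorted_wrt lexlt zs" and z: "\<And>y. y \<in> set zs \<Longrightarrow> lexlt y z" using snoc.prems by (auto simp: sorted_wrt_append)
    have i: "if zs = [] then cur = None else cur \<noteq> None \<and> num_of (the cur) = key1 (last zs) \<and> k = 17 - length (grp zs) \<and>
        num_of t = key2 (grp zs ! (min 17 (length (grp zs)) - 1))"
      and o': "set o' = set out \<union> edge_rec ` {z \<in> set zs. card (closer (set zs) z) \<le> 16}"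
      using snoc.IH[OF srt] by (simp_all add: w)
    have f: "fold thstep (zs @ [z]) (None, 0, NumV 0, out) = thstep z (cur, k, t, o')" by (simp add: w)
    \<comment> \<open>In a sorted list a later record of the same source is not closer than an
      earlier one, so a count is final as soon as its record has been reached.\<close>
    have old: "closer (set (zs @ [z])) y = closer (set zs) y" if "y \<in> set zs" for y
      using z[OF that] by (auto simp: closer_def lexlt_def)
    have new: "closer (set (zs @ [z])) z = closer (set zs) z" by (auto simp: closer_def)
    have znot: "z \<notin> set zs" using z lexlt_irrefl by blast
    have rec: "edge_rec ` {y \<in> set (zs @ [z]). card (closer (set (zs @ [z])) y) \<le> 16} =
        edge_rec ` {y \<in> set zs. card (closer (set zs) y) \<le> 16} \<union> (if card (closer (set zs) z) \<le> 16 then {edge_rec z} else {})"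
    proof -
      have "{y \<in> set (zs @ [z]). card (closer (set (zs @ [z])) y) \<le> 16} =
          {y \<in> set zs. card (closer (set zs) y) \<le> 16} \<union> (if card (closer (set zs) z) \<le> 16 then {z} else {})"
        using old new by auto
      then show ?thesis by (simp add: image_Un)
    qed
    have cl: "closer (set zs) z = {y \<in> set zs. key1 y = key1 z \<and> key2 y < key2 z}" by (simp add: closer_def)
    show ?case
    proof (cases "zs = [] \<or> num_of (the cur) < key1 z")
      case True
      have g: "\<forall>y\<in>set zs. key1 y \<noteq> key1 z"
      proof (cases "zs = []")
        case False
        then have l: "key1 (last zs) < key1 z" using True i by simp
        have "key1 y \<le> key1 (last zs)" if "y \<in> set zs" for y
        proof -
          have "zs = butlast zs @ [last zs]" using False by simp
          then have "y = last zs \<or> lexlt y (last zs)" using srt that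
            by (metis (no_types, lifting) Un_iff empty_iff insert_iff list.set(1,2) set_append sorted_wrt_append)
          then show ?thesis by (auto simp: lexlt_def)
        qed
        then show ?thesis using l by fastforce
      qed simp
      then have c0: "closer (set zs) z = {}" by (auto simp: closer_def)
      have "filter (\<lambda>y. key1 y = key1 z) zs = []" using g by (simp add: filter_empty_conv)
      then have gr: "grp (zs @ [z]) = [z]" by (simp add: grp_def)
      have st: "thstep z (cur, k, t, o') = (Some (lft z), 16, lft (rgt z), edge_rec z # o')"
        using True i by (auto simp: thstep_def split: if_splits)
      show ?thesis unfolding f st rec c0 by (simp add: gr o' key1_def key2_def)
    next
      case False
      then have ne: "zs \<noteq> []" and c: "\<not> num_of (the cur) < key1 z" by auto
      have cur: "cur \<noteq> None" "num_of (the cur) = key1 (last zs)" "k = 17 - length (grp zs)"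
        "num_of t = key2 (grp zs ! (min 17 (length (grp zs)) - 1))" using i ne by auto
      have kz: "key1 (last zs) = key1 z" using z[of "last zs"] ne c cur(2) by (auto simp: lexlt_def)
      define G where "G = grp zs"
      have G: "G = filter (\<lambda>y. key1 y = key1 z) zs" by (simp add: G_def grp_def kz)
      have gr: "grp (zs @ [z]) = G @ [z]" by (simp add: grp_def G)
      have gne: "1 \<le> length G"
      proof -
        have "last zs \<in> set G" using ne kz by (simp add: G)
        then show ?thesis by (cases G) auto
      qed
      have sG: "sorted_wrt lexlt G" using srt by (simp add: G sorted_wrt_filter)
      have clG: "closer (set zs) z = {y \<in> set G. key2 y < key2 z}" by (auto simp: closer_def G)
      have kG: "key1 y = key1 z" if "y \<in> set G" for y using that by (simp add: G)
      have mono: "key2 (G ! i) \<le> key2 (G ! j)" if "i \<le> j" "j < length G" for i j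
      proof (cases "i = j")
        case False
        then have "lexlt (G ! i) (G ! j)" using sorted_wrt_nth_less[OF sG, of i j] that by simp
        then show ?thesis using kG[of "G ! i"] kG[of "G ! j"] that by (auto simp: lexlt_def)
      qed simp
      show ?thesis
      proof (cases "0 < k")
        case True
        then have lG: "length G \<le> 16" using cur(3) by (simp add: G_def)
        have "card (closer (set zs) z) \<le> card (set G)" unfolding clG by (intro card_mono) auto
        also have "\<dots> \<le> 16" using card_length[of G] lG by simp
        finally have few: "card (closer (set zs) z) \<le> 16" .
        have st: "thstep z (cur, k, t, o') = (cur, k - 1, lft (rgt z), edge_rec z # o')"
          using cur(1) c True by (simp add: thstep_def)
        have "min 17 (length (G @ [z])) - 1 = length G" using lG by simp
        then have "key2 ((G @ [z]) ! (min 17 (length (G @ [z])) - 1)) = key2 z" by (simp add: nth_append)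
        then show ?thesis unfolding f st rec using few cur lG by (simp add: gr o' key2_def kz G_def)
      next
        case k0: False
        then have lG: "17 \<le> length G" using cur(3) by (simp add: G_def)
        then have m: "min 17 (length G) - 1 = 16" by simp
        have t: "num_of t = key2 (G ! 16)" using cur(4) m unfolding G_def by simp
        have t': "key2 ((G @ [z]) ! (min 17 (length (G @ [z])) - 1)) = num_of t" using lG t by (simp add: nth_append min_def)
        have iff: "card (closer (set zs) z) \<le> 16 \<longleftrightarrow> \<not> num_of t < key2 z"
        proof
          assume few: "card (closer (set zs) z) \<le> 16"
          show "\<not> num_of t < key2 z"
          proof
            assume lt: "num_of t < key2 z"
            have "set (take 17 G) \<subseteq> closer (set zs) z"
            proof
              fix y assume "y \<in> set (take 17 G)"
              then obtain j where j: "j < 17" "y = G ! j" using lG by (auto simp: in_set_conv_nth)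
              then have "key2 y \<le> key2 (G ! 16)" using mono[of j 16] lG by simp
              then show "y \<in> closer (set zs) z" using lt t j lG unfolding clG by simp
            qed
            moreover have "finite (closer (set zs) z)" by (simp add: closer_def)
            ultimately have "card (set (take 17 G)) \<le> card (closer (set zs) z)" by (rule card_mono[rotated])
            moreover have "distinct (take 17 G)" using sorted_lexlt_distinct[OF sG] by (rule distinct_take)
            then have "card (set (take 17 G)) = 17" using lG by (simp add: distinct_card)
            ultimately show False using few by simp
          qed
        next
          assume le: "\<not> num_of t < key2 z"
          have "closer (set zs) z \<subseteq> set (take 16 G)"
          proof
            fix y assume "y \<in> closer (set zs) z"
            then obtain j where j: "j < length G" "y = G ! j" "key2 y < key2 z"
              unfolding clG by (auto simp: in_set_conv_nth)
            then have "j < 16" using mono[of 16 j] le t by fastforce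
            then show "y \<in> set (take 16 G)" using j lG by (auto simp: in_set_conv_nth intro!: exI[of _ j])
          qed
          then have "card (closer (set zs) z) \<le> card (set (take 16 G))" by (intro card_mono) auto
          also have "\<dots> \<le> 16" using card_length[of "take 16 G"] by simp
          finally show "card (closer (set zs) z) \<le> 16" .
        qed
        have st: "thstep z (cur, k, t, o') = (cur, k, t, if num_of t < key2 z then o' else edge_rec z # o')"
          using cur(1) c k0 by (simp add: thstep_def)
        have k: "k = 17 - length (grp (zs @ [z]))" using k0 lG by (simp add: gr)
        show ?thesis unfolding f st rec iff using cur k t' by (simp add: gr o' kz)
      qed
    qed
  qed simp
  then show ?thesis by (simp add: thr_def split: prod.splits)
qed

text \<open>With ties, the \<open>m\<close> smallest elements are not determined, but the elements
  with fewer than \<open>m\<close> smaller ones are. The induction removes a largest element, which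
  changes none of the counts.\<close>

lemma many_lowest:
  fixes f :: "'a \<Rightarrow> real"
  assumes "finite F" "m \<le> card F"
  shows "m \<le> card {y \<in> F. card {z \<in> F. f z < f y} < m}"
  using assms
proof (induction "card F" arbitrary: F)
  case (Suc n)
  show ?case
  proof (cases "m = card F")
    case True
    have "card {z \<in> F. f z < f y} < card F" if "y \<in> F" for y
      using Suc.prems(1) that by (intro psubset_card_mono) auto
    then have "{y \<in> F. card {z \<in> F. f z < f y} < m} = F" using True by auto
    then show ?thesis using True by simp
  next
    case False
    have "F \<noteq> {}" using Suc.hyps(2) by auto
    then obtain w where w: "w \<in> F" "\<And>y. y \<in> F \<Longrightarrow> f y \<le> f w"
      using arg_min_if_finite[OF Suc.prems(1), of "\<lambda>y. - f y"] by (metis linorder_not_le neg_less_iff_less)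
    have c: "card (F - {w}) = n" using Suc.hyps(2) w(1) by simp
    have "m \<le> card {y \<in> F - {w}. card {z \<in> F - {w}. f z < f y} < m}"
      by (rule Suc.hyps(1)) (use c Suc.prems Suc.hyps(2) False in auto)
    also have "\<dots> \<le> card {y \<in> F. card {z \<in> F. f z < f y} < m}"
    proof (intro card_mono)
      have "{z \<in> F - {w}. f z < f y} = {z \<in> F. f z < f y}" if "y \<in> F" for y using w(2)[OF that] by auto
      then show "{y \<in> F - {w}. card {z \<in> F - {w}. f z < f y} < m} \<subseteq> {y \<in> F. card {z \<in> F. f z < f y} < m}" by auto
    qed (use Suc.prems in simp)
    finally show ?thesis .
  qed
qed simp

abbreviation idx :: "val \<Rightarrow> val" where "idx x \<equiv> lft (rgt (rgt x))"

text \<open>If \<open>y\<close> has at least 17 closer points, then so it has among the candidates, because the 17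
  closest ones are candidates.\<close>

lemma onef_spec:
  assumes S: "plane_inj (set xs)" "inj_on key3 (set xs)"
  shows "set (onef xs out) = set out \<union>
    {CellV (idx x) (CellV (idx y) (NumV 0)) | x y. x \<in> set xs \<and> y \<in> set xs \<and> x \<noteq> y \<and> dominated x y \<and> card (near (set xs) x y) \<le> 16}"
proof -
  define X where "X = set xs"
  define rec where "rec x y = CellV (idx x) (CellV (RealV (sqd x y)) (CellV (idx y) (NumV 0)))" for x y
  define Z where "Z = set (map keyed (cands xs))"
  have fX: "finite X" by (simp add: X_def)
  have rk: "key1 (rec x y) = key3 x" "key2 (rec x y) = sqd x y" "key3 (rec x y) = key3 y" for x y
    by (simp_all add: rec_def key1_def key2_def key3_def)
  have kd: "keyed (CellV (retag False x) (retag True y)) = rec x y" for x y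
    using retag_simps(5)[of False x True y] by (simp add: keyed_def rec_def)
  have sound: "\<exists>x y. z = rec x y \<and> x \<in> X \<and> y \<in> X \<and> x \<noteq> y \<and> dominated x y" if z: "z \<in> Z" for z
  proof -
    obtain c where c: "c \<in> set (cands xs)" "z = keyed c" using z by (auto simp: Z_def)
    then obtain x y where "c = CellV (retag False x) (retag True y)" "x \<in> X" "y \<in> X" "x \<noteq> y" "dominated x y"
      using cands_spec(2)[OF S] unfolding X_def by blast
    then show ?thesis using kd c(2) by blast
  qed
  have complete: "rec x y \<in> Z" if "x \<in> X" "y \<in> X" "x \<noteq> y" "dominated x y" "card (near X x y) \<le> 16" for x y
  proof -
    have "CellV (retag False x) (retag True y) \<in> set (cands xs)"
      using cands_spec(1)[OF S] that unfolding X_def by blast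
    then show ?thesis unfolding Z_def by (metis kd image_eqI set_map)
  qed
  have lex: "lexinj Z"
    unfolding lexinj_def
  proof (intro ballI impI)
    fix z z' assume zz: "z \<in> Z" "z' \<in> Z" "\<not> lexlt z z'" "\<not> lexlt z' z"
    obtain x y where x: "z = rec x y" "x \<in> X" "y \<in> X" using sound[OF zz(1)] by blast
    obtain x' y' where x': "z' = rec x' y'" "x' \<in> X" "y' \<in> X" using sound[OF zz(2)] by blast
    have "key1 z = key1 z'" "key2 z = key2 z'" "key3 z = key3 z'" using zz(3,4) unfolding lexlt_def by linarith+
    then have "key3 x = key3 x'" "key3 y = key3 y'" unfolding x(1) x'(1) rk by simp_all
    then have "x = x'" "y = y'" using S(2) x x' by (auto simp: X_def inj_on_def)
    then show "z = z'" by (simp add: x(1) x'(1))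
  qed
  have Zr: "set (rev (map keyed (cands xs))) = Z" by (simp add: Z_def)
  note s = srt_spec[of "rev (map keyed (cands xs))", unfolded Zr, OF lex]
  have eq: "set (onef xs out) = set out \<union> edge_rec ` {z \<in> Z. card (closer Z z) \<le> 16}"
    unfolding onef_def thr_spec[OF s(1)] s(2) ..
  have few: "card (closer Z (rec x y)) \<le> 16 \<longleftrightarrow> card (near X x y) \<le> 16" if xy: "x \<in> X" "y \<in> X" for x y
  proof
    assume n: "card (near X x y) \<le> 16"
    have "closer Z (rec x y) \<subseteq> rec x ` near X x y"
    proof
      fix z assume z: "z \<in> closer Z (rec x y)"
      then obtain x' y' where z': "z = rec x' y'" "x' \<in> X" "y' \<in> X" "x' \<noteq> y'" "dominated x' y'"
        using sound unfolding closer_def by blast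
      have "key3 x' = key3 x" using z by (simp add: closer_def z'(1) rk)
      then have "x' = x" using S(2) z'(2) xy(1) by (auto simp: X_def inj_on_def)
      then have "y' \<in> near X x y" using z z' by (auto simp: closer_def near_def rk)
      then show "z \<in> rec x ` near X x y" using z'(1) \<open>x' = x\<close> by blast
    qed
    moreover have fn: "finite (near X x y)" using fX by (simp add: near_def)
    ultimately have "card (closer Z (rec x y)) \<le> card (near X x y)"
      using card_mono[OF finite_imageI[OF fn]] card_image_le[OF fn] le_trans by blast
    then show "card (closer Z (rec x y)) \<le> 16" using n by simp
  next
    assume n: "card (closer Z (rec x y)) \<le> 16"
    show "card (near X x y) \<le> 16"
    proof (rule ccontr)
      assume "\<not> card (near X x y) \<le> 16"
      then have m: "17 \<le> card (near X x y)" by simp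
      define Y where "Y = {u \<in> near X x y. card {z \<in> near X x y. sqd x z < sqd x u} < 17}"
      have "17 \<le> card Y" unfolding Y_def by (rule many_lowest[OF _ m]) (simp add: near_def fX)
      have sub: "rec x ` Y \<subseteq> closer Z (rec x y)"
      proof
        fix z assume "z \<in> rec x ` Y"
        then obtain u where u: "u \<in> Y" "z = rec x u" by blast
        have un: "u \<in> near X x y" using u(1) by (simp add: Y_def)
        \<comment> \<open>As \<open>u\<close> is closer than \<open>y\<close>, everything closer
          than \<open>u\<close> is closer than \<open>y\<close> as well; counting inside
          \<open>near X x y\<close> therefore gives the full count that \<open>complete\<close> asks
          for.\<close>
        then have "{z \<in> near X x y. sqd x z < sqd x u} = near X x u" by (auto simp: near_def)
        then have "card (near X x u) \<le> 16" using u(1) by (simp add: Y_def)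
        then have "rec x u \<in> Z" using un xy(1) by (intro complete) (auto simp: near_def)
        then show "z \<in> closer Z (rec x y)" using un by (simp add: u(2) closer_def rk near_def)
      qed
      have "inj_on (rec x) Y"
      proof (rule inj_onI)
        fix u v assume uv: "u \<in> Y" "v \<in> Y" "rec x u = rec x v"
        then have "key3 u = key3 v" using rk(3) by metis
        then show "u = v" using uv(1,2) S(2) by (auto simp: Y_def near_def X_def inj_on_def)
      qed
      then have "card (rec x ` Y) = card Y" by (rule card_image)
      moreover have "card (rec x ` Y) \<le> card (closer Z (rec x y))"
        by (rule card_mono[OF _ sub]) (simp add: closer_def Z_def)
      ultimately show False using n \<open>17 \<le> card Y\<close> by simp
    qed
  qed
  have er: "edge_rec (rec x y) = CellV (idx x) (CellV (idx y) (NumV 0))" for x y by (simp add: edge_rec_def rec_def)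
  have "edge_rec ` {z \<in> Z. card (closer Z z) \<le> 16} =
    {CellV (idx x) (CellV (idx y) (NumV 0)) | x y. x \<in> X \<and> y \<in> X \<and> x \<noteq> y \<and> dominated x y \<and> card (near X x y) \<le> 16}" (is "?l = ?r")
  proof (intro equalityI subsetI)
    fix e assume "e \<in> ?l"
    then obtain z where z: "z \<in> Z" "card (closer Z z) \<le> 16" "e = edge_rec z" by blast
    then obtain x y where x: "z = rec x y" "x \<in> X" "y \<in> X" "x \<noteq> y" "dominated x y" using sound by blast
    then show "e \<in> ?r" using few[OF x(2,3)] z er by blast
  next
    fix e assume "e \<in> ?r"
    then obtain x y where x: "e = edge_rec (rec x y)" "x \<in> X" "y \<in> X" "x \<noteq> y" "dominated x y" "card (near X x y) \<le> 16"
      unfolding er by blast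
    then show "e \<in> ?l" using few[OF x(2,3)] complete by blast
  qed
  then show ?thesis unfolding eq X_def by simp
qed

section \<open>Wedges\<close>

text \<open>The coordinates of \<open>v\<close> are \<open>2 r sin (\<theta> - j \<pi> / 3)\<close> and \<open>2 r sin ((j + 1) \<pi> / 3 - \<theta>)\<close> in
  polar coordinates; they are nonnegative on the wedge with number \<open>j + 1\<close>.\<close>

fun coords :: "nat \<Rightarrow> point \<Rightarrow> real \<times> real" where
  "coords 0 (x, y) = (2 * y, sqrt 3 * x - y)"
| "coords (Suc j) p = (- snd (coords j p), fst (coords j p) + snd (coords j p))"

lemma coords_formula:
  "coords j (x, y) = (2 * (y * cos (real j * (pi / 3)) - x * sin (real j * (pi / 3))),
     2 * (x * sin ((real j + 1) * (pi / 3)) - y * cos ((real j + 1) * (pi / 3))))"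
proof (induction j)
  case 0
  show ?case by (simp add: sin_60 cos_60 algebra_simps)
next
  case (Suc j)
  define \<beta> where "\<beta> = (real j + 1) * (pi / 3)"
  have a: "real j * (pi / 3) = \<beta> - pi / 3" "(real (Suc j) + 1) * (pi / 3) = \<beta> + pi / 3" "real (Suc j) * (pi / 3) = \<beta>"
    by (simp_all add: \<beta>_def field_simps)
  show ?case unfolding coords.simps(2) Suc \<beta>_def[symmetric] a
    by (simp add: sin_add cos_add sin_diff cos_diff sin_60 cos_60 algebra_simps)
qed

lemma coords_diff: "coords j (q - p) = coords j q - coords j p"
  by (cases p; cases q) (simp add: coords_formula algebra_simps)

text \<open>The quadratic form is invariant under the map from one wedge to the next, so only the
  first wedge requires a computation.\<close>

lemma coords_norm:
  "snd (coords j p) * (snd (coords j p) + fst (coords j p)) + fst (coords j p) * fst (coords j p) = 3 * (norm p)\<^sup>2"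
proof (induction j)
  case 0
  obtain x y where p: "p = (x, y)" by (cases p)
  have s: "(sqrt 3 * x) * (sqrt 3 * x) = 3 * (x * x)" by simp
  have "(sqrt 3 * x - y) * ((sqrt 3 * x - y) + 2 * y) + (2 * y) * (2 * y) = (sqrt 3 * x) * (sqrt 3 * x) + 3 * (y * y)"
    by (simp only: ring_distribs algebra_simps)
  then show ?case unfolding s by (simp add: p norm_prod_def power2_eq_square)
next
  case (Suc j)
  then show ?case by (simp add: algebra_simps)
qed

text \<open>For the converse, \<open>v\<close> is turned by -\<alpha> to \<open>(a, b)\<close>. The
  first condition puts it into the upper half-plane, which gives a polar angle between 0 and \<pi>;
  the second condition excludes angles beyond \<pi>/3.\<close>

lemma wedge_coords: "v \<in> wedge (Suc j) \<longleftrightarrow> 0 \<le> fst (coords j v) \<and> 0 \<le> snd (coords j v)"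
proof
  assume "v \<in> wedge (Suc j)"
  then obtain r t where v: "v = (r * cos t, r * sin t)" "0 \<le> r" "real j * (pi / 3) \<le> t" "t \<le> (real j + 1) * (pi / 3)"
    by (auto simp: wedge_def add.commute)
  define \<alpha> where "\<alpha> = real j * (pi / 3)"
  define \<beta> where "\<beta> = (real j + 1) * (pi / 3)"
  have b: "\<beta> = \<alpha> + pi / 3" by (simp add: \<alpha>_def \<beta>_def algebra_simps)
  have t: "\<alpha> \<le> t" "t \<le> \<beta>" using v by (simp_all add: \<alpha>_def \<beta>_def)
  have "0 \<le> sin (t - \<alpha>)" "0 \<le> sin (\<beta> - t)" using t b pi_gt_zero by (intro sin_ge_zero; linarith)+
  then have "0 \<le> r * sin (t - \<alpha>)" "0 \<le> r * sin (\<beta> - t)" using v(2) by simp_all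
  then show "0 \<le> fst (coords j v) \<and> 0 \<le> snd (coords j v)"
    unfolding v(1) coords_formula \<alpha>_def[symmetric] \<beta>_def[symmetric] by (simp add: sin_diff algebra_simps)
next
  assume c: "0 \<le> fst (coords j v) \<and> 0 \<le> snd (coords j v)"
  obtain x y where v: "v = (x, y)" by (cases v)
  define \<alpha> where "\<alpha> = real j * (pi / 3)"
  have b: "(real j + 1) * (pi / 3) = \<alpha> + pi / 3" by (simp add: \<alpha>_def algebra_simps)
  define a where "a = x * cos \<alpha> + y * sin \<alpha>"
  define b where "b = y * cos \<alpha> - x * sin \<alpha>"
  define r where "r = sqrt (a\<^sup>2 + b\<^sup>2)"
  have b0: "0 \<le> b" using c unfolding v coords_formula \<alpha>_def[symmetric] b_def by simp
  have ab: "0 \<le> sqrt 3 * a - b"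
  proof -
    have "0 \<le> x * sin (\<alpha> + pi / 3) - y * cos (\<alpha> + pi / 3)"
      using c unfolding v coords_formula \<open>(real j + 1) * (pi / 3) = \<alpha> + pi / 3\<close> by simp
    also have "\<dots> = (sqrt 3 * a - b) / 2"
      unfolding sin_add cos_add sin_60 cos_60 a_def b_def by (simp add: field_simps)
    finally show ?thesis by simp
  qed
  have x: "x = a * cos \<alpha> - b * sin \<alpha>" and y: "y = a * sin \<alpha> + b * cos \<alpha>"
  proof -
    have "a * cos \<alpha> - b * sin \<alpha> = x * ((sin \<alpha>)\<^sup>2 + (cos \<alpha>)\<^sup>2)" "a * sin \<alpha> + b * cos \<alpha> = y * ((sin \<alpha>)\<^sup>2 + (cos \<alpha>)\<^sup>2)"
      by (simp_all only: a_def b_def power2_eq_square ring_distribs mult.assoc) (simp_all add: algebra_simps)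
    then show "x = a * cos \<alpha> - b * sin \<alpha>" "y = a * sin \<alpha> + b * cos \<alpha>" by simp_all
  qed
  obtain t where t: "0 \<le> t" "t \<le> pi" "a = r * cos t" "b = r * sin t"
  proof (cases "r = 0")
    case True
    then have "a = 0" "b = 0" by (simp_all add: r_def sum_power2_eq_zero_iff)
    then show ?thesis using that[of 0] True by simp
  next
    case False
    then have r: "0 < r" by (simp add: r_def less_le)
    have "a\<^sup>2 + b\<^sup>2 = r\<^sup>2" by (simp add: r_def)
    then have "(a / r)\<^sup>2 + (b / r)\<^sup>2 = 1" using r by (simp add: power_divide flip: add_divide_distrib)
    moreover have "0 \<le> b / r" using b0 r by simp
    ultimately obtain t where "0 \<le> t" "t \<le> pi" "a / r = cos t" "b / r = sin t"
      using sincos_total_pi[of "b / r" "a / r"] by blast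
    then show ?thesis using that[of t] r by (simp add: field_simps)
  qed
  have r0: "0 \<le> r" by (simp add: r_def)
  show "v \<in> wedge (Suc j)"
  proof (cases "r = 0")
    case True
    then have "v = (0 * cos \<alpha>, 0 * sin \<alpha>)" using t x y by (simp add: v)
    then show ?thesis unfolding wedge_def by (intro CollectI exI[of _ 0] exI[of _ \<alpha>]) (auto simp: \<alpha>_def intro!: mult_right_mono)
  next
    case False
    then have r: "0 < r" using r0 by simp
    have "t \<le> pi / 3"
    proof (rule ccontr)
      assume "\<not> t \<le> pi / 3"
      then have "0 < sin (t - pi / 3)" using t(2) pi_gt_zero by (intro sin_gt_zero) linarith+
      then have "0 < 2 * r * sin (t - pi / 3)" using r by simp
      also have "2 * r * sin (t - pi / 3) = b - sqrt 3 * a"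
        by (simp add: t sin_diff sin_60 cos_60 algebra_simps)
      finally show False using ab by simp
    qed
    moreover have "v = (r * cos (\<alpha> + t), r * sin (\<alpha> + t))"
      using x y by (simp add: v t cos_add sin_add algebra_simps)
    ultimately show ?thesis unfolding wedge_def using t(1) r0
      by (intro CollectI exI[of _ r] exI[of _ "\<alpha> + t"]) (auto simp: \<alpha>_def algebra_simps)
  qed
qed

lemma wedge_at_coords:
  "q \<in> wedge_at p (Suc j) \<longleftrightarrow> fst (coords j p) \<le> fst (coords j q) \<and> snd (coords j p) \<le> snd (coords j q)"
proof -
  have "q \<in> wedge_at p (Suc j) \<longleftrightarrow> q - p \<in> wedge (Suc j)"
  proof
    assume "q - p \<in> wedge (Suc j)"
    then show "q \<in> wedge_at p (Suc j)" unfolding wedge_at_def by (intro image_eqI[of _ _ "q - p"]) simp_all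
  qed (auto simp: wedge_at_def)
  then show ?thesis by (simp add: wedge_coords coords_diff)
qed

section \<open>The program computes the graph\<close>

definition item :: "point list \<Rightarrow> nat \<Rightarrow> nat \<Rightarrow> val" where
  "item ps j k = CellV (RealV (fst (coords j (ps ! k)))) (CellV (RealV (snd (coords j (ps ! k)))) (CellV (NumV k) (NumV 0)))"

definition edge_val :: "nat \<times> nat \<Rightarrow> val" where
  "edge_val = (\<lambda>(a, b). CellV (NumV a) (CellV (NumV b) (NumV 0)))"

lemma item_keys [simp]: "key1 (item ps j k) = fst (coords j (ps ! k))" "key2 (item ps j k) = snd (coords j (ps ! k))"
  "key3 (item ps j k) = real k" "idx (item ps j k) = NumV k"
  by (simp_all add: item_def key1_def key2_def key3_def)

lemma sqd_item: "sqd (item ps j a) (item ps j b) = 3 * (dist (ps ! a) (ps ! b))\<^sup>2"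
  using coords_norm[of j "ps ! b - ps ! a"] by (simp add: sqd_def coords_diff dist_norm norm_minus_commute)

lemma item_eq: "item ps j a = item ps j b \<longleftrightarrow> a = b"
  by (auto simp: item_def)

lemma dominated_item: "dominated (item ps j a) (item ps j b) \<longleftrightarrow> ps ! b \<in> wedge_at (ps ! a) (Suc j)"
  by (simp add: dominated_def wedge_at_coords)

lemma item_injective:
  assumes "distinct ps"
  shows "plane_inj (item ps j ` {..<length ps})" "inj_on key3 (item ps j ` {..<length ps})"
proof -
  show "plane_inj (item ps j ` {..<length ps})" unfolding plane_inj_def
  proof (intro ballI impI)
    fix u v assume "u \<in> item ps j ` {..<length ps}" "v \<in> item ps j ` {..<length ps}" and k: "key1 u = key1 v" "key2 u = key2 v"
    then obtain a b where ab: "a < length ps" "b < length ps" "u = item ps j a" "v = item ps j b" by auto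
    have "sqd u v = 0" using k by (simp add: sqd_def)
    then have "ps ! a = ps ! b" unfolding ab sqd_item by simp
    then show "u = v" using assms ab by (simp add: nth_eq_iff_index_eq)
  qed
  show "inj_on key3 (item ps j ` {..<length ps})" by (auto simp: inj_on_def)
qed

lemma card_near_item:
  assumes "distinct ps" "a < length ps"
  shows "card (near (item ps j ` {..<length ps}) (item ps j a) (item ps j b)) =
    card {q \<in> set ps \<inter> wedge_at (ps ! a) (Suc j). q \<noteq> ps ! a \<and> dist (ps ! a) q < dist (ps ! a) (ps ! b)}"
proof -
  define K where "K = {k \<in> {..<length ps}. ps ! k \<in> wedge_at (ps ! a) (Suc j) \<and> k \<noteq> a \<and> dist (ps ! a) (ps ! k) < dist (ps ! a) (ps ! b)}"
  have lt: "sqd (item ps j a) (item ps j k) < sqd (item ps j a) (item ps j b) \<longleftrightarrow> dist (ps ! a) (ps ! k) < dist (ps ! a) (ps ! b)" for k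
    unfolding sqd_item using power_mono_iff[of "dist (ps ! a) (ps ! b)" "dist (ps ! a) (ps ! k)" 2] by (simp flip: not_le)
  have "near (item ps j ` {..<length ps}) (item ps j a) (item ps j b) = item ps j ` K"
    by (auto simp: near_def K_def dominated_item item_eq lt)
  moreover have "inj_on (item ps j) K" by (simp add: inj_on_def item_eq)
  moreover have "{q \<in> set ps \<inter> wedge_at (ps ! a) (Suc j). q \<noteq> ps ! a \<and> dist (ps ! a) q < dist (ps ! a) (ps ! b)} = (!) ps ` K"
  proof (intro equalityI subsetI)
    fix q assume q: "q \<in> {q \<in> set ps \<inter> wedge_at (ps ! a) (Suc j). q \<noteq> ps ! a \<and> dist (ps ! a) q < dist (ps ! a) (ps ! b)}"
    then obtain k where k: "k < length ps" "q = ps ! k" by (auto simp: in_set_conv_nth)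
    have "k \<in> K" using q unfolding k(2) K_def by (auto simp: k(1))
    then show "q \<in> (!) ps ` K" using k(2) by blast
  qed (use assms in \<open>auto simp: K_def nth_eq_iff_index_eq\<close>)
  moreover have "inj_on ((!) ps) K" using assms(1) by (auto simp: inj_on_def K_def nth_eq_iff_index_eq)
  ultimately show ?thesis by (simp add: card_image)
qed

lemma wedgesteps:
  assumes "distinct ps"
    and start: "set xs = item ps 0 ` {..<length ps}"
  shows "set (fst ((wedgestep ^^ m) (xs, []))) = item ps m ` {..<length ps} \<and>
    set (snd ((wedgestep ^^ m) (xs, []))) = edge_val ` {(a, b). a < length ps \<and> b < length ps \<and> a \<noteq> b \<and>
      (\<exists>j<m. ps ! b \<in> wedge_at (ps ! a) (Suc j) \<and>
        card {q \<in> set ps \<inter> wedge_at (ps ! a) (Suc j). q \<noteq> ps ! a \<and> dist (ps ! a) q < dist (ps ! a) (ps ! b)} \<le> 16)}"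
    (is "_ \<and> _ = edge_val ` ?E m")
proof (induction m)
  case 0
  show ?case using start by simp
next
  case (Suc m)
  obtain ys out where w: "(wedgestep ^^ m) (xs, []) = (ys, out)" by fastforce
  have i: "set ys = item ps m ` {..<length ps}" "set out = edge_val ` ?E m" using Suc by (simp_all add: w)
  have s: "(wedgestep ^^ Suc m) (xs, []) = (rev (map rotate_pt ys), onef ys out)"
  proof -
    have "wedgestep (ys, out) = (rev (map rotate_pt ys), onef ys out)" by (simp add: wedgestep_def)
    then show ?thesis by (simp add: w)
  qed
  have rot: "rotate_pt (item ps m k) = item ps (Suc m) k" for k
    by (simp add: rotate_pt_def) (simp add: item_def)
  have "set (onef ys out) = set out \<union> {CellV (idx x) (CellV (idx y) (NumV 0)) | x y. x \<in> set ys \<and> y \<in> set ys \<and> x \<noteq> y \<and>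
      dominated x y \<and> card (near (set ys) x y) \<le> 16}"
    by (rule onef_spec) (use item_injective[OF assms(1)] i in simp_all)
  also have "{CellV (idx x) (CellV (idx y) (NumV 0)) | x y. x \<in> set ys \<and> y \<in> set ys \<and> x \<noteq> y \<and>
      dominated x y \<and> card (near (set ys) x y) \<le> 16} =
    edge_val ` {(a, b). a < length ps \<and> b < length ps \<and> a \<noteq> b \<and> ps ! b \<in> wedge_at (ps ! a) (Suc m) \<and>
        card {q \<in> set ps \<inter> wedge_at (ps ! a) (Suc m). q \<noteq> ps ! a \<and> dist (ps ! a) q < dist (ps ! a) (ps ! b)} \<le> 16}" (is "?l = edge_val ` ?r")
  proof (intro equalityI subsetI)
    fix e assume "e \<in> ?l"
    then obtain x y where xy: "e = CellV (idx x) (CellV (idx y) (NumV 0))" "x \<in> set ys" "y \<in> set ys" "x \<noteq> y"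
      "dominated x y" "card (near (set ys) x y) \<le> 16" by blast
    obtain a b where ab: "a < length ps" "b < length ps" "x = item ps m a" "y = item ps m b" using xy(2,3) i(1) by auto
    have "(a, b) \<in> ?r" using xy(4-6) ab card_near_item[OF assms(1) ab(1), of m b]
      by (simp add: item_eq dominated_item i(1))
    moreover have "e = edge_val (a, b)" by (simp add: xy(1) ab edge_val_def)
    ultimately show "e \<in> edge_val ` ?r" by blast
  next
    fix e assume "e \<in> edge_val ` ?r"
    then obtain a b where ab: "(a, b) \<in> ?r" "e = edge_val (a, b)" by auto
    then have "item ps m a \<in> set ys \<and> item ps m b \<in> set ys \<and> item ps m a \<noteq> item ps m b \<and>
      dominated (item ps m a) (item ps m b) \<and> card (near (set ys) (item ps m a) (item ps m b)) \<le> 16"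
      using card_near_item[OF assms(1), of a m b] by (simp add: item_eq dominated_item i(1))
    moreover have "e = CellV (idx (item ps m a)) (CellV (idx (item ps m b)) (NumV 0))" using ab(2) by (simp add: edge_val_def)
    ultimately show "e \<in> ?l" by blast
  qed
  finally have "set (onef ys out) = edge_val ` (?E m \<union> ?r)" by (simp only: i(2) image_Un)
  moreover have "?E m \<union> ?r = ?E (Suc m)" by (auto simp: less_Suc_eq)
  ultimately have "set (onef ys out) = edge_val ` ?E (Suc m)" by simp
  moreover have "set (rev (map rotate_pt ys)) = item ps (Suc m) ` {..<length ps}" by (simp add: i(1) image_image rot)
  ultimately show ?case unfolding s by simp
qed

lemma encode_points_nth:
  "length (encode_points ps) = 2 * length ps"
  "k < length ps \<Longrightarrow> encode_points ps ! (2 * k) = fst (ps ! k) \<and> encode_points ps ! (2 * k + 1) = snd (ps ! k)"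
proof -
  show "length (encode_points ps) = 2 * length ps" by (induction ps) (auto simp: encode_points_def)
  show "k < length ps \<Longrightarrow> encode_points ps ! (2 * k) = fst (ps ! k) \<and> encode_points ps ! (2 * k + 1) = snd (ps ! k)"
  proof (induction ps arbitrary: k)
    case (Cons p ps)
    obtain x y where "p = (x, y)" by (cases p)
    then have e: "encode_points (p # ps) = x # y # encode_points ps" by (simp add: encode_points_def)
    show ?case
    proof (cases k)
      case (Suc k')
      then show ?thesis using Cons by (simp add: e)
    next
      case 0
      show ?thesis unfolding e by (simp add: 0 \<open>p = (x, y)\<close>)
    qed
  qed simp
qed

lemma output_spec:
  assumes "distinct ps"
  obtains es where "output_of (map (entry (encode_points ps)) [0..<length ps]) = map NumV (encode_edges es)" "distinct es"
    "set es = {(a, b). a < length ps \<and> b < length ps \<and> (ps ! a, ps ! b) \<in> gng17 (set ps)}"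
proof -
  define ents where "ents = map (entry (encode_points ps)) [0..<length ps]"
  define E where "E = {(a, b). a < length ps \<and> b < length ps \<and> (ps ! a, ps ! b) \<in> gng17 (set ps)}"
  have "initial_pt (entry (encode_points ps) k) = item ps 0 k" if "k < length ps" for k
    using encode_points_nth(2)[OF that] by (cases "ps ! k") (simp add: initial_pt_def entry_def item_def)
  then have st: "set (rev (map initial_pt ents)) = item ps 0 ` {..<length ps}"
    by (auto simp: ents_def image_image intro!: image_cong)
  have "set (all_edges ents) = edge_val ` {(a, b). a < length ps \<and> b < length ps \<and> a \<noteq> b \<and>
      (\<exists>j<6. ps ! b \<in> wedge_at (ps ! a) (Suc j) \<and>
        card {q \<in> set ps \<inter> wedge_at (ps ! a) (Suc j). q \<noteq> ps ! a \<and> dist (ps ! a) q < dist (ps ! a) (ps ! b)} \<le> 16)}"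
    unfolding all_edges_def using wedgesteps[OF assms st, of 6] by blast
  also have "{(a, b). a < length ps \<and> b < length ps \<and> a \<noteq> b \<and>
      (\<exists>j<6. ps ! b \<in> wedge_at (ps ! a) (Suc j) \<and>
        card {q \<in> set ps \<inter> wedge_at (ps ! a) (Suc j). q \<noteq> ps ! a \<and> dist (ps ! a) q < dist (ps ! a) (ps ! b)} \<le> 16)} = E"
  proof -
    have ex: "(\<exists>i\<in>{1..6}. P i) \<longleftrightarrow> (\<exists>j<6. P (Suc j))" for P :: "nat \<Rightarrow> bool"
    proof -
      have "{1..6} = Suc ` {..<6}" by (simp add: image_Suc_lessThan)
      then show ?thesis by auto
    qed
    have "(a, b) \<in> E \<longleftrightarrow> a < length ps \<and> b < length ps \<and> a \<noteq> b \<and>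
      (\<exists>j<6. ps ! b \<in> wedge_at (ps ! a) (Suc j) \<and>
        card {q \<in> set ps \<inter> wedge_at (ps ! a) (Suc j). q \<noteq> ps ! a \<and> dist (ps ! a) q < dist (ps ! a) (ps ! b)} \<le> 16)" for a b
      unfolding E_def gng17_def ex by (cases "a < length ps \<and> b < length ps") (auto simp: nth_eq_iff_index_eq[OF assms])
    then show ?thesis by auto
  qed
  finally have S: "set (all_edges ents) = edge_val ` E" .
  have "lexinj (edge_val ` E)"
    by (auto simp: lexinj_def lexlt_def edge_val_def key1_def key2_def)
  then have s: "sorted_wrt lexlt (srt (all_edges ents))" "set (srt (all_edges ents)) = edge_val ` E"
    using srt_spec[of "all_edges ents"] S by auto
  then have "\<exists>es. srt (all_edges ents) = map edge_val es" unfolding ex_map_conv by blast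
  then obtain es where es: "srt (all_edges ents) = map edge_val es" ..
  have inj: "inj edge_val" by (auto simp: inj_on_def edge_val_def)
  have "edge_val ` set es = edge_val ` E" using s(2) es by simp
  then have 1: "set es = E" using inj by (simp add: inj_image_eq_iff)
  have 2: "distinct es" using sorted_lexlt_distinct[OF s(1)] es by (simp add: distinct_map)
  have "output_of ents = map NumV (encode_edges es)"
    unfolding output_of_def es by (induction es) (auto simp: encode_edges_def edge_val_def)
  then show ?thesis using that 1 2 unfolding ents_def E_def by blast
qed

text \<open>10^15 leaves room for 40 instructions per cost unit of \<open>mainE\<close>, whose cost
  has the constant 10^13, and for input and output. The summands 1 keep the bound positive for tiny
  inputs.\<close>

definition time_bound :: "nat \<Rightarrow> nat" where
  "time_bound n = 1000000000000000 * ((n + 1) * (lg n + 1) ^ 3)"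

text \<open>The constant 51 is 47 + 4: the heap needs fewer than \<open>2^47 * M\<close> addresses,
  since 8 * 10^13 + 120 < 2^47, and \<open>2 \<le> n + 2\<close> together with
  \<open>M \<le> (n + 2)^4\<close> turns this into \<open>(n + 2)^51\<close>.\<close>

lemma program_reports:
  assumes "distinct ps" "51 * log 2 (real (length ps) + 2) \<le> real w"
  shows "reports_gng17 (program_of mainE) w ps (time_bound (length ps))"
proof -
  define n where "n = length ps"
  define xs where "xs = encode_points ps"
  define ents where "ents = map (entry xs) [0..<n]"
  define M where "M = (n + 1) * (lg n + 1) ^ 3"
  obtain es where es: "output_of ents = map NumV (encode_edges es)" "distinct es"
    "set es = {(a, b). a < length ps \<and> b < length ps \<and> (ps ! a, ps ! b) \<in> gng17 (set ps)}"
    using output_spec[OF assms(1)] unfolding ents_def xs_def n_def by blast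
  have len: "length ents = n" by (simp add: ents_def)
  have ct: "ct mainE [vl ents] \<le> 10000000000000 * M" using ct_main[of ents] unfolding len M_def by (simp only: mult.assoc)
  have "length (encode_edges es) = length (output_of ents)" by (simp add: es(1))
  also have "\<dots> \<le> 2400000 * (n + 1) * (lg n + 1) ^ 2" using length_output[of ents] unfolding len .
  also have "\<dots> \<le> 2400000 * (n + 1) * (lg n + 1) ^ 3" by (intro mult_le_mono2 power_increasing) auto
  finally have out: "length (encode_edges es) \<le> 2400000 * M" by (simp add: M_def algebra_simps)
  have nM: "n + 1 \<le> M" using mult_le_mono2[of 1 "(lg n + 1) ^ 3" "n + 1"] unfolding M_def by simp
  have "M \<le> (n + 1) * (n + 1) ^ 3" using lg_le_self[of n] unfolding M_def by (intro mult_le_mono2 power_mono) auto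
  also have "\<dots> = (n + 1) ^ 4" by (simp add: eval_nat_numeral)
  also have "\<dots> \<le> (n + 2) ^ 4" by (intro power_mono) auto
  finally have M4: "M \<le> (n + 2) ^ 4" .
  have "8 + 120 * n + 8 * ct mainE [vl ents] < 2 ^ 47 * M" using ct nM by simp
  also have "\<dots> \<le> (n + 2) ^ 47 * (n + 2) ^ 4" by (intro mult_le_mono M4 power_mono) auto
  also have "\<dots> = (n + 2) ^ 51" by (simp flip: power_add)
  also have "\<dots> \<le> 2 ^ w"
  proof -
    have "real (n + 2) ^ 51 = real (n + 2) powr 51" by (simp add: powr_realpow flip: powr_numeral)
    also have "\<dots> = 2 powr (51 * log 2 (real n + 2))" by (simp add: powr_def log_def)
    also have "\<dots> \<le> 2 powr real w" using assms(2) by (intro powr_mono) (auto simp: n_def)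
    also have "\<dots> = 2 ^ w" by (simp add: powr_realpow)
    finally have "real ((n + 2) ^ 51) \<le> real (2 ^ w)" by simp
    then show ?thesis unfolding of_nat_le_iff .
  qed
  finally have w: "8 + 120 * n + 8 * ct mainE [vl ents] < 2 ^ w" .
  have t: "10 + 600 * n + 40 * ct mainE [vl ents] + 15 * length (encode_edges es) \<le> time_bound n"
    using ct out nM unfolding time_bound_def M_def[symmetric] by simp
  have "outputs_within (program_of mainE) w xs (time_bound n) (encode_edges es)"
    using machine.program_outputs[OF refl, of xs n mainE "encode_edges es" w "time_bound n"] w t es(1) ev_main[of ents]
      encode_points_nth(1)[of ps]
    by (simp add: ents_def xs_def n_def)
  then show ?thesis unfolding reports_gng17_def using es(2,3) by (auto simp: xs_def n_def)
qed

lemma time_bound_bigo: "(\<lambda>n. real (time_bound n)) \<in> O(\<lambda>n. real n * log 2 (real n) ^ 3)"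
\<comment> \<open>The constant is 10^15 * 2 * 3^3, from \<open>n + 1 \<le> 2 * n\<close> and
  \<open>lg n + 1 \<le> 3 * log 2 n\<close> for \<open>n \<ge> 2\<close>.\<close>
proof (rule bigoI[of _ 54000000000000000])
  show "\<forall>\<^sub>F n in sequentially. norm (real (time_bound n)) \<le> 54000000000000000 * norm (real n * log 2 (real n) ^ 3)"
  proof (rule eventually_sequentiallyI[of 2])
    fix n :: nat assume n: "2 \<le> n"
    define l where "l = log 2 (real n)"
    have l1: "1 \<le> l" using n by (simp add: l_def le_log_iff)
    have "real n = 2 powr l" using n by (simp add: l_def)
    also have "\<dots> \<le> 2 powr real (nat \<lceil>l\<rceil>)" by (intro powr_mono real_nat_ceiling_ge) simp
    also have "\<dots> = real (2 ^ nat \<lceil>l\<rceil>)" by (simp add: powr_realpow)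
    finally have "lg n \<le> nat \<lceil>l\<rceil>" by (intro lg_le) (simp only: of_nat_le_iff)
    then have "real (lg n) + 1 \<le> real (nat \<lceil>l\<rceil>) + 1" by simp
    also have "\<dots> \<le> 3 * l" using l1 by linarith
    finally have L: "real (lg n) + 1 \<le> 3 * l" .
    have "real (time_bound n) = 1000000000000000 * ((real n + 1) * (real (lg n) + 1) ^ 3)" by (simp add: time_bound_def algebra_simps)
    also have "\<dots> \<le> 1000000000000000 * ((2 * real n) * (3 * l) ^ 3)"
      using n L by (intro mult_left_mono mult_mono power_mono) auto
    also have "\<dots> = 54000000000000000 * (real n * l ^ 3)" by (simp add: power_mult_distrib)
    finally show "norm (real (time_bound n)) \<le> 54000000000000000 * norm (real n * log 2 (real n) ^ 3)"
      using l1 by (simp add: l_def[symmetric])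
  qed
qed

theorem mainTheorem2:
  "\<exists>(prog :: program) (c :: nat) (T :: nat \<Rightarrow> nat).
     (\<lambda>n. real (T n)) \<in> O(\<lambda>n. real n * log 2 (real n) ^ 3) \<and>
     (\<forall>(l :: nat) (n :: nat) (P :: point set).
        n = 2 * l \<and> finite P \<and> card P = n \<longrightarrow> solves_gng17 prog c P (T n))"
proof (intro exI conjI allI impI)
  show "(\<lambda>n. real (time_bound n)) \<in> O(\<lambda>n. real n * log 2 (real n) ^ 3)" by (rule time_bound_bigo)
  fix l n :: nat and P :: "point set"
  assume P: "n = 2 * l \<and> finite P \<and> card P = n"
  show "solves_gng17 (program_of mainE) 51 P (time_bound n)" unfolding solves_gng17_def
  proof (intro allI impI, elim conjE)
    fix ps w assume ps: "distinct ps" "set ps = P" and w: "real 51 * log 2 (real (card P) + 2) \<le> real w"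
    have "length ps = n" using ps P distinct_card by force
    then show "reports_gng17 (program_of mainE) w ps (time_bound n)"
      using program_reports[OF ps(1), of w] w P by simp
  qed
qed

end
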